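(* Let $n\ge1$, $1<p<\infty$ and let $U\subset\mathbb{R}^n$ be quasiopen. Then $\hat N^{1,p}(U)=W^{1,p}(U)$ and $\|u\|_{\hat N^{1,p}(U)}=\|u\|_{W^{1,p}(U)}$ for all $u\in\hat N^{1,p}(U)$. Moreover, for every $u\in\hat N^{1,p}(U)$ and every $v\in N^{1,p}(U)$ with $v=u$ a.e. in $U$, we have $g_{v,U}=|\nabla u|$ a.e. in $U$, where $\nabla u$ is the fine gradient of $u$.
   Context: $\mathbb{R}^n$ carries the Euclidean metric and Lebesgue measure. Measurable $E\subset\mathbb{R}^n$ is regarded as a metric measure space with restricted metric and measure. Curves are nonconstant compact rectifiable curves parametrized by arc length. For $f:E\to[-\infty,\infty]$, a Borel $g:E\to[0,\infty]$ is an upper gradient of $f$ in $E$ if $|f(\gamma(0))-f(\gamma(l_\gamma))|\le\int_\gamma g\,ds$ for every curve $\gamma:[0,l_\gamma]\to E$ (left side $\infty$ if either value is infinite); a measurable $g\ge0$ is a $p$-weak upper gradient if this holds for all curves in $E$ outside a family of zero $p$-modulus ($\mathrm{Mod}_p(\Gamma)=\inf\int\rho^p\,dx$ over Borel $\rho\ge0$ with $\int_\gamma\rho\,ds\ge1$ on $\Gamma$). $N^{1,p}(E)$: everywhere defined measurable $f:E\to[-\infty,\infty]$ with $\|f\|_{N^{1,p}(E)}=(\int_E|f|^p\,dx+\inf_g\int_Eg^p\,dx)^{1/p}<\infty$, infimum over upper gradients in $E$; $g_{f,E}$ denotes the minimal $p$-weak upper gradient of $f$ in $E$ (unique a.e.).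 $\hat N^{1,p}(U)=\{u: u=v\text{ a.e. in }U\text{ for some }v\in N^{1,p}(U)\}$ with $\|u\|_{\hat N^{1,p}(U)}=\|v\|_{N^{1,p}(U)}$ (independent of the choice of $v$). Capacity: $C_p(E)=\inf\|w\|^p_{N^{1,p}(\mathbb{R}^n)}$ over $w\in N^{1,p}(\mathbb{R}^n)$ with $w\ge1$ on $E$. $U$ is quasiopen if for every $\varepsilon>0$ there is open $G$ with $C_p(G)<\varepsilon$ and $U\cup G$ open. A quasicovering of $U$ is a countable family $\mathcal B$ of quasiopen sets with $\bigcup\mathcal B\subset U$ and $C_p(U\setminus\bigcup\mathcal B)=0$. Definition of $W^{1,p}(U)$ (Kilpeläinen–Malý): a function $u$ on $U$ (considered up to sets of measure zero) belongs to $W^{1,p}(U)$ if (i) $u\in L^p(U)$; (ii) there is a quasicovering $\mathcal B$ of $U$ such that for every $V\in\mathcal B$ there are an open $G_V\supset V$ and $u_V$ in the classical Sobolev space $W^{1,p}(G_V)$ with $u=u_V$ in $V$; (iii) the fine gradient $\nabla u$, defined by $\nabla u=\nabla u_V$ a.e. on each $V\in\mathcal B$, belongs to $L^p(U)$. Its norm is $\|u\|_{W^{1,p}(U)}=(\int_U(|u|^p+|\nabla u|^p)\,dx)^{1/p}$. *)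

theory Defs
  imports "HOL-Analysis.Analysis"
begin

definition curve_variation :: "(real \<Rightarrow> 'a::euclidean_space) \<Rightarrow> real \<Rightarrow> real \<Rightarrow> ereal" where
  "curve_variation \<gamma> s t =
     (SUP xs \<in> {xs. sorted xs \<and> set xs \<subseteq> {s..t}}.
        ereal (\<Sum>i<length xs - 1. dist (\<gamma> (xs ! i)) (\<gamma> (xs ! Suc i))))"

definition arc_curve :: "(real \<Rightarrow> 'a::euclidean_space) \<Rightarrow> real \<Rightarrow> bool" where
  "arc_curve \<gamma> l \<longleftrightarrow> 0 < l \<and>
     (\<forall>s t. 0 \<le> s \<and> s \<le> t \<and> t \<le> l \<longrightarrow> curve_variation \<gamma> s t = ereal (t - s))"

definition curve_in :: "(real \<Rightarrow> 'a::euclidean_space) \<Rightarrow> real \<Rightarrow> 'a set \<Rightarrow> bool" where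
  "curve_in \<gamma> l E \<longleftrightarrow> arc_curve \<gamma> l \<and> \<gamma> ` {0..l} \<subseteq> E"

definition line_int :: "('a::euclidean_space \<Rightarrow> ennreal) \<Rightarrow> (real \<Rightarrow> 'a) \<Rightarrow> real \<Rightarrow> ennreal" where
  "line_int g \<gamma> l = (\<integral>\<^sup>+ t\<in>{0..l}. g (\<gamma> t) \<partial>lborel)"

definition ediff :: "ereal \<Rightarrow> ereal \<Rightarrow> ennreal" where
  "ediff a b = (case (a, b) of (ereal x, ereal y) \<Rightarrow> ennreal \<bar>x - y\<bar> | _ \<Rightarrow> \<infinity>)"

definition epow :: "ennreal \<Rightarrow> real \<Rightarrow> ennreal" where
  "epow x p = (if x = \<infinity> then \<infinity> else ennreal (enn2real x powr p))"

definition eabs_pow :: "ereal \<Rightarrow> real \<Rightarrow> ennreal" where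
  "eabs_pow x p = (case x of ereal r \<Rightarrow> ennreal (\<bar>r\<bar> powr p) | _ \<Rightarrow> \<infinity>)"

text \<open>Borel upper gradient in E (a Borel function on the subspace E is the restriction of a
  Borel function on R^n, so we take g Borel on R^n).\<close>
definition upper_gradient :: "'a::euclidean_space set \<Rightarrow> ('a \<Rightarrow> ereal) \<Rightarrow> ('a \<Rightarrow> ennreal) \<Rightarrow> bool" where
  "upper_gradient E f g \<longleftrightarrow> g \<in> borel_measurable borel \<and>
     (\<forall>\<gamma> l. curve_in \<gamma> l E \<longrightarrow> ediff (f (\<gamma> 0)) (f (\<gamma> l)) \<le> line_int g \<gamma> l)"

definition Modp :: "real \<Rightarrow> 'a::euclidean_space set \<Rightarrow> ((real \<Rightarrow> 'a) \<times> real) set \<Rightarrow> ennreal" where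
  "Modp p E \<Gamma> = (INF \<rho> \<in> {\<rho>. \<rho> \<in> borel_measurable borel \<and>
       (\<forall>(\<gamma>, l) \<in> \<Gamma>. 1 \<le> line_int \<rho> \<gamma> l)}. (\<integral>\<^sup>+ x\<in>E. epow (\<rho> x) p \<partial>lebesgue))"

definition p_weak_upper_gradient :: "real \<Rightarrow> 'a::euclidean_space set \<Rightarrow> ('a \<Rightarrow> ereal) \<Rightarrow> ('a \<Rightarrow> ennreal) \<Rightarrow> bool" where
  "p_weak_upper_gradient p E f g \<longleftrightarrow> g \<in> borel_measurable (restrict_space lebesgue E) \<and>
     (\<exists>\<Gamma>. Modp p E \<Gamma> = 0 \<and>
        (\<forall>\<gamma> l. curve_in \<gamma> l E \<and> (\<gamma>, l) \<notin> \<Gamma> \<longrightarrow> ediff (f (\<gamma> 0)) (f (\<gamma> l)) \<le> line_int g \<gamma> l))"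

definition minimal_pwug :: "real \<Rightarrow> 'a::euclidean_space set \<Rightarrow> ('a \<Rightarrow> ereal) \<Rightarrow> ('a \<Rightarrow> ennreal) \<Rightarrow> bool" where
  "minimal_pwug p E f g \<longleftrightarrow> p_weak_upper_gradient p E f g \<and>
     (\<integral>\<^sup>+ x\<in>E. epow (g x) p \<partial>lebesgue) < \<infinity> \<and>
     (\<forall>g'. p_weak_upper_gradient p E f g' \<and> (\<integral>\<^sup>+ x\<in>E. epow (g' x) p \<partial>lebesgue) < \<infinity>
        \<longrightarrow> (AE x in lebesgue. x \<in> E \<longrightarrow> g x \<le> g' x))"

definition N1p_normp :: "real \<Rightarrow> 'a::euclidean_space set \<Rightarrow> ('a \<Rightarrow> ereal) \<Rightarrow> ennreal" where
  "N1p_normp p E f = (\<integral>\<^sup>+ x\<in>E. eabs_pow (f x) p \<partial>lebesgue) +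
     (INF g \<in> {g. upper_gradient E f g}. (\<integral>\<^sup>+ x\<in>E. epow (g x) p \<partial>lebesgue))"

definition N1p :: "real \<Rightarrow> 'a::euclidean_space set \<Rightarrow> ('a \<Rightarrow> ereal) set" where
  "N1p p E = {f. f \<in> borel_measurable (restrict_space lebesgue E) \<and> N1p_normp p E f < \<infinity>}"

definition N1p_norm :: "real \<Rightarrow> 'a::euclidean_space set \<Rightarrow> ('a \<Rightarrow> ereal) \<Rightarrow> real" where
  "N1p_norm p E f = enn2real (N1p_normp p E f) powr (1 / p)"

definition Cp :: "real \<Rightarrow> 'a::euclidean_space set \<Rightarrow> ennreal" where
  "Cp p E = (INF w \<in> {w. w \<in> N1p p UNIV \<and> (\<forall>x\<in>E. 1 \<le> w x)}. N1p_normp p UNIV w)"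

definition quasiopen :: "real \<Rightarrow> 'a::euclidean_space set \<Rightarrow> bool" where
  "quasiopen p U \<longleftrightarrow> (\<forall>\<epsilon>>0. \<exists>G. open G \<and> Cp p G < ennreal \<epsilon> \<and> open (U \<union> G))"

definition quasicovering :: "real \<Rightarrow> 'a::euclidean_space set \<Rightarrow> 'a set set \<Rightarrow> bool" where
  "quasicovering p U \<B> \<longleftrightarrow> countable \<B> \<and> (\<forall>V\<in>\<B>. quasiopen p V) \<and> \<Union>\<B> \<subseteq> U \<and>
     Cp p (U - \<Union>\<B>) = 0"

definition Nhat :: "real \<Rightarrow> 'a::euclidean_space set \<Rightarrow> ('a \<Rightarrow> real) set" where
  "Nhat p U = {u. \<exists>v \<in> N1p p U. AE x in lebesgue. x \<in> U \<longrightarrow> v x = ereal (u x)}"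

definition Nhat_norm :: "real \<Rightarrow> 'a::euclidean_space set \<Rightarrow> ('a \<Rightarrow> real) \<Rightarrow> real" where
  "Nhat_norm p U u = N1p_norm p U
     (SOME v. v \<in> N1p p U \<and> (AE x in lebesgue. x \<in> U \<longrightarrow> v x = ereal (u x)))"

definition Lp_on :: "real \<Rightarrow> 'a::euclidean_space set \<Rightarrow> ('a \<Rightarrow> 'b::{real_normed_vector,second_countable_topology}) \<Rightarrow> bool" where
  "Lp_on p E f \<longleftrightarrow> set_borel_measurable lebesgue E f \<and>
     (\<integral>\<^sup>+ x\<in>E. ennreal (norm (f x) powr p) \<partial>lebesgue) < \<infinity>"

fun iter_pd :: "'a list \<Rightarrow> ('a::euclidean_space \<Rightarrow> real) \<Rightarrow> 'a \<Rightarrow> real" where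
  "iter_pd [] f = f"
| "iter_pd (b # bs) f = (\<lambda>x. frechet_derivative (iter_pd bs f) (at x) b)"

definition smooth_fun :: "('a::euclidean_space \<Rightarrow> real) \<Rightarrow> bool" where
  "smooth_fun f \<longleftrightarrow> (\<forall>bs. set bs \<subseteq> Basis \<longrightarrow> (\<forall>x. iter_pd bs f differentiable at x))"

definition test_fun :: "'a::euclidean_space set \<Rightarrow> ('a \<Rightarrow> real) \<Rightarrow> bool" where
  "test_fun G \<phi> \<longleftrightarrow> smooth_fun \<phi> \<and> compact (closure {x. \<phi> x \<noteq> 0}) \<and> closure {x. \<phi> x \<noteq> 0} \<subseteq> G"

definition classical_W1p :: "real \<Rightarrow> 'a::euclidean_space set \<Rightarrow> ('a \<Rightarrow> real) \<Rightarrow> ('a \<Rightarrow> 'a) \<Rightarrow> bool" where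
  "classical_W1p p G w Dw \<longleftrightarrow> open G \<and> Lp_on p G w \<and> Lp_on p G Dw \<and>
     (\<forall>\<phi>. test_fun G \<phi> \<longrightarrow> (\<forall>i\<in>Basis.
        (LINT x:G|lebesgue. w x * frechet_derivative \<phi> (at x) i) =
        - (LINT x:G|lebesgue. (Dw x \<bullet> i) * \<phi> x)))"

text \<open>Kilpelainen--Maly space: u in W^{1,p}(U) with fine gradient Du.\<close>
definition KM_W1p :: "real \<Rightarrow> 'a::euclidean_space set \<Rightarrow> ('a \<Rightarrow> real) \<Rightarrow> ('a \<Rightarrow> 'a) \<Rightarrow> bool" where
  "KM_W1p p U u Du \<longleftrightarrow> Lp_on p U u \<and>
     (\<exists>\<B>. quasicovering p U \<B> \<and>
        (\<forall>V\<in>\<B>. \<exists>G w Dw. open G \<and> V \<subseteq> G \<and> classical_W1p p G w Dw \<and>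
           (AE x in lebesgue. x \<in> V \<longrightarrow> u x = w x) \<and>
           (AE x in lebesgue. x \<in> V \<longrightarrow> Du x = Dw x))) \<and>
     Lp_on p U Du"

definition KM_norm :: "real \<Rightarrow> 'a::euclidean_space set \<Rightarrow> ('a \<Rightarrow> real) \<Rightarrow> ('a \<Rightarrow> 'a) \<Rightarrow> real" where
  "KM_norm p U u Du =
     enn2real (\<integral>\<^sup>+ x\<in>U. ennreal (\<bar>u x\<bar> powr p + norm (Du x) powr p) \<partial>lebesgue) powr (1 / p)"

end

theory Submission
  imports Defs "HOL-Probability.Probability" "HOL-Real_Asymp.Real_Asymp"
begin

text \<open>
  Exceptional curve families are handled through densities in L^p with infinite line integral, so
  that quasiopen sets are open along almost every curve, and two functions which satisfy upper
  gradient inequalities and agree a.e. agree along almost every curve.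

  Every classical Sobolev function has, as limit of fast converging mollifications, a
  quasicontinuous representative F for which |DF| is an upper gradient along almost every curve
  and the fundamental theorem of calculus holds along almost every line. Hence any upper gradient
  on a path-open set dominates |DF| there: average over short segments and differentiate.
  If u is in the Kilpelainen-Maly space, the representatives of its classical pieces agree along
  almost every curve, because a curve meets the pieces in relatively open sets; so they glue to a
  Newtonian function with minimal weak upper gradient |Du|, and this gives the equality of norms.

  Conversely, for v in the Newtonian space choose open sets G of small capacity with U \<union> G open,
  an admissible function w for G and a bump function on a small ball in U \<union> G, and put
  psi = max 0 (min bump (1 - w)). Truncating v between - k psi and k psi gives a function with an
  upper gradient in all of space; difference quotients dominated in L^p yield its weak gradient,
  and the quasiopen sets where the truncation is inactive form the required quasicovering.
\<close>

text \<open>A quasiopen set may have empty interior, so inside it there is no room for balls, test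
  functions or mollification. Everything is therefore transported either along curves or through
  functions on the whole space. The comparison of gradients asks only for one short segment issuing
  from almost every point in each of countably many directions, and openness along curves supplies
  such segments.

  The passage from L^p estimates to single curves or points always uses one device. Errors whose
  p-th powers have integral of order \<open>small_cap p j\<close> are weighted by 2^j and collected
  in a supremum. This is one p-integrable density, and where its integral is finite the errors decay
  like 2^-j. Suprema are used because their p-th powers add up with constant 1.

  Positivity of the cutoff \<psi> confines a curve to U. This is why truncation at height k \<psi>
  gives an inequality along every curve of the whole space, including curves that leave U: whenever
  the curve meets a zero of \<psi>, the truncation is controlled by \<psi> alone.\<close>

section \<open>Powers with exponent p of extended nonnegative numbers\<close>

lemma epow_top [simp]: "epow \<infinity> p = \<infinity>" "epow top p = top"
  by (auto simp: epow_def)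

lemma epow_ennreal [simp]: "0 \<le> r \<Longrightarrow> epow (ennreal r) p = ennreal (r powr p)"
  by (auto simp: epow_def)

lemma epow_0 [simp]: "epow 0 p = 0"
  by (auto simp: epow_def)

lemma epow_mono:
  assumes "x \<le> y" "0 \<le> p" shows "epow x p \<le> epow y p"
  using assms by (cases x; cases y) (auto simp: top_unique intro!: powr_mono2)

lemma measurable_epow [measurable]: "(\<lambda>x. epow x p) \<in> borel_measurable borel"
  unfolding epow_def by measurable

lemma epow_inverse:
  assumes "0 < p" shows "epow (epow x (1/p)) p = x"
  using assms by (cases x) (auto simp: powr_powr)

lemma epow_cmult:
  assumes "0 < c" shows "epow (ennreal c * x) p = ennreal (c powr p) * epow x p"
  using assms by (cases x) (auto simp: powr_mult ennreal_mult[symmetric] ennreal_mult_top)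

text \<open>The sum is at most twice the maximum. Closeness in L^p is handled with this factor 2^p
  throughout, as the estimates below tolerate fixed factors.\<close>

lemma epow_add_le:
  assumes "0 \<le> p" shows "epow (x + y) p \<le> ennreal (2 powr p) * (epow x p + epow y p)"
proof -
  have "x + y \<le> ennreal 2 * max x y"
    by (metis add_mono ennreal_numeral max.cobounded1 max.cobounded2 mult_2 zero_le_numeral)
  then have "epow (x + y) p \<le> epow (ennreal 2 * max x y) p" using assms by (rule epow_mono)
  also have "\<dots> = ennreal (2 powr p) * epow (max x y) p" by (simp only: epow_cmult zero_less_numeral)
  also have "\<dots> \<le> ennreal (2 powr p) * (epow x p + epow y p)"
    by (intro mult_left_mono) (auto simp: max_def)
  finally show ?thesis .
qed

text \<open>Each \<open>f i\<close> is at most the p-th root of the series. The constant is 1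
  however many functions are involved, so countable families of densities are merged by suprema and
  not by sums.\<close>

lemma epow_SUP_le:
  fixes f :: "nat \<Rightarrow> ennreal"
  assumes "0 < p" shows "epow (SUP i. f i) p \<le> (\<Sum>i. epow (f i) p)"
proof -
  let ?S = "\<Sum>i. epow (f i) p"
  have "f i \<le> epow ?S (1/p)" for i
  proof -
    have "epow (f i) p \<le> ?S"
      using sum_le_suminf[of "\<lambda>i. epow (f i) p" "{i}"] by auto
    then have "epow (epow (f i) p) (1/p) \<le> epow ?S (1/p)"
      using assms by (intro epow_mono) auto
    moreover have "epow (epow (f i) p) (1/p) = f i"
      using epow_inverse[of "1/p" "f i"] assms by simp
    ultimately show ?thesis by simp
  qed
  then have "(SUP i. f i) \<le> epow ?S (1/p)" by (rule SUP_least)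
  then have "epow (SUP i. f i) p \<le> epow (epow ?S (1/p)) p" using assms by (intro epow_mono) auto
  then show ?thesis using assms by (simp add: epow_inverse)
qed

text \<open>Turns finite p-integrals into finite integrals on sets of finite measure, infinite
  values included.\<close>

lemma le_one_plus_epow:
  assumes "1 \<le> p" shows "x \<le> 1 + epow x p"
proof (cases x)
  case (real r)
  have "r \<le> 1 + r powr p"
  proof (cases "r \<le> 1")
    case True then show ?thesis by (smt (verit) powr_ge_zero)
  next
    case False
    then have "r powr 1 \<le> r powr p" using assms by (intro powr_mono) auto
    with False show ?thesis by simp
  qed
  then show ?thesis using real
    by (metis ennreal_1 ennreal_leI ennreal_plus epow_ennreal powr_ge_zero zero_le_one)
qed auto

lemma eabs_pow_eq: "eabs_pow x p = epow (e2ennreal \<bar>x\<bar>) p"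
  by (cases x) (auto simp: eabs_pow_def e2ennreal_ereal)

section \<open>Curves\<close>

definition cint :: "('a::euclidean_space \<Rightarrow> ennreal) \<Rightarrow> (real \<Rightarrow> 'a) \<Rightarrow> real \<Rightarrow> real \<Rightarrow> ennreal" where
  "cint g \<gamma> s t = (\<integral>\<^sup>+ \<tau>\<in>{s..t}. g (\<gamma> \<tau>) \<partial>lborel)"

lemma line_int_cint: "line_int g \<gamma> l = cint g \<gamma> 0 l"
  by (simp add: line_int_def cint_def)

text \<open>A curve is a total function together with a length, so a shift of the parameter
  suffices; the end of the subcurve enters only through its length.\<close>

definition subcurve :: "(real \<Rightarrow> 'a) \<Rightarrow> real \<Rightarrow> real \<Rightarrow> 'a" where
  "subcurve \<gamma> s = (\<lambda>\<tau>. \<gamma> (s + \<tau>))"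

lemma arc_curve_pos: "arc_curve \<gamma> l \<Longrightarrow> 0 < l"
  by (simp add: arc_curve_def)

lemma arc_curve_dist:
  assumes "arc_curve \<gamma> l" "0 \<le> s" "s \<le> t" "t \<le> l"
  shows "dist (\<gamma> s) (\<gamma> t) \<le> t - s"
proof -
  have "ereal (dist (\<gamma> s) (\<gamma> t)) \<le> curve_variation \<gamma> s t"
    unfolding curve_variation_def using assms
    by (intro SUP_upper2[of "[s,t]"]) auto
  then show ?thesis using assms by (auto simp: arc_curve_def)
qed

lemma arc_curve_continuous:
  assumes "arc_curve \<gamma> l" shows "continuous_on {0..l} \<gamma>"
proof (rule lipschitz_on_continuous_on[OF lipschitz_onI])
  fix x y assume "x \<in> {0..l}" "y \<in> {0..l}"
  then show "dist (\<gamma> x) (\<gamma> y) \<le> 1 * dist x y"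
    using arc_curve_dist[OF assms, of x y] arc_curve_dist[OF assms, of y x]
    by (cases "x \<le> y") (auto simp: dist_real_def dist_commute)
qed auto

lemma curve_variation_shift:
  "curve_variation (subcurve \<gamma> a) s t = curve_variation \<gamma> (a + s) (a + t)"
proof -
  have *: "{xs. sorted xs \<and> set xs \<subseteq> {a+s..a+t}} = map ((+) a) ` {xs. sorted xs \<and> set xs \<subseteq> {s..t}}"
  proof safe
    fix xs assume xs: "sorted xs" "set xs \<subseteq> {a + s..a + t}"
    have "xs = map ((+) a) (map (\<lambda>x. x - a) xs)" by (simp add: o_def)
    moreover have "sorted (map (\<lambda>x. x - a) xs)" "set (map (\<lambda>x. x - a) xs) \<subseteq> {s..t}"
      using xs by (auto simp: sorted_map sorted_wrt_iff_nth_less)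
    ultimately show "xs \<in> map ((+) a) ` {xs. sorted xs \<and> set xs \<subseteq> {s..t}}" by blast
  qed (auto simp: sorted_map sorted_wrt_iff_nth_less)
  show ?thesis
    unfolding curve_variation_def * image_image by (intro SUP_cong) (auto simp: subcurve_def)
qed

lemma arc_curve_subcurve:
  assumes "arc_curve \<gamma> l" "0 \<le> s" "s < t" "t \<le> l"
  shows "arc_curve (subcurve \<gamma> s) (t - s)"
  using assms unfolding arc_curve_def curve_variation_shift by auto

lemma curve_in_subcurve:
  assumes "curve_in \<gamma> l E" "0 \<le> s" "s < t" "t \<le> l" "\<gamma> ` {s..t} \<subseteq> E'"
  shows "curve_in (subcurve \<gamma> s) (t - s) E'"
proof -
  have "subcurve \<gamma> s ` {0..t - s} \<subseteq> E'"
    using assms(5) by (auto simp: subcurve_def)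
  then show ?thesis using assms arc_curve_subcurve by (auto simp: curve_in_def)
qed

lemma curve_in_mono: "curve_in \<gamma> l E \<Longrightarrow> E \<subseteq> E' \<Longrightarrow> curve_in \<gamma> l E'"
  by (auto simp: curve_in_def)

text \<open>Along a unit vector every partition sum telescopes, so the partition
  \<open>[s,t]\<close> already attains the supremum.\<close>

lemma arc_curve_segment:
  fixes e :: "'a::euclidean_space"
  assumes "norm e = 1" "0 < l"
  shows "arc_curve (\<lambda>t. x + t *\<^sub>R e) l"
  unfolding arc_curve_def
proof (intro conjI allI impI)
  fix s t assume st: "0 \<le> s \<and> s \<le> t \<and> t \<le> l"
  have d: "dist (x + a *\<^sub>R e) (x + b *\<^sub>R e) = \<bar>b - a\<bar>" for a b
  proof -
    have "dist (x + a *\<^sub>R e) (x + b *\<^sub>R e) = norm ((a - b) *\<^sub>R e)"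
      by (simp add: dist_norm algebra_simps)
    then show ?thesis using assms by simp
  qed
  show "curve_variation (\<lambda>t. x + t *\<^sub>R e) s t = ereal (t - s)"
    unfolding curve_variation_def d
  proof (rule antisym)
    show "(SUP xs\<in>{xs. sorted xs \<and> set xs \<subseteq> {s..t}}.
        ereal (\<Sum>i<length xs - 1. \<bar>xs ! Suc i - xs ! i\<bar>)) \<le> ereal (t - s)"
    proof (rule SUP_least)
      fix xs :: "real list" assume xs: "xs \<in> {xs. sorted xs \<and> set xs \<subseteq> {s..t}}"
      have "(\<Sum>i<length xs - 1. \<bar>xs ! Suc i - xs ! i\<bar>) = (\<Sum>i<length xs - 1. xs ! Suc i - xs ! i)"
        using xs by (intro sum.cong) (auto intro!: abs_of_nonneg simp: sorted_iff_nth_mono)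
      also have "\<dots> = xs ! (length xs - 1) - xs ! 0" by (rule sum_lessThan_telescope)
      also have "\<dots> \<le> t - s"
      proof (cases "xs = []")
        case False
        then have "xs ! (length xs - 1) \<in> set xs" "xs ! 0 \<in> set xs" by auto
        then have "xs ! (length xs - 1) \<le> t" "s \<le> xs ! 0" using xs by auto
        then show ?thesis by simp
      qed (use st in auto)
      finally show "ereal (\<Sum>i<length xs - 1. \<bar>xs ! Suc i - xs ! i\<bar>) \<le> ereal (t - s)" by simp
    qed
    show "ereal (t - s) \<le> (SUP xs\<in>{xs. sorted xs \<and> set xs \<subseteq> {s..t}}.
        ereal (\<Sum>i<length xs - 1. \<bar>xs ! Suc i - xs ! i\<bar>))"
      using st by (intro SUP_upper2[of "[s,t]"]) auto
  qed
qed (use assms in auto)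

text \<open>A curve is unconstrained outside \<open>{0..l}\<close>, so compositions with it need not
  be measurable on the line. Freezing the parameter at the endpoints gives a continuous function
  with the same values on the interval.\<close>

lemma arc_curve_extend:
  assumes "arc_curve \<gamma> l"
  obtains \<gamma>' where "continuous_on UNIV \<gamma>'" "\<And>t. t \<in> {0..l} \<Longrightarrow> \<gamma>' t = \<gamma> t"
proof
  show "continuous_on UNIV (\<lambda>t. \<gamma> (max 0 (min l t)))"
    using arc_curve_pos[OF assms]
    by (intro continuous_on_compose2[OF arc_curve_continuous[OF assms]] continuous_intros) auto
qed auto

lemma measurable_along_curve:
  assumes "arc_curve \<gamma> l" "g \<in> borel_measurable borel" "0 \<le> s" "t \<le> l"
  shows "(\<lambda>\<tau>. g (\<gamma> \<tau>) * indicator {s..t} \<tau> :: ennreal) \<in> borel_measurable borel"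
proof -
  obtain \<gamma>' where \<gamma>': "continuous_on UNIV \<gamma>'" "\<And>t. t \<in> {0..l} \<Longrightarrow> \<gamma>' t = \<gamma> t"
    using arc_curve_extend[OF assms(1)] by blast
  have [measurable]: "\<gamma>' \<in> borel_measurable borel" using \<gamma>'(1) by (rule borel_measurable_continuous_onI)
  note [measurable] = assms(2)
  have "(\<lambda>\<tau>. g (\<gamma> \<tau>) * indicator {s..t} \<tau>) = (\<lambda>\<tau>. g (\<gamma>' \<tau>) * indicator {s..t} \<tau>)"
    using \<gamma>'(2) assms by (auto simp: fun_eq_iff indicator_def)
  then show ?thesis by simp
qed

lemma cint_split:
  assumes "arc_curve \<gamma> l" "g \<in> borel_measurable borel" "0 \<le> s" "s \<le> r" "r \<le> t" "t \<le> l"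
  shows "cint g \<gamma> s t = cint g \<gamma> s r + cint g \<gamma> r t"
proof -
  have "cint g \<gamma> s r + cint g \<gamma> r t
     = (\<integral>\<^sup>+ \<tau>. g (\<gamma> \<tau>) * indicator {s..r} \<tau> + g (\<gamma> \<tau>) * indicator {r..t} \<tau> \<partial>lborel)"
    unfolding cint_def using assms measurable_along_curve[OF assms(1,2)]
    by (intro nn_integral_add[symmetric]) auto
  also have "\<dots> = cint g \<gamma> s t"
    unfolding cint_def
    using AE_lborel_singleton[of r]
    by (intro nn_integral_cong_AE, eventually_elim) (use assms in \<open>auto simp: indicator_def\<close>)
  finally show ?thesis by simp
qed

lemma cint_mono_interval: "s \<le> s' \<Longrightarrow> t' \<le> t \<Longrightarrow> cint g \<gamma> s' t' \<le> cint g \<gamma> s t"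
  unfolding cint_def by (intro nn_integral_mono) (auto simp: indicator_def)

lemma cint_mono: "(\<And>\<tau>. \<tau> \<in> {s..t} \<Longrightarrow> g (\<gamma> \<tau>) \<le> h (\<gamma> \<tau>)) \<Longrightarrow> cint g \<gamma> s t \<le> cint h \<gamma> s t"
  unfolding cint_def by (intro nn_integral_mono) (auto simp: indicator_def)

lemma cint_mono_AE:
  "(AE \<tau> in lborel. \<tau> \<in> {s..t} \<longrightarrow> g (\<gamma> \<tau>) \<le> h (\<gamma> \<tau>)) \<Longrightarrow> cint g \<gamma> s t \<le> cint h \<gamma> s t"
  unfolding cint_def by (intro nn_integral_mono_AE) (auto simp: indicator_def)

lemma cint_add:
  assumes "arc_curve \<gamma> l" "g \<in> borel_measurable borel" "h \<in> borel_measurable borel" "0 \<le> s" "t \<le> l"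
  shows "cint (\<lambda>x. g x + h x) \<gamma> s t = cint g \<gamma> s t + cint h \<gamma> s t"
  unfolding cint_def using assms measurable_along_curve[OF assms(1)]
  by (subst nn_integral_add[symmetric]) (auto simp: algebra_simps)

lemma cint_cmult:
  assumes "arc_curve \<gamma> l" "g \<in> borel_measurable borel" "0 \<le> s" "t \<le> l"
  shows "cint (\<lambda>x. c * g x) \<gamma> s t = c * cint g \<gamma> s t"
  unfolding cint_def using assms measurable_along_curve[OF assms(1)]
  by (subst nn_integral_cmult[symmetric]) (auto simp: algebra_simps)

lemma cint_subcurve:
  assumes "arc_curve \<gamma> l" "g \<in> borel_measurable borel" "0 \<le> a" "a + t \<le> l" "0 \<le> s"
  shows "cint g (subcurve \<gamma> a) s t = cint g \<gamma> (a + s) (a + t)"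
proof -
  have "cint g \<gamma> (a + s) (a + t) = (\<integral>\<^sup>+\<tau>. g (\<gamma> (a + 1 * \<tau>)) * indicator {a+s..a+t} (a + 1 * \<tau>) \<partial>lborel)"
    unfolding cint_def
    by (subst nn_integral_real_affine[where c=1 and t=a]) (use assms measurable_along_curve[OF assms(1,2)] in auto)
  also have "\<dots> = cint g (subcurve \<gamma> a) s t"
    unfolding cint_def by (intro nn_integral_cong) (auto simp: subcurve_def indicator_def)
  finally show ?thesis by simp
qed

lemma line_int_subcurve:
  assumes "arc_curve \<gamma> l" "g \<in> borel_measurable borel" "0 \<le> s" "t \<le> l"
  shows "line_int g (subcurve \<gamma> s) (t - s) = cint g \<gamma> s t"
  unfolding line_int_cint using cint_subcurve[OF assms(1,2,3), of "t - s" 0] assms by simp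

text \<open>The continuous nondecreasing \<open>H\<close> turns integrals over subintervals into
  increments, so that an upper gradient inequality becomes a modulus of continuity. Finiteness of
  the integral allows the density to be replaced almost everywhere by a real function.\<close>

lemma cint_primitive:
  assumes "arc_curve \<gamma> l" "g \<in> borel_measurable borel" "cint g \<gamma> 0 l < \<infinity>"
  obtains H where "continuous_on {0..l} H"
    "\<And>s t. 0 \<le> s \<Longrightarrow> s \<le> t \<Longrightarrow> t \<le> l \<Longrightarrow> H s \<le> H t \<and> cint g \<gamma> s t = ennreal (H t - H s)"
proof
  let ?k = "\<lambda>\<tau>. g (\<gamma> \<tau>) * indicator {0..l} \<tau>"
  let ?h = "\<lambda>\<tau>. enn2real (?k \<tau>)"
  have km: "?k \<in> borel_measurable borel" using measurable_along_curve[OF assms(1,2), of 0 l] by auto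
  have fin: "cint g \<gamma> s t < \<infinity>" if "0 \<le> s" "t \<le> l" for s t
    using cint_mono_interval[of 0 s t l g \<gamma>] that assms(3) by (auto simp: top.extremum_strict less_top)
  have hk: "AE \<tau> in lborel. ennreal (?h \<tau>) = ?k \<tau>"
    using nn_integral_noteq_infinite[of ?k lborel] km assms(3) by (auto simp: cint_def less_top)
  define H where "H = (\<lambda>t. enn2real (cint g \<gamma> 0 t))"
  show "H s \<le> H t \<and> cint g \<gamma> s t = ennreal (H t - H s)" if "0 \<le> s" "s \<le> t" "t \<le> l" for s t
  proof -
    have "cint g \<gamma> 0 t = cint g \<gamma> 0 s + cint g \<gamma> s t" using cint_split[OF assms(1,2), of 0 s t] that by auto
    then show ?thesis using fin[of 0 s] fin[of s t] that unfolding H_def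
      by (cases "cint g \<gamma> 0 s"; cases "cint g \<gamma> s t") (auto simp: ennreal_plus[symmetric] simp del: ennreal_plus)
  qed
  have int: "integrable lborel ?h"
  proof (rule integrableI_nonneg)
    have "(\<integral>\<^sup>+ \<tau>. ennreal (?h \<tau>) \<partial>lborel) = cint g \<gamma> 0 l"
      unfolding cint_def using hk by (intro nn_integral_cong_AE) auto
    then show "(\<integral>\<^sup>+ \<tau>. ennreal (?h \<tau>) \<partial>lborel) < \<infinity>" using assms(3) by simp
  qed (use km in auto)
  have si: "set_integrable lborel {0..t} ?h" for t
    unfolding set_integrable_def using int by (intro integrable_mult_indicator) auto
  have "integral {0..t} ?h = H t" if "t \<in> {0..l}" for t
  proof -
    have "integral {0..t} ?h = (\<integral>\<tau>. ?h \<tau> * indicator {0..t} \<tau> \<partial>lborel)"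
      using set_borel_integral_eq_integral(2)[OF si, of t]
      by (simp add: set_lebesgue_integral_def mult.commute)
    moreover have "\<dots> = enn2real (\<integral>\<^sup>+\<tau>. ennreal (?h \<tau> * indicator {0..t} \<tau>) \<partial>lborel)"
      using km by (intro integral_eq_nn_integral) auto
    moreover have "(\<integral>\<^sup>+\<tau>. ennreal (?h \<tau> * indicator {0..t} \<tau>) \<partial>lborel) = cint g \<gamma> 0 t"
      unfolding cint_def using hk
      by (intro nn_integral_cong_AE, eventually_elim) (use that in \<open>auto simp: indicator_def split: if_splits\<close>)
    ultimately show ?thesis by (simp add: H_def)
  qed
  moreover have "continuous_on {0..l} (\<lambda>t. integral {0..t} ?h)"
    by (intro indefinite_integral_continuous_1 set_borel_integral_eq_integral(1) si)
  ultimately show "continuous_on {0..l} H"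
    using continuous_on_cong[of "{0..l}" "{0..l}" H "\<lambda>t. integral {0..t} ?h"] by simp
qed

section \<open>Upper gradient inequalities along a single curve\<close>

text \<open>Stated for all subintervals of the parameter domain and for real-valued f. In this form
  the inequality implies continuity along the curve when the integral is finite, and it can be
  checked locally.\<close>

definition ugc :: "('a::euclidean_space \<Rightarrow> real) \<Rightarrow> ('a \<Rightarrow> ennreal) \<Rightarrow> (real \<Rightarrow> 'a) \<Rightarrow> real \<Rightarrow> bool" where
  "ugc f g \<gamma> l \<longleftrightarrow> (\<forall>s t. 0 \<le> s \<and> s \<le> t \<and> t \<le> l \<longrightarrow> ennreal \<bar>f (\<gamma> s) - f (\<gamma> t)\<bar> \<le> cint g \<gamma> s t)"

lemma ugcD: "ugc f g \<gamma> l \<Longrightarrow> 0 \<le> s \<Longrightarrow> s \<le> t \<Longrightarrow> t \<le> l \<Longrightarrow> ennreal \<bar>f (\<gamma> s) - f (\<gamma> t)\<bar> \<le> cint g \<gamma> s t"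
  by (auto simp: ugc_def)

lemma ugc_continuous:
  assumes "arc_curve \<gamma> l" "g \<in> borel_measurable borel" "cint g \<gamma> 0 l < \<infinity>" "ugc f g \<gamma> l"
  shows "continuous_on {0..l} (\<lambda>t. f (\<gamma> t))"
proof -
  obtain H where H: "continuous_on {0..l} H"
    "\<And>s t. 0 \<le> s \<Longrightarrow> s \<le> t \<Longrightarrow> t \<le> l \<Longrightarrow> H s \<le> H t \<and> cint g \<gamma> s t = ennreal (H t - H s)"
    using cint_primitive[OF assms(1-3)] by blast
  have d: "dist (f (\<gamma> s)) (f (\<gamma> t)) \<le> dist (H s) (H t)" if "s \<in> {0..l}" "t \<in> {0..l}" for s t
  proof -
    have *: "\<bar>f (\<gamma> a) - f (\<gamma> b)\<bar> \<le> H b - H a" if "0 \<le> a" "a \<le> b" "b \<le> l" for a b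
      using ugcD[OF assms(4) that] H(2)[OF that] by (simp add: ennreal_le_iff)
    show ?thesis using *[of s t] *[of t s] that by (cases "s \<le> t") (auto simp: dist_real_def)
  qed
  show ?thesis
    unfolding continuous_on_iff
  proof (intro ballI allI impI)
    fix x e :: real assume x: "x \<in> {0..l}" "0 < e"
    then obtain \<delta> where \<delta>: "\<delta>>0" "\<forall>x'\<in>{0..l}. dist x' x < \<delta> \<longrightarrow> dist (H x') (H x) < e"
      using H(1) unfolding continuous_on_iff by blast
    have "dist (f (\<gamma> x')) (f (\<gamma> x)) < e" if "x' \<in> {0..l}" "dist x' x < \<delta>" for x'
      using \<delta>(2) d[of x' x] that x by force
    then show "\<exists>d>0. \<forall>x'\<in>{0..l}. dist x' x < d \<longrightarrow> dist (f (\<gamma> x')) (f (\<gamma> x)) < e"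
      using \<delta>(1) by blast
  qed
qed

text \<open>The estimate passes to concatenated intervals because the integral splits. Bisection of
  intervals (\<open>Bolzano\<close>) then spreads it from short intervals around each parameter to
  all intervals.\<close>

lemma ugc_localI:
  assumes "arc_curve \<gamma> l" "g \<in> borel_measurable borel"
    and loc: "\<And>r. 0 \<le> r \<Longrightarrow> r \<le> l \<Longrightarrow> \<exists>d>0. \<forall>s t. 0 \<le> s \<and> s \<le> r \<and> r \<le> t \<and> t \<le> l \<and> t - s < d \<longrightarrow>
       ennreal \<bar>f (\<gamma> s) - f (\<gamma> t)\<bar> \<le> cint g \<gamma> s t"
  shows "ugc f g \<gamma> l"
  unfolding ugc_def
proof (intro allI impI)
  fix s t assume st: "0 \<le> s \<and> s \<le> t \<and> t \<le> l"
  then have "s \<le> t" by simp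
  then have "0 \<le> s \<and> t \<le> l \<longrightarrow> ennreal \<bar>f (\<gamma> s) - f (\<gamma> t)\<bar> \<le> cint g \<gamma> s t"
  proof (induction rule: Bolzano)
    case (trans a b c)
    show ?case
    proof
      assume ac: "0 \<le> a \<and> c \<le> l"
      have "ennreal \<bar>f (\<gamma> a) - f (\<gamma> c)\<bar> \<le> ennreal (\<bar>f (\<gamma> a) - f (\<gamma> b)\<bar> + \<bar>f (\<gamma> b) - f (\<gamma> c)\<bar>)"
        by (intro ennreal_leI) auto
      also have "\<dots> \<le> cint g \<gamma> a b + cint g \<gamma> b c"
        using trans ac by (auto intro!: add_mono)
      also have "\<dots> = cint g \<gamma> a c" using cint_split[OF assms(1,2), of a b c] ac trans by auto
      finally show "ennreal \<bar>f (\<gamma> a) - f (\<gamma> c)\<bar> \<le> cint g \<gamma> a c" .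
    qed
  next
    case (local x)
    then show ?case using loc[of x] st by (auto; meson)
  qed
  then show "ennreal \<bar>f (\<gamma> s) - f (\<gamma> t)\<bar> \<le> cint g \<gamma> s t" using st by blast
qed

section \<open>Exceptional families of curves\<close>

text \<open>Borel measurability makes the composition with every curve measurable. Lebesgue
  measurability would not do so, since a curve may run inside a null set.\<close>

definition Lpb :: "real \<Rightarrow> ('a::euclidean_space \<Rightarrow> ennreal) \<Rightarrow> bool" where
  "Lpb p \<rho> \<longleftrightarrow> \<rho> \<in> borel_measurable borel \<and> (\<integral>\<^sup>+x. epow (\<rho> x) p \<partial>lborel) < \<infinity>"

lemma Lpb_measurable: "Lpb p \<rho> \<Longrightarrow> \<rho> \<in> borel_measurable borel"
  by (simp add: Lpb_def)

lemma Lpb_SUP: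
  fixes \<rho> :: "nat \<Rightarrow> 'a::euclidean_space \<Rightarrow> ennreal"
  assumes "0 < p" "\<And>i. \<rho> i \<in> borel_measurable borel" "(\<Sum>i. \<integral>\<^sup>+x. epow (\<rho> i x) p \<partial>lborel) < \<infinity>"
  shows "Lpb p (\<lambda>x. SUP i. \<rho> i x)"
proof -
  note [measurable] = assms(2)
  have "(\<integral>\<^sup>+x. epow (SUP i. \<rho> i x) p \<partial>lborel) \<le> (\<integral>\<^sup>+x. (\<Sum>i. epow (\<rho> i x) p) \<partial>lborel)"
    by (intro nn_integral_mono epow_SUP_le assms)
  also have "\<dots> = (\<Sum>i. \<integral>\<^sup>+x. epow (\<rho> i x) p \<partial>lborel)"
    by (intro nn_integral_suminf) auto
  finally show ?thesis using assms unfolding Lpb_def by (auto intro: le_less_trans)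
qed

lemma Lpb_add:
  assumes "Lpb p f" "Lpb p g" "0 \<le> p" shows "Lpb p (\<lambda>x. f x + g x)"
proof -
  have [measurable]: "f \<in> borel_measurable borel" "g \<in> borel_measurable borel" using assms by (auto simp: Lpb_def)
  have "(\<integral>\<^sup>+x. epow (f x + g x) p \<partial>lborel) \<le> (\<integral>\<^sup>+x. ennreal (2 powr p) * (epow (f x) p + epow (g x) p) \<partial>lborel)"
    by (intro nn_integral_mono epow_add_le assms)
  also have "\<dots> = ennreal (2 powr p) * ((\<integral>\<^sup>+x. epow (f x) p \<partial>lborel) + (\<integral>\<^sup>+x. epow (g x) p \<partial>lborel))"
    by (simp add: nn_integral_cmult nn_integral_add)
  also have "\<dots> < \<infinity>" using assms by (auto simp: Lpb_def ennreal_mult_less_top)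
  finally show ?thesis by (simp add: Lpb_def)
qed

lemma Lpb_cmult:
  assumes "Lpb p f" "0 < c" shows "Lpb p (\<lambda>x. ennreal c * f x)"
  using assms by (auto simp: Lpb_def epow_cmult nn_integral_cmult ennreal_mult_less_top)

text \<open>``For p-almost every curve in E'': the exceptional curves have infinite line integral against a
  single p-integrable Borel density. Equivalent to modulus zero, and inherited by subcurves.\<close>

definition pae :: "real \<Rightarrow> 'a::euclidean_space set \<Rightarrow> ((real \<Rightarrow> 'a) \<Rightarrow> real \<Rightarrow> bool) \<Rightarrow> bool" where
  "pae p E P \<longleftrightarrow> (\<exists>\<rho>. Lpb p \<rho> \<and> (\<forall>\<gamma> l. curve_in \<gamma> l E \<and> line_int \<rho> \<gamma> l < \<infinity> \<longrightarrow> P \<gamma> l))"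

lemma pae_mono:
  assumes "pae p E P" "\<And>\<gamma> l. curve_in \<gamma> l E \<Longrightarrow> P \<gamma> l \<Longrightarrow> Q \<gamma> l" shows "pae p E Q"
  using assms unfolding pae_def by blast

text \<open>The supremum of suitably scaled densities is again in L^p, and a finite integral against
  it makes all the individual integrals finite. The countable index type is enumerated by
  \<open>from_nat\<close>.\<close>

lemma pae_all:
  fixes P :: "'i::countable \<Rightarrow> (real \<Rightarrow> 'a::euclidean_space) \<Rightarrow> real \<Rightarrow> bool"
  assumes "0 < p" "\<And>i. pae p E (P i)" shows "pae p E (\<lambda>\<gamma> l. \<forall>i. P i \<gamma> l)"
proof -
  have "\<forall>i. \<exists>\<rho>. Lpb p \<rho> \<and> (\<forall>\<gamma> l. curve_in \<gamma> l E \<and> line_int \<rho> \<gamma> l < \<infinity> \<longrightarrow> P i \<gamma> l)"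
    using assms(2) by (auto simp: pae_def)
  then obtain \<rho> where \<rho>: "\<And>i. Lpb p (\<rho> i)"
    "\<And>i \<gamma> l. curve_in \<gamma> l E \<Longrightarrow> line_int (\<rho> i) \<gamma> l < \<infinity> \<Longrightarrow> P i \<gamma> l" by metis
  define A where "A = (\<lambda>n. enn2real (\<integral>\<^sup>+x. epow (\<rho> (from_nat n) x) p \<partial>lborel))"
  have A: "(\<integral>\<^sup>+x. epow (\<rho> (from_nat n) x) p \<partial>lborel) = ennreal (A n)" for n
    using \<rho>(1)[of "from_nat n"] by (auto simp: A_def Lpb_def)
  have A0: "0 \<le> A n" for n by (simp add: A_def)
  \<comment> \<open>The p-th power of \<open>c n\<close> brings the n-th p-integral down to 2^-n;
    the summand 1 keeps the quotient defined when \<open>A n\<close> is 0.\<close>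
  define c where "c = (\<lambda>n. ((1/2)^n / (1 + A n)) powr (1/p))"
  have c0: "c n > 0" for n using A0[of n] by (simp add: c_def add_nonneg_pos pos_add_strict)
  have cp: "c n powr p * A n \<le> (1/2)^n" for n
  proof -
    have "c n powr p = (1/2)^n / (1 + A n)" using assms(1) A0[of n] by (simp add: c_def powr_powr)
    moreover have "(1/2)^n / (1 + A n) * A n = (1/2)^n * (A n / (1 + A n))" by simp
    moreover have "(1/2)^n * (A n / (1 + A n)) \<le> (1/2)^n * 1"
      using A0[of n] by (intro mult_left_mono) auto
    ultimately show ?thesis by simp
  qed
  define R where "R = (\<lambda>x. SUP n. ennreal (c n) * \<rho> (from_nat n) x)"
  have m: "\<rho> i \<in> borel_measurable borel" for i using \<rho>(1) by (rule Lpb_measurable)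
  have "Lpb p R"
    unfolding R_def
  proof (rule Lpb_SUP)
    have "(\<Sum>n. \<integral>\<^sup>+x. epow (ennreal (c n) * \<rho> (from_nat n) x) p \<partial>lborel) \<le> (\<Sum>n. ennreal ((1/2)^n))"
      using m c0 cp A0
      by (intro suminf_le) (auto simp: epow_cmult nn_integral_cmult A ennreal_mult[symmetric] intro!: ennreal_leI)
    also have "\<dots> = ennreal (\<Sum>n. (1/2)^n)" by (intro suminf_ennreal2) (auto simp: summable_geometric)
    finally show "(\<Sum>n. \<integral>\<^sup>+x. epow (ennreal (c n) * \<rho> (from_nat n) x) p \<partial>lborel) < \<infinity>"
      by (auto intro: le_less_trans)
  qed (use assms m in auto)
  moreover have "P i \<gamma> l" if "curve_in \<gamma> l E" "line_int R \<gamma> l < \<infinity>" for i \<gamma> l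
  proof (rule \<rho>(2))
    have ac: "arc_curve \<gamma> l" using that by (simp add: curve_in_def)
    have "ennreal (c (to_nat i)) * line_int (\<rho> i) \<gamma> l = line_int (\<lambda>x. ennreal (c (to_nat i)) * \<rho> i x) \<gamma> l"
      unfolding line_int_cint using cint_cmult[OF ac m] by simp
    also have "\<dots> \<le> line_int R \<gamma> l"
      unfolding line_int_cint R_def by (intro cint_mono SUP_upper2[of "to_nat i"]) auto
    also have "\<dots> < \<infinity>" by fact
    finally show "line_int (\<rho> i) \<gamma> l < \<infinity>" using c0[of "to_nat i"] by (auto simp: ennreal_mult_less_top)
  qed fact
  ultimately show ?thesis by (auto simp: pae_def)
qed

lemma pae_conj:
  assumes "0 < p" "pae p E P" "pae p E Q" shows "pae p E (\<lambda>\<gamma> l. P \<gamma> l \<and> Q \<gamma> l)"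
proof -
  have "pae p E (\<lambda>\<gamma> l. \<forall>b::bool. (if b then P else Q) \<gamma> l)"
    using assms by (intro pae_all) auto
  then show ?thesis
  proof (rule pae_mono)
    fix \<gamma> l assume "\<forall>b::bool. (if b then P else Q) \<gamma> l"
    from this[THEN spec, of True] this[THEN spec, of False] show "P \<gamma> l \<and> Q \<gamma> l" by simp
  qed
qed

lemma pae_finite: "Lpb p \<rho> \<Longrightarrow> pae p E (\<lambda>\<gamma> l. cint \<rho> \<gamma> 0 l < \<infinity>)"
  unfolding pae_def line_int_cint by blast

text \<open>The same density serves, as its integral over a subcurve is no larger. Only the subcurve
  has to lie in E; the ambient curve may run in any set.\<close>

lemma pae_subcurves:
  assumes "pae p E P"
  shows "pae p E' (\<lambda>\<gamma> l. \<forall>s t. 0 \<le> s \<and> s < t \<and> t \<le> l \<and> \<gamma> ` {s..t} \<subseteq> E \<longrightarrow> P (subcurve \<gamma> s) (t - s))"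
proof -
  obtain \<rho> where \<rho>: "Lpb p \<rho>" "\<And>\<gamma> l. curve_in \<gamma> l E \<Longrightarrow> line_int \<rho> \<gamma> l < \<infinity> \<Longrightarrow> P \<gamma> l"
    using assms by (auto simp: pae_def)
  have "P (subcurve \<gamma> s) (t - s)" if "curve_in \<gamma> l E'" "line_int \<rho> \<gamma> l < \<infinity>"
    "0 \<le> s" "s < t" "t \<le> l" "\<gamma> ` {s..t} \<subseteq> E" for \<gamma> l s t
  proof (rule \<rho>(2))
    show "curve_in (subcurve \<gamma> s) (t - s) E" using that curve_in_subcurve by blast
    have "line_int \<rho> (subcurve \<gamma> s) (t - s) = cint \<rho> \<gamma> s t"
      using that \<rho>(1) by (intro line_int_subcurve) (auto simp: curve_in_def Lpb_def)
    also have "\<dots> \<le> cint \<rho> \<gamma> 0 l" using that by (intro cint_mono_interval) auto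
    finally show "line_int \<rho> (subcurve \<gamma> s) (t - s) < \<infinity>" using that by (simp add: line_int_cint)
  qed
  then show ?thesis using \<rho>(1) unfolding pae_def by blast
qed

lemma pae_subset:
  assumes "pae p E P" "E' \<subseteq> E" shows "pae p E' P"
  using assms unfolding pae_def by (meson curve_in_mono)

text \<open>The value infinity on a Borel null set has vanishing p-integral, while a finite line
  integral forces the curve to spend parameter measure zero in that set.\<close>

lemma pae_AE:
  fixes Q :: "'a::euclidean_space \<Rightarrow> bool"
  assumes "AE x in lborel. Q x"
  shows "pae p E (\<lambda>\<gamma> l. AE t in lborel. t \<in> {0..l} \<longrightarrow> Q (\<gamma> t))"
proof -
  obtain N where N: "N \<in> null_sets lborel" "{x. \<not> Q x} \<subseteq> N"
    using assms by (auto elim!: AE_E simp: null_sets_def)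
  have [measurable]: "N \<in> sets borel" using N by (auto simp: null_sets_def)
  let ?\<rho> = "\<lambda>x. \<infinity> * indicator N x :: ennreal"
  have "epow (?\<rho> x) p = ?\<rho> x" for x by (auto simp: indicator_def)
  then have "(\<integral>\<^sup>+x. epow (?\<rho> x) p \<partial>lborel) = 0"
    using N by (simp add: nn_integral_cmult_indicator null_sets_def)
  then have "Lpb p ?\<rho>" by (simp add: Lpb_def)
  moreover have "AE t in lborel. t \<in> {0..l} \<longrightarrow> Q (\<gamma> t)" if "curve_in \<gamma> l E" "line_int ?\<rho> \<gamma> l < \<infinity>" for \<gamma> l
  proof -
    have "AE t in lborel. ?\<rho> (\<gamma> t) * indicator {0..l} t \<noteq> \<infinity>"
      using that unfolding line_int_def
      by (intro nn_integral_noteq_infinite) (use measurable_along_curve[of \<gamma> l ?\<rho> 0 l] in \<open>auto simp: curve_in_def\<close>)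
    then show ?thesis
      by eventually_elim (use N(2) in \<open>auto simp: indicator_def split: if_splits\<close>)
  qed
  ultimately show ?thesis by (auto simp: pae_def)
qed

section \<open>Borel majorants and families of modulus zero\<close>

lemma nn_integral_lebesgue: "(\<integral>\<^sup>+x. f x \<partial>lebesgue) = (\<integral>\<^sup>+x. f x \<partial>lborel)"
  by (rule nn_integral_completion)

lemma AE_lebesgue_iff: "(AE x in lebesgue. P x) \<longleftrightarrow> (AE x in lborel. P x)"
  by (rule AE_completion_iff)

text \<open>A Borel function equal to g almost everywhere is raised to infinity on a Borel null set
  containing the exceptional points. It then majorizes g at every point of U, so upper bounds along
  curves in U survive, while integrals are unchanged.\<close>

lemma borel_envelope:
  fixes g :: "'a::euclidean_space \<Rightarrow> ennreal"
  assumes "U \<in> sets lebesgue" "g \<in> borel_measurable (restrict_space lebesgue U)"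
  obtains h where "h \<in> borel_measurable borel" "\<And>x. x \<in> U \<Longrightarrow> g x \<le> h x"
    "AE x in lborel. h x = g x * indicator U x"
proof -
  have "(\<lambda>x. g x * indicator U x) \<in> borel_measurable lebesgue"
    using assms by (subst borel_measurable_restrict_space_iff_ennreal[symmetric]) auto
  from completion_ex_borel_measurable[OF this] obtain g' where
    g': "g' \<in> borel_measurable lborel" "AE x in lborel. g x * indicator U x = g' x" by auto
  obtain N where N: "N \<in> null_sets lborel" "{x. g x * indicator U x \<noteq> g' x} \<subseteq> N"
    using g'(2) by (auto elim!: AE_E simp: null_sets_def)
  define h where "h = (\<lambda>x. if x \<in> N then \<infinity> else g' x)"
  have [measurable]: "N \<in> sets borel" "g' \<in> borel_measurable borel" using N g' by (auto simp: null_sets_def)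
  show ?thesis
  proof
    show "h \<in> borel_measurable borel" unfolding h_def by measurable
    show "g x \<le> h x" if "x \<in> U" for x
    proof (cases "x \<in> N")
      case False
      then have "g x * indicator U x = g' x" using N(2) by auto
      then show ?thesis using that False by (simp add: h_def)
    qed (simp add: h_def)
    have "AE x in lborel. x \<notin> N" using N(1) by (rule AE_not_in)
    then show "AE x in lborel. h x = g x * indicator U x"
      by eventually_elim (use N(2) in \<open>force simp: h_def\<close>)
  qed
qed

lemma Lpb_envelope:
  fixes g :: "'a::euclidean_space \<Rightarrow> ennreal"
  assumes "U \<in> sets lebesgue" "g \<in> borel_measurable (restrict_space lebesgue U)"
  obtains h where "h \<in> borel_measurable borel" "\<And>x. x \<in> U \<Longrightarrow> g x \<le> h x"
    "AE x in lborel. h x = g x * indicator U x"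
    "(\<integral>\<^sup>+x. epow (h x) p \<partial>lborel) = (\<integral>\<^sup>+x\<in>U. epow (g x) p \<partial>lebesgue)"
proof -
  obtain h where h: "h \<in> borel_measurable borel" "\<And>x. x \<in> U \<Longrightarrow> g x \<le> h x"
    "AE x in lborel. h x = g x * indicator U x"
    using borel_envelope[OF assms] by blast
  have "(\<integral>\<^sup>+x. epow (h x) p \<partial>lborel) = (\<integral>\<^sup>+x\<in>U. epow (g x) p \<partial>lborel)"
    using h(3) by (intro nn_integral_cong_AE, eventually_elim) (auto simp: indicator_def)
  then show ?thesis using that h by (simp add: nn_integral_lebesgue)
qed

lemma measurable_restrict_borel:
  "g \<in> borel_measurable borel \<Longrightarrow> g \<in> borel_measurable (restrict_space lebesgue U)"
  by (intro measurable_restrict_space1 measurable_completion) auto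

text \<open>Densities almost realizing modulus zero are multiplied by 2^i and joined in one
  supremum; a curve of the family then has integral at least 2^i for every i. The modulus integrates
  over U only, so the densities are first replaced by envelopes that vanish almost everywhere off
  U.\<close>

lemma pae_Modp:
  assumes "0 < p" "U \<in> sets lebesgue" "Modp p U \<Gamma> = 0"
  shows "pae p U (\<lambda>\<gamma> l. (\<gamma>, l) \<notin> \<Gamma>)"
proof -
  \<comment> \<open>The first factor absorbs the p-th power of the weight 2^i, the second makes the
    series converge.\<close>
  define c where "c = (\<lambda>i::nat. (2 powr (- real i * p)) * (1/2)^i)"
  have c0: "c i > 0" for i by (simp add: c_def)
  have "\<exists>h. h \<in> borel_measurable borel \<and> (\<integral>\<^sup>+x. epow (h x) p \<partial>lborel) \<le> ennreal (c i) \<and>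
      (\<forall>\<gamma> l. (\<gamma>,l) \<in> \<Gamma> \<and> curve_in \<gamma> l U \<longrightarrow> 1 \<le> line_int h \<gamma> l)" for i
  proof -
    have "Modp p U \<Gamma> < ennreal (c i)" using c0[of i] assms(3) by simp
    then obtain \<rho> where \<rho>: "\<rho> \<in> borel_measurable borel" "\<forall>(\<gamma>, l) \<in> \<Gamma>. 1 \<le> line_int \<rho> \<gamma> l"
      "(\<integral>\<^sup>+ x\<in>U. epow (\<rho> x) p \<partial>lebesgue) < ennreal (c i)"
      unfolding Modp_def INF_less_iff by auto
    obtain h where h: "h \<in> borel_measurable borel" "\<And>x. x \<in> U \<Longrightarrow> \<rho> x \<le> h x"
      "(\<integral>\<^sup>+x. epow (h x) p \<partial>lborel) = (\<integral>\<^sup>+x\<in>U. epow (\<rho> x) p \<partial>lebesgue)"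
      using Lpb_envelope[OF assms(2) measurable_restrict_borel[OF \<rho>(1)]] by blast
    have "1 \<le> line_int h \<gamma> l" if "(\<gamma>,l) \<in> \<Gamma>" "curve_in \<gamma> l U" for \<gamma> l
    proof -
      have "line_int \<rho> \<gamma> l \<le> line_int h \<gamma> l"
        unfolding line_int_cint using that by (intro cint_mono h(2)) (auto simp: curve_in_def)
      then show ?thesis using \<rho>(2) that by (auto intro: order_trans)
    qed
    then show ?thesis using h \<rho> by (intro exI[of _ h]) auto
  qed
  then obtain h where h: "\<And>i. h i \<in> borel_measurable borel" "\<And>i. (\<integral>\<^sup>+x. epow (h i x) p \<partial>lborel) \<le> ennreal (c i)"
     "\<And>i \<gamma> l. (\<gamma>,l) \<in> \<Gamma> \<Longrightarrow> curve_in \<gamma> l U \<Longrightarrow> 1 \<le> line_int (h i) \<gamma> l" by metis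
  define R where "R = (\<lambda>x. SUP i. ennreal (2^i) * h i x)"
  have "Lpb p R"
    unfolding R_def
  proof (rule Lpb_SUP)
    have "(\<integral>\<^sup>+x. epow (ennreal (2^i) * h i x) p \<partial>lborel) \<le> ennreal ((1/2)^i)" for i
    proof -
      have "(\<integral>\<^sup>+x. epow (ennreal (2^i) * h i x) p \<partial>lborel) = ennreal ((2^i) powr p) * (\<integral>\<^sup>+x. epow (h i x) p \<partial>lborel)"
        using h(1)[of i] by (subst epow_cmult) (auto simp: nn_integral_cmult)
      also have "\<dots> \<le> ennreal ((2^i) powr p) * ennreal (c i)" using h(2) by (intro mult_left_mono) auto
      also have "\<dots> = ennreal ((1/2)^i)"
        by (simp add: c_def ennreal_mult[symmetric] powr_realpow[symmetric] powr_powr powr_add[symmetric] mult.assoc[symmetric])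
      finally show ?thesis .
    qed
    then have "(\<Sum>n. \<integral>\<^sup>+x. epow (ennreal (2^n) * h n x) p \<partial>lborel) \<le> (\<Sum>n. ennreal ((1/2)^n))"
      by (intro suminf_le) auto
    also have "\<dots> = ennreal (\<Sum>n. (1/2)^n)" by (intro suminf_ennreal2) (auto simp: summable_geometric)
    finally show "(\<Sum>n. \<integral>\<^sup>+x. epow (ennreal (2^n) * h n x) p \<partial>lborel) < \<infinity>"
      by (auto intro: le_less_trans)
  qed (use assms h(1) in auto)
  moreover have "(\<gamma>, l) \<notin> \<Gamma>" if "curve_in \<gamma> l U" and fin: "line_int R \<gamma> l < \<infinity>" for \<gamma> l
  proof
    assume \<Gamma>: "(\<gamma>, l) \<in> \<Gamma>"
    have ac: "arc_curve \<gamma> l" using that by (simp add: curve_in_def)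
    have "ennreal (2^i) \<le> line_int R \<gamma> l" for i
    proof -
      have "ennreal (2^i) * 1 \<le> ennreal (2^i) * line_int (h i) \<gamma> l"
        using h(3)[OF \<Gamma> that(1)] by (intro mult_left_mono) auto
      also have "\<dots> = line_int (\<lambda>x. ennreal (2^i) * h i x) \<gamma> l"
        unfolding line_int_cint using cint_cmult[OF ac h(1)] by simp
      also have "\<dots> \<le> line_int R \<gamma> l"
        unfolding line_int_cint R_def by (intro cint_mono SUP_upper2[of i]) auto
      finally show ?thesis by simp
    qed
    moreover obtain r where "line_int R \<gamma> l = ennreal r" "0 \<le> r" using fin by (cases "line_int R \<gamma> l") auto
    ultimately have "2^i \<le> r" for i using ennreal_le_iff by metis
    moreover obtain i where "r < 2^i" using real_arch_pow[of 2 r] by auto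
    ultimately show False by (meson not_less)
  qed
  ultimately show ?thesis by (auto simp: pae_def)
qed

lemma ennreal_zeroI:
  fixes a :: ennreal
  assumes "C < \<infinity>" "\<And>\<epsilon>. 0 < \<epsilon> \<Longrightarrow> a \<le> ennreal \<epsilon> * C" shows "a = 0"
proof -
  obtain r where r: "C = ennreal r" "0 \<le> r" using assms(1) by (cases C) auto
  have "a \<le> 0 + ennreal e" if "0 < e" for e
  proof -
    have "a \<le> ennreal (e / (1 + r)) * C" using r that by (intro assms(2)) (auto intro!: divide_pos_pos)
    also have "\<dots> = ennreal (e * (r / (1 + r)))" using r that by (simp add: ennreal_mult[symmetric])
    also have "\<dots> \<le> ennreal e" using r that by (intro ennreal_leI) (auto intro!: mult_left_le simp: field_simps)
    finally show ?thesis by simp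
  qed
  then have "a \<le> 0" by (rule ennreal_le_epsilon) auto
  then show ?thesis by simp
qed

text \<open>Every positive multiple of the density is admissible on curves of infinite integral, so
  the infimum is at most an arbitrarily small multiple of a finite number.\<close>

lemma Modp_infinite_zero:
  assumes "0 < p" "Lpb p \<rho>"
  shows "Modp p E {(\<gamma>, l). arc_curve \<gamma> l \<and> line_int \<rho> \<gamma> l = \<infinity>} = 0"
proof (rule ennreal_zeroI)
  show "(\<integral>\<^sup>+x. epow (\<rho> x) p \<partial>lborel) < \<infinity>" using assms by (simp add: Lpb_def)
  fix \<epsilon> :: real assume \<epsilon>: "0 < \<epsilon>"
  define d where "d = \<epsilon> powr (1/p)"
  have d: "0 < d" "d powr p = \<epsilon>" using \<epsilon> assms by (auto simp: d_def powr_powr)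
  have m: "\<rho> \<in> borel_measurable borel" using assms by (simp add: Lpb_def)
  have "Modp p E {(\<gamma>, l). arc_curve \<gamma> l \<and> line_int \<rho> \<gamma> l = \<infinity>} \<le> (\<integral>\<^sup>+ x\<in>E. epow (ennreal d * \<rho> x) p \<partial>lebesgue)"
    unfolding Modp_def
  proof (rule INF_lower, clarsimp, intro conjI allI impI)
    show "(\<lambda>x. ennreal d * \<rho> x) \<in> borel_measurable borel" using m by auto
    fix \<gamma> l assume "arc_curve \<gamma> l \<and> line_int \<rho> \<gamma> l = \<top>"
    then show "1 \<le> line_int (\<lambda>x. ennreal d * \<rho> x) \<gamma> l"
      unfolding line_int_cint using d by (subst cint_cmult) (auto simp: m ennreal_mult_top)
  qed
  also have "\<dots> \<le> (\<integral>\<^sup>+ x. epow (ennreal d * \<rho> x) p \<partial>lborel)"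
    unfolding nn_integral_lebesgue by (intro nn_integral_mono) (auto simp: indicator_def)
  also have "\<dots> = ennreal \<epsilon> * (\<integral>\<^sup>+ x. epow (\<rho> x) p \<partial>lborel)"
    using d m by (simp add: epow_cmult nn_integral_cmult)
  finally show "Modp p E {(\<gamma>, l). arc_curve \<gamma> l \<and> line_int \<rho> \<gamma> l = \<infinity>} \<le> \<dots>" .
qed

lemma p_weak_upper_gradientI:
  assumes "0 < p" "g \<in> borel_measurable (restrict_space lebesgue E)"
    "pae p E (\<lambda>\<gamma> l. ediff (f (\<gamma> 0)) (f (\<gamma> l)) \<le> line_int g \<gamma> l)"
  shows "p_weak_upper_gradient p E f g"
proof -
  obtain \<rho> where \<rho>: "Lpb p \<rho>" "\<And>\<gamma> l. curve_in \<gamma> l E \<Longrightarrow> line_int \<rho> \<gamma> l < \<infinity> \<Longrightarrow>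
     ediff (f (\<gamma> 0)) (f (\<gamma> l)) \<le> line_int g \<gamma> l" using assms(3) by (auto simp: pae_def)
  show ?thesis
    unfolding p_weak_upper_gradient_def
    using assms(2) Modp_infinite_zero[OF assms(1) \<rho>(1), of E] \<rho>(2)
    by (intro conjI exI[of _ "{(\<gamma>, l). arc_curve \<gamma> l \<and> line_int \<rho> \<gamma> l = \<infinity>}"])
       (auto simp: less_top curve_in_def)
qed

lemma p_weak_upper_gradientD:
  assumes "0 < p" "E \<in> sets lebesgue" "p_weak_upper_gradient p E f g"
  shows "pae p E (\<lambda>\<gamma> l. ediff (f (\<gamma> 0)) (f (\<gamma> l)) \<le> line_int g \<gamma> l)"
proof -
  obtain \<Gamma> where \<Gamma>: "Modp p E \<Gamma> = 0"
    "\<And>\<gamma> l. curve_in \<gamma> l E \<Longrightarrow> (\<gamma>, l) \<notin> \<Gamma> \<Longrightarrow> ediff (f (\<gamma> 0)) (f (\<gamma> l)) \<le> line_int g \<gamma> l"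
    using assms(3) by (auto simp: p_weak_upper_gradient_def)
  show ?thesis by (rule pae_mono[OF pae_Modp[OF assms(1,2) \<Gamma>(1)]]) (use \<Gamma>(2) in auto)
qed

lemma upper_gradient_cint:
  assumes "upper_gradient E f g" "arc_curve \<gamma> l" "0 \<le> s" "s < t" "t \<le> l" "\<gamma> ` {s..t} \<subseteq> E"
  shows "ediff (f (\<gamma> s)) (f (\<gamma> t)) \<le> cint g \<gamma> s t"
proof -
  have "curve_in (subcurve \<gamma> s) (t - s) E"
    using assms curve_in_subcurve[of \<gamma> l UNIV s t E] by (auto simp: curve_in_def)
  then have "ediff (f (subcurve \<gamma> s 0)) (f (subcurve \<gamma> s (t - s))) \<le> line_int g (subcurve \<gamma> s) (t - s)"
    using assms(1) unfolding upper_gradient_def by blast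
  also have "\<dots> = cint g \<gamma> s t"
    using assms by (intro line_int_subcurve) (auto simp: upper_gradient_def)
  finally show ?thesis by (simp add: subcurve_def)
qed

lemma ediff_commute: "ediff a b = ediff b a"
  unfolding ediff_def by (cases a; cases b) (auto simp: abs_minus_commute)

lemma ediff_real [simp]: "ediff (ereal a) (ereal b) = ennreal \<bar>a - b\<bar>"
  by (simp add: ediff_def)

lemma ediff_finite:
  assumes "ediff a b < \<infinity>" shows "\<bar>a\<bar> \<noteq> \<infinity>" "\<bar>b\<bar> \<noteq> \<infinity>"
  using assms by (cases a; cases b; auto simp: ediff_def)+

lemma ediff_ereal_of:
  assumes "ediff a b < \<infinity>" shows "ediff a b = ennreal \<bar>real_of_ereal a - real_of_ereal b\<bar>"
  using assms by (cases a; cases b) (auto simp: ediff_def)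

section \<open>Capacity\<close>

lemma measurable_e2ennreal_abs:
  "v \<in> borel_measurable M \<Longrightarrow> (\<lambda>x. e2ennreal \<bar>v x\<bar>) \<in> borel_measurable M"
  by simp

lemma N1p_normp_less:
  assumes "N1p_normp p E w < c"
  obtains g where "upper_gradient E w g"
    "(\<integral>\<^sup>+ x\<in>E. eabs_pow (w x) p \<partial>lebesgue) + (\<integral>\<^sup>+ x\<in>E. epow (g x) p \<partial>lebesgue) < c"
proof -
  let ?a = "\<integral>\<^sup>+ x\<in>E. eabs_pow (w x) p \<partial>lebesgue"
  let ?I = "INF g \<in> {g. upper_gradient E w g}. (\<integral>\<^sup>+ x\<in>E. epow (g x) p \<partial>lebesgue)"
  have lt: "?a + ?I < c" using assms by (simp add: N1p_normp_def)
  have fin: "?a < \<infinity>"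
  proof (rule ccontr)
    assume "\<not> ?a < \<infinity>"
    then have "?a = \<infinity>" by (simp add: not_less top_unique)
    then show False using lt by simp
  qed
  have "?I < c - ?a" using lt fin by (simp add: add.commute less_diff_eq_ennreal)
  then obtain g where g: "upper_gradient E w g" "(\<integral>\<^sup>+ x\<in>E. epow (g x) p \<partial>lebesgue) < c - ?a"
    unfolding INF_less_iff by auto
  have "?a + (\<integral>\<^sup>+ x\<in>E. epow (g x) p \<partial>lebesgue) < c"
    using g(2) fin by (simp add: less_diff_eq_ennreal add.commute)
  then show ?thesis using that g(1) by blast
qed

lemma Cp_less:
  assumes "Cp p A < c"
  obtains w g where "w \<in> N1p p UNIV" "\<And>x. x \<in> A \<Longrightarrow> 1 \<le> w x" "upper_gradient UNIV w g"
    "(\<integral>\<^sup>+ x. eabs_pow (w x) p \<partial>lborel) + (\<integral>\<^sup>+ x. epow (g x) p \<partial>lborel) < c"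
proof -
  obtain w where w: "w \<in> N1p p UNIV" "\<forall>x\<in>A. 1 \<le> w x" "N1p_normp p UNIV w < c"
    using assms unfolding Cp_def INF_less_iff by auto
  obtain g where "upper_gradient UNIV w g"
    "(\<integral>\<^sup>+ x\<in>UNIV. eabs_pow (w x) p \<partial>lebesgue) + (\<integral>\<^sup>+ x\<in>UNIV. epow (g x) p \<partial>lebesgue) < c"
    using N1p_normp_less[OF w(3)] by blast
  then show ?thesis using that w by (auto simp: nn_integral_lebesgue)
qed

lemma Cp_le:
  assumes "w \<in> borel_measurable lebesgue" "\<And>x. x \<in> A \<Longrightarrow> 1 \<le> w x" "upper_gradient UNIV w g"
  shows "Cp p A \<le> (\<integral>\<^sup>+ x. eabs_pow (w x) p \<partial>lborel) + (\<integral>\<^sup>+ x. epow (g x) p \<partial>lborel)" (is "_ \<le> ?R")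
proof (cases "?R < \<infinity>")
  case True
  have "N1p_normp p UNIV w \<le> ?R"
    unfolding N1p_normp_def using assms(3) by (intro add_mono INF_lower2[of g]) (auto simp: nn_integral_lebesgue)
  moreover from this True have "w \<in> N1p p UNIV"
    using assms(1) by (auto simp: N1p_def lebesgue_on_UNIV_eq intro: le_less_trans)
  ultimately show ?thesis unfolding Cp_def using assms(2) by (intro INF_lower2[of w]) auto
qed (auto simp: not_less top_unique)

lemma Cp_mono: "A \<subseteq> B \<Longrightarrow> Cp p A \<le> Cp p B"
  unfolding Cp_def by (intro INF_superset_mono) auto

lemma N1p_envelope:
  assumes "w \<in> N1p p UNIV"
  obtains W where "W \<in> borel_measurable borel" "\<And>x. e2ennreal \<bar>w x\<bar> \<le> W x"
    "(\<integral>\<^sup>+x. epow (W x) p \<partial>lborel) = (\<integral>\<^sup>+ x. eabs_pow (w x) p \<partial>lborel)"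
proof -
  have "(\<lambda>x. e2ennreal \<bar>w x\<bar>) \<in> borel_measurable (restrict_space lebesgue UNIV)"
    using assms unfolding N1p_def by (intro measurable_e2ennreal_abs) auto
  from Lpb_envelope[OF _ this, of p] obtain W where "W \<in> borel_measurable borel" "\<And>x. e2ennreal \<bar>w x\<bar> \<le> W x"
    "(\<integral>\<^sup>+x. epow (W x) p \<partial>lborel) = (\<integral>\<^sup>+x. epow (e2ennreal \<bar>w x\<bar>) p \<partial>lebesgue)" by auto
  then show ?thesis using that by (simp add: nn_integral_lebesgue eabs_pow_eq)
qed

text \<open>For a function that is at least 1 at one point of a curve: a small gradient integral
  keeps its modulus at 1/2 or more elsewhere on the curve.\<close>

lemma ediff_half:
  assumes "ediff a b \<le> ennreal r" "r < 1/2" "0 \<le> r" "1 \<le> b"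
  shows "ennreal (1/2) \<le> e2ennreal \<bar>a\<bar>"
proof -
  have f: "ediff a b < \<infinity>" using assms(1) by (auto intro: le_less_trans)
  obtain x y where xy: "a = ereal x" "b = ereal y" using ediff_finite[OF f] by (cases a; cases b) auto
  have "\<bar>x - y\<bar> \<le> r" using assms xy by (simp add: ennreal_le_iff)
  moreover have "1 \<le> y" using assms xy by (simp add: one_ereal_def)
  ultimately have "1/2 \<le> \<bar>x\<bar>" using assms by auto
  then have "ennreal (1/2) \<le> ennreal \<bar>x\<bar>" by (rule ennreal_leI)
  then show ?thesis using xy by (simp add: e2ennreal_ereal)
qed

text \<open>Chosen such that the factors 2^j still leave a summable series: the sum of 2^(jp) times
  small_cap p j is finite.\<close>

definition small_cap :: "real \<Rightarrow> nat \<Rightarrow> real" where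
  "small_cap p j = 2 powr (- real j * p) * (1/2)^j"

lemma small_cap_pos: "0 < small_cap p j"
  by (simp add: small_cap_def)

text \<open>A finite integral of the weighted supremum R bounds the integral of
  \<open>W j + g j\<close> along the curve by C/2^j. If the curve met \<open>A j\<close> for large
  j, the gradient bound would keep \<open>w j\<close> at 1/2 or more along the whole curve, and the
  integral of \<open>W j\<close> would be at least l/2. This is impossible once C/2^j is below
  l/2.\<close>

lemma pae_small_cap:
  fixes A :: "nat \<Rightarrow> 'a::euclidean_space set"
  assumes "0 < p" "\<And>j. Cp p (A j) < ennreal (small_cap p j)"
  shows "pae p E (\<lambda>\<gamma> l. \<exists>j0. \<forall>j\<ge>j0. \<gamma> ` {0..l} \<inter> A j = {})"
proof -
  have "\<exists>w g W. (\<forall>x\<in>A j. 1 \<le> w x) \<and> upper_gradient UNIV w g \<and> W \<in> borel_measurable borel \<and>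
     (\<forall>x. e2ennreal \<bar>w x\<bar> \<le> W x) \<and>
     (\<integral>\<^sup>+x. epow (W x) p \<partial>lborel) + (\<integral>\<^sup>+ x. epow (g x) p \<partial>lborel) < ennreal (small_cap p j)" for j
  proof -
    obtain w g where w: "w \<in> N1p p UNIV" "\<And>x. x \<in> A j \<Longrightarrow> 1 \<le> w x" "upper_gradient UNIV w g"
      "(\<integral>\<^sup>+ x. eabs_pow (w x) p \<partial>lborel) + (\<integral>\<^sup>+ x. epow (g x) p \<partial>lborel) < ennreal (small_cap p j)"
      using Cp_less[OF assms(2)] by blast
    from N1p_envelope[OF w(1)] obtain W where "W \<in> borel_measurable borel" "\<And>x. e2ennreal \<bar>w x\<bar> \<le> W x"
    "(\<integral>\<^sup>+x. epow (W x) p \<partial>lborel) = (\<integral>\<^sup>+ x. eabs_pow (w x) p \<partial>lborel)" by blast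
    then show ?thesis using w by (intro exI[of _ w] exI[of _ g] exI[of _ W]) auto
  qed
  then obtain w g W where w: "\<And>j x. x \<in> A j \<Longrightarrow> 1 \<le> w j x" "\<And>j. upper_gradient UNIV (w j) (g j)"
    "\<And>j. W j \<in> borel_measurable borel" "\<And>j x. e2ennreal \<bar>w j x\<bar> \<le> W j x"
    "\<And>j. (\<integral>\<^sup>+x. epow (W j x) p \<partial>lborel) + (\<integral>\<^sup>+ x. epow (g j x) p \<partial>lborel) < ennreal (small_cap p j)"
    by metis
  have gm: "g j \<in> borel_measurable borel" for j using w(2) by (simp add: upper_gradient_def)
  note [measurable] = gm w(3)
  define R where "R = (\<lambda>x. SUP j. ennreal (2^j) * (W j x + g j x))"
  have "Lpb p R"
    unfolding R_def
  proof (rule Lpb_SUP)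
    have "(\<integral>\<^sup>+x. epow (ennreal (2^i) * (W i x + g i x)) p \<partial>lborel) \<le> ennreal (2 powr p * (1/2)^i)" for i
    proof -
      have "(\<integral>\<^sup>+x. epow (ennreal (2^i) * (W i x + g i x)) p \<partial>lborel)
         = ennreal ((2^i) powr p) * (\<integral>\<^sup>+x. epow (W i x + g i x) p \<partial>lborel)"
        by (subst epow_cmult) (auto simp: nn_integral_cmult)
      also have "\<dots> \<le> ennreal ((2^i) powr p) * (\<integral>\<^sup>+x. ennreal (2 powr p) * (epow (W i x) p + epow (g i x) p) \<partial>lborel)"
        using assms by (intro mult_left_mono nn_integral_mono epow_add_le) auto
      also have "\<dots> = ennreal ((2^i) powr p) * (ennreal (2 powr p) * ((\<integral>\<^sup>+x. epow (W i x) p \<partial>lborel) + (\<integral>\<^sup>+ x. epow (g i x) p \<partial>lborel)))"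
        by (simp add: nn_integral_cmult nn_integral_add)
      also have "\<dots> \<le> ennreal ((2^i) powr p) * (ennreal (2 powr p) * ennreal (small_cap p i))"
        using w(5)[of i] by (intro mult_left_mono) auto
      also have "\<dots> = ennreal (((2^i) powr p * 2 powr (- real i * p)) * (2 powr p * (1/2)^i))"
        by (simp add: small_cap_def ennreal_mult[symmetric] mult_ac)
      also have "(2^i) powr p * 2 powr (- real i * p) = 1"
        by (simp add: powr_realpow[symmetric] powr_powr powr_add[symmetric])
      finally show ?thesis by simp
    qed
    then have "(\<Sum>n. \<integral>\<^sup>+x. epow (ennreal (2^n) * (W n x + g n x)) p \<partial>lborel) \<le> (\<Sum>n. ennreal (2 powr p * (1/2)^n))"
      by (intro suminf_le) auto
    also have "\<dots> = ennreal (\<Sum>n. 2 powr p * (1/2)^n)" by (intro suminf_ennreal2 summable_mult) (auto simp: summable_geometric)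
    finally show "(\<Sum>n. \<integral>\<^sup>+x. epow (ennreal (2^n) * (W n x + g n x)) p \<partial>lborel) < \<infinity>"
      by (auto intro: le_less_trans)
  qed (use assms in auto)
  moreover have "\<exists>j0. \<forall>j\<ge>j0. \<gamma> ` {0..l} \<inter> A j = {}" if "curve_in \<gamma> l E" and fin: "line_int R \<gamma> l < \<infinity>" for \<gamma> l
  proof -
    have ac: "arc_curve \<gamma> l" and l: "0 < l" using that arc_curve_pos by (auto simp: curve_in_def)
    obtain C where C: "line_int R \<gamma> l = ennreal C" "0 \<le> C" using fin by (cases "line_int R \<gamma> l") auto
    have b: "cint (\<lambda>x. W j x + g j x) \<gamma> 0 l \<le> ennreal (C / 2^j)" for j
    proof -
      have "ennreal (2^j) * cint (\<lambda>x. W j x + g j x) \<gamma> 0 l = line_int (\<lambda>x. ennreal (2^j) * (W j x + g j x)) \<gamma> l"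
        unfolding line_int_cint by (rule cint_cmult[OF ac, symmetric]) auto
      also have "\<dots> \<le> line_int R \<gamma> l"
        unfolding line_int_cint R_def by (intro cint_mono SUP_upper2[of j]) auto
      finally have *: "ennreal (2^j) * cint (\<lambda>x. W j x + g j x) \<gamma> 0 l \<le> ennreal C" using C by simp
      have "cint (\<lambda>x. W j x + g j x) \<gamma> 0 l = ennreal (1/2^j) * (ennreal (2^j) * cint (\<lambda>x. W j x + g j x) \<gamma> 0 l)"
        by (simp add: mult.assoc[symmetric] ennreal_mult[symmetric])
      also have "\<dots> \<le> ennreal (1/2^j) * ennreal C" using * by (intro mult_left_mono) auto
      finally show ?thesis using C by (simp add: ennreal_mult[symmetric])
    qed
    have "(\<lambda>j. C / 2^j) \<longlonglongrightarrow> 0" by real_asymp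
    \<comment> \<open>The bound 1/2 keeps \<open>w j\<close> from dropping below 1/2 along the
      curve; the bound l/2 contradicts the resulting lower estimate for the integral of
      \<open>W j\<close>.\<close>
    moreover have "0 < min (1/2) (l/2)" using l by simp
    ultimately have "\<forall>\<^sub>F j in sequentially. C / 2^j < min (1/2) (l/2)" by (rule order_tendstoD)
    then obtain j0 where j0: "\<And>j. j \<ge> j0 \<Longrightarrow> C / 2^j < min (1/2) (l/2)"
      by (auto simp: eventually_sequentially)
    have "\<gamma> ` {0..l} \<inter> A j = {}" if "j \<ge> j0" for j
    proof (rule ccontr)
      assume "\<not> ?thesis"
      then obtain t where t: "0 \<le> t" "t \<le> l" "\<gamma> t \<in> A j" by auto
      \<comment> \<open>The parameter t is left out because the gradient estimate concerns
        nondegenerate subcurves; a single point does not affect the integral.\<close>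
      have half: "ennreal (1/2) \<le> W j (\<gamma> s)" if s: "s \<in> {0..l}" "s \<noteq> t" for s
      proof -
        have sub: "cint (g j) \<gamma> a b \<le> ennreal (C / 2^j)" if "0 \<le> a" "b \<le> l" for a b
        proof -
          have "cint (g j) \<gamma> a b \<le> cint (\<lambda>x. W j x + g j x) \<gamma> a b" by (intro cint_mono) auto
          also have "\<dots> \<le> cint (\<lambda>x. W j x + g j x) \<gamma> 0 l" using that by (intro cint_mono_interval) auto
          finally show ?thesis using b[of j] by simp
        qed
        have "ediff (w j (\<gamma> s)) (w j (\<gamma> t)) \<le> ennreal (C / 2^j)"
        proof (cases "s < t")
          case True
          then show ?thesis using upper_gradient_cint[OF w(2) ac, of s t j] sub[of s t] s t by force
        next
          case False
          then have "t < s" using s by simp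
          then show ?thesis using upper_gradient_cint[OF w(2) ac, of t s j] sub[of t s] s t ediff_commute[of "w j (\<gamma> s)"] by force
        qed
        then have "ennreal (1/2) \<le> e2ennreal \<bar>w j (\<gamma> s)\<bar>"
          using j0[OF \<open>j \<ge> j0\<close>] C(2) by (intro ediff_half[OF _ _ _ w(1)[OF t(3)], of _ "C / 2^j"]) auto
        then show ?thesis using w(4) order_trans by blast
      qed
      have "ennreal (1/2) * ennreal l = (\<integral>\<^sup>+ \<tau>. ennreal (1/2) * indicator {0..l} \<tau> \<partial>lborel)"
        using l by (subst nn_integral_cmult_indicator) auto
      also have "\<dots> \<le> cint (\<lambda>x. W j x + g j x) \<gamma> 0 l"
        unfolding cint_def using AE_lborel_singleton[of t]
        by (intro nn_integral_mono_AE, eventually_elim) (use half in \<open>auto simp: indicator_def add_increasing2\<close>)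
      also have "\<dots> \<le> ennreal (C / 2^j)" by (rule b)
      finally have "ennreal (1/2 * l) \<le> ennreal (C / 2^j)" using l by (simp only: ennreal_mult)
      then have "1/2 * l \<le> C / 2^j" using C by (subst (asm) ennreal_le_iff) auto
      then show False using j0[OF that] by simp
    qed
    then show ?thesis by blast
  qed
  ultimately show ?thesis by (auto simp: pae_def)
qed

lemma pae_Cp_zero:
  assumes "0 < p" "Cp p Z = 0"
  shows "pae p E (\<lambda>\<gamma> l. \<gamma> ` {0..l} \<inter> Z = {})"
  by (rule pae_mono[OF pae_small_cap[where A="\<lambda>_. Z"]]) (use assms small_cap_pos in auto)

text \<open>The admissible function is only Lebesgue measurable, so the superlevel set is taken of a
  Borel envelope W. Its measure is at most the p-integral of W.\<close>

lemma Cp_cover: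
  assumes "Cp p A < c" "0 < p"
  obtains B where "B \<in> sets borel" "A \<subseteq> B" "emeasure lborel B \<le> c"
proof -
  obtain w g where w: "w \<in> N1p p UNIV" "\<And>x. x \<in> A \<Longrightarrow> 1 \<le> w x" "upper_gradient UNIV w g"
    "(\<integral>\<^sup>+ x. eabs_pow (w x) p \<partial>lborel) + (\<integral>\<^sup>+ x. epow (g x) p \<partial>lborel) < c"
    using Cp_less[OF assms(1)] by blast
  obtain W where W: "W \<in> borel_measurable borel" "\<And>x. e2ennreal \<bar>w x\<bar> \<le> W x"
    "(\<integral>\<^sup>+x. epow (W x) p \<partial>lborel) = (\<integral>\<^sup>+ x. eabs_pow (w x) p \<partial>lborel)" using N1p_envelope[OF w(1)] by blast
  note [measurable] = W(1)
  show ?thesis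
  proof
    show m: "{x. 1 \<le> W x} \<in> sets borel" by measurable
    show "A \<subseteq> {x. 1 \<le> W x}"
    proof clarsimp
      fix x assume "x \<in> A"
      then have "1 \<le> \<bar>w x\<bar>" using w(2)[of x] by (cases "w x") (auto simp: one_ereal_def)
      then have "e2ennreal 1 \<le> e2ennreal \<bar>w x\<bar>" by (rule e2ennreal_mono)
      then have "1 \<le> e2ennreal \<bar>w x\<bar>" by (simp add: one_ennreal_def)
      then show "1 \<le> W x" using W(2) order_trans by blast
    qed
    have one: "1 = epow 1 p" using epow_ennreal[of 1 p] by simp
    have "emeasure lborel {x. 1 \<le> W x} = (\<integral>\<^sup>+x. indicator {x. 1 \<le> W x} x \<partial>lborel)" using m by simp
    also have "\<dots> \<le> (\<integral>\<^sup>+x. epow (W x) p \<partial>lborel)"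
      using assms(2) by (intro nn_integral_mono) (auto simp: indicator_def intro!: epow_mono[of 1 _ p, folded one])
    also have "\<dots> \<le> c" using w(4) W(3) by (intro order_trans[OF _ less_imp_le[OF w(4)]]) (simp add: add_increasing2)
    finally show "emeasure lborel {x. 1 \<le> W x} \<le> c" .
  qed
qed

text \<open>Each set has a Borel cover of measure at most \<open>small_cap p j\<close>, and these
  bounds tend to 0.\<close>

lemma small_cap_Inter_null:
  assumes "0 < p" "\<And>j. Cp p (A j) < ennreal (small_cap p j)"
  shows "AE x in lborel. x \<notin> (\<Inter>j. A j)"
proof -
  have "\<exists>B. B \<in> sets borel \<and> A j \<subseteq> B \<and> emeasure lborel B \<le> ennreal (small_cap p j)" for j
    using Cp_cover[OF assms(2) assms(1)] by blast
  then obtain B where B: "\<And>j. B j \<in> sets borel" "\<And>j. A j \<subseteq> B j" "\<And>j. emeasure lborel (B j) \<le> ennreal (small_cap p j)"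
    by metis
  have "(\<lambda>j. small_cap p j) \<longlonglongrightarrow> 0"
    unfolding small_cap_def
  proof (rule tendsto_sandwich[of "\<lambda>_. 0"])
    show "\<forall>\<^sub>F n in sequentially. 2 powr (- real n * p) * (1 / 2) ^ n \<le> (1/2 :: real) ^ n"
      using assms(1) powr_mono[of "- real _ * p" 0 2]
      by (intro always_eventually allI mult_left_le_one_le) auto
  qed (auto intro: LIMSEQ_power_zero)
  then have lim: "(\<lambda>j. ennreal (small_cap p j)) \<longlonglongrightarrow> 0" using tendsto_ennrealI by fastforce
  have "emeasure lborel (\<Inter>j. B j) \<le> ennreal (small_cap p j)" for j
    using B(1,3)[of j] by (intro order_trans[OF emeasure_mono B(3)]) auto
  then have "emeasure lborel (\<Inter>j. B j) \<le> 0"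
    by (intro LIMSEQ_le_const[OF lim]) auto
  then have "(\<Inter>j. B j) \<in> null_sets lborel" using B(1) by (auto simp: null_sets_def)
  from AE_not_in[OF this] show ?thesis by eventually_elim (use B(2) in blast)
qed

lemma Cp_zero_AE:
  assumes "0 < p" "Cp p Z = 0" shows "AE x in lborel. x \<notin> Z"
  using small_cap_Inter_null[OF assms(1), of "\<lambda>_. Z"] assms small_cap_pos by auto

lemma sets_lebesgue_AE:
  assumes "AE x in lborel. x \<notin> Z" shows "Z \<in> sets lebesgue"
proof -
  have "AE x in lebesgue. x \<notin> Z" using assms by (simp add: AE_lebesgue_iff)
  then have "Z \<in> null_sets lebesgue" by (simp add: completion.null_sets_iff_AE)
  then show ?thesis by auto
qed

section \<open>Quasiopen sets along curves\<close>

lemma quasiopenE: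
  assumes "quasiopen p V"
  obtains G where "\<And>j. open (G j)" "\<And>j. Cp p (G j) < ennreal (small_cap p j)" "\<And>j. open (V \<union> G j)"
proof -
  have "\<forall>j. \<exists>G. open G \<and> Cp p G < ennreal (small_cap p j) \<and> open (V \<union> G)"
    using assms small_cap_pos[of p] unfolding quasiopen_def by blast
  then show ?thesis using that by metis
qed

abbreviation path_open :: "real \<Rightarrow> 'a::euclidean_space set \<Rightarrow> 'a set \<Rightarrow> bool" where
  "path_open p E V \<equiv> pae p E (\<lambda>\<gamma> l. openin (top_of_set {0..l}) {t \<in> {0..l}. \<gamma> t \<in> V})"

text \<open>Almost every curve misses \<open>G j\<close> for some j, and on such a curve V cannot be
  told from the open set V \<union> \<open>G j\<close>.\<close>

lemma quasiopen_path_open: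
  assumes "0 < p" "quasiopen p V"
  shows "path_open p E V"
proof -
  obtain G where G: "\<And>j. open (G j)" "\<And>j. Cp p (G j) < ennreal (small_cap p j)" "\<And>j. open (V \<union> G j)"
    using quasiopenE[OF assms(2)] by blast
  show ?thesis
  proof (rule pae_mono[OF pae_small_cap[OF assms(1) G(2)]])
    fix \<gamma> l assume c: "curve_in \<gamma> l E" and "\<exists>j0. \<forall>j\<ge>j0. \<gamma> ` {0..l} \<inter> G j = {}"
    then obtain j where j: "\<gamma> ` {0..l} \<inter> G j = {}" by blast
    then have "{t \<in> {0..l}. \<gamma> t \<in> V} = {0..l} \<inter> \<gamma> -` (V \<union> G j)" by auto
    moreover have "openin (top_of_set {0..l}) ({0..l} \<inter> \<gamma> -` (V \<union> G j))"
      using c G(3) arc_curve_continuous by (intro continuous_openin_preimage_gen) (auto simp: curve_in_def)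
    ultimately show "openin (top_of_set {0..l}) {t \<in> {0..l}. \<gamma> t \<in> V}" by simp
  qed
qed

text \<open>The intersection of the open sets U \<union> \<open>G j\<close> is Borel and exceeds U
  only by a part of the null set common to all \<open>G j\<close>.\<close>

lemma quasiopen_sets_lebesgue:
  assumes "0 < p" "quasiopen p U" shows "U \<in> sets lebesgue"
proof -
  obtain G where G: "\<And>j. open (G j)" "\<And>j. Cp p (G j) < ennreal (small_cap p j)" "\<And>j. open (U \<union> G j)"
    using quasiopenE[OF assms(2)] by blast
  let ?O = "\<Inter>j. U \<union> G j"
  have "?O \<in> sets borel" using G(3) by (intro sets.countable_INT borel_open) auto
  then have O: "?O \<in> sets lebesgue" by (intro sets_completionI_sets) simp
  have "AE x in lborel. x \<notin> ?O - U"
    using small_cap_Inter_null[OF assms(1) G(2)] by eventually_elim auto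
  then have "?O - U \<in> sets lebesgue" by (rule sets_lebesgue_AE)
  moreover have "U = ?O - (?O - U)" by auto
  ultimately show ?thesis using O by (metis sets.Diff)
qed

section \<open>Sets of capacity zero and countable subadditivity\<close>

text \<open>Converse to \<open>pae_Cp_zero\<close> and \<open>Cp_zero_AE\<close>. The indicator of Z
  is admissible, and every positive multiple of the density is an upper gradient of it: curves of
  finite integral avoid Z, and on all others the right side is infinite.\<close>

lemma Cp_zeroI:
  fixes Z :: "'a::euclidean_space set"
  assumes "0 < p" "AE x in lborel. x \<notin> Z" "pae p UNIV (\<lambda>\<gamma> l. \<gamma> ` {0..l} \<inter> Z = {})"
  shows "Cp p Z = 0"
proof -
  obtain \<rho> where \<rho>: "Lpb p \<rho>" "\<And>\<gamma> l. curve_in \<gamma> l UNIV \<Longrightarrow> line_int \<rho> \<gamma> l < \<infinity> \<Longrightarrow> \<gamma> ` {0..l} \<inter> Z = {}"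
    using assms(3) by (auto simp: pae_def)
  have m: "\<rho> \<in> borel_measurable borel" using \<rho>(1) by (simp add: Lpb_def)
  have Zm: "Z \<in> sets lebesgue" using assms(2) by (rule sets_lebesgue_AE)
  show ?thesis
  proof (rule ennreal_zeroI)
    show "(\<integral>\<^sup>+x. epow (\<rho> x) p \<partial>lborel) < \<infinity>" using \<rho>(1) by (simp add: Lpb_def)
    fix \<epsilon> :: real assume \<epsilon>: "0 < \<epsilon>"
    define d where "d = \<epsilon> powr (1/p)"
    have d: "0 < d" "d powr p = \<epsilon>" using \<epsilon> assms by (auto simp: d_def powr_powr)
    have "Cp p Z \<le> (\<integral>\<^sup>+ x. eabs_pow (ereal (indicator Z x)) p \<partial>lborel) + (\<integral>\<^sup>+ x. epow (ennreal d * \<rho> x) p \<partial>lborel)"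
    proof (rule Cp_le)
      show "(\<lambda>x. ereal (indicator Z x)) \<in> borel_measurable lebesgue" using Zm by measurable
      show "upper_gradient UNIV (\<lambda>x. ereal (indicator Z x)) (\<lambda>x. ennreal d * \<rho> x)"
        unfolding upper_gradient_def
      proof (intro conjI allI impI)
        show "(\<lambda>x. ennreal d * \<rho> x) \<in> borel_measurable borel" using m by auto
        fix \<gamma> l assume c: "curve_in \<gamma> l (UNIV :: 'a set)"
        then have ac: "arc_curve \<gamma> l" by (simp add: curve_in_def)
        show "ediff (ereal (indicator Z (\<gamma> 0))) (ereal (indicator Z (\<gamma> l))) \<le> line_int (\<lambda>x. ennreal d * \<rho> x) \<gamma> l"
        proof (cases "line_int \<rho> \<gamma> l < \<infinity>")
          case True
          have "\<gamma> 0 \<in> \<gamma> ` {0..l}" "\<gamma> l \<in> \<gamma> ` {0..l}" using arc_curve_pos[OF ac] by auto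
          then have "\<gamma> 0 \<notin> Z" "\<gamma> l \<notin> Z" using \<rho>(2)[OF c True] by blast+
          then show ?thesis by simp
        next
          case False
          then have "line_int (\<lambda>x. ennreal d * \<rho> x) \<gamma> l = \<infinity>"
            unfolding line_int_cint using d by (subst cint_cmult[OF ac m]) (auto simp: ennreal_mult_top not_less top_unique)
          then show ?thesis by simp
        qed
      qed
    qed (auto simp: one_ereal_def)
    also have "(\<integral>\<^sup>+ x. eabs_pow (ereal (indicator Z x)) p \<partial>lborel) = (\<integral>\<^sup>+ x. 0 \<partial>(lborel :: 'a measure))"
      using assms(2) by (intro nn_integral_cong_AE, eventually_elim) (auto simp: eabs_pow_def)
    also have "(\<integral>\<^sup>+ x. epow (ennreal d * \<rho> x) p \<partial>lborel) = ennreal \<epsilon> * (\<integral>\<^sup>+ x. epow (\<rho> x) p \<partial>lborel)"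
      using d m by (simp add: epow_cmult nn_integral_cmult)
    finally show "Cp p Z \<le> ennreal \<epsilon> * (\<integral>\<^sup>+ x. epow (\<rho> x) p \<partial>lborel)" by simp
  qed
qed

lemma clamp01_le:
  fixes a b :: ereal
  assumes "ediff a b \<le> ennreal r" "0 \<le> r"
  shows "min 1 (max 0 a) \<le> min 1 (max 0 b) + ereal r"
proof -
  have f: "ediff a b < \<infinity>" using assms(1) by (auto intro: le_less_trans)
  obtain x y where xy: "a = ereal x" "b = ereal y" using ediff_finite[OF f] by (cases a; cases b) auto
  have "\<bar>x - y\<bar> \<le> r" using assms xy by (simp add: ennreal_le_iff)
  then have "min 1 (max 0 x) \<le> min 1 (max 0 y) + r" by (auto simp: min_def max_def)
  moreover have m: "min 1 (max 0 (ereal z)) = ereal (min 1 (max 0 z))" for z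
    by (auto simp: min_def max_def one_ereal_def zero_ereal_def)
  ultimately show ?thesis unfolding xy m by (simp only: plus_ereal.simps ereal_less_eq)
qed

text \<open>Admissible functions are truncated to [0,1] and joined by a supremum, which has the
  supremum of the gradients as upper gradient. The truncation keeps the supremum finite, and the
  strict bounds \<open>c i\<close> allow admissible functions to be chosen without further error
  terms.\<close>

lemma Cp_Union_le:
  fixes A :: "nat \<Rightarrow> 'a::euclidean_space set"
  assumes "0 < p" "\<And>i. Cp p (A i) < c i"
  shows "Cp p (\<Union>i. A i) \<le> (\<Sum>i. c i)"
proof -
  have "\<exists>w g. w \<in> N1p p UNIV \<and> (\<forall>x\<in>A i. 1 \<le> w x) \<and> upper_gradient UNIV w g \<and>
     (\<integral>\<^sup>+ x. eabs_pow (w x) p \<partial>lborel) + (\<integral>\<^sup>+ x. epow (g x) p \<partial>lborel) < c i" for i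
    using Cp_less[OF assms(2)[of i]] by metis
  then obtain w g where w: "\<And>i. w i \<in> N1p p UNIV" "\<And>i x. x \<in> A i \<Longrightarrow> 1 \<le> w i x" "\<And>i. upper_gradient UNIV (w i) (g i)"
     "\<And>i. (\<integral>\<^sup>+ x. eabs_pow (w i x) p \<partial>lborel) + (\<integral>\<^sup>+ x. epow (g i x) p \<partial>lborel) < c i" by metis
  define T where "T = (\<lambda>i x. min 1 (max 0 (w i x)))"
  define S where "S = (\<lambda>x. SUP i. T i x)"
  have wm[measurable]: "w i \<in> borel_measurable lebesgue" for i using w(1)[of i] by (simp add: N1p_def lebesgue_on_UNIV_eq)
  have gm[measurable]: "g i \<in> borel_measurable borel" for i using w(3)[of i] by (simp add: upper_gradient_def)
  have S01: "0 \<le> S x" "S x \<le> 1" for x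
    unfolding S_def T_def by (auto intro!: SUP_least SUP_upper2[of 0])
  have Sabs: "e2ennreal \<bar>S x\<bar> \<le> (SUP i. e2ennreal \<bar>w i x\<bar>)" for x
  proof -
    have "T i x \<le> enn2ereal (SUP i. e2ennreal \<bar>w i x\<bar>)" for i
    proof -
      have "T i x \<le> \<bar>w i x\<bar>" unfolding T_def by (auto simp: min_def max_def abs_ereal_ge0)
      also have "\<dots> = enn2ereal (e2ennreal \<bar>w i x\<bar>)" by (simp add: enn2ereal_e2ennreal)
      also have "\<dots> \<le> enn2ereal (SUP i. e2ennreal \<bar>w i x\<bar>)"
        by (auto simp: less_eq_ennreal.rep_eq[symmetric] intro: SUP_upper)
      finally show ?thesis .
    qed
    then have "S x \<le> enn2ereal (SUP i. e2ennreal \<bar>w i x\<bar>)" unfolding S_def by (rule SUP_least)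
    then have "e2ennreal (S x) \<le> (SUP i. e2ennreal \<bar>w i x\<bar>)" by (metis e2ennreal_mono e2ennreal_enn2ereal)
    then show ?thesis using S01(1)[of x] by simp
  qed
  let ?g = "\<lambda>x. SUP i. g i x"
  have "Cp p (\<Union>i. A i) \<le> (\<integral>\<^sup>+ x. eabs_pow (S x) p \<partial>lborel) + (\<integral>\<^sup>+ x. epow (?g x) p \<partial>lborel)"
  proof (rule Cp_le)
    show "S \<in> borel_measurable lebesgue" unfolding S_def T_def by measurable
    show "1 \<le> S x" if "x \<in> (\<Union>i. A i)" for x
    proof -
      from that obtain i where "x \<in> A i" by auto
      then have "1 \<le> T i x" using w(2)[of x i] by (cases "w i x") (auto simp: T_def min_def max_def one_ereal_def)
      then show ?thesis unfolding S_def by (rule SUP_upper2[rotated]) auto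
    qed
    show "upper_gradient UNIV S ?g"
      unfolding upper_gradient_def
    proof (intro conjI allI impI)
      show "?g \<in> borel_measurable borel" by measurable
      fix \<gamma> l assume c: "curve_in \<gamma> l (UNIV::'a set)"
      show "ediff (S (\<gamma> 0)) (S (\<gamma> l)) \<le> line_int ?g \<gamma> l"
      proof (cases "line_int ?g \<gamma> l")
        case (real r)
        have "ediff (w i (\<gamma> 0)) (w i (\<gamma> l)) \<le> ennreal r" for i
        proof -
          have "ediff (w i (\<gamma> 0)) (w i (\<gamma> l)) \<le> line_int (g i) \<gamma> l"
            using w(3)[of i] c by (auto simp: upper_gradient_def)
          also have "\<dots> \<le> line_int ?g \<gamma> l" unfolding line_int_cint by (intro cint_mono SUP_upper) auto
          finally show ?thesis using real by simp
        qed
        then have "T i (\<gamma> 0) \<le> T i (\<gamma> l) + ereal r" "T i (\<gamma> l) \<le> T i (\<gamma> 0) + ereal r" for i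
          unfolding T_def using clamp01_le real ediff_commute by metis+
        moreover have "T i x \<le> S x" for i x unfolding S_def by (auto intro: SUP_upper)
        ultimately have "T i (\<gamma> 0) \<le> S (\<gamma> l) + ereal r" "T i (\<gamma> l) \<le> S (\<gamma> 0) + ereal r" for i
          by (meson add_right_mono order_trans)+
        then have "S (\<gamma> 0) \<le> S (\<gamma> l) + ereal r" "S (\<gamma> l) \<le> S (\<gamma> 0) + ereal r"
          by (auto intro!: SUP_least simp: S_def)
        moreover obtain a b where "S (\<gamma> 0) = ereal a" "S (\<gamma> l) = ereal b"
          using S01[of "\<gamma> 0"] S01[of "\<gamma> l"] by (cases "S (\<gamma> 0)"; cases "S (\<gamma> l)") auto
        ultimately show ?thesis using real by (auto intro!: ennreal_leI)
      qed simp
    qed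
  qed
  also have "\<dots> \<le> (\<integral>\<^sup>+ x. (\<Sum>i. eabs_pow (w i x) p) \<partial>lborel) + (\<integral>\<^sup>+ x. (\<Sum>i. epow (g i x) p) \<partial>lborel)"
  proof (intro add_mono nn_integral_mono)
    show "eabs_pow (S x) p \<le> (\<Sum>i. eabs_pow (w i x) p)" for x
      unfolding eabs_pow_eq by (rule order_trans[OF epow_mono[OF Sabs] epow_SUP_le]) (use assms in auto)
    show "epow (?g x) p \<le> (\<Sum>i. epow (g i x) p)" for x by (rule epow_SUP_le[OF assms(1)])
  qed
  also have "\<dots> = (\<Sum>i. \<integral>\<^sup>+ x. eabs_pow (w i x) p \<partial>lebesgue) + (\<Sum>i. \<integral>\<^sup>+ x. epow (g i x) p \<partial>lborel)"
    unfolding nn_integral_lebesgue[symmetric] eabs_pow_eq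
    by (subst (1 2) nn_integral_suminf) (auto intro!: measurable_compose[OF _ measurable_epow] measurable_completion)
  also have "\<dots> = (\<Sum>i. (\<integral>\<^sup>+ x. eabs_pow (w i x) p \<partial>lebesgue) + (\<integral>\<^sup>+ x. epow (g i x) p \<partial>lborel))"
    by (rule suminf_add) auto
  also have "\<dots> \<le> (\<Sum>i. c i)"
    using w(4) by (intro suminf_le) (auto simp: nn_integral_lebesgue intro: less_imp_le)
  finally show ?thesis .
qed

lemma Cp_empty: "0 < p \<Longrightarrow> Cp p {} = 0"
  by (rule Cp_zeroI) (auto simp: pae_def Lpb_def intro!: exI[of _ "\<lambda>_. 0"])

lemma Cp_Un_less:
  assumes "0 < p" "Cp p A < ennreal (e/4)" "Cp p B < ennreal (e/4)" "0 < e"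
  shows "Cp p (A \<union> B) < ennreal e"
proof -
  let ?A = "\<lambda>i::nat. if i = 0 then A else if i = 1 then B else {}"
  \<comment> \<open>The bounds e/4, e/4, e/8, ... must be positive also at the empty sets, because
    \<open>Cp_Union_le\<close> asks for strict inequalities. Their sum 3e/4 is below e.\<close>
  let ?c = "\<lambda>i::nat. ennreal ((e/4) * (1/2)^(i-1))"
  have "Cp p (\<Union>i. ?A i) \<le> (\<Sum>i. ?c i)"
    using assms by (intro Cp_Union_le) (auto simp: Cp_empty)
  also have "(\<Union>i. ?A i) = A \<union> B"
    by (auto split: if_splits intro: exI[of _ "0::nat"] exI[of _ "1::nat"])
  also have "(\<lambda>i::nat. (e/4) * (1/2)^(i-1)) sums (e/4 + e/2)"
  proof -
    have "(\<lambda>i::nat. (e/4) * (1/2)^i) sums ((e/4) * (1 / (1 - 1/2)))" by (intro sums_mult geometric_sums) auto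
    then have "(\<lambda>i. (\<lambda>i::nat. (e/4) * (1/2)^(i-1)) (Suc i)) sums (e/2)" by simp
    from sums_Suc[OF this] show ?thesis by (simp add: add.commute)
  qed
  then have "(\<Sum>i. ?c i) = ennreal (e/4 + e/2)"
    using assms(4) by (subst suminf_ennreal2) (auto simp: sums_iff)
  also have "\<dots> < ennreal e" using assms(4) by (intro ennreal_lessI) auto
  finally show ?thesis .
qed

section \<open>Averages in \<open>L\<^sup>p\<close>\<close>

text \<open>The p-th power of the L^p norm, without the root; closeness in L^p is measured in this
  form.\<close>

definition pint :: "real \<Rightarrow> ('a::euclidean_space \<Rightarrow> 'b::euclidean_space) \<Rightarrow> ennreal" where
  "pint p f = (\<integral>\<^sup>+x. ennreal (norm (f x) powr p) \<partial>lborel)"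

definition Lp :: "real \<Rightarrow> ('a::euclidean_space \<Rightarrow> 'b::euclidean_space) \<Rightarrow> bool" where
  "Lp p f \<longleftrightarrow> f \<in> borel_measurable borel \<and> pint p f < \<infinity>"

lemma Lp_measurable: "Lp p f \<Longrightarrow> f \<in> borel_measurable borel"
  by (simp add: Lp_def)

lemma Lp_Lpb: "Lp p f \<Longrightarrow> Lpb p (\<lambda>x. ennreal (norm (f x)))"
  by (auto simp: Lp_def Lpb_def pint_def)

lemma pint_mono:
  assumes "0 \<le> p" "AE x in lborel. norm (f x) \<le> norm (g x)" shows "pint p f \<le> pint p g"
  unfolding pint_def using assms(2)
  by (intro nn_integral_mono_AE, eventually_elim) (use assms(1) in \<open>auto intro!: ennreal_leI powr_mono2\<close>)

lemma powr_norm_add_le: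
  assumes "0 \<le> p"
  shows "ennreal (norm (a + b) powr p) \<le> ennreal (2 powr p) * (ennreal (norm a powr p) + ennreal (norm b powr p))"
proof -
  have "epow (ennreal (norm (a + b))) p \<le> epow (ennreal (norm a) + ennreal (norm b)) p"
    using assms by (intro epow_mono) (auto simp: ennreal_plus[symmetric] norm_triangle_ineq simp del: ennreal_plus intro!: ennreal_leI)
  also have "\<dots> \<le> ennreal (2 powr p) * (epow (ennreal (norm a)) p + epow (ennreal (norm b)) p)"
    by (rule epow_add_le[OF assms])
  finally show ?thesis by simp
qed

lemma pint_add_le:
  assumes "0 \<le> p" "f \<in> borel_measurable borel" "g \<in> borel_measurable borel"
  shows "pint p (\<lambda>x. f x + g x) \<le> ennreal (2 powr p) * (pint p f + pint p g)"
proof -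
  note [measurable] = assms(2,3)
  have "pint p (\<lambda>x. f x + g x) \<le> (\<integral>\<^sup>+x. ennreal (2 powr p) * (ennreal (norm (f x) powr p) + ennreal (norm (g x) powr p)) \<partial>lborel)"
    unfolding pint_def by (intro nn_integral_mono powr_norm_add_le assms)
  also have "\<dots> = ennreal (2 powr p) * (pint p f + pint p g)"
    unfolding pint_def by (simp add: nn_integral_cmult nn_integral_add)
  finally show ?thesis .
qed

lemma Lp_add:
  assumes "0 \<le> p" "Lp p f" "Lp p g" shows "Lp p (\<lambda>x. f x + g x)"
proof -
  have "pint p (\<lambda>x. f x + g x) \<le> ennreal (2 powr p) * (pint p f + pint p g)"
    using assms by (intro pint_add_le) (auto simp: Lp_def)
  also have "\<dots> < \<infinity>" using assms by (auto simp: Lp_def ennreal_mult_less_top)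
  finally show ?thesis using assms by (auto simp: Lp_def)
qed

lemma pint_uminus: "pint p (\<lambda>x. - f x) = pint p f"
  by (simp add: pint_def)

lemma pint_diff_commute: "pint p (\<lambda>x. f x - g x) = pint p (\<lambda>x. g x - f x)"
  by (simp add: pint_def norm_minus_commute)

lemma Lp_uminus: "Lp p f \<Longrightarrow> Lp p (\<lambda>x. - f x)"
  by (simp add: Lp_def pint_uminus)

lemma Lp_diff: "0 \<le> p \<Longrightarrow> Lp p f \<Longrightarrow> Lp p g \<Longrightarrow> Lp p (\<lambda>x. f x - g x)"
  using Lp_add[of p f "\<lambda>x. - g x"] Lp_uminus[of p g] by simp

lemma Lp_mono:
  assumes "0 \<le> p" "Lp p g" "f \<in> borel_measurable borel" "AE x in lborel. norm (f x) \<le> norm (g x)" shows "Lp p f"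
  using pint_mono[OF assms(1,4)] assms(2,3) by (auto simp: Lp_def intro: le_less_trans)

lemma nn_integral_translate:
  fixes f :: "'a::euclidean_space \<Rightarrow> ennreal"
  assumes "f \<in> borel_measurable borel"
  shows "(\<integral>\<^sup>+x. f (x + y) \<partial>lborel) = (\<integral>\<^sup>+x. f x \<partial>lborel)"
proof -
  have "(\<integral>\<^sup>+x. f x \<partial>lborel) = (\<integral>\<^sup>+x. f x \<partial>(distr lborel borel ((+) y)))"
    by (simp add: lborel_distr_plus)
  also have "\<dots> = (\<integral>\<^sup>+x. f (y + x) \<partial>lborel)" using assms by (intro nn_integral_distr) auto
  finally show ?thesis by (simp add: add.commute)
qed

lemma integral_translate:
  fixes f :: "'a::euclidean_space \<Rightarrow> 'b::{banach,second_countable_topology}"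
  assumes "f \<in> borel_measurable borel"
  shows "(\<integral>x. f (x + y) \<partial>lborel) = (\<integral>x. f x \<partial>lborel)"
proof -
  have "(\<integral>x. f x \<partial>lborel) = (\<integral>x. f x \<partial>(distr lborel borel ((+) y)))"
    by (simp add: lborel_distr_plus)
  also have "\<dots> = (\<integral>x. f (y + x) \<partial>lborel)" using assms by (intro integral_distr) auto
  finally show ?thesis by (simp add: add.commute)
qed

lemma AE_translate:
  fixes y :: "'a::euclidean_space"
  assumes "AE x in lborel. P x" shows "AE x in lborel. P (x + y)"
proof -
  have "AE x in distr lborel borel ((+) y). P x" unfolding lborel_distr_plus by (rule assms)
  then have "AE x in lborel. P (y + x)" using AE_distrD[of "(+) y" lborel borel P] by simp
  then show ?thesis by (simp add: add.commute)
qed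

lemma pint_translate:
  assumes "f \<in> borel_measurable borel" shows "pint p (\<lambda>x. f (x + y)) = pint p f"
  unfolding pint_def using assms by (intro nn_integral_translate) auto

section \<open>Density of continuous functions and continuity of translations\<close>

definition cutoff :: "real \<Rightarrow> 'a::euclidean_space \<Rightarrow> real" where
  "cutoff M x = max 0 (min 1 (M + 1 - norm x))"

text \<open>For positive M, the radial retraction of the space onto the closed ball of radius
  M.\<close>

definition radial_clamp :: "real \<Rightarrow> 'b::euclidean_space \<Rightarrow> 'b" where
  "radial_clamp M z = (M / max M (norm z)) *\<^sub>R z"

lemma radial_clamp:
  assumes "0 < M" shows "norm (radial_clamp M z) \<le> M" "norm z \<le> M \<Longrightarrow> radial_clamp M z = z"
    "continuous_on UNIV (radial_clamp M)"
proof -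
  have "M * norm z / max M (norm z) \<le> M" using assms by (auto simp: max_def field_simps)
  then show "norm (radial_clamp M z) \<le> M" using assms by (simp add: radial_clamp_def)
  show "norm z \<le> M \<Longrightarrow> radial_clamp M z = z" using assms by (simp add: radial_clamp_def max_def)
  show "continuous_on UNIV (radial_clamp M)" unfolding radial_clamp_def
    using assms by (intro continuous_intros) (auto simp: max_def)
qed

text \<open>\<open>measurable_on\<close> supplies continuous functions converging to h off a
  negligible set, without any bound on them. Retracting their values to the ball of radius M and
  cutting them off beyond radius M + 1 makes them dominated. The limit is not moved, since h itself
  obeys both bounds.\<close>

lemma continuous_approx_bounded:
  fixes h :: "'a::euclidean_space \<Rightarrow> 'b::euclidean_space"
  assumes "0 < p" "h \<in> borel_measurable borel" "0 < M" "\<And>x. norm (h x) \<le> M" "\<And>x. M < norm x \<Longrightarrow> h x = 0" "0 < e"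
  obtains g where "continuous_on UNIV g" "\<And>x. M + 1 < norm x \<Longrightarrow> g x = 0" "pint p (\<lambda>x. h x - g x) < ennreal e"
proof -
  have "h measurable_on UNIV"
    using assms(2) by (intro lebesgue_measurable_imp_measurable_on) (auto simp: measurable_completion)
  then obtain N q where N: "negligible N" and q: "\<And>n. continuous_on UNIV (q n)"
    "\<And>x. x \<notin> N \<Longrightarrow> (\<lambda>n. q n x) \<longlonglongrightarrow> h x"
    unfolding measurable_on_def by auto
  define g where "g = (\<lambda>n x. cutoff M x *\<^sub>R radial_clamp M (q n x))"
  have gc: "continuous_on UNIV (g n)" for n
    unfolding g_def cutoff_def
    by (intro continuous_intros continuous_on_compose2[OF radial_clamp(3)[OF assms(3)] q(1)]) auto
  have gb: "norm (g n x) \<le> M * indicator (cball 0 (M+1)) x" for n x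
  proof -
    have "norm (g n x) \<le> 1 * M * indicator (cball 0 (M+1)) x"
    proof (cases "norm x \<le> M + 1")
      case True
      then have "norm (g n x) \<le> 1 * M" unfolding g_def norm_scaleR
        using radial_clamp(1)[OF assms(3), of "q n x"] assms(3) by (intro mult_mono) (auto simp: cutoff_def)
      with True show ?thesis by simp
    qed (auto simp: g_def cutoff_def)
    then show ?thesis by simp
  qed
  have hb: "norm (h x) \<le> M * indicator (cball 0 (M+1)) x" for x
    using assms(4)[of x] assms(5)[of x] by (auto simp: indicator_def not_le)
  have "N \<in> null_sets lebesgue" using N by (simp add: negligible_iff_null_sets)
  from AE_not_in[OF this] have ae: "AE x in lborel. x \<notin> N" by (simp only: AE_lebesgue_iff)
  have gm[measurable]: "g n \<in> borel_measurable borel" for n using gc by (rule borel_measurable_continuous_onI)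
  note [measurable] = assms(2)
  have "(\<lambda>n. \<integral>\<^sup>+x. ennreal (norm (h x - g n x) powr p) \<partial>lborel) \<longlonglongrightarrow> (\<integral>\<^sup>+x. 0 \<partial>(lborel::'a measure))"
  proof (rule nn_integral_dominated_convergence[where w="\<lambda>x. ennreal ((2 * M) powr p) * indicator (cball 0 (M+1)) x"])
    show "AE x in lborel. ennreal (norm (h x - g j x) powr p) \<le> ennreal ((2 * M) powr p) * indicator (cball 0 (M+1)) x" for j
    proof (rule AE_I2)
      fix x
      have "norm (h x - g j x) \<le> 2 * M * indicator (cball 0 (M+1)) x"
        using norm_triangle_ineq4[of "h x" "g j x"] hb[of x] gb[of j x] by linarith
      then show "ennreal (norm (h x - g j x) powr p) \<le> ennreal ((2 * M) powr p) * indicator (cball 0 (M+1)) x"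
        using assms(1,3) by (auto simp: indicator_def intro!: ennreal_leI powr_mono2 split: if_splits)
    qed
    show "(\<integral>\<^sup>+x. ennreal ((2 * M) powr p) * indicator (cball 0 (M+1)) x \<partial>(lborel::'a measure)) < \<infinity>"
      using emeasure_lborel_cball_finite[of "0::'a" "M+1"] by (subst nn_integral_cmult_indicator) (auto simp: ennreal_mult_less_top)
    show "AE x in lborel. (\<lambda>n. ennreal (norm (h x - g n x) powr p)) \<longlonglongrightarrow> 0"
      using ae
    proof eventually_elim
      case (elim x)
      have "continuous_on UNIV (radial_clamp M :: 'b \<Rightarrow> 'b)" by (rule radial_clamp(3)[OF assms(3)])
      then have "isCont (radial_clamp M) (h x)" by (simp add: continuous_on_eq_continuous_at)
      then have "(\<lambda>n. radial_clamp M (q n x)) \<longlonglongrightarrow> radial_clamp M (h x)" using q(2)[OF elim] by (rule isCont_tendsto_compose)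
      then have "(\<lambda>n. g n x) \<longlonglongrightarrow> cutoff M x *\<^sub>R radial_clamp M (h x)" unfolding g_def by (intro tendsto_intros)
      moreover have "cutoff M x *\<^sub>R radial_clamp M (h x) = h x"
        using radial_clamp(2)[OF assms(3), of "h x"] assms(4,5)[of x] by (cases "norm x \<le> M") (auto simp: cutoff_def)
      ultimately have "(\<lambda>n. h x - g n x) \<longlonglongrightarrow> h x - h x" by (intro tendsto_intros) simp
      then have lim0: "(\<lambda>n. norm (h x - g n x)) \<longlonglongrightarrow> 0" by (simp add: tendsto_norm_zero)
      have "(\<lambda>n. norm (h x - g n x) powr p) \<longlonglongrightarrow> 0 powr p"
        by (rule tendsto_powr2[OF lim0 tendsto_const]) (use assms(1) in auto)
      from tendsto_ennrealI[OF this] show ?case by simp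
    qed
    show "(\<lambda>x. ennreal (norm (h x - g i x) powr p)) \<in> borel_measurable lborel" for i by measurable
    show "(\<lambda>x. ennreal ((2 * M) powr p) * indicator (cball 0 (M+1)) x) \<in> borel_measurable (lborel::'a measure)"
    proof -
      have [measurable]: "cball (0::'a) (M+1) \<in> sets borel" by simp
      show ?thesis by measurable
    qed
  qed simp
  then have "\<forall>\<^sub>F n in sequentially. pint p (\<lambda>x. h x - g n x) < ennreal e"
    unfolding pint_def using assms(6) by (intro order_tendstoD) auto
  then obtain n where "pint p (\<lambda>x. h x - g n x) < ennreal e" by (auto simp: eventually_sequentially)
  moreover have "g n x = 0" if "M + 1 < norm x" for x using that by (simp add: g_def cutoff_def)
  ultimately show ?thesis using that gc by blast
qed

lemma continuous_approx:
  fixes h :: "'a::euclidean_space \<Rightarrow> 'b::euclidean_space"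
  assumes "0 < p" "Lp p h" "0 < e"
  obtains g R where "continuous_on UNIV g" "\<And>x. R < norm x \<Longrightarrow> g x = 0" "pint p (\<lambda>x. h x - g x) < ennreal e"
proof -
  have [measurable]: "h \<in> borel_measurable borel" and fin: "pint p h < \<infinity>" using assms(2) by (auto simp: Lp_def)
  define t where "t = (\<lambda>n x. if norm x \<le> real n \<and> norm (h x) \<le> real n then h x else 0)"
  have tm[measurable]: "t n \<in> borel_measurable borel" for n unfolding t_def by measurable
  have "(\<lambda>n. \<integral>\<^sup>+x. ennreal (norm (h x - t n x) powr p) \<partial>lborel) \<longlonglongrightarrow> (\<integral>\<^sup>+x. 0 \<partial>(lborel::'a measure))"
  proof (rule nn_integral_dominated_convergence[where w="\<lambda>x. ennreal (norm (h x) powr p)"])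
    show "AE x in lborel. (\<lambda>n. ennreal (norm (h x - t n x) powr p)) \<longlonglongrightarrow> 0"
    proof (rule AE_I2, rule tendsto_eventually)
      fix x
      obtain m :: nat where m: "max (norm x) (norm (h x)) \<le> real m" using real_arch_simple by blast
      then have "t n x = h x" if "n \<ge> m" for n
        using that by (auto simp: t_def intro: order_trans[OF _ of_nat_mono])
      then show "\<forall>\<^sub>F n in sequentially. ennreal (norm (h x - t n x) powr p) = 0"
        using assms(1) by (auto simp: eventually_sequentially intro!: exI[of _ m])
    qed
    show "AE x in lborel. ennreal (norm (h x - t j x) powr p) \<le> ennreal (norm (h x) powr p)" for j
      using assms(1) by (intro AE_I2) (auto simp: t_def)
    show "(\<integral>\<^sup>+x. ennreal (norm (h x) powr p) \<partial>lborel) < \<infinity>" using fin by (simp add: pint_def)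
  qed auto
  moreover define d where "d = e / (2 powr p * 2)"
  moreover have d: "0 < d" using assms by (simp add: d_def)
  ultimately have "\<forall>\<^sub>F n in sequentially. pint p (\<lambda>x. h x - t n x) < ennreal d"
    unfolding pint_def by (intro order_tendstoD) auto
  then obtain n0 where n0: "\<And>n. n \<ge> n0 \<Longrightarrow> pint p (\<lambda>x. h x - t n x) < ennreal d" by (auto simp: eventually_sequentially)
  \<comment> \<open>The successor makes the bound positive, as
    \<open>continuous_approx_bounded\<close> requires.\<close>
  define n where "n = Suc n0"
  have n: "pint p (\<lambda>x. h x - t n x) < ennreal d" "0 < real n" using n0[of n] by (auto simp: n_def)
  obtain g where g: "continuous_on UNIV g" "\<And>x. real n + 1 < norm x \<Longrightarrow> g x = 0" "pint p (\<lambda>x. t n x - g x) < ennreal d"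
  proof (rule continuous_approx_bounded[OF assms(1) tm n(2), of n d])
    show "norm (t n x) \<le> real n" for x by (simp add: t_def)
    show "real n < norm x \<Longrightarrow> t n x = 0" for x by (simp add: t_def)
  qed (use d that in auto)
  have gm: "g \<in> borel_measurable borel" using g(1) by (rule borel_measurable_continuous_onI)
  have "pint p (\<lambda>x. h x - g x) = pint p (\<lambda>x. (h x - t n x) + (t n x - g x))" by simp
  also have "\<dots> \<le> ennreal (2 powr p) * (pint p (\<lambda>x. h x - t n x) + pint p (\<lambda>x. t n x - g x))"
    using gm assms(1) by (intro pint_add_le) auto
  also have "\<dots> < ennreal (2 powr p) * (ennreal d + ennreal d)"
    using n g by (intro ennreal_mult_strict_left_mono add_strict_mono) auto
  also have "\<dots> = ennreal e" using assms d by (simp add: d_def ennreal_mult[symmetric] ennreal_plus[symmetric] del: ennreal_plus)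
  finally show ?thesis using that[OF g(1,2)] by blast
qed

text \<open>A compactly supported continuous function is uniformly continuous, and translation
  preserves p-integrals, so h may be replaced by such a function before and after the shift.\<close>

lemma translation_continuous:
  fixes h :: "'a::euclidean_space \<Rightarrow> 'b::euclidean_space"
  assumes "0 < p" "Lp p h" "0 < e"
  obtains \<delta> where "0 < \<delta>" "\<And>y. norm y \<le> \<delta> \<Longrightarrow> pint p (\<lambda>x. h (x + y) - h x) \<le> ennreal e"
proof -
  \<comment> \<open>Two uses of \<open>pint_add_le\<close> give 2^p d + 4^p 2d, which is at most 4^p
    3d = e.\<close>
  define d where "d = e / (4 powr p * 3)"
  have d: "0 < d" using assms by (simp add: d_def)
  obtain g R where g: "continuous_on UNIV g" "\<And>x. R < norm x \<Longrightarrow> g x = 0" "pint p (\<lambda>x. h x - g x) < ennreal d"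
    using continuous_approx[OF assms(1,2) d] by metis
  have [measurable]: "h \<in> borel_measurable borel" "g \<in> borel_measurable borel"
    using assms(2) g(1) by (auto simp: Lp_def intro: borel_measurable_continuous_onI)
  \<comment> \<open>R may be negative, hence the absolute value; the extra 1 covers shifts of length
    at most 1.\<close>
  define K where "K = measure lborel (cball (0::'a) (\<bar>R\<bar> + 1))"
  have K: "emeasure lborel (cball (0::'a) (\<bar>R\<bar> + 1)) = ennreal K" "0 \<le> K"
    unfolding K_def using emeasure_lborel_cball_finite[of "0::'a" "\<bar>R\<bar>+1"] by (auto simp: emeasure_eq_ennreal_measure)
  \<comment> \<open>A uniform error \<eta> on a ball of volume K then has p-integral at most
    d.\<close>
  define \<eta> where "\<eta> = (d / (1 + K)) powr (1/p)"
  have \<eta>: "0 < \<eta>" "\<eta> powr p * K \<le> d"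
  proof -
    show "0 < \<eta>" using d K by (simp add: \<eta>_def)
    have "\<eta> powr p * K = d * (K / (1 + K))" using d K assms by (simp add: \<eta>_def powr_powr)
    also have "\<dots> \<le> d * 1" using d K by (intro mult_left_mono) auto
    finally show "\<eta> powr p * K \<le> d" by simp
  qed
  have "uniformly_continuous_on (cball 0 (\<bar>R\<bar> + 3)) g"
    by (intro compact_uniformly_continuous continuous_on_subset[OF g(1)]) auto
  then obtain \<delta>0 where \<delta>0: "0 < \<delta>0" "\<And>x x'. x \<in> cball 0 (\<bar>R\<bar> + 3) \<Longrightarrow> x' \<in> cball 0 (\<bar>R\<bar> + 3) \<Longrightarrow> dist x' x < \<delta>0 \<Longrightarrow> dist (g x') (g x) < \<eta>"
    unfolding uniformly_continuous_on_def using \<eta>(1) by metis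
  define \<delta> where "\<delta> = min 1 (\<delta>0/2)"
  have \<delta>: "0 < \<delta>" "\<delta> \<le> 1" "\<delta> < \<delta>0" using \<delta>0(1) by (auto simp: \<delta>_def)
  have main: "pint p (\<lambda>x. h (x + y) - h x) \<le> ennreal e" if y: "norm y \<le> \<delta>" for y
  proof -
    have pt: "norm (g (x + y) - g x) \<le> \<eta> * indicator (cball 0 (\<bar>R\<bar> + 1)) x" for x
    proof (cases "x \<in> cball 0 (\<bar>R\<bar> + 1)")
      case True
      then have "x + y \<in> cball 0 (\<bar>R\<bar> + 3)" using norm_triangle_ineq[of x y] y \<delta> by auto
      then have "dist (g (x+y)) (g x) < \<eta>" using True y \<delta> by (intro \<delta>0(2)) (auto simp: dist_norm)
      then show ?thesis using True by (simp add: dist_norm)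
    next
      case False
      then have x: "\<bar>R\<bar> + 1 < norm x" by simp
      have "norm x \<le> norm (x + y) + norm y" using norm_triangle_ineq4[of "x+y" y] by simp
      then have "R < norm x" "R < norm (x + y)" using x y \<delta> by auto
      then show ?thesis using g(2) False by simp
    qed
    have g2: "pint p (\<lambda>x. g (x + y) - g x) \<le> ennreal d"
    proof -
      have "pint p (\<lambda>x. g (x + y) - g x) \<le> (\<integral>\<^sup>+x. ennreal (\<eta> powr p) * indicator (cball 0 (\<bar>R\<bar> + 1)) x \<partial>(lborel::'a measure))"
        unfolding pint_def
      proof (intro nn_integral_mono)
        fix x
        show "ennreal (norm (g (x + y) - g x) powr p) \<le> ennreal (\<eta> powr p) * indicator (cball 0 (\<bar>R\<bar> + 1)) x"
          using pt[of x] assms(1) by (auto simp: indicator_def intro!: ennreal_leI powr_mono2 split: if_splits)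
      qed
      also have "\<dots> = ennreal (\<eta> powr p * K)" using K by (subst nn_integral_cmult_indicator) (auto simp: ennreal_mult)
      also have "\<dots> \<le> ennreal d" using \<eta>(2) by (rule ennreal_leI)
      finally show ?thesis .
    qed
    have hg: "pint p (\<lambda>x. h (x + y) - g (x + y)) \<le> ennreal d"
      using g(3) pint_translate[of "\<lambda>x. h x - g x" p y] by simp
    have gh: "pint p (\<lambda>x. g x - h x) \<le> ennreal d" using g(3) by (subst pint_diff_commute) simp
    have "pint p (\<lambda>x. h (x + y) - h x) = pint p (\<lambda>x. (h (x + y) - g (x + y)) + ((g (x + y) - g x) + (g x - h x)))" by simp
    also have "\<dots> \<le> ennreal (2 powr p) * (pint p (\<lambda>x. h (x + y) - g (x + y)) + pint p (\<lambda>x. (g (x + y) - g x) + (g x - h x)))"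
      using assms(1) by (intro pint_add_le) auto
    finally have A: "pint p (\<lambda>x. h (x + y) - h x) \<le> ennreal (2 powr p) * (pint p (\<lambda>x. h (x + y) - g (x + y)) + pint p (\<lambda>x. (g (x + y) - g x) + (g x - h x)))" .
    have "pint p (\<lambda>x. (g (x + y) - g x) + (g x - h x)) \<le> ennreal (2 powr p) * (pint p (\<lambda>x. g (x + y) - g x) + pint p (\<lambda>x. g x - h x))"
      using assms(1) by (intro pint_add_le) auto
    also have "\<dots> \<le> ennreal (2 powr p) * (ennreal d + ennreal d)"
      using g2 gh by (intro mult_left_mono add_mono) auto
    finally have B: "pint p (\<lambda>x. (g (x + y) - g x) + (g x - h x)) \<le> ennreal (2 powr p) * (ennreal d + ennreal d)" .
    note A
    also have "ennreal (2 powr p) * (pint p (\<lambda>x. h (x + y) - g (x + y)) + pint p (\<lambda>x. (g (x + y) - g x) + (g x - h x)))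
        \<le> ennreal (2 powr p) * (ennreal d + ennreal (2 powr p) * (ennreal d + ennreal d))"
      using hg B by (intro mult_left_mono add_mono) auto
    also have "\<dots> = ennreal (2 powr p * d + 4 powr p * (2 * d))"
      using d by (simp add: ennreal_mult[symmetric] ennreal_plus[symmetric] distrib_left powr_mult[symmetric] mult.assoc[symmetric] del: ennreal_plus)
    also have "\<dots> \<le> ennreal (4 powr p * d + 4 powr p * (2 * d))"
      using d assms(1) by (intro ennreal_leI add_mono mult_right_mono powr_mono2) auto
    also have "4 powr p * d + 4 powr p * (2 * d) = e" by (simp add: d_def field_simps)
    finally show ?thesis .
  qed
  show ?thesis by (rule that[OF \<delta>(1) main])
qed

section \<open>Averages over probability measures concentrated near the origin\<close>

text \<open>The mean c is finite because F is at most 1 + F^p. Integrating the tangent-line bound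
  for the p-th power at c, arranged as in Young's inequality, gives the claim; an infinite right
  side is trivial.\<close>

lemma jensen_epow:
  assumes "prob_space \<nu>" "1 \<le> p" "F \<in> borel_measurable \<nu>"
  shows "epow (\<integral>\<^sup>+y. F y \<partial>\<nu>) p \<le> (\<integral>\<^sup>+y. epow (F y) p \<partial>\<nu>)"
proof (cases "(\<integral>\<^sup>+y. epow (F y) p \<partial>\<nu>) < \<infinity>")
  case True
  interpret prob_space \<nu> by fact
  note [measurable] = assms(3)
  have "(\<integral>\<^sup>+y. F y \<partial>\<nu>) \<le> (\<integral>\<^sup>+y. 1 + epow (F y) p \<partial>\<nu>)"
    by (intro nn_integral_mono le_one_plus_epow assms)
  also have "\<dots> = 1 + (\<integral>\<^sup>+y. epow (F y) p \<partial>\<nu>)" by (simp add: nn_integral_add emeasure_space_1)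
  also have "\<dots> < \<infinity>" using True by simp
  finally have Ffin: "(\<integral>\<^sup>+y. F y \<partial>\<nu>) < \<infinity>" .
  then obtain c where c: "(\<integral>\<^sup>+y. F y \<partial>\<nu>) = ennreal c" "0 \<le> c" by (cases "\<integral>\<^sup>+y. F y \<partial>\<nu>") auto
  obtain b where b: "(\<integral>\<^sup>+y. epow (F y) p \<partial>\<nu>) = ennreal b" "0 \<le> b" using True by (cases "\<integral>\<^sup>+y. epow (F y) p \<partial>\<nu>") auto
  have p0: "0 < p" using assms by simp
  have young: "x * c powr (p - 1) \<le> x powr p / p + (1 - 1/p) * c powr p" if "0 \<le> x" for x
  proof (cases "x = 0 \<or> c = 0 \<or> p = 1")
    case True then show ?thesis using assms(2) c that by auto
  next
    case False
    then have "0 < x" "0 < c" "1 < p" using that c assms by auto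
    define u where "u = x / c"
    have u: "0 < u" using \<open>0 < x\<close> \<open>0 < c\<close> by (simp add: u_def)
    have "1 + p * (u - 1) \<le> u powr p"
    proof -
      have "(u powr p) powr (1/p) * 1 powr (1 - 1/p) \<le> (1/p) * u powr p + (1 - 1/p) * 1"
        using \<open>1 < p\<close> u by (intro Youngs_inequality_0) auto
      then have "u \<le> (1/p) * u powr p + (1 - 1/p)" using u \<open>1 < p\<close> by (simp add: powr_powr)
      then have "p * u \<le> p * ((1/p) * u powr p + (1 - 1/p))" using \<open>1 < p\<close> by (intro mult_left_mono) auto
      also have "\<dots> = u powr p + p - 1" using \<open>1 < p\<close> by (simp add: field_simps)
      finally show ?thesis by (simp add: algebra_simps)
    qed
    then have "c powr p * (1 + p * (u - 1)) \<le> c powr p * u powr p" by (intro mult_left_mono) auto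
    also have "c powr p * u powr p = x powr p" using \<open>0 < x\<close> \<open>0 < c\<close> by (simp add: u_def powr_divide)
    also have "c powr p * (1 + p * (u - 1)) = p * (x * c powr (p - 1)) - (p - 1) * c powr p"
    proof -
      have "c powr p = c * c powr (p - 1)" using \<open>0 < c\<close> by (simp add: powr_diff)
      then have "c powr p * u = x * c powr (p - 1)" using \<open>0 < c\<close> by (simp add: u_def)
      then show ?thesis by (simp add: algebra_simps)
    qed
    finally show ?thesis using \<open>1 < p\<close> by (simp add: field_simps)
  qed
  have "ennreal (c powr (p - 1)) * F y \<le> ennreal (1/p) * epow (F y) p + ennreal ((1 - 1/p) * c powr p)" for y
  proof (cases "F y")
    case (real x)
    have "ennreal (c powr (p - 1)) * F y = ennreal (x * c powr (p - 1))" using real by (simp add: ennreal_mult[symmetric] mult.commute)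
    also have "\<dots> \<le> ennreal (x powr p / p + (1 - 1/p) * c powr p)" using young[of x] real by (intro ennreal_leI) auto
    also have "\<dots> = ennreal (1/p) * epow (F y) p + ennreal ((1 - 1/p) * c powr p)"
      using real assms(2) by (subst ennreal_plus) (auto simp: ennreal_mult[symmetric])
    finally show ?thesis .
  next
    case top then show ?thesis using p0 by (simp add: ennreal_mult_top)
  qed
  then have "(\<integral>\<^sup>+y. ennreal (c powr (p - 1)) * F y \<partial>\<nu>) \<le> (\<integral>\<^sup>+y. ennreal (1/p) * epow (F y) p + ennreal ((1 - 1/p) * c powr p) \<partial>\<nu>)"
    by (intro nn_integral_mono)
  also have "\<dots> = ennreal (b / p + (1 - 1/p) * c powr p)"
    using b assms(2) by (simp add: nn_integral_add nn_integral_cmult emeasure_space_1 ennreal_mult[symmetric] ennreal_plus[symmetric] del: ennreal_plus)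
  finally have "ennreal (c powr (p - 1)) * ennreal c \<le> ennreal (b / p + (1 - 1/p) * c powr p)"
    using c by (simp add: nn_integral_cmult)
  then have "c powr (p - 1) * c \<le> b / p + (1 - 1/p) * c powr p"
  proof -
    assume *: "ennreal (c powr (p - 1)) * ennreal c \<le> ennreal (b / p + (1 - 1/p) * c powr p)"
    have "0 \<le> b / p + (1 - 1/p) * c powr p" using b assms(2) by simp
    then show ?thesis using * c(2) by (simp only: ennreal_mult[symmetric] powr_ge_zero ennreal_le_iff)
  qed
  moreover have "c powr (p - 1) * c = c powr p" using c by (cases "c = 0") (auto simp: powr_diff)
  ultimately have "c powr p / p \<le> b / p" by (simp add: algebra_simps)
  then have "c powr p \<le> b" using p0 by (simp add: divide_le_cancel)
  then show ?thesis using b c by (simp add: ennreal_leI)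
qed (auto simp: not_less top_unique)

lemma conv_measurable:
  fixes h :: "'a::euclidean_space \<Rightarrow> 'b::euclidean_space"
  assumes "prob_space \<nu>" "sets \<nu> = sets borel" "h \<in> borel_measurable borel"
  shows "(\<lambda>x. \<integral>y. h (x + y) \<partial>\<nu>) \<in> borel_measurable borel"
proof -
  interpret prob_space \<nu> by fact
  note [measurable_cong] = assms(2)
  note [measurable] = assms(3)
  show ?thesis by measurable
qed

text \<open>Jensen's inequality for the inner average, Fubini, and continuity of translations for
  each single shift. Quantifying over all probability measures near 0 lets one estimate serve both
  mollifiers and averages over segments.\<close>

lemma conv_close:
  fixes h :: "'a::euclidean_space \<Rightarrow> 'b::euclidean_space"
  assumes "1 \<le> p" "Lp p h" "0 < e"
  shows "\<exists>\<delta>>0. \<forall>\<nu>. prob_space \<nu> \<and> sets \<nu> = sets borel \<and> (AE y in \<nu>. norm y \<le> \<delta>) \<longrightarrow>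
     pint p (\<lambda>x. (\<integral>y. h (x + y) \<partial>\<nu>) - h x) \<le> ennreal e"
proof -
  have p0: "0 < p" using assms by simp
  have [measurable]: "h \<in> borel_measurable borel" using assms(2) by (simp add: Lp_def)
  obtain \<delta> where \<delta>: "0 < \<delta>" "\<And>y. norm y \<le> \<delta> \<Longrightarrow> pint p (\<lambda>x. h (x + y) - h x) \<le> ennreal e"
    using translation_continuous[OF p0 assms(2,3)] by blast
  have main: "pint p (\<lambda>x. (\<integral>y. h (x + y) \<partial>\<nu>) - h x) \<le> ennreal e"
    if \<nu>: "prob_space \<nu>" and s: "sets \<nu> = sets borel" and ae: "AE y in \<nu>. norm y \<le> \<delta>" for \<nu>
  proof -
    interpret prob_space \<nu> by fact
    note [measurable_cong] = s
    have pt: "ennreal (norm ((\<integral>y. h (x + y) \<partial>\<nu>) - h x) powr p) \<le> (\<integral>\<^sup>+y. ennreal (norm (h (x + y) - h x) powr p) \<partial>\<nu>)" for x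
    proof (cases "integrable \<nu> (\<lambda>y. h (x + y) - h x)")
      case True
      then have "integrable \<nu> (\<lambda>y. (h (x + y) - h x) + h x)" by (intro Bochner_Integration.integrable_add) auto
      then have "integrable \<nu> (\<lambda>y. h (x + y))" by simp
      then have "(\<integral>y. h (x + y) \<partial>\<nu>) - h x = (\<integral>y. h (x + y) - h x \<partial>\<nu>)"
        by (subst Bochner_Integration.integral_diff) (auto simp: prob_space)
      then have "ennreal (norm ((\<integral>y. h (x + y) \<partial>\<nu>) - h x)) \<le> (\<integral>\<^sup>+y. ennreal (norm (h (x + y) - h x)) \<partial>\<nu>)"
        using integral_norm_bound_ennreal[OF True] by simp
      then have "epow (ennreal (norm ((\<integral>y. h (x + y) \<partial>\<nu>) - h x))) p \<le> epow (\<integral>\<^sup>+y. ennreal (norm (h (x + y) - h x)) \<partial>\<nu>) p"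
        using p0 by (intro epow_mono) auto
      also have "\<dots> \<le> (\<integral>\<^sup>+y. epow (ennreal (norm (h (x + y) - h x))) p \<partial>\<nu>)"
        by (rule jensen_epow[OF \<nu> assms(1)]) measurable
      finally show ?thesis by simp
    next
      \<comment> \<open>Here the Bochner integral takes its default value, but the right side is
        infinite.\<close>
      case False
      then have "(\<integral>\<^sup>+y. ennreal (norm (h (x + y) - h x)) \<partial>\<nu>) = \<infinity>"
        unfolding integrable_iff_bounded by (auto simp: not_less top_unique)
      then have "epow \<infinity> p \<le> (\<integral>\<^sup>+y. epow (ennreal (norm (h (x + y) - h x))) p \<partial>\<nu>)"
        using jensen_epow[OF \<nu> assms(1), of "\<lambda>y. ennreal (norm (h (x + y) - h x))"] by simp
      then show ?thesis by (simp add: top_unique)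
    qed
    interpret PS: pair_sigma_finite \<nu> "lborel :: 'a measure" ..
    have "pint p (\<lambda>x. (\<integral>y. h (x + y) \<partial>\<nu>) - h x) \<le> (\<integral>\<^sup>+x. \<integral>\<^sup>+y. ennreal (norm (h (x + y) - h x) powr p) \<partial>\<nu> \<partial>lborel)"
      unfolding pint_def by (intro nn_integral_mono pt)
    also have "\<dots> = (\<integral>\<^sup>+y. \<integral>\<^sup>+x. ennreal (norm (h (x + y) - h x) powr p) \<partial>lborel \<partial>\<nu>)"
      by (rule PS.Fubini') measurable
    also have "\<dots> \<le> (\<integral>\<^sup>+y. ennreal e \<partial>\<nu>)"
      using ae by (intro nn_integral_mono_AE, eventually_elim) (use \<delta>(2) in \<open>auto simp: pint_def\<close>)
    also have "\<dots> = ennreal e" by (simp add: emeasure_space_1)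
    finally show ?thesis .
  qed
  show ?thesis using \<delta>(1) main by (intro exI[of _ \<delta>]) auto
qed

section \<open>Mollification\<close>

text \<open>The family is closed under differentiation up to linear combinations, which makes the bump
  function below smooth by a single induction.\<close>

definition flat_exp :: "nat \<Rightarrow> real \<Rightarrow> real" where
  "flat_exp m t = (if 0 < t then exp (- 1 / t) / t ^ m else 0)"

lemma flat_exp_nonneg: "0 \<le> flat_exp m t"
  by (simp add: flat_exp_def)

text \<open>A single term of the exponential series bounds exp (1/t) from below. The free exponent k
  gives boundedness for k = 0 and quadratic decay at the origin for k = 2.\<close>

lemma flat_exp_le: "flat_exp m t \<le> fact (m + k) * \<bar>t\<bar> ^ k"
proof (cases "0 < t")
  case True
  have s: "(\<lambda>n. (1 / t) ^ n /\<^sub>R fact n) sums exp (1 / t)" by (rule exp_converges)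
  have "(\<Sum>n\<in>{m + k}. (1 / t) ^ n /\<^sub>R fact n) \<le> (\<Sum>n. (1 / t) ^ n /\<^sub>R fact n)"
    using True sums_summable[OF s] by (intro sum_le_suminf) auto
  then have "(1 / t) ^ (m + k) / fact (m + k) \<le> exp (1 / t)"
    using sums_unique[OF s] by (simp add: divide_inverse mult.commute)
  then have "1 / exp (1/t) \<le> fact (m + k) * t ^ (m + k)"
    using True by (simp add: field_simps power_divide)
  then have "exp (- 1 / t) \<le> fact (m + k) * t ^ (m + k)" by (simp add: exp_minus field_simps)
  then have "exp (- 1 / t) / t ^ m \<le> fact (m + k) * t ^ (m + k) / t ^ m" using True by (intro divide_right_mono) auto
  then show ?thesis using True by (simp add: flat_exp_def power_add)
qed (simp add: flat_exp_def)

text \<open>Away from 0 this is the quotient rule or a constant function; at 0 the quadratic decay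
  makes the difference quotient vanish in the limit.\<close>

lemma flat_exp_deriv: "(flat_exp m has_real_derivative (- real m * flat_exp (Suc m) t + flat_exp (m + 2) t)) (at t)"
proof -
  consider "0 < t" | "t < 0" | "t = 0" by linarith
  then show ?thesis
  proof cases
    case 1
    have "((\<lambda>t. exp (- 1 / t) / t ^ m) has_real_derivative
      (exp (- 1 / t) * (1 / (t * t)) * t ^ m - exp (- 1 / t) * (real m * t ^ (m - Suc 0))) / (t ^ m * t ^ m)) (at t)"
      using 1 by (auto intro!: derivative_eq_intros)
    moreover have "(exp (- 1 / t) * (1 / (t * t)) * t ^ m - exp (- 1 / t) * (real m * t ^ (m - Suc 0))) / (t ^ m * t ^ m)
      = - real m * flat_exp (Suc m) t + flat_exp (m + 2) t"
      using 1 by (cases m) (auto simp: flat_exp_def field_simps)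
    ultimately have "((\<lambda>t. exp (- 1 / t) / t ^ m) has_real_derivative (- real m * flat_exp (Suc m) t + flat_exp (m + 2) t)) (at t)"
      by simp
    then show ?thesis
      by (rule has_field_derivative_transform_within_open[of _ _ _ "{0<..}"]) (use 1 in \<open>auto simp: flat_exp_def\<close>)
  next
    case 2
    have "((\<lambda>t. 0) has_real_derivative (- real m * flat_exp (Suc m) t + flat_exp (m + 2) t)) (at t)"
      using 2 by (simp add: flat_exp_def)
    then show ?thesis
      by (rule has_field_derivative_transform_within_open[of _ _ _ "{..<0}"]) (use 2 in \<open>auto simp: flat_exp_def\<close>)
  next
    case 3
    obtain K where K: "\<And>h. flat_exp m h \<le> K * \<bar>h\<bar> ^ 2" using flat_exp_le by blast
    have pt: "norm (flat_exp m h / h) \<le> K * \<bar>h\<bar>" for h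
    proof (cases "h = 0")
      case False
      have "norm (flat_exp m h / h) = flat_exp m h / \<bar>h\<bar>" using flat_exp_nonneg[of m h] by (simp add: abs_divide)
      also have "\<dots> \<le> K * \<bar>h\<bar> ^ 2 / \<bar>h\<bar>" using K[of h] by (rule divide_right_mono) simp
      also have "\<dots> = K * \<bar>h\<bar>" using False by (simp add: divide_eq_eq power2_eq_square mult.assoc)
      finally show ?thesis .
    qed simp
    have ev: "\<forall>\<^sub>F h in at 0. norm (flat_exp m h / h) \<le> K * \<bar>h\<bar>"
      using pt by (rule always_eventually[OF allI])
    have "((\<lambda>h::real. K * \<bar>h\<bar>) \<longlongrightarrow> K * \<bar>0\<bar>) (at 0)"
      by (intro tendsto_intros)
    then have "((\<lambda>h. flat_exp m h / h) \<longlongrightarrow> 0) (at 0)"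
      using Lim_null_comparison[OF ev] by simp
    then show ?thesis unfolding 3 DERIV_def by (simp add: flat_exp_def)
  qed
qed

text \<open>An algebra containing the bump and closed under derivatives in a fixed direction, so all
  iterated partial derivatives demanded by \<open>smooth_fun\<close> stay in it.\<close>

inductive smooth_class :: "('a::euclidean_space \<Rightarrow> real) \<Rightarrow> bool" where
  flat_exp: "smooth_class (\<lambda>x. flat_exp m (r\<^sup>2 - (x - a) \<bullet> (x - a)))"
| const: "smooth_class (\<lambda>x. c)"
| lin: "smooth_class (\<lambda>x. (x - a) \<bullet> b)"
| add: "smooth_class f \<Longrightarrow> smooth_class g \<Longrightarrow> smooth_class (\<lambda>x. f x + g x)"
| mult: "smooth_class f \<Longrightarrow> smooth_class g \<Longrightarrow> smooth_class (\<lambda>x. f x * g x)"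

lemma flat_exp_comp_has_derivative:
  fixes a :: "'a::euclidean_space"
  shows "((\<lambda>x. flat_exp m (r\<^sup>2 - (x - a) \<bullet> (x - a))) has_derivative
    (\<lambda>h. (- real m * flat_exp (Suc m) (r\<^sup>2 - (x - a) \<bullet> (x - a)) + flat_exp (m + 2) (r\<^sup>2 - (x - a) \<bullet> (x - a))) * (- 2 * ((x - a) \<bullet> h)))) (at x)"
proof -
  have "((\<lambda>x. r\<^sup>2 - (x - a) \<bullet> (x - a)) has_derivative (\<lambda>h. - 2 * ((x - a) \<bullet> h))) (at x)"
    by (auto intro!: derivative_eq_intros simp: inner_commute)
  from has_derivative_compose[OF this flat_exp_deriv[unfolded has_field_derivative_def]] show ?thesis by simp
qed

lemma smooth_class_derivative:
  assumes "smooth_class f"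
  shows "(\<forall>x. f differentiable at x) \<and> smooth_class (\<lambda>x. frechet_derivative f (at x) b)"
  using assms
proof induction
  case (flat_exp m r a)
  note d = flat_exp_comp_has_derivative[of m r a]
  have "(\<lambda>x. frechet_derivative (\<lambda>x. flat_exp m (r\<^sup>2 - (x - a) \<bullet> (x - a))) (at x) b) =
    (\<lambda>x. (- real m * flat_exp (Suc m) (r\<^sup>2 - (x - a) \<bullet> (x - a)) + flat_exp (m + 2) (r\<^sup>2 - (x - a) \<bullet> (x - a))) * (- 2 * ((x - a) \<bullet> b)))"
    using frechet_derivative_at[OF d, symmetric] by (simp add: fun_eq_iff)
  moreover have "smooth_class \<dots>" by (intro smooth_class.intros)
  ultimately show ?case using d unfolding differentiable_def by auto
next
  case (const c)
  then show ?case by (auto intro: smooth_class.intros)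
next
  case (lin a c)
  have d: "((\<lambda>x. (x - a) \<bullet> c) has_derivative (\<lambda>h. h \<bullet> c)) (at x)" for x
    by (auto intro!: derivative_eq_intros)
  have "(\<lambda>x. frechet_derivative (\<lambda>x. (x - a) \<bullet> c) (at x) b) = (\<lambda>x. b \<bullet> c)"
    using frechet_derivative_at[OF d, symmetric] by (simp add: fun_eq_iff)
  then show ?case using d unfolding differentiable_def by (auto intro: smooth_class.intros)
next
  case (add f g)
  then have d: "(f has_derivative frechet_derivative f (at x)) (at x)" "(g has_derivative frechet_derivative g (at x)) (at x)" for x
    using frechet_derivative_works by blast+
  have d2: "((\<lambda>x. f x + g x) has_derivative (\<lambda>h. frechet_derivative f (at x) h + frechet_derivative g (at x) h)) (at x)" for x
    by (intro has_derivative_add d)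
  have "(\<lambda>x. frechet_derivative (\<lambda>x. f x + g x) (at x) b) = (\<lambda>x. frechet_derivative f (at x) b + frechet_derivative g (at x) b)"
    using frechet_derivative_at[OF d2, symmetric] by (simp add: fun_eq_iff)
  then show ?case using d2 add unfolding differentiable_def by (auto intro: smooth_class.intros)
next
  case (mult f g)
  then have d: "(f has_derivative frechet_derivative f (at x)) (at x)" "(g has_derivative frechet_derivative g (at x)) (at x)" for x
    using frechet_derivative_works by blast+
  have d2: "((\<lambda>x. f x * g x) has_derivative (\<lambda>h. f x * frechet_derivative g (at x) h + frechet_derivative f (at x) h * g x)) (at x)" for x
    by (intro has_derivative_mult d)
  have "(\<lambda>x. frechet_derivative (\<lambda>x. f x * g x) (at x) b) = (\<lambda>x. f x * frechet_derivative g (at x) b + frechet_derivative f (at x) b * g x)"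
    using frechet_derivative_at[OF d2, symmetric] by (simp add: fun_eq_iff)
  then show ?case using d2 mult unfolding differentiable_def by (auto intro: smooth_class.intros)
qed

lemma smooth_class_smooth:
  assumes "smooth_class f" shows "smooth_fun f"
proof -
  have "smooth_class (iter_pd bs f)" for bs
    by (induction bs) (use assms smooth_class_derivative in auto)
  then show ?thesis unfolding smooth_fun_def using smooth_class_derivative by blast
qed

section \<open>Bump functions on balls\<close>

text \<open>The standard function exp (-1/(r^2 - |x-a|^2)) on the ball, extended by 0. It is not
  normalized; \<open>bump_mass\<close> divides it out later.\<close>

definition bump :: "real \<Rightarrow> 'a::euclidean_space \<Rightarrow> 'a \<Rightarrow> real" where
  "bump r a x = flat_exp 0 (r\<^sup>2 - (x - a) \<bullet> (x - a))"

definition grad_bump :: "real \<Rightarrow> 'a::euclidean_space \<Rightarrow> 'a \<Rightarrow> 'a" where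
  "grad_bump r a x = (- 2 * flat_exp 2 (r\<^sup>2 - (x - a) \<bullet> (x - a))) *\<^sub>R (x - a)"

lemma bump_has_derivative: "(bump r a has_derivative (\<lambda>h. grad_bump r a x \<bullet> h)) (at x)"
proof -
  have "bump r a = (\<lambda>x. flat_exp 0 (r\<^sup>2 - (x - a) \<bullet> (x - a)))" by (auto simp: bump_def)
  then show ?thesis using flat_exp_comp_has_derivative[of 0 r a x]
    by (simp add: grad_bump_def mult_ac numeral_2_eq_2)
qed

lemma norm_less_iff_inner: "0 < r \<Longrightarrow> 0 < r\<^sup>2 - (x - a) \<bullet> (x - a) \<longleftrightarrow> norm (x - a) < r"
  using power2_less_imp_less[of "norm (x - a)" r] power_strict_mono[of "norm (x - a)" r 2]
  by (auto simp: power2_norm_eq_inner[symmetric])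

lemma bump_zero: "0 < r \<Longrightarrow> r \<le> norm (x - a) \<Longrightarrow> bump r a x = 0"
  using norm_less_iff_inner[of r x a] by (auto simp: bump_def flat_exp_def)

lemma bump_pos: "0 < r \<Longrightarrow> norm (x - a) < r \<Longrightarrow> 0 < bump r a x"
  using norm_less_iff_inner[of r x a] by (auto simp: bump_def flat_exp_def)

lemma grad_bump_zero: "0 < r \<Longrightarrow> r \<le> norm (x - a) \<Longrightarrow> grad_bump r a x = 0"
  using norm_less_iff_inner[of r x a] by (auto simp: grad_bump_def flat_exp_def)

lemma bump_bounds: "0 \<le> bump r a x" "bump r a x \<le> 1"
  using flat_exp_nonneg[of 0] flat_exp_le[of 0 _ 0] by (auto simp: bump_def)

text \<open>A factor 2 comes from the chain rule, another from the bound 2 for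
  \<open>flat_exp 2\<close>, and the remaining r from the size of the ball.\<close>

lemma grad_bump_bound: "0 < r \<Longrightarrow> norm (grad_bump r a x) \<le> 4 * r"
proof (cases "r \<le> norm (x - a)")
  case False
  assume r: "0 < r"
  have "flat_exp 2 (r\<^sup>2 - (x - a) \<bullet> (x - a)) \<le> 2" using flat_exp_le[of 2 _ 0] by simp
  then have "flat_exp 2 (r\<^sup>2 - (x - a) \<bullet> (x - a)) * norm (x - a) \<le> 2 * r"
    using False r flat_exp_nonneg by (intro mult_mono) auto
  then show ?thesis using flat_exp_nonneg[of 2] by (simp add: grad_bump_def mult.commute)
qed (simp add: grad_bump_zero)

lemma flat_exp_continuous: "continuous_on UNIV (flat_exp m)"
  by (intro continuous_at_imp_continuous_on ballI) (rule DERIV_isCont[OF flat_exp_deriv])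

lemma bump_continuous: "continuous_on UNIV (\<lambda>(a, x). bump r a x)"
  unfolding bump_def case_prod_unfold
  by (intro continuous_on_compose2[OF flat_exp_continuous] continuous_intros) auto

lemma cball_sets_borel [measurable]: "cball (a::'a::euclidean_space) r \<in> sets borel"
  by simp

lemma bump_measurable [measurable]: "bump r a \<in> borel_measurable borel"
  unfolding bump_def[abs_def]
  by (intro borel_measurable_continuous_onI continuous_on_compose2[OF flat_exp_continuous] continuous_intros) auto

lemma grad_bump_continuous1: "continuous_on UNIV (grad_bump r a)"
  unfolding grad_bump_def[abs_def]
  by (intro continuous_intros continuous_on_compose2[OF flat_exp_continuous]) auto

lemma grad_bump_measurable [measurable]: "grad_bump r a \<in> borel_measurable borel"
  by (rule borel_measurable_continuous_onI[OF grad_bump_continuous1])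

lemma test_fun_bump:
  assumes "0 < r" "cball a r \<subseteq> G" shows "test_fun G (bump r a)"
proof -
  have "{x. bump r a x \<noteq> 0} \<subseteq> cball a r"
    using bump_zero[OF assms(1)] by (force simp: dist_norm norm_minus_commute)
  then have c: "closure {x. bump r a x \<noteq> 0} \<subseteq> cball a r" by (simp add: closure_minimal)
  moreover from this have "compact (closure {x. bump r a x \<noteq> 0})"
    by (meson bounded_cball bounded_subset closed_closure compact_eq_bounded_closed)
  moreover have "smooth_fun (bump r a)"
    unfolding bump_def[abs_def] by (intro smooth_class_smooth smooth_class.flat_exp)
  ultimately show ?thesis using assms(2) unfolding test_fun_def by blast
qed

lemma frechet_bump: "frechet_derivative (bump r a) (at x) v = grad_bump r a x \<bullet> v"
  using frechet_derivative_at[OF bump_has_derivative[of r a x], symmetric] by simp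

lemma Lp_integrable_cball:
  fixes h :: "'a::euclidean_space \<Rightarrow> 'b::euclidean_space"
  assumes "1 \<le> p" "Lp p h"
  shows "integrable lborel (\<lambda>z. indicator (cball a R) z *\<^sub>R h z)"
proof (rule integrableI_bounded)
  have [measurable]: "h \<in> borel_measurable borel" using assms by (simp add: Lp_def)
  show "(\<lambda>z. indicator (cball a R) z *\<^sub>R h z) \<in> borel_measurable lborel" by measurable
  have "(\<integral>\<^sup>+z. ennreal (norm (indicator (cball a R) z *\<^sub>R h z)) \<partial>lborel)
    \<le> (\<integral>\<^sup>+z. indicator (cball a R) z + ennreal (norm (h z) powr p) \<partial>lborel)"
  proof (intro nn_integral_mono)
    fix z
    show "ennreal (norm (indicator (cball a R) z *\<^sub>R h z)) \<le> indicator (cball a R) z + ennreal (norm (h z) powr p)"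
      using le_one_plus_epow[OF assms(1), of "ennreal (norm (h z))"] by (auto simp: indicator_def)
  qed
  also have "\<dots> = emeasure lborel (cball a R) + pint p h" unfolding pint_def by (subst nn_integral_add) auto
  also have "\<dots> < \<infinity>" using assms(2) emeasure_lborel_cball_finite[of a R] by (auto simp: Lp_def)
  finally show "(\<integral>\<^sup>+z. ennreal (norm (indicator (cball a R) z *\<^sub>R h z)) \<partial>lborel) < \<infinity>" .
qed

lemma Lp_integrable_kernel:
  fixes h :: "'a::euclidean_space \<Rightarrow> 'b::euclidean_space"
  assumes "1 \<le> p" "Lp p h" "k \<in> borel_measurable borel" "\<And>z. \<bar>k z\<bar> \<le> C" "\<And>z. z \<notin> cball a R \<Longrightarrow> k z = 0"
  shows "integrable lborel (\<lambda>z. k z *\<^sub>R h z)"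
proof (rule Bochner_Integration.integrable_bound)
  show "integrable lborel (\<lambda>z. C *\<^sub>R (indicator (cball a R) z *\<^sub>R h z))"
    by (intro integrable_scaleR_right Lp_integrable_cball[OF assms(1,2)])
  show "(\<lambda>z. k z *\<^sub>R h z) \<in> borel_measurable lborel" using assms(2,3) by (auto simp: Lp_def)
  have "norm (k z *\<^sub>R h z) \<le> norm (C *\<^sub>R (indicator (cball a R) z *\<^sub>R h z))" for z
  proof (cases "z \<in> cball a R")
    case True
    have "\<bar>k z\<bar> * norm (h z) \<le> \<bar>C\<bar> * norm (h z)" using assms(4)[of z] by (intro mult_right_mono) auto
    then show ?thesis using True by simp
  qed (use assms(5) in auto)
  then show "AE z in lborel. norm (k z *\<^sub>R h z) \<le> norm (C *\<^sub>R (indicator (cball a R) z *\<^sub>R h z))" by simp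
qed

lemma integrable_bump_mult:
  fixes h :: "'a::euclidean_space \<Rightarrow> 'b::euclidean_space"
  assumes "1 \<le> p" "Lp p h" "0 < r"
  shows "integrable lborel (\<lambda>z. bump r x z *\<^sub>R h z)"
proof (rule Lp_integrable_kernel[OF assms(1,2), where C=1 and a=x and R=r])
  show "\<bar>bump r x z\<bar> \<le> 1" for z using bump_bounds[of r x z] by simp
  show "z \<notin> cball x r \<Longrightarrow> bump r x z = 0" for z by (intro bump_zero[OF assms(3)]) (simp add: dist_norm norm_minus_commute)
qed auto

lemma integrable_grad_bump_mult:
  fixes h :: "'a::euclidean_space \<Rightarrow> 'b::euclidean_space"
  assumes "1 \<le> p" "Lp p h" "0 < r"
  shows "integrable lborel (\<lambda>z. (grad_bump r x z \<bullet> v) *\<^sub>R h z)"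
proof (rule Lp_integrable_kernel[OF assms(1,2), where C="4 * r * norm v" and a=x and R=r])
  show "\<bar>grad_bump r x z \<bullet> v\<bar> \<le> 4 * r * norm v" for z
    using Cauchy_Schwarz_ineq2[of "grad_bump r x z" v] mult_right_mono[OF grad_bump_bound[OF assms(3), of x z], of "norm v"] by simp
  show "z \<notin> cball x r \<Longrightarrow> grad_bump r x z \<bullet> v = 0" for z using grad_bump_zero[OF assms(3), of z x] by (simp add: dist_norm norm_minus_commute)
qed auto

lemma integrable_bump:
  fixes a :: "'a::euclidean_space"
  assumes "0 < r" shows "integrable lborel (bump r a)"
proof (rule integrableI_bounded)
  have "(\<integral>\<^sup>+x. ennreal (norm (bump r a x)) \<partial>lborel) \<le> (\<integral>\<^sup>+x. indicator (cball a r) x \<partial>lborel)"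
  proof (intro nn_integral_mono)
    fix x show "ennreal (norm (bump r a x)) \<le> indicator (cball a r) x"
      using bump_bounds[of r a x] bump_zero[OF assms, of x a]
      by (cases "x \<in> cball a r") (auto simp: dist_norm norm_minus_commute)
  qed
  also have "\<dots> < \<infinity>" using emeasure_lborel_cball_finite[of a r] by simp
  finally show "(\<integral>\<^sup>+x. ennreal (norm (bump r a x)) \<partial>lborel) < \<infinity>" .
qed simp

definition bump_mass :: "'a::euclidean_space \<Rightarrow> real \<Rightarrow> real" where
  "bump_mass a r = (\<integral>x. bump r a x \<partial>lborel)"

lemma bump_mass_pos:
  fixes a :: "'a::euclidean_space"
  assumes "0 < r" shows "0 < bump_mass a r"
proof (rule ccontr)
  assume "\<not> 0 < bump_mass a r"
  moreover have "0 \<le> bump_mass a r" unfolding bump_mass_def by (intro integral_nonneg_AE AE_I2 bump_bounds)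
  ultimately have "(\<integral>x. bump r a x \<partial>lborel) = 0" by (simp add: bump_mass_def)
  then have "AE x in lborel. bump r a x = 0"
    using integral_nonneg_eq_0_iff_AE[OF integrable_bump[OF assms, of a]] bump_bounds by auto
  then have "AE x in lborel. x \<notin> ball a r"
    by eventually_elim (use bump_pos[OF assms] in \<open>force simp: dist_norm norm_minus_commute\<close>)
  then have "emeasure lborel (ball a r) = 0"
    by (subst (asm) AE_iff_measurable[of "ball a r"]) auto
  then have "negligible (ball a r)" by (simp add: negligible_iff_null_sets null_sets_def)
  then show False using assms by (simp add: open_not_negligible)
qed

section \<open>Mollified functions and their derivatives\<close>

text \<open>The mollifier is encoded as a probability measure so that \<open>conv_close\<close>
  applies to it directly.\<close>

definition mollm :: "real \<Rightarrow> 'a::euclidean_space measure" where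
  "mollm r = density lborel (\<lambda>y. ennreal (bump r 0 y / bump_mass (0::'a) r))"

definition moll :: "real \<Rightarrow> ('a::euclidean_space \<Rightarrow> 'b::euclidean_space) \<Rightarrow> 'a \<Rightarrow> 'b" where
  "moll r h x = (\<integral>y. h (x + y) \<partial>mollm r)"

lemma sets_mollm: "sets (mollm r) = sets borel"
  by (simp add: mollm_def)

lemma prob_space_mollm:
  assumes "0 < r" shows "prob_space (mollm r :: 'a::euclidean_space measure)"
proof
  have "emeasure (mollm r :: 'a measure) (space (mollm r)) = (\<integral>\<^sup>+y. ennreal (bump r (0::'a) y / bump_mass (0::'a) r) \<partial>lborel)"
    unfolding mollm_def by (subst emeasure_density) auto
  also have "\<dots> = ennreal (\<integral>y. bump r (0::'a) y / bump_mass (0::'a) r \<partial>lborel)"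
    using bump_mass_pos[OF assms, of "0::'a"] bump_bounds[of r "0::'a"]
    by (intro nn_integral_eq_integral integrable_divide integrable_bump assms) auto
  also have "\<dots> = 1" using bump_mass_pos[OF assms, of "0::'a"] by (simp add: bump_mass_def)
  finally show "emeasure (mollm r :: 'a measure) (space (mollm r)) = 1" .
qed

lemma AE_mollm:
  fixes r :: real assumes "0 < r" shows "AE y in (mollm r :: 'a::euclidean_space measure). norm y \<le> r"
proof -
  have "norm y \<le> r" if "0 < bump r 0 y / bump_mass (0::'a) r" for y :: 'a
    using bump_zero[OF assms, of y 0] that by (cases "norm y \<le> r") auto
  then show ?thesis unfolding mollm_def by (subst AE_density) auto
qed

lemma bump_shift: "bump r x (y + x) = bump r 0 y"
  by (simp add: bump_def)

lemma bump_swap: "bump r x y = bump r y x" "grad_bump r x y = - grad_bump r y x"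
proof -
  have "(y - x) \<bullet> (y - x) = (x - y) \<bullet> (x - y)" by (simp add: inner_diff_left inner_diff_right inner_commute)
  then show "bump r x y = bump r y x" "grad_bump r x y = - grad_bump r y x"
    by (auto simp: bump_def grad_bump_def scaleR_minus_right[symmetric] simp del: scaleR_minus_right)
qed

text \<open>Translation moves the dependence on x from h, which is merely measurable, to the smooth
  kernel. Continuity and differentiation of mollified functions rest on this form.\<close>

lemma moll_eq:
  fixes h :: "'a::euclidean_space \<Rightarrow> 'b::euclidean_space"
  assumes "0 < r" "h \<in> borel_measurable borel"
  shows "moll r h x = (\<integral>z. (bump r x z / bump_mass (0::'a) r) *\<^sub>R h z \<partial>lborel)"
proof -
  note [measurable] = assms(2)
  have "moll r h x = (\<integral>y. (bump r 0 y / bump_mass (0::'a) r) *\<^sub>R h (x + y) \<partial>lborel)"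
    unfolding moll_def mollm_def
    using bump_mass_pos[OF assms(1), of "0::'a"] bump_bounds[of r "0::'a"] by (subst integral_density) auto
  also have "\<dots> = (\<integral>y. (\<lambda>z. (bump r x z / bump_mass (0::'a) r) *\<^sub>R h z) (y + x) \<partial>lborel)"
    by (simp add: bump_shift add.commute)
  also have "\<dots> = (\<integral>z. (bump r x z / bump_mass (0::'a) r) *\<^sub>R h z \<partial>lborel)"
    by (rule integral_translate) measurable
  finally show ?thesis .
qed

lemma moll_continuous:
  fixes h :: "'a::euclidean_space \<Rightarrow> 'b::euclidean_space"
  assumes "1 \<le> p" "Lp p h" "0 < r"
  shows "continuous_on UNIV (moll r h)"
proof (rule continuous_on_sequentiallyI)
  fix u :: "nat \<Rightarrow> 'a" and x assume u: "u \<longlonglongrightarrow> x"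
  have [measurable]: "h \<in> borel_measurable borel" using assms by (simp add: Lp_def)
  let ?Z = "bump_mass (0::'a) r"
  have Z: "0 < ?Z" by (rule bump_mass_pos[OF assms(3)])
  obtain M where M: "\<And>n. norm (u n - x) \<le> M"
    using convergent_imp_bounded[of "\<lambda>n. u n - x"] LIM_zero[OF u] by (auto simp: bounded_iff convergent_def)
  have "(\<lambda>n. \<integral>z. (bump r (u n) z / ?Z) *\<^sub>R h z \<partial>lborel) \<longlonglongrightarrow> (\<integral>z. (bump r x z / ?Z) *\<^sub>R h z \<partial>lborel)"
  proof (rule integral_dominated_convergence[where w="\<lambda>z. norm ((1/?Z) *\<^sub>R (indicator (cball x (r + M)) z *\<^sub>R h z))"])
    show "integrable lborel (\<lambda>z. norm ((1/?Z) *\<^sub>R (indicator (cball x (r + M)) z *\<^sub>R h z)))"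
      by (intro integrable_norm integrable_scaleR_right Lp_integrable_cball[OF assms(1,2)])
    show "AE z in lborel. (\<lambda>n. (bump r (u n) z / ?Z) *\<^sub>R h z) \<longlonglongrightarrow> (bump r x z / ?Z) *\<^sub>R h z"
    proof (intro AE_I2 tendsto_intros)
      fix z
      have "continuous_on UNIV (\<lambda>(a::'a, x). bump r a x)" by (rule bump_continuous)
      then have "isCont (\<lambda>(a, x). bump r a x) (x, z)" by (simp add: continuous_on_eq_continuous_at)
      moreover have "(\<lambda>n. (u n, z)) \<longlonglongrightarrow> (x, z)" using u by (intro tendsto_intros)
      ultimately show "(\<lambda>n. bump r (u n) z) \<longlonglongrightarrow> bump r x z"
        using isCont_tendsto_compose by fastforce
    qed (use Z in auto)
    show "AE z in lborel. norm ((bump r (u n) z / ?Z) *\<^sub>R h z) \<le> norm ((1/?Z) *\<^sub>R (indicator (cball x (r + M)) z *\<^sub>R h z))" for n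
    proof (rule AE_I2)
      fix z
      show "norm ((bump r (u n) z / ?Z) *\<^sub>R h z) \<le> norm ((1/?Z) *\<^sub>R (indicator (cball x (r + M)) z *\<^sub>R h z))"
      proof (cases "norm (z - u n) < r")
        case True
        have "norm (z - x) \<le> norm (z - u n) + norm (u n - x)" using norm_triangle_ineq[of "z - u n" "u n - x"] by simp
        then have "z \<in> cball x (r + M)" using True M[of n] by (simp add: dist_norm norm_minus_commute)
        moreover have "bump r (u n) z * norm (h z) \<le> 1 * norm (h z)" using bump_bounds[of r "u n" z] by (intro mult_right_mono) auto
        ultimately show ?thesis using Z bump_bounds[of r "u n" z] by (simp add: divide_right_mono)
      next
        case False
        then show ?thesis using bump_zero[OF assms(3), of z "u n"] by simp
      qed
    qed
  qed auto
  then show "(\<lambda>n. moll r h (u n)) \<longlonglongrightarrow> moll r h x"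
    by (simp add: moll_eq[OF assms(3)])
qed

lemma bump_lipschitz:
  assumes "0 < r" shows "\<bar>bump r a x - bump r a y\<bar> \<le> 4 * r * norm (x - y)"
proof -
  have "norm (bump r a x - bump r a y) \<le> (4 * r) * norm (x - y)"
  proof (rule differentiable_bound[of UNIV])
    show "(bump r a has_derivative (\<lambda>h. grad_bump r a x \<bullet> h)) (at x within UNIV)" for x
      by (rule bump_has_derivative)
    show "onorm (\<lambda>h. grad_bump r a x \<bullet> h) \<le> 4 * r" for x
    proof (rule onorm_bound)
      fix h
      show "norm (grad_bump r a x \<bullet> h) \<le> 4 * r * norm h"
        using Cauchy_Schwarz_ineq2[of "grad_bump r a x" h] mult_right_mono[OF grad_bump_bound[OF assms, of a x], of "norm h"] by simp
    qed (use assms in auto)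
  qed auto
  then show ?thesis by simp
qed

text \<open>The bump is symmetric in centre and argument, so moving the centre produces the negative
  of the gradient in the argument.\<close>

lemma bump_line_deriv:
  "((\<lambda>t. bump r (a + t *\<^sub>R v) z) has_real_derivative - (grad_bump r (a + t *\<^sub>R v) z \<bullet> v)) (at t)"
proof -
  have "((\<lambda>t. a + t *\<^sub>R v) has_derivative (\<lambda>h. h *\<^sub>R v)) (at t)" by (auto intro!: derivative_eq_intros)
  from has_derivative_compose[OF this bump_has_derivative[of r z]]
  have "((\<lambda>t. bump r z (a + t *\<^sub>R v)) has_derivative (\<lambda>h. h * (grad_bump r z (a + t *\<^sub>R v) \<bullet> v))) (at t)"
    by simp
  moreover have "(\<lambda>h. h * (grad_bump r z (a + t *\<^sub>R v) \<bullet> v)) = (*) (- (grad_bump r (a + t *\<^sub>R v) z \<bullet> v))"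
    by (auto simp: fun_eq_iff bump_swap(2)[of r z])
  ultimately show ?thesis
    by (simp add: has_field_derivative_def bump_swap(1)[of r z])
qed

text \<open>Differentiation under the integral, by dominated convergence along sequences of
  increments. The Lipschitz constant 4r of the bump bounds the quotients, and one ball of radius r +
  M |v| contains the supports for all increments.\<close>

lemma moll_deriv:
  fixes f :: "'a::euclidean_space \<Rightarrow> real"
  assumes "1 \<le> p" "Lp p f" "0 < r"
  shows "((\<lambda>t. moll r f (a + t *\<^sub>R v)) has_real_derivative
     (\<integral>z. (- (grad_bump r (a + t *\<^sub>R v) z \<bullet> v) / bump_mass (0::'a) r) * f z \<partial>lborel)) (at t)"
  unfolding DERIV_def tendsto_at_iff_sequentially
proof (intro allI impI)
  fix X :: "nat \<Rightarrow> real" assume X0: "\<forall>i. X i \<in> UNIV - {0}" and X: "X \<longlonglongrightarrow> 0"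
  have [measurable]: "f \<in> borel_measurable borel" using assms by (simp add: Lp_def)
  let ?Z = "bump_mass (0::'a) r"
  let ?c = "a + t *\<^sub>R v"
  have Z: "0 < ?Z" by (rule bump_mass_pos[OF assms(3)])
  obtain M where M: "\<And>n. \<bar>X n\<bar> \<le> M"
    using convergent_imp_bounded[OF X] by (auto simp: bounded_iff)
  let ?q = "\<lambda>i z. ((bump r (a + (t + X i) *\<^sub>R v) z - bump r ?c z) / X i / ?Z) * f z"
  have int: "integrable lborel (\<lambda>z. bump r x z / ?Z * f z)" for x
  proof -
    have "integrable lborel (\<lambda>z. (bump r x z *\<^sub>R f z) / ?Z)"
      by (intro integrable_divide integrable_bump_mult[OF assms])
    then show ?thesis by simp
  qed
  have eq: "(moll r f (a + (t + X i) *\<^sub>R v) - moll r f ?c) / X i = (\<integral>z. ?q i z \<partial>lborel)" for i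
  proof -
    have d: "moll r f (a + (t + X i) *\<^sub>R v) - moll r f ?c
      = (\<integral>z. bump r (a + (t + X i) *\<^sub>R v) z / ?Z * f z - bump r ?c z / ?Z * f z \<partial>lborel)"
      unfolding Bochner_Integration.integral_diff[OF int int] by (simp add: moll_eq[OF assms(3)])
    have "(moll r f (a + (t + X i) *\<^sub>R v) - moll r f ?c) / X i
      = (\<integral>z. (bump r (a + (t + X i) *\<^sub>R v) z / ?Z * f z - bump r ?c z / ?Z * f z) / X i \<partial>lborel)"
      unfolding d by (rule integral_divide_zero[symmetric])
    also have "\<dots> = (\<integral>z. ?q i z \<partial>lborel)"
      by (intro Bochner_Integration.integral_cong refl) (simp add: left_diff_distrib right_diff_distrib diff_divide_distrib mult.commute)
    finally show ?thesis .
  qed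
  have "(\<lambda>i. \<integral>z. ?q i z \<partial>lborel) \<longlonglongrightarrow> (\<integral>z. (- (grad_bump r ?c z \<bullet> v) / ?Z) * f z \<partial>lborel)"
  proof (rule integral_dominated_convergence[where w="\<lambda>z. norm ((4 * r * norm v / ?Z) *\<^sub>R (indicator (cball ?c (r + M * norm v)) z *\<^sub>R f z))"])
    show "integrable lborel (\<lambda>z. norm ((4 * r * norm v / ?Z) *\<^sub>R (indicator (cball ?c (r + M * norm v)) z *\<^sub>R f z)))"
      by (intro integrable_norm integrable_scaleR_right Lp_integrable_cball[OF assms(1,2)])
    show "AE z in lborel. (\<lambda>i. ?q i z) \<longlonglongrightarrow> (- (grad_bump r ?c z \<bullet> v) / ?Z) * f z"
    proof (intro AE_I2 tendsto_intros)
      fix z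
      show "(\<lambda>i. (bump r (a + (t + X i) *\<^sub>R v) z - bump r ?c z) / X i) \<longlonglongrightarrow> - (grad_bump r ?c z \<bullet> v)"
        using bump_line_deriv[of r a v z t] X0 X unfolding DERIV_def tendsto_at_iff_sequentially
        by (auto simp: o_def)
    qed (use Z in auto)
    show "AE z in lborel. norm (?q i z) \<le> norm ((4 * r * norm v / ?Z) *\<^sub>R (indicator (cball ?c (r + M * norm v)) z *\<^sub>R f z))" for i
    proof (rule AE_I2)
      fix z
      have Xi: "X i \<noteq> 0" using X0 by auto
      have Mv: "norm (X i *\<^sub>R v) \<le> M * norm v" using M[of i] by (simp add: mult_right_mono)
      have eq: "a + (t + X i) *\<^sub>R v = ?c + X i *\<^sub>R v" by (simp add: algebra_simps)
      show "norm (?q i z) \<le> norm ((4 * r * norm v / ?Z) *\<^sub>R (indicator (cball ?c (r + M * norm v)) z *\<^sub>R f z))"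
      proof (cases "z \<in> cball ?c (r + M * norm v)")
        case True
        have "\<bar>bump r z (?c + X i *\<^sub>R v) - bump r z ?c\<bar> \<le> 4 * r * norm ((?c + X i *\<^sub>R v) - ?c)"
          by (rule bump_lipschitz[OF assms(3)])
        then have "\<bar>bump r (a + (t + X i) *\<^sub>R v) z - bump r ?c z\<bar> \<le> 4 * r * norm v * \<bar>X i\<bar>"
          unfolding eq bump_swap(1)[of r _ z] by (simp add: mult_ac)
        then have "\<bar>bump r (a + (t + X i) *\<^sub>R v) z - bump r ?c z\<bar> / \<bar>X i\<bar> \<le> 4 * r * norm v"
          using Xi by (simp add: divide_le_eq)
        then have "\<bar>bump r (a + (t + X i) *\<^sub>R v) z - bump r ?c z\<bar> / \<bar>X i\<bar> / ?Z * \<bar>f z\<bar> \<le> 4 * r * norm v / ?Z * \<bar>f z\<bar>"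
          using Z by (intro mult_right_mono divide_right_mono) auto
        then show ?thesis using True Z assms(3) by (simp add: abs_mult)
      next
        case False
        then have far: "r + M * norm v < norm (z - ?c)" by (simp add: dist_norm norm_minus_commute)
        have M0: "0 \<le> M * norm v" using Mv norm_ge_zero order_trans by blast
        have "norm (z - ?c) \<le> norm (z - (?c + X i *\<^sub>R v)) + norm (X i *\<^sub>R v)"
          using norm_triangle_ineq[of "z - (?c + X i *\<^sub>R v)" "X i *\<^sub>R v"] by (simp add: algebra_simps)
        then have "r \<le> norm (z - (?c + X i *\<^sub>R v))" "r \<le> norm (z - ?c)" using far Mv M0 by linarith+
        then have "bump r (?c + X i *\<^sub>R v) z = 0" "bump r ?c z = 0" using bump_zero[OF assms(3)] by blast+
        then show ?thesis unfolding eq by simp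
      qed
    qed
  qed auto
  then show "((\<lambda>h. (moll r f (a + (t + h) *\<^sub>R v) - moll r f ?c) / h) \<circ> X)
     \<longlonglongrightarrow> (\<integral>z. (- (grad_bump r ?c z \<bullet> v) / ?Z) * f z \<partial>lborel)"
    by (simp add: o_def eq)
qed

section \<open>Weak gradients under mollification\<close>

text \<open>Borel form of the integration by parts in \<open>classical_W1p\<close>. The integrals
  run over the whole space, since test functions vanish off G.\<close>

definition weak_grad :: "'a::euclidean_space set \<Rightarrow> ('a \<Rightarrow> real) \<Rightarrow> ('a \<Rightarrow> 'a) \<Rightarrow> bool" where
  "weak_grad G f Df \<longleftrightarrow> (\<forall>\<phi>. test_fun G \<phi> \<longrightarrow> (\<forall>i\<in>Basis.
     (\<integral>x. f x * frechet_derivative \<phi> (at x) i \<partial>lborel) = - (\<integral>x. (Df x \<bullet> i) * \<phi> x \<partial>lborel)))"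

text \<open>The kernel \<open>bump r x\<close> is a test function in G because its closed ball lies
  in G. Since \<open>weak_grad\<close> speaks of basis directions, v is expanded in the
  basis.\<close>

lemma moll_weak_grad:
  fixes f :: "'a::euclidean_space \<Rightarrow> real"
  assumes "1 \<le> p" "Lp p f" "Lp p Df" "weak_grad G f Df" "0 < r" "cball x r \<subseteq> G"
  shows "(\<integral>z. (- (grad_bump r x z \<bullet> v) / bump_mass (0::'a) r) * f z \<partial>lborel) = moll r Df x \<bullet> v"
proof -
  let ?Z = "bump_mass (0::'a) r"
  have Z: "0 < ?Z" by (rule bump_mass_pos[OF assms(5)])
  have [measurable]: "f \<in> borel_measurable borel" "Df \<in> borel_measurable borel" using assms by (auto simp: Lp_def)
  have i1: "integrable lborel (\<lambda>z. (grad_bump r x z \<bullet> i) * f z)" for i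
    using integrable_grad_bump_mult[OF assms(1,2,5), of x i] by simp
  have i2: "integrable lborel (\<lambda>z. bump r x z *\<^sub>R Df z)" by (rule integrable_bump_mult[OF assms(1,3,5)])
  have i3: "integrable lborel (\<lambda>z. bump r x z * (Df z \<bullet> i))" for i
    using integrable_inner_left[OF i2, of i] by simp
  have w: "(\<integral>z. (grad_bump r x z \<bullet> i) * f z \<partial>lborel) = - (\<integral>z. bump r x z * (Df z \<bullet> i) \<partial>lborel)" if "i \<in> Basis" for i
  proof -
    have "(\<integral>z. f z * frechet_derivative (bump r x) (at z) i \<partial>lborel) = - (\<integral>z. (Df z \<bullet> i) * bump r x z \<partial>lborel)"
      using assms(4) test_fun_bump[OF assms(5,6)] that unfolding weak_grad_def by blast
    then show ?thesis by (simp add: frechet_bump mult.commute)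
  qed
  have "(\<integral>z. (grad_bump r x z \<bullet> v) * f z \<partial>lborel) = (\<integral>z. (\<Sum>i\<in>Basis. (v \<bullet> i) * ((grad_bump r x z \<bullet> i) * f z)) \<partial>lborel)"
    by (intro Bochner_Integration.integral_cong refl) (subst euclidean_inner, simp add: sum_distrib_left sum_distrib_right mult_ac)
  also have "\<dots> = (\<Sum>i\<in>Basis. (v \<bullet> i) * (\<integral>z. (grad_bump r x z \<bullet> i) * f z \<partial>lborel))"
    using i1 by (subst Bochner_Integration.integral_sum) auto
  also have "\<dots> = - (\<Sum>i\<in>Basis. (v \<bullet> i) * (\<integral>z. bump r x z * (Df z \<bullet> i) \<partial>lborel))"
    by (simp add: w sum_negf)
  also have "(\<Sum>i\<in>Basis. (v \<bullet> i) * (\<integral>z. bump r x z * (Df z \<bullet> i) \<partial>lborel)) = (\<integral>z. (\<Sum>i\<in>Basis. (v \<bullet> i) * (bump r x z * (Df z \<bullet> i))) \<partial>lborel)"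
    using i3 by (subst Bochner_Integration.integral_sum) auto
  also have "\<dots> = (\<integral>z. bump r x z * (Df z \<bullet> v) \<partial>lborel)"
    by (intro Bochner_Integration.integral_cong refl) (subst (2) euclidean_inner, simp add: sum_distrib_left mult_ac)
  finally have *: "(\<integral>z. (grad_bump r x z \<bullet> v) * f z \<partial>lborel) = - (\<integral>z. bump r x z * (Df z \<bullet> v) \<partial>lborel)" .
  have "(\<integral>z. (- (grad_bump r x z \<bullet> v) / ?Z) * f z \<partial>lborel) = (\<integral>z. (- 1 / ?Z) * ((grad_bump r x z \<bullet> v) * f z) \<partial>lborel)"
    by (intro Bochner_Integration.integral_cong refl) simp
  also have "\<dots> = (\<integral>z. bump r x z * (Df z \<bullet> v) \<partial>lborel) / ?Z"
    using * by (simp only: integral_mult_right_zero) simp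
  also have "\<dots> = (\<integral>z. ((bump r x z / ?Z) *\<^sub>R Df z) \<bullet> v \<partial>lborel)"
    by simp
  also have "\<dots> = moll r Df x \<bullet> v"
  proof -
    have "integrable lborel (\<lambda>z. (1/?Z) *\<^sub>R (bump r x z *\<^sub>R Df z))" using i2 by (rule integrable_scaleR_right)
    then have "integrable lborel (\<lambda>z. (bump r x z / ?Z) *\<^sub>R Df z)" by simp
    then show ?thesis unfolding moll_eq[OF assms(5) Lp_measurable[OF assms(3)]] by (rule integral_inner_left)
  qed
  finally show ?thesis .
qed

text \<open>Differentiability is encoded along lines, which is the form used by mean value estimates
  and by the fundamental theorem on segments. The field is continuous everywhere, but it is the
  gradient only at points of B.\<close>

definition c1grad :: "'a::euclidean_space set \<Rightarrow> ('a \<Rightarrow> real) \<Rightarrow> ('a \<Rightarrow> 'a) \<Rightarrow> bool" where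
  "c1grad B f F \<longleftrightarrow> continuous_on UNIV F \<and> (\<forall>a v t. a + t *\<^sub>R v \<in> B \<longrightarrow>
     ((\<lambda>t. f (a + t *\<^sub>R v)) has_real_derivative (F (a + t *\<^sub>R v) \<bullet> v)) (at t))"

lemma moll_c1grad:
  fixes f :: "'a::euclidean_space \<Rightarrow> real"
  assumes "1 \<le> p" "Lp p f" "Lp p Df" "weak_grad G f Df" "0 < r" "\<And>x. x \<in> B \<Longrightarrow> cball x r \<subseteq> G"
  shows "c1grad B (moll r f) (moll r Df)"
  unfolding c1grad_def
proof (intro conjI allI impI moll_continuous[OF assms(1,3,5)])
  fix a v t assume "a + t *\<^sub>R v \<in> B"
  then have "(\<integral>z. (- (grad_bump r (a + t *\<^sub>R v) z \<bullet> v) / bump_mass (0::'a) r) * f z \<partial>lborel) = moll r Df (a + t *\<^sub>R v) \<bullet> v"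
    by (intro moll_weak_grad[OF assms(1-5)] assms(6))
  then show "((\<lambda>t. moll r f (a + t *\<^sub>R v)) has_real_derivative moll r Df (a + t *\<^sub>R v) \<bullet> v) (at t)"
    using moll_deriv[OF assms(1,2,5), of a v t] by simp
qed

lemma c1grad_bump: "c1grad B (bump r a) (grad_bump r a)"
  unfolding c1grad_def
proof (intro conjI allI impI grad_bump_continuous1)
  fix b v :: 'a and t
  have "((\<lambda>t. b + t *\<^sub>R v) has_derivative (\<lambda>h. h *\<^sub>R v)) (at t)" by (auto intro!: derivative_eq_intros)
  from has_derivative_compose[OF this bump_has_derivative[of r a]]
  show "((\<lambda>t. bump r a (b + t *\<^sub>R v)) has_real_derivative grad_bump r a (b + t *\<^sub>R v) \<bullet> v) (at t)"
    by (simp add: has_field_derivative_def mult_commute_abs)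
qed

lemma c1grad_diff:
  assumes "c1grad B f F" "c1grad B g H" shows "c1grad B (\<lambda>x. f x - g x) (\<lambda>x. F x - H x)"
  using assms unfolding c1grad_def by (auto intro!: continuous_intros derivative_eq_intros simp: inner_diff_left)

lemma c1grad_cmult:
  assumes "c1grad B f F" shows "c1grad B (\<lambda>x. c * f x) (\<lambda>x. c *\<^sub>R F x)"
  using assms unfolding c1grad_def by (auto intro!: continuous_intros derivative_eq_intros)

lemma c1grad_bound:
  assumes "c1grad B f F" "convex S" "S \<subseteq> B" "\<And>x. x \<in> S \<Longrightarrow> norm (F x) \<le> K" "a \<in> S" "b \<in> S"
  shows "\<bar>f b - f a\<bar> \<le> K * norm (b - a)"
proof -
  have seg: "a + t *\<^sub>R (b - a) \<in> S" if "0 \<le> t" "t \<le> 1" for t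
  proof -
    have "(1 - t) *\<^sub>R a + t *\<^sub>R b \<in> S" using that assms by (intro convexD) auto
    then show ?thesis by (simp add: algebra_simps)
  qed
  have "\<exists>z>0. z < 1 \<and> f (a + 1 *\<^sub>R (b - a)) - f (a + 0 *\<^sub>R (b - a)) = (1 - 0) * (F (a + z *\<^sub>R (b - a)) \<bullet> (b - a))"
  proof (rule MVT2)
    fix t :: real assume "0 \<le> t" "t \<le> 1"
    then show "((\<lambda>t. f (a + t *\<^sub>R (b - a))) has_real_derivative F (a + t *\<^sub>R (b - a)) \<bullet> (b - a)) (at t)"
      using assms(1,3) seg unfolding c1grad_def by blast
  qed simp
  then obtain z where z: "0 < z" "z < 1" "f b - f a = F (a + z *\<^sub>R (b - a)) \<bullet> (b - a)" by auto
  have "\<bar>f b - f a\<bar> \<le> norm (F (a + z *\<^sub>R (b - a))) * norm (b - a)" unfolding z(3) by (rule Cauchy_Schwarz_ineq2)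
  also have "\<dots> \<le> K * norm (b - a)" using assms(4) seg z by (intro mult_right_mono) auto
  finally show ?thesis .
qed

text \<open>Near each parameter the field varies by less than e/2, so the mean value inequality on a
  small ball and unit speed give the estimate with |F| + e. \<open>ugc_localI\<close> removes the
  restriction to short arcs, and e tends to 0 because the curve has finite length.\<close>

lemma c1grad_ugc:
  fixes f :: "'a::euclidean_space \<Rightarrow> real"
  assumes "c1grad B f F" "open B" "curve_in \<gamma> l B"
  shows "ugc f (\<lambda>x. ennreal (norm (F x))) \<gamma> l"
proof -
  have ac: "arc_curve \<gamma> l" and inB: "\<And>t. t \<in> {0..l} \<Longrightarrow> \<gamma> t \<in> B" using assms(3) by (auto simp: curve_in_def)
  have Fc: "continuous_on UNIV F" using assms(1) by (simp add: c1grad_def)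
  have Fm[measurable]: "F \<in> borel_measurable borel" using Fc by (rule borel_measurable_continuous_onI)
  have eps: "ugc f (\<lambda>x. ennreal (norm (F x) + e)) \<gamma> l" if e: "0 < e" for e
  proof (rule ugc_localI[OF ac])
    show "(\<lambda>x. ennreal (norm (F x) + e)) \<in> borel_measurable borel" by measurable
    fix r assume r: "0 \<le> r" "r \<le> l"
    have "isCont F (\<gamma> r)" using Fc by (simp add: continuous_on_eq_continuous_at)
    then obtain \<eta> where \<eta>: "0 < \<eta>" "\<And>x. dist x (\<gamma> r) < \<eta> \<Longrightarrow> dist (F x) (F (\<gamma> r)) < e/2"
      unfolding continuous_at_eps_delta using e by (meson half_gt_zero)
    obtain \<eta>' where \<eta>': "0 < \<eta>'" "ball (\<gamma> r) \<eta>' \<subseteq> B" using assms(2) inB[of r] r open_contains_ball by (metis atLeastAtMost_iff)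
    define d where "d = min \<eta> \<eta>'"
    have "ennreal \<bar>f (\<gamma> s) - f (\<gamma> t)\<bar> \<le> cint (\<lambda>x. ennreal (norm (F x) + e)) \<gamma> s t"
      if st: "0 \<le> s \<and> s \<le> r \<and> r \<le> t \<and> t \<le> l \<and> t - s < d" for s t
    proof -
      have near: "dist (\<gamma> \<tau>) (\<gamma> r) < d" if "\<tau> \<in> {s..t}" for \<tau>
        using arc_curve_dist[OF ac, of \<tau> r] arc_curve_dist[OF ac, of r \<tau>] that st r
        by (cases "\<tau> \<le> r") (auto simp: dist_commute)
      let ?K = "norm (F (\<gamma> r)) + e/2"
      have K: "norm (F x) \<le> ?K" if "x \<in> ball (\<gamma> r) d" for x
      proof -
        have "dist (F x) (F (\<gamma> r)) < e/2" using that by (intro \<eta>(2)) (auto simp: d_def dist_commute)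
        then show ?thesis using norm_triangle_ineq2[of "F x" "F (\<gamma> r)"] by (simp add: dist_norm)
      qed
      have "\<bar>f (\<gamma> t) - f (\<gamma> s)\<bar> \<le> ?K * norm (\<gamma> t - \<gamma> s)"
        by (rule c1grad_bound[OF assms(1) convex_ball[of "\<gamma> r" d]]) (use K near[of s] near[of t] st \<eta>' in \<open>auto simp: d_def dist_commute\<close>)
      also have "\<dots> \<le> ?K * (t - s)"
        using arc_curve_dist[OF ac, of s t] st e by (intro mult_left_mono) (auto simp: dist_norm norm_minus_commute)
      finally have 1: "\<bar>f (\<gamma> s) - f (\<gamma> t)\<bar> \<le> ?K * (t - s)" by (simp add: abs_minus_commute)
      have "ennreal (?K * (t - s)) = (\<integral>\<^sup>+\<tau>. ennreal ?K * indicator {s..t} \<tau> \<partial>lborel)"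
        using st e by (subst nn_integral_cmult_indicator) (auto simp: ennreal_mult)
      also have "\<dots> \<le> cint (\<lambda>x. ennreal (norm (F x) + e)) \<gamma> s t"
        unfolding cint_def
      proof (intro nn_integral_mono)
        fix \<tau>
        show "ennreal ?K * indicator {s..t} \<tau> \<le> ennreal (norm (F (\<gamma> \<tau>)) + e) * indicator {s..t} \<tau>"
        proof (cases "\<tau> \<in> {s..t}")
          case True
          then have "dist (F (\<gamma> \<tau>)) (F (\<gamma> r)) < e/2" using near[of \<tau>] by (intro \<eta>(2)) (auto simp: d_def)
          then have "?K \<le> norm (F (\<gamma> \<tau>)) + e" using norm_triangle_ineq3[of "F (\<gamma> \<tau>)" "F (\<gamma> r)"] by (simp add: dist_norm)
          then show ?thesis using True by (simp add: ennreal_leI)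
        qed simp
      qed
      finally show ?thesis using 1 ennreal_leI order_trans by blast
    qed
    moreover have "0 < d" using \<eta> \<eta>' by (simp add: d_def)
    ultimately show "\<exists>d>0. \<forall>s t. 0 \<le> s \<and> s \<le> r \<and> r \<le> t \<and> t \<le> l \<and> t - s < d \<longrightarrow>
       ennreal \<bar>f (\<gamma> s) - f (\<gamma> t)\<bar> \<le> cint (\<lambda>x. ennreal (norm (F x) + e)) \<gamma> s t" by blast
  qed
  show ?thesis
    unfolding ugc_def
  proof (intro allI impI)
    fix s t assume st: "0 \<le> s \<and> s \<le> t \<and> t \<le> l"
    show "ennreal \<bar>f (\<gamma> s) - f (\<gamma> t)\<bar> \<le> cint (\<lambda>x. ennreal (norm (F x))) \<gamma> s t"
    proof (rule ennreal_le_epsilon)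
      fix e :: real assume e: "0 < e"
      define e' where "e' = e / (1 + l)"
      have e': "0 < e'" "e' * (t - s) \<le> e"
      proof -
        show "0 < e'" using e arc_curve_pos[OF ac] by (simp add: e'_def)
        then have "e' * (t - s) \<le> e' * (1 + l)" using st by (intro mult_left_mono) auto
        then show "e' * (t - s) \<le> e" using arc_curve_pos[OF ac] by (simp add: e'_def)
      qed
      have "cint (\<lambda>x. ennreal (norm (F x) + e')) \<gamma> s t = cint (\<lambda>x. ennreal (norm (F x)) + ennreal e') \<gamma> s t"
        using e' by simp
      also have "\<dots> = cint (\<lambda>x. ennreal (norm (F x))) \<gamma> s t + cint (\<lambda>x. ennreal e') \<gamma> s t"
        using st by (intro cint_add[OF ac]) auto
      also have "cint (\<lambda>x. ennreal e') \<gamma> s t = ennreal (e' * (t - s))"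
        unfolding cint_def using st e' by (subst nn_integral_cmult_indicator) (auto simp: ennreal_mult)
      finally have "cint (\<lambda>x. ennreal (norm (F x) + e')) \<gamma> s t \<le> cint (\<lambda>x. ennreal (norm (F x))) \<gamma> s t + ennreal e"
        using e'(2) by (auto intro!: add_left_mono ennreal_leI)
      then show "ennreal \<bar>f (\<gamma> s) - f (\<gamma> t)\<bar> \<le> cint (\<lambda>x. ennreal (norm (F x))) \<gamma> s t + ennreal e"
        using ugcD[OF eps[OF e'(1)]] st order_trans by blast
    qed
  qed
qed

section \<open>Quasicontinuous representatives\<close>

text \<open>The weight 2^j multiplies the p-integral by 2^(jp), which \<open>small_cap\<close>
  cancels with a factor 2^-j to spare.\<close>

lemma Lpb_fast:
  fixes r :: "nat \<Rightarrow> 'a::euclidean_space \<Rightarrow> ennreal"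
  assumes "0 < p" "\<And>j. r j \<in> borel_measurable borel"
    "\<And>j. (\<integral>\<^sup>+x. epow (r j x) p \<partial>lborel) \<le> ennreal (K * small_cap p j)" "0 \<le> K"
  shows "Lpb p (\<lambda>x. SUP j. ennreal (2^j) * r j x)"
proof (rule Lpb_SUP)
  note [measurable] = assms(2)
  have "(\<integral>\<^sup>+x. epow (ennreal (2^i) * r i x) p \<partial>lborel) \<le> ennreal (K * (1/2)^i)" for i
  proof -
    have "(\<integral>\<^sup>+x. epow (ennreal (2^i) * r i x) p \<partial>lborel) = ennreal ((2^i) powr p) * (\<integral>\<^sup>+x. epow (r i x) p \<partial>lborel)"
      by (subst epow_cmult) (auto simp: nn_integral_cmult)
    also have "\<dots> \<le> ennreal ((2^i) powr p) * ennreal (K * small_cap p i)" using assms(3) by (intro mult_left_mono) auto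
    also have "\<dots> = ennreal (((2^i) powr p * 2 powr (- real i * p)) * (K * (1/2)^i))"
      using assms(4) by (simp add: small_cap_def ennreal_mult[symmetric] mult_ac)
    also have "(2^i) powr p * 2 powr (- real i * p) = 1"
      by (simp add: powr_realpow[symmetric] powr_powr powr_add[symmetric])
    finally show ?thesis by simp
  qed
  then have "(\<Sum>n. \<integral>\<^sup>+x. epow (ennreal (2^n) * r n x) p \<partial>lborel) \<le> (\<Sum>n. ennreal (K * (1/2)^n))"
    by (intro suminf_le) auto
  also have "\<dots> = ennreal (\<Sum>n. K * (1/2)^n)"
    using assms(4) by (intro suminf_ennreal2 summable_mult) (auto simp: summable_geometric)
  finally show "(\<Sum>n. \<integral>\<^sup>+x. epow (ennreal (2^n) * r n x) p \<partial>lborel) < \<infinity>"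
    by (auto intro: le_less_trans)
qed (use assms in auto)

lemma ennreal_fast_le:
  assumes "ennreal (2^j) * a \<le> ennreal C" "0 \<le> C" shows "a \<le> ennreal (C / 2^j)"
proof -
  have "a = ennreal (1/2^j) * (ennreal (2^j) * a)"
    by (simp add: mult.assoc[symmetric] ennreal_mult[symmetric])
  also have "\<dots> \<le> ennreal (1/2^j) * ennreal C" using assms by (intro mult_left_mono) auto
  finally show ?thesis using assms by (simp add: ennreal_mult[symmetric])
qed

lemma cint_fast:
  assumes "arc_curve \<gamma> l" "r j \<in> borel_measurable borel"
    "cint (\<lambda>x. SUP j. ennreal (2^j) * r j x) \<gamma> 0 l \<le> ennreal C" "0 \<le> C" "0 \<le> s" "t \<le> l"
  shows "cint (r j) \<gamma> s t \<le> ennreal (C / 2^j)"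
proof (rule ennreal_fast_le[OF _ assms(4)])
  have "ennreal (2^j) * cint (r j) \<gamma> s t = cint (\<lambda>x. ennreal (2^j) * r j x) \<gamma> s t"
    by (rule cint_cmult[symmetric]) fact+
  also have "\<dots> \<le> cint (\<lambda>x. SUP j. ennreal (2^j) * r j x) \<gamma> s t" by (intro cint_mono SUP_upper2[of j]) auto
  also have "\<dots> \<le> cint (\<lambda>x. SUP j. ennreal (2^j) * r j x) \<gamma> 0 l" using assms by (intro cint_mono_interval) auto
  also have "\<dots> \<le> ennreal C" by fact
  finally show "ennreal (2^j) * cint (r j) \<gamma> s t \<le> ennreal C" .
qed

lemma Lpb_AE_finite:
  assumes "0 < p" "Lpb p \<rho>" shows "AE x in lborel. \<rho> x < \<infinity>"
proof -
  have "AE x in lborel. epow (\<rho> x) p \<noteq> \<infinity>"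
    using assms(2) unfolding Lpb_def by (intro nn_integral_noteq_infinite) auto
  then show ?thesis by eventually_elim (auto simp: less_top[symmetric])
qed

text \<open>Pointwise counterpart of \<open>cint_fast\<close>: where the weighted supremum of the
  errors is finite, they decay geometrically.\<close>

lemma fast_AE_tendsto:
  fixes u :: "nat \<Rightarrow> 'a::euclidean_space \<Rightarrow> 'b::euclidean_space"
  assumes "0 < p" "\<And>k. u k \<in> borel_measurable borel" "v \<in> borel_measurable borel"
    "\<And>k. pint p (\<lambda>x. u k x - v x) \<le> ennreal (small_cap p k)"
  shows "AE x in lborel. (\<lambda>k. u k x) \<longlonglongrightarrow> v x"
proof -
  note [measurable] = assms(2,3)
  have "Lpb p (\<lambda>x. SUP j. ennreal (2^j) * ennreal (norm (u j x - v x)))"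
    by (rule Lpb_fast[where K=1]) (use assms in \<open>auto simp: pint_def\<close>)
  from Lpb_AE_finite[OF assms(1) this] show ?thesis
  proof eventually_elim
    case (elim x)
    then obtain C where C: "(SUP j. ennreal (2^j) * ennreal (norm (u j x - v x))) = ennreal C" "0 \<le> C"
      by (cases "SUP j. ennreal (2^j) * ennreal (norm (u j x - v x))") auto
    have "norm (u k x - v x) \<le> C / 2^k" for k
    proof -
      have "ennreal (2^k) * ennreal (norm (u k x - v x)) \<le> ennreal C" unfolding C(1)[symmetric] by (rule SUP_upper) simp
      from ennreal_fast_le[OF this C(2)] show ?thesis using C(2) by (simp add: ennreal_le_iff)
    qed
    then have "\<forall>\<^sub>F k in sequentially. norm (u k x - v x) \<le> C / 2^k" by simp
    moreover have "(\<lambda>k. C / 2^k) \<longlonglongrightarrow> 0" by real_asymp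
    ultimately have "(\<lambda>k. u k x - v x) \<longlonglongrightarrow> 0" by (rule Lim_null_comparison)
    then show ?case by (simp add: LIM_zero_iff)
  qed
qed

text \<open>Vacuous on curves that are not unit-speed segments. On segments it is a signed identity,
  so it determines directional derivatives, whereas \<open>ugc\<close> only bounds them.\<close>

definition line_ftc :: "('a::euclidean_space \<Rightarrow> real) \<Rightarrow> ('a \<Rightarrow> 'a) \<Rightarrow> (real \<Rightarrow> 'a) \<Rightarrow> real \<Rightarrow> bool" where
  "line_ftc F DF \<gamma> l \<longleftrightarrow> (\<forall>x e. norm e = 1 \<and> (\<forall>\<tau>\<in>{0..l}. \<gamma> \<tau> = x + \<tau> *\<^sub>R e) \<longrightarrow>
     set_integrable lborel {0..l} (\<lambda>\<tau>. DF (x + \<tau> *\<^sub>R e) \<bullet> e) \<and>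
     F (x + l *\<^sub>R e) - F x = (LINT \<tau>:{0..l}|lborel. DF (x + \<tau> *\<^sub>R e) \<bullet> e))"

section \<open>Limits of rapidly converging smooth approximations\<close>

text \<open>The approximations are close on the whole space, but \<open>Fk\<close> has to be the
  gradient of \<open>fk\<close> only on B. This covers both global weak gradients, with B the whole
  space, and local ones, with B a ball well inside the domain.\<close>

locale fast_seq =
  fixes p :: real and B :: "'a::euclidean_space set" and f :: "'a \<Rightarrow> real" and Df :: "'a \<Rightarrow> 'a"
    and fk :: "nat \<Rightarrow> 'a \<Rightarrow> real" and Fk :: "nat \<Rightarrow> 'a \<Rightarrow> 'a"
  assumes p1: "1 \<le> p" and B: "open B" and Lpf: "Lp p f" and LpD: "Lp p Df"
    and c1: "\<And>k. c1grad B (fk k) (Fk k)" and cont: "\<And>k. continuous_on UNIV (fk k)"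
    and close_f: "\<And>k. pint p (\<lambda>x. fk k x - f x) \<le> ennreal (small_cap p k)"
    and close_F: "\<And>k. pint p (\<lambda>x. Fk k x - Df x) \<le> ennreal (small_cap p k)"
begin

lemma p0: "0 < p" using p1 by simp

lemma meas [measurable]: "f \<in> borel_measurable borel" "Df \<in> borel_measurable borel"
  "fk k \<in> borel_measurable borel" "Fk k \<in> borel_measurable borel"
  using Lpf LpD cont[of k] c1[of k] by (auto simp: Lp_def c1grad_def intro: borel_measurable_continuous_onI)

definition r :: "nat \<Rightarrow> 'a \<Rightarrow> ennreal" where
  "r k x = ennreal \<bar>fk k x - f x\<bar> + ennreal (norm (Fk k x - Df x))"

lemma r_measurable [measurable]: "r k \<in> borel_measurable borel"
  unfolding r_def by measurable

lemma Lpb_r: "Lpb p (\<lambda>x. SUP j. ennreal (2^j) * r j x)"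
proof (rule Lpb_fast[where K="2 powr p * 2", OF p0 r_measurable])
  fix j
  have "(\<integral>\<^sup>+x. epow (r j x) p \<partial>lborel) \<le> (\<integral>\<^sup>+x. ennreal (2 powr p) * (ennreal (\<bar>fk j x - f x\<bar> powr p) + ennreal (norm (Fk j x - Df x) powr p)) \<partial>lborel)"
    unfolding r_def using epow_add_le[of p] p0 by (intro nn_integral_mono) (metis abs_ge_zero epow_ennreal less_imp_le norm_ge_zero)
  also have "\<dots> = ennreal (2 powr p) * (pint p (\<lambda>x. fk j x - f x) + pint p (\<lambda>x. Fk j x - Df x))"
    unfolding pint_def by (simp add: nn_integral_cmult nn_integral_add)
  also have "\<dots> \<le> ennreal (2 powr p) * (ennreal (small_cap p j) + ennreal (small_cap p j))"
    using close_f close_F by (intro mult_left_mono add_mono) auto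
  also have "\<dots> = ennreal (2 powr p * 2 * small_cap p j)"
    using small_cap_pos[of p j] by (simp add: ennreal_mult[symmetric] ennreal_plus[symmetric] del: ennreal_plus)
  finally show "(\<integral>\<^sup>+x. epow (r j x) p \<partial>lborel) \<le> ennreal (2 powr p * 2 * small_cap p j)" .
qed simp

text \<open>The value is arbitrary where the sequence diverges; almost every curve in B avoids such
  points.\<close>

definition flim :: "'a \<Rightarrow> real" where
  "flim x = lim (\<lambda>k. fk k x)"

lemma flim_AE: "AE x in lborel. flim x = f x"
  using fast_AE_tendsto[OF p0, of fk f] close_f
  by (auto simp: flim_def limI elim!: eventually_mono)

context
  fixes \<gamma> l C assumes \<gamma>: "curve_in \<gamma> l B" and C: "cint (\<lambda>x. SUP j. ennreal (2^j) * r j x) \<gamma> 0 l \<le> ennreal C" "0 \<le> C"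
begin

lemma ac: "arc_curve \<gamma> l" using \<gamma> by (simp add: curve_in_def)

lemma r_cint: "0 \<le> s \<Longrightarrow> t \<le> l \<Longrightarrow> cint (r k) \<gamma> s t \<le> ennreal (C / 2^k)"
  by (rule cint_fast[OF ac r_measurable C])

lemma fk_diff_osc:
  assumes "0 \<le> s" "s \<le> t" "t \<le> l"
  shows "\<bar>(fk k (\<gamma> s) - fk m (\<gamma> s)) - (fk k (\<gamma> t) - fk m (\<gamma> t))\<bar> \<le> C / 2^k + C / 2^m"
proof -
  have "ennreal \<bar>(fk k (\<gamma> s) - fk m (\<gamma> s)) - (fk k (\<gamma> t) - fk m (\<gamma> t))\<bar> \<le> cint (\<lambda>x. ennreal (norm (Fk k x - Fk m x))) \<gamma> s t"
    by (rule ugcD[OF c1grad_ugc[OF c1grad_diff[OF c1 c1] B \<gamma>] assms])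
  also have "\<dots> \<le> cint (\<lambda>x. r k x + r m x) \<gamma> s t"
  proof (rule cint_mono)
    fix \<tau>
    have "norm (Fk k (\<gamma> \<tau>) - Fk m (\<gamma> \<tau>)) \<le> norm (Fk k (\<gamma> \<tau>) - Df (\<gamma> \<tau>)) + norm (Fk m (\<gamma> \<tau>) - Df (\<gamma> \<tau>))"
      using norm_triangle_ineq4[of "Fk k (\<gamma> \<tau>) - Df (\<gamma> \<tau>)" "Fk m (\<gamma> \<tau>) - Df (\<gamma> \<tau>)"] by simp
    then have "ennreal (norm (Fk k (\<gamma> \<tau>) - Fk m (\<gamma> \<tau>))) \<le> ennreal (norm (Fk k (\<gamma> \<tau>) - Df (\<gamma> \<tau>))) + ennreal (norm (Fk m (\<gamma> \<tau>) - Df (\<gamma> \<tau>)))"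
      by (simp add: ennreal_plus[symmetric] ennreal_leI del: ennreal_plus)
    also have "\<dots> \<le> r k (\<gamma> \<tau>) + r m (\<gamma> \<tau>)" unfolding r_def by (intro add_mono) auto
    finally show "ennreal (norm (Fk k (\<gamma> \<tau>) - Fk m (\<gamma> \<tau>))) \<le> r k (\<gamma> \<tau>) + r m (\<gamma> \<tau>)" .
  qed
  also have "\<dots> = cint (r k) \<gamma> s t + cint (r m) \<gamma> s t" using assms by (intro cint_add[OF ac]) auto
  also have "\<dots> \<le> ennreal (C / 2^k) + ennreal (C / 2^m)" using assms by (intro add_mono r_cint) auto
  also have "\<dots> = ennreal (C / 2^k + C / 2^m)" using C(2) by simp
  finally show ?thesis using C(2) by (subst (asm) ennreal_le_iff) auto
qed

text \<open>The gradients control only the oscillation of \<open>fk k - fk m\<close> along the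
  curve. Averaging over the curve brings in the closeness of both to f and turns this into a bound
  at every single point.\<close>

lemma fk_diff_bound:
  assumes "t \<in> {0..l}"
  shows "\<bar>fk k (\<gamma> t) - fk m (\<gamma> t)\<bar> * l \<le> (C / 2^k + C / 2^m) * (1 + l)"
proof -
  let ?K = "C / 2^k + C / 2^m"
  let ?D = "\<lambda>s. fk k (\<gamma> s) - fk m (\<gamma> s)"
  have l: "0 < l" by (rule arc_curve_pos[OF ac])
  have K: "0 \<le> ?K" using C(2) by simp
  have osc: "\<bar>?D t\<bar> \<le> \<bar>?D s\<bar> + ?K" if "s \<in> {0..l}" for s
    using fk_diff_osc[of s t k m] fk_diff_osc[of t s k m] that assms by (cases "s \<le> t") auto
  have "ennreal (\<bar>?D t\<bar> * l) = (\<integral>\<^sup>+s. ennreal \<bar>?D t\<bar> * indicator {0..l} s \<partial>lborel)"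
    using l by (subst nn_integral_cmult_indicator) (auto simp: ennreal_mult)
  also have "\<dots> \<le> cint (\<lambda>x. (r k x + r m x) + ennreal ?K) \<gamma> 0 l"
    unfolding cint_def
  proof (intro nn_integral_mono)
    fix s
    show "ennreal \<bar>?D t\<bar> * indicator {0..l} s \<le> ((r k (\<gamma> s) + r m (\<gamma> s)) + ennreal ?K) * indicator {0..l} s"
    proof (cases "s \<in> {0..l}")
      case True
      have "\<bar>?D t\<bar> \<le> (\<bar>fk k (\<gamma> s) - f (\<gamma> s)\<bar> + \<bar>fk m (\<gamma> s) - f (\<gamma> s)\<bar>) + ?K" using osc[OF True] by linarith
      then have "ennreal \<bar>?D t\<bar> \<le> (ennreal \<bar>fk k (\<gamma> s) - f (\<gamma> s)\<bar> + ennreal \<bar>fk m (\<gamma> s) - f (\<gamma> s)\<bar>) + ennreal ?K"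
        using K by (simp add: ennreal_plus[symmetric] ennreal_leI del: ennreal_plus)
      also have "\<dots> \<le> (r k (\<gamma> s) + r m (\<gamma> s)) + ennreal ?K" unfolding r_def by (intro add_mono) auto
      finally show ?thesis using True by simp
    qed simp
  qed
  also have "\<dots> = cint (r k) \<gamma> 0 l + cint (r m) \<gamma> 0 l + ennreal (?K * l)"
  proof -
    have "cint (\<lambda>x. ennreal ?K) \<gamma> 0 l = ennreal (?K * l)"
      unfolding cint_def using l K by (subst nn_integral_cmult_indicator) (auto simp: ennreal_mult)
    then show ?thesis by (subst cint_add[OF ac], simp, simp, simp, simp)+ simp
  qed
  also have "\<dots> \<le> ennreal (C / 2^k) + ennreal (C / 2^m) + ennreal (?K * l)"
    by (intro add_mono r_cint) auto
  also have "\<dots> = ennreal (?K * (1 + l))" using C(2) l K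
    by (simp add: ennreal_plus[symmetric] distrib_left del: ennreal_plus)
  finally show ?thesis using K l by (subst (asm) ennreal_le_iff) auto
qed

lemma fk_tendsto:
  assumes "t \<in> {0..l}" shows "(\<lambda>k. fk k (\<gamma> t)) \<longlonglongrightarrow> flim (\<gamma> t)"
proof -
  have l: "0 < l" by (rule arc_curve_pos[OF ac])
  define A where "A = C * (1 + l) / l"
  have b: "\<bar>fk k (\<gamma> t) - fk m (\<gamma> t)\<bar> \<le> A / 2^k + A / 2^m" for k m
  proof -
    have "\<bar>fk k (\<gamma> t) - fk m (\<gamma> t)\<bar> \<le> (C / 2^k + C / 2^m) * (1 + l) / l"
      using fk_diff_bound[OF assms, of k m] l by (simp only: pos_le_divide_eq)
    also have "\<dots> = A / 2^k + A / 2^m" by (simp add: A_def add_divide_distrib distrib_left distrib_right mult.commute)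
    finally show ?thesis .
  qed
  have "Cauchy (\<lambda>k. fk k (\<gamma> t))"
  proof (rule CauchyI)
    fix e :: real assume "0 < e"
    have "(\<lambda>k. A / 2^k) \<longlonglongrightarrow> 0" by real_asymp
    then have "\<forall>\<^sub>F k in sequentially. A / 2^k < e/2" using \<open>0 < e\<close> by (intro order_tendstoD) auto
    then obtain M where M: "\<And>k. k \<ge> M \<Longrightarrow> A / 2^k < e/2" by (auto simp: eventually_sequentially)
    have "norm (fk m (\<gamma> t) - fk n (\<gamma> t)) < e" if "m \<ge> M" "n \<ge> M" for m n
      using b[of m n] M[OF that(1)] M[OF that(2)] unfolding real_norm_def by linarith
    then show "\<exists>M. \<forall>m\<ge>M. \<forall>n\<ge>M. norm (fk m (\<gamma> t) - fk n (\<gamma> t)) < e" by blast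
  qed
  then have "convergent (\<lambda>k. fk k (\<gamma> t))" by (simp add: Cauchy_convergent_iff)
  then show ?thesis by (simp add: flim_def convergent_LIMSEQ_iff)
qed

lemma flim_ugc: "ugc flim (\<lambda>x. ennreal (norm (Df x))) \<gamma> l"
  unfolding ugc_def
proof (intro allI impI)
  fix s t assume st: "0 \<le> s \<and> s \<le> t \<and> t \<le> l"
  let ?J = "cint (\<lambda>x. ennreal (norm (Df x))) \<gamma> s t"
  have b: "ennreal \<bar>fk k (\<gamma> s) - fk k (\<gamma> t)\<bar> \<le> ?J + ennreal (C / 2^k)" for k
  proof -
    have "ennreal \<bar>fk k (\<gamma> s) - fk k (\<gamma> t)\<bar> \<le> cint (\<lambda>x. ennreal (norm (Fk k x))) \<gamma> s t"
      using c1grad_ugc[OF c1 B \<gamma>] st by (intro ugcD) auto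
    also have "\<dots> \<le> cint (\<lambda>x. ennreal (norm (Df x)) + r k x) \<gamma> s t"
    proof (rule cint_mono)
      fix \<tau>
      have "norm (Fk k (\<gamma> \<tau>)) \<le> norm (Df (\<gamma> \<tau>)) + norm (Fk k (\<gamma> \<tau>) - Df (\<gamma> \<tau>))"
        using norm_triangle_ineq[of "Df (\<gamma> \<tau>)" "Fk k (\<gamma> \<tau>) - Df (\<gamma> \<tau>)"] by simp
      then have "ennreal (norm (Fk k (\<gamma> \<tau>))) \<le> ennreal (norm (Df (\<gamma> \<tau>))) + ennreal (norm (Fk k (\<gamma> \<tau>) - Df (\<gamma> \<tau>)))"
        by (simp add: ennreal_plus[symmetric] ennreal_leI del: ennreal_plus)
      also have "\<dots> \<le> ennreal (norm (Df (\<gamma> \<tau>))) + r k (\<gamma> \<tau>)" unfolding r_def by (intro add_mono) auto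
      finally show "ennreal (norm (Fk k (\<gamma> \<tau>))) \<le> ennreal (norm (Df (\<gamma> \<tau>))) + r k (\<gamma> \<tau>)" .
    qed
    also have "\<dots> = ?J + cint (r k) \<gamma> s t" using st by (intro cint_add[OF ac]) auto
    also have "\<dots> \<le> ?J + ennreal (C / 2^k)" using st by (intro add_left_mono r_cint) auto
    finally show ?thesis .
  qed
  have "(\<lambda>k. \<bar>fk k (\<gamma> s) - fk k (\<gamma> t)\<bar>) \<longlonglongrightarrow> \<bar>flim (\<gamma> s) - flim (\<gamma> t)\<bar>"
    using fk_tendsto[of s] fk_tendsto[of t] st by (intro tendsto_intros) auto
  then have 1: "(\<lambda>k. ennreal \<bar>fk k (\<gamma> s) - fk k (\<gamma> t)\<bar>) \<longlonglongrightarrow> ennreal \<bar>flim (\<gamma> s) - flim (\<gamma> t)\<bar>" by (rule tendsto_ennrealI)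
  have "(\<lambda>k. C / 2^k) \<longlonglongrightarrow> 0" by real_asymp
  from tendsto_ennrealI[OF this] have 2: "(\<lambda>k. ?J + ennreal (C / 2^k)) \<longlonglongrightarrow> ?J + 0"
    by (intro tendsto_add tendsto_const) simp
  show "ennreal \<bar>flim (\<gamma> s) - flim (\<gamma> t)\<bar> \<le> ?J"
    using LIMSEQ_le[OF 1 2] b by auto
qed

text \<open>The identity holds for each smooth \<open>fk k\<close>, and the integrals of
  \<open>Fk k\<close> and \<open>Df\<close> along the segment differ by at most the line integral of
  \<open>r k\<close>.\<close>

lemma flim_line:
  assumes fin: "cint (\<lambda>x. ennreal (norm (Df x))) \<gamma> 0 l < \<infinity>"
  shows "line_ftc flim Df \<gamma> l"
  unfolding line_ftc_def
proof (intro allI impI)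
  fix x e assume a: "norm e = 1 \<and> (\<forall>\<tau>\<in>{0..l}. \<gamma> \<tau> = x + \<tau> *\<^sub>R e)"
  let ?c = "\<lambda>\<tau>::real. x + \<tau> *\<^sub>R e"
  have l: "0 < l" by (rule arc_curve_pos[OF ac])
  have eq: "cint g \<gamma> 0 l = (\<integral>\<^sup>+\<tau>. g (?c \<tau>) * indicator {0..l} \<tau> \<partial>lborel)" for g
    unfolding cint_def using a by (intro nn_integral_cong) (auto simp: indicator_def)
  have inn: "\<bar>z \<bullet> e\<bar> \<le> norm z" for z using Cauchy_Schwarz_ineq2[of z e] a by simp
  have bd: "ennreal (norm (indicator {0..l} \<tau> *\<^sub>R (z \<bullet> e))) \<le> ennreal (norm z) * indicator {0..l} \<tau>" for z and \<tau> :: real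
    using inn[of z] by (auto simp: indicator_def intro!: ennreal_leI)
  have intD: "set_integrable lborel {0..l} (\<lambda>\<tau>. Df (?c \<tau>) \<bullet> e)"
    unfolding set_integrable_def
  proof (rule integrableI_bounded)
    have "(\<integral>\<^sup>+\<tau>. ennreal (norm (indicator {0..l} \<tau> *\<^sub>R (Df (?c \<tau>) \<bullet> e))) \<partial>lborel) \<le> cint (\<lambda>x. ennreal (norm (Df x))) \<gamma> 0 l"
      unfolding eq by (intro nn_integral_mono bd)
    then show "(\<integral>\<^sup>+\<tau>. ennreal (norm (indicator {0..l} \<tau> *\<^sub>R (Df (?c \<tau>) \<bullet> e))) \<partial>lborel) < \<infinity>" using fin by auto
  qed measurable
  have ftc: "set_integrable lborel {0..l} (\<lambda>\<tau>. Fk k (?c \<tau>) \<bullet> e) \<and>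
    fk k (?c l) - fk k x = (LINT \<tau>:{0..l}|lborel. Fk k (?c \<tau>) \<bullet> e)" for k
  proof -
    have cF: "continuous_on UNIV (Fk k)" using c1[of k] by (simp add: c1grad_def)
    have co: "continuous_on {0..l} (\<lambda>\<tau>. Fk k (?c \<tau>) \<bullet> e)"
      by (intro continuous_intros continuous_on_compose2[OF cF]) auto
    have si: "set_integrable lborel {0..l} (\<lambda>\<tau>. Fk k (?c \<tau>) \<bullet> e)"
      using borel_integrable_atLeastAtMost'[OF co] .
    have "((\<lambda>\<tau>. Fk k (?c \<tau>) \<bullet> e) has_integral (fk k (?c l) - fk k (?c 0))) {0..l}"
    proof (rule fundamental_theorem_of_calculus)
      fix \<tau> assume \<tau>: "\<tau> \<in> {0..l}"
      then have "\<gamma> \<tau> \<in> B" "\<gamma> \<tau> = ?c \<tau>" using a \<gamma> unfolding curve_in_def by blast+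
      then have "?c \<tau> \<in> B" by simp
      then have "((\<lambda>t. fk k (?c t)) has_real_derivative (Fk k (?c \<tau>) \<bullet> e)) (at \<tau>)"
        using c1[of k] unfolding c1grad_def by blast
      then show "((\<lambda>t. fk k (?c t)) has_vector_derivative (Fk k (?c \<tau>) \<bullet> e)) (at \<tau> within {0..l})"
        by (simp add: has_real_derivative_iff_has_vector_derivative has_vector_derivative_at_within)
    qed (use l in auto)
    then have "fk k (?c l) - fk k x = integral {0..l} (\<lambda>\<tau>. Fk k (?c \<tau>) \<bullet> e)" by (simp add: integral_unique)
    then show ?thesis using si set_borel_integral_eq_integral(2)[OF si] by simp
  qed
  have lim1: "(\<lambda>k. LINT \<tau>:{0..l}|lborel. Fk k (?c \<tau>) \<bullet> e) \<longlonglongrightarrow> (LINT \<tau>:{0..l}|lborel. Df (?c \<tau>) \<bullet> e)"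
  proof (rule LIM_zero_cancel, rule Lim_null_comparison)
    show "\<forall>\<^sub>F k in sequentially. norm ((LINT \<tau>:{0..l}|lborel. Fk k (?c \<tau>) \<bullet> e) - (LINT \<tau>:{0..l}|lborel. Df (?c \<tau>) \<bullet> e)) \<le> C / 2^k"
    proof (rule always_eventually, rule allI)
      fix k
      have d: "(LINT \<tau>:{0..l}|lborel. Fk k (?c \<tau>) \<bullet> e) - (LINT \<tau>:{0..l}|lborel. Df (?c \<tau>) \<bullet> e)
        = (LINT \<tau>:{0..l}|lborel. (Fk k (?c \<tau>) - Df (?c \<tau>)) \<bullet> e)"
        using set_integral_diff(2)[OF conjunct1[OF ftc] intD] by (simp add: inner_diff_left)
      have si: "set_integrable lborel {0..l} (\<lambda>\<tau>. (Fk k (?c \<tau>) - Df (?c \<tau>)) \<bullet> e)"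
        using set_integral_diff(1)[OF conjunct1[OF ftc] intD] by (simp add: inner_diff_left)
      have "ennreal (norm (LINT \<tau>:{0..l}|lborel. (Fk k (?c \<tau>) - Df (?c \<tau>)) \<bullet> e))
         \<le> (\<integral>\<^sup>+\<tau>. ennreal (norm (indicator {0..l} \<tau> *\<^sub>R ((Fk k (?c \<tau>) - Df (?c \<tau>)) \<bullet> e))) \<partial>lborel)"
        unfolding set_lebesgue_integral_def using si unfolding set_integrable_def by (rule integral_norm_bound_ennreal)
      also have "\<dots> \<le> (\<integral>\<^sup>+\<tau>. r k (?c \<tau>) * indicator {0..l} \<tau> \<partial>lborel)"
      proof (intro nn_integral_mono order_trans[OF bd] mult_right_mono)
        show "ennreal (norm (Fk k (?c \<tau>) - Df (?c \<tau>))) \<le> r k (?c \<tau>)" for \<tau> by (simp add: r_def)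
      qed simp
      also have "\<dots> = cint (r k) \<gamma> 0 l" by (simp add: eq)
      also have "\<dots> \<le> ennreal (C / 2^k)" by (rule r_cint) auto
      finally show "norm ((LINT \<tau>:{0..l}|lborel. Fk k (?c \<tau>) \<bullet> e) - (LINT \<tau>:{0..l}|lborel. Df (?c \<tau>) \<bullet> e)) \<le> C / 2^k"
        unfolding d using C(2) by (subst (asm) ennreal_le_iff) auto
    qed
    show "(\<lambda>k. C / 2^k) \<longlonglongrightarrow> 0" by real_asymp
  qed
  have "(\<lambda>k. fk k (?c l) - fk k (?c 0)) \<longlonglongrightarrow> flim (?c l) - flim (?c 0)"
    using fk_tendsto[of l] fk_tendsto[of 0] a l by (intro tendsto_diff) auto
  then have "(\<lambda>k. LINT \<tau>:{0..l}|lborel. Fk k (?c \<tau>) \<bullet> e) \<longlonglongrightarrow> flim (?c l) - flim x"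
    using ftc by simp
  then have "flim (?c l) - flim x = (LINT \<tau>:{0..l}|lborel. Df (?c \<tau>) \<bullet> e)"
    using lim1 LIMSEQ_unique by blast
  then show "set_integrable lborel {0..l} (\<lambda>\<tau>. Df (?c \<tau>) \<bullet> e) \<and>
     flim (?c l) - flim x = (LINT \<tau>:{0..l}|lborel. Df (?c \<tau>) \<bullet> e)" using intD by blast
qed

end

lemma flim_pae: "pae p B (\<lambda>\<gamma> l. ugc flim (\<lambda>x. ennreal (norm (Df x))) \<gamma> l \<and> line_ftc flim Df \<gamma> l)"
proof -
  have "pae p B (\<lambda>\<gamma> l. cint (\<lambda>x. SUP j. ennreal (2^j) * r j x) \<gamma> 0 l < \<infinity> \<and> cint (\<lambda>x. ennreal (norm (Df x))) \<gamma> 0 l < \<infinity>)"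
    by (intro pae_conj p0 pae_finite Lpb_r Lp_Lpb LpD)
  then show ?thesis
  proof (rule pae_mono)
    fix \<gamma> l assume \<gamma>: "curve_in \<gamma> l B" and
      fin: "cint (\<lambda>x. SUP j. ennreal (2^j) * r j x) \<gamma> 0 l < \<infinity> \<and> cint (\<lambda>x. ennreal (norm (Df x))) \<gamma> 0 l < \<infinity>"
    then obtain C where C: "cint (\<lambda>x. SUP j. ennreal (2^j) * r j x) \<gamma> 0 l = ennreal C" "0 \<le> C"
      by (cases "cint (\<lambda>x. SUP j. ennreal (2^j) * r j x) \<gamma> 0 l") auto
    show "ugc flim (\<lambda>x. ennreal (norm (Df x))) \<gamma> l \<and> line_ftc flim Df \<gamma> l"
      using flim_ugc[OF \<gamma> _ C(2)] flim_line[OF \<gamma> _ C(2)] C(1) fin by simp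
  qed
qed

text \<open>The modulus of 2^k (\<open>fk (Suc k)\<close> - \<open>fk k\<close>) is admissible for
  the level set, and the factor 2^(kp) in its energy is absorbed by \<open>small_cap\<close>.
  Capacity refers to upper gradients in the whole space, hence the condition on B.\<close>

lemma Cp_level:
  assumes "B = UNIV"
  shows "Cp p {x. 1 / 2^k < \<bar>fk (Suc k) x - fk k x\<bar>} \<le> ennreal (2 powr p * 4 * (1/2)^k)"
proof -
  let ?u = "\<lambda>x. fk (Suc k) x - fk k x"
  let ?U = "\<lambda>x. Fk (Suc k) x - Fk k x"
  have cu: "c1grad UNIV (\<lambda>x. 2^k * ?u x) (\<lambda>x. (2^k) *\<^sub>R ?U x)"
    using c1grad_cmult[OF c1grad_diff[OF c1 c1]] assms by simp
  have small: "small_cap p (Suc k) \<le> small_cap p k"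
  proof -
    have "2 powr (- real (Suc k) * p) \<le> 2 powr (- real k * p)" using p0 by (intro powr_mono) (auto simp: algebra_simps)
    then show ?thesis unfolding small_cap_def by (intro mult_mono) auto
  qed
  have pd: "pint p (\<lambda>x. v (Suc k) x - v k x) \<le> ennreal (2 powr p * 2 * small_cap p k)"
    if m: "\<And>j. v j \<in> borel_measurable borel" "w \<in> borel_measurable borel" and cl: "\<And>j. pint p (\<lambda>x. v j x - w x) \<le> ennreal (small_cap p j)"
    for v :: "nat \<Rightarrow> 'a \<Rightarrow> 'c::euclidean_space" and w
  proof -
    have "pint p (\<lambda>x. v (Suc k) x - v k x) = pint p (\<lambda>x. (v (Suc k) x - w x) + (w x - v k x))" by simp
    also have "\<dots> \<le> ennreal (2 powr p) * (pint p (\<lambda>x. v (Suc k) x - w x) + pint p (\<lambda>x. w x - v k x))"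
      using m p0 by (intro pint_add_le) auto
    also have "\<dots> \<le> ennreal (2 powr p) * (ennreal (small_cap p k) + ennreal (small_cap p k))"
      using cl[of "Suc k"] cl[of k] small ennreal_leI[OF small] unfolding pint_diff_commute[of p w]
      by (intro mult_left_mono add_mono) (auto intro: order_trans)
    also have "\<dots> = ennreal (2 powr p * 2 * small_cap p k)"
      using small_cap_pos[of p k] by (simp add: ennreal_mult[symmetric] ennreal_plus[symmetric] del: ennreal_plus)
    finally show ?thesis .
  qed
  have sc: "(2^k) powr p * small_cap p k = (1/2)^k"
    by (simp add: small_cap_def powr_realpow[symmetric] powr_powr powr_add[symmetric] mult.assoc[symmetric])
  have "Cp p {x. 1 / 2^k < \<bar>?u x\<bar>} \<le> (\<integral>\<^sup>+ x. eabs_pow (ereal \<bar>2^k * ?u x\<bar>) p \<partial>lborel) + (\<integral>\<^sup>+ x. epow (ennreal (norm ((2^k) *\<^sub>R ?U x))) p \<partial>lborel)"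
  proof (rule Cp_le)
    have "(\<lambda>x. \<bar>2^k * ?u x\<bar>) \<in> borel_measurable borel" by measurable
    then show "(\<lambda>x. ereal \<bar>2^k * ?u x\<bar>) \<in> borel_measurable lebesgue" by (intro borel_measurable_ereal measurable_completion) simp
    show "1 \<le> ereal \<bar>2^k * ?u x\<bar>" if "x \<in> {x. 1 / 2^k < \<bar>?u x\<bar>}" for x
    proof -
      have "\<bar>2^k * ?u x\<bar> = 2^k * \<bar>?u x\<bar>" by (simp only: abs_mult) simp
      moreover have "2^k * (1 / 2^k) < 2^k * \<bar>?u x\<bar>" using that by (intro mult_strict_left_mono) auto
      ultimately show ?thesis by (simp add: one_ereal_def)
    qed
    show "upper_gradient UNIV (\<lambda>x. ereal \<bar>2^k * ?u x\<bar>) (\<lambda>x. ennreal (norm ((2^k) *\<^sub>R ?U x)))"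
      unfolding upper_gradient_def
    proof (intro conjI allI impI)
      show "(\<lambda>x. ennreal (norm ((2^k) *\<^sub>R ?U x))) \<in> borel_measurable borel" by measurable
      fix \<gamma> l assume c: "curve_in \<gamma> l (UNIV :: 'a set)"
      then have "0 < l" using arc_curve_pos by (auto simp: curve_in_def)
      then have "ennreal \<bar>2^k * ?u (\<gamma> 0) - 2^k * ?u (\<gamma> l)\<bar> \<le> cint (\<lambda>x. ennreal (norm ((2^k) *\<^sub>R ?U x))) \<gamma> 0 l"
        using c1grad_ugc[OF cu open_UNIV c] by (intro ugcD) auto
      moreover have "ennreal \<bar>\<bar>2^k * ?u (\<gamma> 0)\<bar> - \<bar>2^k * ?u (\<gamma> l)\<bar>\<bar> \<le> ennreal \<bar>2^k * ?u (\<gamma> 0) - 2^k * ?u (\<gamma> l)\<bar>"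
        by (intro ennreal_leI abs_triangle_ineq3)
      ultimately show "ediff (ereal \<bar>2^k * ?u (\<gamma> 0)\<bar>) (ereal \<bar>2^k * ?u (\<gamma> l)\<bar>) \<le> line_int (\<lambda>x. ennreal (norm ((2^k) *\<^sub>R ?U x))) \<gamma> l"
        unfolding line_int_cint ediff_real by (rule order_trans[rotated])
    qed
  qed
  also have "(\<integral>\<^sup>+ x. eabs_pow (ereal \<bar>2^k * ?u x\<bar>) p \<partial>lborel) = ennreal ((2^k) powr p) * pint p ?u"
    unfolding pint_def by (subst nn_integral_cmult[symmetric]) (auto simp: eabs_pow_def abs_mult powr_mult ennreal_mult)
  also have "(\<integral>\<^sup>+ x. epow (ennreal (norm ((2^k) *\<^sub>R ?U x))) p \<partial>lborel) = ennreal ((2^k) powr p) * pint p ?U"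
  proof -
    have "epow (ennreal (norm ((2^k) *\<^sub>R ?U x))) p = ennreal ((2^k) powr p) * ennreal (norm (?U x) powr p)" for x
      by (simp only: epow_ennreal norm_ge_zero norm_scaleR) (simp add: powr_mult ennreal_mult[symmetric])
    then show ?thesis unfolding pint_def by (subst nn_integral_cmult[symmetric]) auto
  qed
  also have "ennreal ((2^k) powr p) * pint p ?u + ennreal ((2^k) powr p) * pint p ?U
     \<le> ennreal ((2^k) powr p) * ennreal (2 powr p * 2 * small_cap p k) + ennreal ((2^k) powr p) * ennreal (2 powr p * 2 * small_cap p k)"
    using pd[of fk f] pd[of Fk Df] close_f close_F by (intro add_mono mult_left_mono) auto
  also have "\<dots> = ennreal (2 powr p * 4 * ((2^k) powr p * small_cap p k))"
    using small_cap_pos[of p k] by (simp add: ennreal_mult[symmetric] ennreal_plus[symmetric] mult_ac del: ennreal_plus)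
  finally show ?thesis unfolding sc .
qed

text \<open>Off the union of the open level sets with index at least m, successive differences are
  at most 2^-k, so the continuous functions \<open>fk k\<close> converge uniformly there.\<close>

lemma flim_quasicontinuous:
  assumes "B = UNIV" "0 < e"
  obtains A where "open A" "Cp p A < ennreal e" "continuous_on (- A) flim"
proof -
  let ?L = "\<lambda>k. {x. 1 / 2^k < \<bar>fk (Suc k) x - fk k x\<bar>}"
  have oL: "open (?L k)" for k
    using cont by (intro open_Collect_less continuous_intros)
  \<comment> \<open>Twice the constant of \<open>Cp_level\<close>, to obtain the strict inequality
    that \<open>Cp_Union_le\<close> asks for.\<close>
  define K where "K = 2 powr p * 8"
  have K: "0 < K" by (simp add: K_def)
  have "(\<lambda>m. 2 * K * (1/2)^m) \<longlonglongrightarrow> 0" by real_asymp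
  then have "\<forall>\<^sub>F m in sequentially. 2 * K * (1/2)^m < e" using assms(2) by (intro order_tendstoD) auto
  then obtain m where m: "2 * K * (1/2)^m < e" by (auto simp: eventually_sequentially)
  define A where "A = (\<Union>i. ?L (i + m))"
  have "Cp p A \<le> (\<Sum>i. ennreal (K * (1/2)^(i + m)))"
    unfolding A_def
  proof (rule Cp_Union_le[OF p0])
    fix i
    have "2 powr p * 4 * (1/2)^(i+m) < K * (1/2)^(i+m)" by (simp add: K_def)
    then show "Cp p (?L (i + m)) < ennreal (K * (1/2)^(i + m))"
      using Cp_level[OF assms(1), of "i + m"] K by (intro le_less_trans[OF _ ennreal_lessI]) auto
  qed
  also have "\<dots> = ennreal (\<Sum>i. (K * (1/2)^m) * (1/2)^i)"
  proof -
    have e: "(\<lambda>i. K * (1/2)^(i + m)) = (\<lambda>i. (K * (1/2)^m) * (1/2)^i)" by (simp add: power_add fun_eq_iff)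
    have "summable (\<lambda>i. K * (1/2)^(i + m))" unfolding e by (intro summable_mult summable_geometric) simp
    then have "(\<Sum>i. ennreal (K * (1/2)^(i + m))) = ennreal (\<Sum>i. K * (1/2)^(i + m))" using K by (intro suminf_ennreal2) auto
    then show ?thesis unfolding e .
  qed
  also have "(\<Sum>i. (K * (1/2)^m) * (1/2)^i) = 2 * K * (1/2)^m"
    by (subst suminf_mult) (auto simp: suminf_geometric summable_geometric)
  also have "ennreal (2 * K * (1/2)^m) < ennreal e" using m K by (intro ennreal_lessI) (auto intro: less_trans[OF _ m])
  finally have "Cp p A < ennreal e" .
  moreover have "open A" unfolding A_def using oL by auto
  moreover have "continuous_on (- A) flim"
  proof (rule uniform_limit_theorem)
    show "\<forall>\<^sub>F n in sequentially. continuous_on (- A) (fk n)"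
      using cont continuous_on_subset by (intro always_eventually) blast
    have step: "\<bar>fk (Suc k) x - fk k x\<bar> \<le> 1 / 2^k" if "x \<in> - A" "k \<ge> m" for x k
    proof -
      have "x \<notin> ?L ((k - m) + m)" using that(1) unfolding A_def by blast
      then show ?thesis using that(2) by auto
    qed
    \<comment> \<open>The right side is the exact sum of 1/2^i over k \<le> i < k + j, which is what
      makes the induction close.\<close>
    have tail: "\<bar>fk (k + j) x - fk k x\<bar> \<le> 2 / 2^k - 2 / 2^(k+j)" if "x \<in> - A" "k \<ge> m" for x k j
    proof (induction j)
      case (Suc j)
      have "\<bar>fk (Suc (k + j)) x - fk (k + j) x\<bar> \<le> 1 / 2^(k+j)" using that by (intro step) auto
      moreover have "2 / 2 ^ (k + Suc j) = (1 / 2 ^ (k + j) :: real)" by simp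
      moreover have "2 / 2 ^ (k + j) = 2 * (1 / 2 ^ (k + j) :: real)" by simp
      ultimately show ?case using Suc unfolding add_Suc_right by linarith
    qed simp
    have uc: "uniformly_convergent_on (- A) fk"
    proof (rule Cauchy_uniformly_convergent, rule uniformly_Cauchy_onI')
      fix e :: real assume "0 < e"
      have "(\<lambda>k. 2 / 2^k :: real) \<longlonglongrightarrow> 0" by real_asymp
      then have "\<forall>\<^sub>F k in sequentially. 2 / 2^k < e" using \<open>0 < e\<close> by (intro order_tendstoD) auto
      then obtain N where N: "\<And>k. k \<ge> N \<Longrightarrow> 2 / 2^k < e" by (auto simp: eventually_sequentially)
      show "\<exists>M. \<forall>x\<in>- A. \<forall>k\<ge>M. \<forall>n>k. dist (fk k x) (fk n x) < e"
      proof (intro exI[of _ "max m N"] ballI allI impI)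
        fix x k n assume a: "x \<in> - A" "max m N \<le> k" "k < n"
        have n: "k + (n - k) = n" using a by simp
        have "\<bar>fk (k + (n - k)) x - fk k x\<bar> \<le> 2 / 2^k - 2 / 2^(k+(n-k))" using a by (intro tail) auto
        then have "\<bar>fk n x - fk k x\<bar> \<le> 2 / 2^k - 2 / 2^n" unfolding n .
        moreover have "0 < (2 / 2^n :: real)" by simp
        moreover have "2 / 2^k < e" using N[of k] a by simp
        ultimately have "\<bar>fk n x - fk k x\<bar> < e" by linarith
        then show "dist (fk k x) (fk n x) < e" by (simp add: dist_real_def abs_minus_commute)
      qed
    qed
    then show "uniform_limit (- A) fk flim sequentially"
      unfolding uniformly_convergent_uniform_limit_iff flim_def .
  qed simp
  ultimately show ?thesis using that by blast
qed

end

lemma fast_seq_exists: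
  fixes f :: "'a::euclidean_space \<Rightarrow> real"
  assumes "1 \<le> p" "Lp p f" "Lp p Df" "weak_grad G f Df" "0 < \<delta>" "\<And>x. x \<in> B \<Longrightarrow> cball x \<delta> \<subseteq> G" "open B"
  obtains fk Fk where "fast_seq p B f Df fk Fk"
proof -
  have "\<exists>r. 0 < r \<and> r \<le> \<delta> \<and> pint p (\<lambda>x. moll r f x - f x) \<le> ennreal (small_cap p k)
     \<and> pint p (\<lambda>x. moll r Df x - Df x) \<le> ennreal (small_cap p k)" for k
  proof -
    obtain d1 where d1: "0 < d1" "\<forall>\<nu>. prob_space \<nu> \<and> sets \<nu> = sets borel \<and> (AE y in \<nu>. norm y \<le> d1) \<longrightarrow>
       pint p (\<lambda>x. (\<integral>y. f (x + y) \<partial>\<nu>) - f x) \<le> ennreal (small_cap p k)"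
      using conv_close[OF assms(1,2) small_cap_pos[of p k]] by blast
    obtain d2 where d2: "0 < d2" "\<forall>\<nu>. prob_space \<nu> \<and> sets \<nu> = sets borel \<and> (AE y in \<nu>. norm y \<le> d2) \<longrightarrow>
       pint p (\<lambda>x. (\<integral>y. Df (x + y) \<partial>\<nu>) - Df x) \<le> ennreal (small_cap p k)"
      using conv_close[OF assms(1,3) small_cap_pos[of p k]] by blast
    define r where "r = min \<delta> (min d1 d2)"
    have r: "0 < r" "r \<le> \<delta>" "r \<le> d1" "r \<le> d2" using assms(5) d1 d2 by (auto simp: r_def)
    have "AE y in mollm r. norm y \<le> d1" "AE y in mollm r. norm y \<le> d2"
      using AE_mollm[OF r(1)] r by (auto elim!: eventually_mono)
    then show ?thesis using d1(2) d2(2) prob_space_mollm[OF r(1)] sets_mollm r unfolding moll_def by blast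
  qed
  then obtain r where r: "\<And>k. 0 < r k" "\<And>k. r k \<le> \<delta>" "\<And>k. pint p (\<lambda>x. moll (r k) f x - f x) \<le> ennreal (small_cap p k)"
    "\<And>k. pint p (\<lambda>x. moll (r k) Df x - Df x) \<le> ennreal (small_cap p k)" by metis
  have "cball x (r k) \<subseteq> G" if "x \<in> B" for x k
    using assms(6)[OF that] r(2)[of k] by force
  then have c1: "c1grad B (moll (r k) f) (moll (r k) Df)" for k by (intro moll_c1grad[OF assms(1-4) r(1)]) auto
  have "fast_seq p B f Df (\<lambda>k. moll (r k) f) (\<lambda>k. moll (r k) Df)"
    by (unfold_locales; (rule c1 moll_continuous[OF assms(1,2) r(1)] r(3,4) assms))
  then show ?thesis by (rule that)
qed

section \<open>Restriction to lines\<close>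

lemma continuous_AE_zero:
  fixes u :: "real \<Rightarrow> real"
  assumes "continuous_on {0..l} u" "AE t in lborel. t \<in> {0..l} \<longrightarrow> u t = 0" "0 < l" "t \<in> {0..l}"
  shows "u t = 0"
proof (rule ccontr)
  assume nz: "u t \<noteq> 0"
  then obtain d where d: "0 < d" "\<And>s. s \<in> {0..l} \<Longrightarrow> dist s t < d \<Longrightarrow> dist (u s) (u t) < \<bar>u t\<bar>"
    using assms(1,4) unfolding continuous_on_iff by (metis zero_less_abs_iff)
  define a where "a = max 0 (t - d/2)"
  define b where "b = min l (t + d/2)"
  have ab: "a < b" using assms(3,4) d(1) by (auto simp: a_def b_def min_def max_def)
  have "u s \<noteq> 0" if "s \<in> {a..b}" for s
  proof -
    have "s \<in> {0..l}" "dist s t < d" using that d(1) by (auto simp: a_def b_def dist_real_def)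
    then show ?thesis using d(2)[of s] by (auto simp: dist_real_def)
  qed
  moreover have "{a..b} \<subseteq> {0..l}" using assms(4) by (auto simp: a_def b_def)
  ultimately have "AE s in lborel. s \<notin> {a..b}" using assms(2) by (auto elim!: eventually_mono)
  then have "emeasure lborel {a..b} = 0"
    by (subst (asm) AE_iff_measurable[of "{a..b}"]) auto
  then show False using ab by simp
qed

text \<open>Along almost every curve both compositions are continuous and agree at almost every
  parameter, hence at every parameter.\<close>

lemma pae_eq:
  assumes "0 < p" "Lpb p g1" "Lpb p g2" "pae p S (ugc F1 g1)" "pae p S (ugc F2 g2)"
    "AE x in lborel. x \<in> S \<longrightarrow> F1 x = F2 x"
  shows "pae p S (\<lambda>\<gamma> l. \<forall>t\<in>{0..l}. F1 (\<gamma> t) = F2 (\<gamma> t))"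
proof -
  have "pae p S (\<lambda>\<gamma> l. (ugc F1 g1 \<gamma> l \<and> ugc F2 g2 \<gamma> l) \<and> (cint g1 \<gamma> 0 l < \<infinity> \<and> cint g2 \<gamma> 0 l < \<infinity>) \<and>
    (AE t in lborel. t \<in> {0..l} \<longrightarrow> (\<gamma> t \<in> S \<longrightarrow> F1 (\<gamma> t) = F2 (\<gamma> t))))"
    by (intro pae_conj pae_finite pae_AE assms)
  then show ?thesis
  proof (rule pae_mono)
    fix \<gamma> l
    assume c: "curve_in \<gamma> l S" and *: "(ugc F1 g1 \<gamma> l \<and> ugc F2 g2 \<gamma> l) \<and> (cint g1 \<gamma> 0 l < \<infinity> \<and> cint g2 \<gamma> 0 l < \<infinity>) \<and>
      (AE t in lborel. t \<in> {0..l} \<longrightarrow> (\<gamma> t \<in> S \<longrightarrow> F1 (\<gamma> t) = F2 (\<gamma> t)))"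
    have ac: "arc_curve \<gamma> l" using c by (simp add: curve_in_def)
    have "continuous_on {0..l} (\<lambda>t. F1 (\<gamma> t))" "continuous_on {0..l} (\<lambda>t. F2 (\<gamma> t))"
      using * ugc_continuous[OF ac Lpb_measurable[OF assms(2)]] ugc_continuous[OF ac Lpb_measurable[OF assms(3)]] by blast+
    then have "continuous_on {0..l} (\<lambda>t. F1 (\<gamma> t) - F2 (\<gamma> t))" by (rule continuous_on_diff)
    moreover have "AE t in lborel. t \<in> {0..l} \<longrightarrow> F1 (\<gamma> t) - F2 (\<gamma> t) = 0"
      using * c by (auto simp: curve_in_def image_subset_iff elim!: eventually_mono)
    ultimately have "F1 (\<gamma> t) - F2 (\<gamma> t) = 0" if "t \<in> {0..l}" for t
      using continuous_AE_zero arc_curve_pos[OF ac] that by blast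
    then show "\<forall>t\<in>{0..l}. F1 (\<gamma> t) = F2 (\<gamma> t)" by simp
  qed
qed

text \<open>Fubini over the starting points: by translation invariance every parameter contributes
  the same p-integral, so the total over unit segments is finite.\<close>

lemma AE_line_finite:
  fixes e :: "'a::euclidean_space"
  assumes "1 \<le> p" "Lpb p \<rho>"
  shows "AE x in lborel. cint \<rho> (\<lambda>t. x + t *\<^sub>R e) 0 1 < \<infinity>"
proof -
  have [measurable]: "\<rho> \<in> borel_measurable borel" using assms(2) by (simp add: Lpb_def)
  have "(\<integral>\<^sup>+x. \<integral>\<^sup>+t. epow (\<rho> (x + t *\<^sub>R e)) p * indicator {0..1} t \<partial>lborel \<partial>lborel)
     = (\<integral>\<^sup>+t. \<integral>\<^sup>+x. epow (\<rho> (x + t *\<^sub>R e)) p * indicator {0..1} t \<partial>lborel \<partial>lborel)"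
    by (rule lborel_pair.Fubini') measurable
  also have "\<dots> = (\<integral>\<^sup>+t. (\<integral>\<^sup>+x. epow (\<rho> x) p \<partial>lborel) * indicator {0..1} (t::real) \<partial>lborel)"
  proof (intro nn_integral_cong)
    fix t :: real
    have "(\<integral>\<^sup>+x. epow (\<rho> (x + t *\<^sub>R e)) p * indicator {0..1} t \<partial>lborel) = (\<integral>\<^sup>+x. epow (\<rho> (x + t *\<^sub>R e)) p \<partial>lborel) * indicator {0..1} t"
      by (rule nn_integral_multc) measurable
    also have "(\<integral>\<^sup>+x. epow (\<rho> (x + t *\<^sub>R e)) p \<partial>lborel) = (\<integral>\<^sup>+x. epow (\<rho> x) p \<partial>lborel)"
      by (rule nn_integral_translate) measurable
    finally show "(\<integral>\<^sup>+x. epow (\<rho> (x + t *\<^sub>R e)) p * indicator {0..1} t \<partial>lborel) = (\<integral>\<^sup>+x. epow (\<rho> x) p \<partial>lborel) * indicator {0..1} t" .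
  qed
  also have "\<dots> = (\<integral>\<^sup>+x. epow (\<rho> x) p \<partial>lborel)" by (subst nn_integral_cmult_indicator) auto
  also have "\<dots> < \<infinity>" using assms(2) by (simp add: Lpb_def)
  finally have "AE x in lborel. (\<integral>\<^sup>+t. epow (\<rho> (x + t *\<^sub>R e)) p * indicator {0..1} t \<partial>lborel) \<noteq> \<infinity>"
    by (intro nn_integral_noteq_infinite) auto
  then show ?thesis
  proof eventually_elim
    case (elim x)
    have "cint \<rho> (\<lambda>t. x + t *\<^sub>R e) 0 1 \<le> (\<integral>\<^sup>+t. indicator {0..1} (t::real) + epow (\<rho> (x + t *\<^sub>R e)) p * indicator {0..1} t \<partial>lborel)"
      unfolding cint_def using le_one_plus_epow[OF assms(1)] by (intro nn_integral_mono) (auto simp: indicator_def)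
    also have "\<dots> = 1 + (\<integral>\<^sup>+t. epow (\<rho> (x + t *\<^sub>R e)) p * indicator {0..1} t \<partial>lborel)"
      by (subst nn_integral_add) auto
    also have "\<dots> < \<infinity>" using elim by (simp add: less_top)
    finally show ?case .
  qed
qed

text \<open>Segments of a fixed direction in an exceptional family start in a null set. This is how
  statements on almost every curve become statements at almost every point.\<close>

lemma pae_line:
  assumes "1 \<le> p" "pae p UNIV P" "norm e = 1"
  shows "AE x in lborel. P (\<lambda>t. x + t *\<^sub>R e) 1"
proof -
  obtain \<rho> where \<rho>: "Lpb p \<rho>" "\<And>\<gamma> l. curve_in \<gamma> l UNIV \<Longrightarrow> line_int \<rho> \<gamma> l < \<infinity> \<Longrightarrow> P \<gamma> l"
    using assms(2) by (auto simp: pae_def)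
  have "AE x in lborel. cint \<rho> (\<lambda>t. x + t *\<^sub>R e) 0 1 < \<infinity>" by (rule AE_line_finite[OF assms(1) \<rho>(1)])
  then show ?thesis
  proof eventually_elim
    case (elim x)
    then show ?case using arc_curve_segment[OF assms(3), of 1 x] by (intro \<rho>(2)) (auto simp: curve_in_def line_int_cint)
  qed
qed

section \<open>Averages over short segments\<close>

text \<open>For positive \<delta>, the uniform distribution on the segment from 0 to \<delta> e. It
  presents \<open>lineavg\<close> as an average to which \<open>conv_close\<close> applies.\<close>

definition linem :: "real \<Rightarrow> 'a::euclidean_space \<Rightarrow> 'a measure" where
  "linem \<delta> e = distr (density lborel (\<lambda>s. ennreal (indicator {0..\<delta>} s / \<delta>))) borel (\<lambda>s. s *\<^sub>R e)"

definition lineavg :: "real \<Rightarrow> 'a::euclidean_space \<Rightarrow> ('a \<Rightarrow> real) \<Rightarrow> 'a \<Rightarrow> real" where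
  "lineavg \<delta> e h x = (LINT s:{0..\<delta>}|lborel. h (x + s *\<^sub>R e)) / \<delta>"

lemma linem:
  fixes e :: "'a::euclidean_space"
  assumes "0 < \<delta>" "norm e = 1"
  shows "prob_space (linem \<delta> e)" "sets (linem \<delta> e) = sets borel" "AE y in linem \<delta> e. norm y \<le> \<delta>"
proof -
  let ?D = "density lborel (\<lambda>s. ennreal (indicator {0..\<delta>} s / \<delta>))"
  have "emeasure ?D (space ?D) = (\<integral>\<^sup>+s. ennreal (1 / \<delta>) * indicator {0..\<delta>} s \<partial>lborel)"
    by (subst emeasure_density) (auto intro!: nn_integral_cong simp: indicator_def)
  also have "\<dots> = ennreal (1 / \<delta>) * ennreal \<delta>" using assms(1) by (subst nn_integral_cmult_indicator) auto
  also have "\<dots> = 1" using assms(1) by (simp add: ennreal_mult[symmetric])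
  finally have "prob_space ?D" by (rule prob_spaceI)
  then show "prob_space (linem \<delta> e)" unfolding linem_def by (rule prob_space.prob_space_distr) simp
  show "sets (linem \<delta> e) = sets borel" by (simp add: linem_def)
  have "AE s in ?D. norm (s *\<^sub>R e) \<le> \<delta>"
    using assms by (subst AE_density) (auto intro!: AE_I2 simp: indicator_def split: if_splits)
  then show "AE y in linem \<delta> e. norm y \<le> \<delta>" unfolding linem_def by (subst AE_distr_iff) auto
qed

lemma lineavg_eq:
  assumes "h \<in> borel_measurable borel" "0 < \<delta>"
  shows "lineavg \<delta> e h x = (\<integral>y. h (x + y) \<partial>linem \<delta> e)"
proof -
  note [measurable] = assms(1)
  have "(\<integral>y. h (x + y) \<partial>linem \<delta> e) = (\<integral>s. h (x + s *\<^sub>R e) \<partial>density lborel (\<lambda>s. ennreal (indicator {0..\<delta>} s / \<delta>)))"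
    unfolding linem_def by (subst integral_distr) auto
  also have "\<dots> = (\<integral>s. (indicator {0..\<delta>} s / \<delta>) *\<^sub>R h (x + s *\<^sub>R e) \<partial>lborel)"
    using assms(2) by (subst integral_density) auto
  also have "\<dots> = (\<integral>s. (indicator {0..\<delta>} s *\<^sub>R h (x + s *\<^sub>R e)) / \<delta> \<partial>lborel)" by simp
  also have "\<dots> = lineavg \<delta> e h x"
    unfolding lineavg_def set_lebesgue_integral_def by (rule integral_divide_zero)
  finally show ?thesis by simp
qed

lemma lineavg_measurable:
  assumes "h \<in> borel_measurable borel" "0 < \<delta>" "norm e = 1"
  shows "lineavg \<delta> e h \<in> borel_measurable borel"
  using conv_measurable[OF linem(1,2)[OF assms(2,3)] assms(1)] lineavg_eq[OF assms(1,2), of e] by presburger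

text \<open>A differentiation statement along e: the lengths are chosen so small that the averages
  converge at a rate which yields convergence almost everywhere, and the bound 1/(k+1) sends the
  lengths to 0.\<close>

lemma fast_lineavg:
  fixes h :: "'a::euclidean_space \<Rightarrow> real"
  assumes "1 \<le> p" "Lp p h" "norm e = 1"
  obtains \<delta> where "\<And>k. 0 < \<delta> k" "\<And>k. \<delta> k \<le> 1 / real (Suc k)"
    "\<And>k. pint p (\<lambda>x. lineavg (\<delta> k) e h x - h x) \<le> ennreal (small_cap p k)"
proof -
  have m: "h \<in> borel_measurable borel" using assms by (simp add: Lp_def)
  have "\<exists>\<delta>. 0 < \<delta> \<and> \<delta> \<le> 1 / real (Suc k) \<and> pint p (\<lambda>x. lineavg \<delta> e h x - h x) \<le> ennreal (small_cap p k)" for k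
  proof -
    obtain d where d: "0 < d" "\<forall>\<nu>. prob_space \<nu> \<and> sets \<nu> = sets borel \<and> (AE y in \<nu>. norm y \<le> d) \<longrightarrow>
       pint p (\<lambda>x. (\<integral>y. h (x + y) \<partial>\<nu>) - h x) \<le> ennreal (small_cap p k)"
      using conv_close[OF assms(1,2) small_cap_pos[of p k]] by blast
    define \<delta> where "\<delta> = min d (1 / real (Suc k))"
    have \<delta>: "0 < \<delta>" "\<delta> \<le> 1 / real (Suc k)" "\<delta> \<le> d" using d(1) by (auto simp: \<delta>_def)
    have "AE y in linem \<delta> e. norm y \<le> d"
      using linem(3)[OF \<delta>(1) assms(3)] \<delta>(3) by (auto elim!: eventually_mono)
    then have "pint p (\<lambda>x. (\<integral>y. h (x + y) \<partial>linem \<delta> e) - h x) \<le> ennreal (small_cap p k)"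
      using linem(1,2)[OF \<delta>(1) assms(3)] d(2) by blast
    then show ?thesis using \<delta> lineavg_eq[OF m \<delta>(1), of e] by auto
  qed
  then show ?thesis using that by metis
qed

lemma countable_closure_UNIV:
  obtains D :: "'a::euclidean_space set" where "countable D" "closure D = UNIV"
proof -
  obtain D :: "'a set" where D: "countable D" "\<And>X. open X \<Longrightarrow> X \<noteq> {} \<Longrightarrow> \<exists>d\<in>D. d \<in> X"
    using countable_dense_setE by blast
  have "x \<in> closure D" for x
    unfolding closure_approachable
  proof (intro allI impI)
    fix e :: real assume "0 < e"
    then obtain d where "d \<in> D" "d \<in> ball x e" using D(2)[of "ball x e"] by auto
    then show "\<exists>y\<in>D. dist y x < e" by (auto simp: dist_commute)
  qed
  then show ?thesis using that D(1) by blast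
qed

text \<open>By continuity the inequality extends to z itself, which gives |z|^2 \<le> c |z|. The
  alternative z = 0 covers negative c.\<close>

lemma norm_le_dense:
  fixes z :: "'a::euclidean_space"
  assumes "closure D = UNIV" "\<And>x. x \<in> D \<Longrightarrow> x \<noteq> 0 \<Longrightarrow> z \<bullet> (x /\<^sub>R norm x) \<le> c"
  shows "norm z \<le> c \<or> z = 0"
proof -
  have D: "z \<bullet> x - c * norm x \<le> 0" if "x \<in> D" for x
  proof (cases "x = 0")
    case False
    then show ?thesis using assms(2)[OF that] by (simp add: field_simps)
  qed simp
  have "z \<bullet> z - c * norm z \<le> 0"
  proof (rule continuous_le_on_closure[of D "\<lambda>x. z \<bullet> x - c * norm x"])
    show "continuous_on (closure D) (\<lambda>x. z \<bullet> x - c * norm x)" by (intro continuous_intros)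
  qed (use assms(1) D in auto)
  then have "norm z * norm z \<le> c * norm z" by (simp add: power2_norm_eq_inner[symmetric] power2_eq_square)
  then show ?thesis by (cases "z = 0") auto
qed

lemma Lp_enn2real:
  assumes "0 < p" "Lpb p b" shows "Lp p (\<lambda>x. enn2real (b x))"
proof -
  have [measurable]: "b \<in> borel_measurable borel" using assms(2) by (simp add: Lpb_def)
  have "ennreal (norm (enn2real (b x)) powr p) \<le> epow (b x) p" for x
    by (cases "b x") auto
  then have "pint p (\<lambda>x. enn2real (b x)) \<le> (\<integral>\<^sup>+x. epow (b x) p \<partial>lborel)"
    unfolding pint_def by (intro nn_integral_mono)
  then show ?thesis using assms(2) by (auto simp: Lp_def Lpb_def)
qed

lemma Lpb_AE_enn2real:
  assumes "0 < p" "Lpb p b" shows "AE x in lborel. b x = ennreal (enn2real (b x))"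
  using Lpb_AE_finite[OF assms] by eventually_elim simp

lemma line_LINT_enn2real:
  fixes x e :: "'a::euclidean_space"
  assumes "b \<in> borel_measurable borel" "cint b (\<lambda>t. x + t *\<^sub>R e) 0 \<delta> < \<infinity>"
    "AE t in lborel. t \<in> {0..\<delta>} \<longrightarrow> b (x + t *\<^sub>R e) = ennreal (enn2real (b (x + t *\<^sub>R e)))"
  shows "set_integrable lborel {0..\<delta>} (\<lambda>t. enn2real (b (x + t *\<^sub>R e)))"
    "cint b (\<lambda>t. x + t *\<^sub>R e) 0 \<delta> = ennreal (LINT t:{0..\<delta>}|lborel. enn2real (b (x + t *\<^sub>R e)))"
proof -
  note [measurable] = assms(1)
  let ?u = "\<lambda>t. indicator {0..\<delta>} t *\<^sub>R enn2real (b (x + t *\<^sub>R e))"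
  have eq: "(\<integral>\<^sup>+t. ennreal (?u t) \<partial>lborel) = cint b (\<lambda>t. x + t *\<^sub>R e) 0 \<delta>"
    unfolding cint_def using assms(3)
    by (intro nn_integral_cong_AE, eventually_elim) (auto simp: indicator_def)
  have i: "integrable lborel ?u"
  proof (rule integrableI_nonneg)
    show "AE t in lborel. 0 \<le> ?u t" by (auto simp: indicator_def)
    show "(\<integral>\<^sup>+t. ennreal (?u t) \<partial>lborel) < \<infinity>" using eq assms(2) by simp
  qed measurable
  then show "set_integrable lborel {0..\<delta>} (\<lambda>t. enn2real (b (x + t *\<^sub>R e)))" by (simp add: set_integrable_def)
  show "cint b (\<lambda>t. x + t *\<^sub>R e) 0 \<delta> = ennreal (LINT t:{0..\<delta>}|lborel. enn2real (b (x + t *\<^sub>R e)))"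
    unfolding set_lebesgue_integral_def using nn_integral_eq_integral[OF i] eq by (auto simp: indicator_def)
qed

text \<open>Fix a unit vector e. For almost every x in S, path-openness keeps a short initial
  segment from x in direction e inside S. There the signed identity for DF and the inequality for b
  make the averages of \<open>?b\<close> minus the e-component of DF nonnegative, and along a
  suitable sequence of lengths they tend to the value at x. Directions from a countable dense set
  recover the norm.\<close>

lemma local_grad_bound:
  fixes S :: "'a::euclidean_space set"
  assumes p: "1 \<le> p" and po: "path_open p UNIV S"
    and DF: "Lp p DF" and ftc: "pae p S (line_ftc F DF)" and b: "Lpb p b" and ug: "pae p S (ugc F b)"
  shows "AE x in lborel. x \<in> S \<longrightarrow> ennreal (norm (DF x)) \<le> b x"
proof -
  have p0: "0 < p" using p by simp
  have [measurable]: "b \<in> borel_measurable borel" "DF \<in> borel_measurable borel" using b DF by (auto simp: Lpb_def Lp_def)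
  let ?b = "\<lambda>x. enn2real (b x)"
  have bb: "AE x in lborel. b x = ennreal (?b x)" by (rule Lpb_AE_enn2real[OF p0 b])
  have dir: "AE x in lborel. x \<in> S \<longrightarrow> DF x \<bullet> e \<le> ?b x" if e: "norm e = 1" for e :: 'a
  proof -
    define h where "h = (\<lambda>x. ?b x - DF x \<bullet> e)"
    have "Lp p (\<lambda>x. DF x \<bullet> e)"
    proof (rule Lp_mono[OF _ DF])
      show "AE x in lborel. norm (DF x \<bullet> e) \<le> norm (DF x)"
        using Cauchy_Schwarz_ineq2[of _ e] e by (intro AE_I2) (metis mult.right_neutral real_norm_def)
    qed (use p0 in auto)
    then have h: "Lp p h" unfolding h_def using p0 by (intro Lp_diff Lp_enn2real b) auto
    obtain \<delta> where \<delta>: "\<And>k. 0 < \<delta> k" "\<And>k. \<delta> k \<le> 1 / real (Suc k)"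
      "\<And>k. pint p (\<lambda>x. lineavg (\<delta> k) e h x - h x) \<le> ennreal (small_cap p k)"
      using fast_lineavg[OF p h e] by blast
    have flat_exp: "h \<in> borel_measurable borel" using h by (simp add: Lp_def)
    have lim: "AE x in lborel. (\<lambda>k. lineavg (\<delta> k) e h x) \<longlonglongrightarrow> h x"
      using lineavg_measurable[OF flat_exp \<delta>(1) e] flat_exp \<delta>(3) by (intro fast_AE_tendsto[OF p0])
    have "pae p UNIV (\<lambda>\<gamma> l. openin (top_of_set {0..l}) {t \<in> {0..l}. \<gamma> t \<in> S} \<and>
       ((\<forall>s t. 0 \<le> s \<and> s < t \<and> t \<le> l \<and> \<gamma> ` {s..t} \<subseteq> S \<longrightarrow> line_ftc F DF (subcurve \<gamma> s) (t - s)) \<and>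
        (\<forall>s t. 0 \<le> s \<and> s < t \<and> t \<le> l \<and> \<gamma> ` {s..t} \<subseteq> S \<longrightarrow> ugc F b (subcurve \<gamma> s) (t - s))) \<and>
       cint b \<gamma> 0 l < \<infinity> \<and> (AE t in lborel. t \<in> {0..l} \<longrightarrow> b (\<gamma> t) = ennreal (?b (\<gamma> t))))"
      by (intro pae_conj p0 po pae_subcurves ftc ug pae_finite b pae_AE bb)
    from pae_line[OF p this e] lim show ?thesis
    proof eventually_elim
      case (elim x)
      let ?\<gamma> = "\<lambda>t. x + t *\<^sub>R e"
      note P = elim(1)
      show ?case
      proof
        assume x: "x \<in> S"
        then have "0 \<in> {t \<in> {0..1}. ?\<gamma> t \<in> S}" by simp
        then obtain d where d: "0 < d" "ball 0 d \<inter> {0..1} \<subseteq> {t \<in> {0..1}. ?\<gamma> t \<in> S}"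
          using P unfolding openin_contains_ball by blast
        have pos: "0 \<le> lineavg t e h x" if t: "0 < t" "t < d" "t \<le> 1" for t
        proof -
          have sub: "?\<gamma> ` {0..t} \<subseteq> S"
          proof clarsimp
            fix s assume "0 \<le> s" "s \<le> t"
            then have "s \<in> ball 0 d \<inter> {0..1}" using t by auto
            then show "x + s *\<^sub>R e \<in> S" using d(2) by blast
          qed
          have sc: "subcurve ?\<gamma> 0 = ?\<gamma>" by (simp add: subcurve_def)
          have c: "0 \<le> (0::real) \<and> 0 < t \<and> t \<le> 1 \<and> ?\<gamma> ` {0..t} \<subseteq> S" using sub t by simp
          have "line_ftc F DF (subcurve ?\<gamma> 0) (t - 0)" "ugc F b (subcurve ?\<gamma> 0) (t - 0)"
            using P c by blast+
          then have lf: "line_ftc F DF ?\<gamma> t" and ugt: "ugc F b ?\<gamma> t" unfolding sc by simp_all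
          have I: "set_integrable lborel {0..t} (\<lambda>s. DF (x + s *\<^sub>R e) \<bullet> e)"
            "F (x + t *\<^sub>R e) - F x = (LINT s:{0..t}|lborel. DF (x + s *\<^sub>R e) \<bullet> e)"
            using lf e unfolding line_ftc_def by blast+
          have cb: "cint b ?\<gamma> 0 t < \<infinity>" using P cint_mono_interval[of 0 0 t 1 b ?\<gamma>] t by (auto intro: le_less_trans)
          have "AE s in lborel. s \<in> {0..t} \<longrightarrow> b (?\<gamma> s) = ennreal (?b (?\<gamma> s))"
            using P t by (auto elim!: eventually_mono)
          note B = line_LINT_enn2real[OF _ cb this]
          have "ennreal \<bar>F (?\<gamma> 0) - F (?\<gamma> t)\<bar> \<le> cint b ?\<gamma> 0 t" using t by (intro ugcD[OF ugt]) auto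
          then have "ennreal \<bar>F x - F (x + t *\<^sub>R e)\<bar> \<le> ennreal (LINT s:{0..t}|lborel. ?b (x + s *\<^sub>R e))" using B(2) by simp
          moreover have "0 \<le> (LINT s:{0..t}|lborel. ?b (x + s *\<^sub>R e))"
            unfolding set_lebesgue_integral_def by (intro integral_nonneg_AE) (auto simp: indicator_def)
          ultimately have "\<bar>F x - F (x + t *\<^sub>R e)\<bar> \<le> (LINT s:{0..t}|lborel. ?b (x + s *\<^sub>R e))" by (simp add: ennreal_le_iff)
          then have "(LINT s:{0..t}|lborel. DF (x + s *\<^sub>R e) \<bullet> e) \<le> (LINT s:{0..t}|lborel. ?b (x + s *\<^sub>R e))" using I(2) by linarith
          moreover have "(LINT s:{0..t}|lborel. h (x + s *\<^sub>R e)) = (LINT s:{0..t}|lborel. ?b (x + s *\<^sub>R e)) - (LINT s:{0..t}|lborel. DF (x + s *\<^sub>R e) \<bullet> e)"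
            unfolding h_def using B(1) I(1) by (intro set_integral_diff(2)) auto
          ultimately show ?thesis using t by (simp add: lineavg_def)
        qed
        have "(\<lambda>k. 1 / real (Suc k)) \<longlonglongrightarrow> 0" by real_asymp
        then have "\<forall>\<^sub>F k in sequentially. 1 / real (Suc k) < d" using d(1) by (intro order_tendstoD) auto
        then have "\<forall>\<^sub>F k in sequentially. 0 \<le> lineavg (\<delta> k) e h x"
        proof eventually_elim
          case (elim k)
          have "1 / real (Suc k) \<le> 1" by simp
          then have "\<delta> k < d" "\<delta> k \<le> 1" using elim \<delta>(2)[of k] by linarith+
          then show ?case using \<delta>(1)[of k] by (intro pos)
        qed
        then have "0 \<le> h x" using elim(2) tendsto_lowerbound by force
        then show "DF x \<bullet> e \<le> ?b x" by (simp add: h_def)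
      qed
    qed
  qed
  obtain D :: "'a set" where D: "countable D" "closure D = UNIV" by (rule countable_closure_UNIV)
  have "AE x in lborel. \<forall>y\<in>D. y \<noteq> 0 \<longrightarrow> (x \<in> S \<longrightarrow> DF x \<bullet> (y /\<^sub>R norm y) \<le> ?b x)"
    unfolding AE_ball_countable[OF D(1)]
  proof
    fix y
    show "AE x in lborel. y \<noteq> 0 \<longrightarrow> (x \<in> S \<longrightarrow> DF x \<bullet> (y /\<^sub>R norm y) \<le> ?b x)"
      using dir[of "y /\<^sub>R norm y"] by (cases "y = 0") auto
  qed
  with bb show ?thesis
  proof eventually_elim
    case (elim x)
    show ?case
    proof
      assume "x \<in> S"
      then have "norm (DF x) \<le> ?b x \<or> DF x = 0" using elim(2) by (intro norm_le_dense[OF D(2)]) auto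
      then have "norm (DF x) \<le> ?b x" by auto
      then show "ennreal (norm (DF x)) \<le> b x" using elim(1) ennreal_leI by metis
    qed
  qed
qed

section \<open>Existence of weak gradients\<close>

text \<open>Elements of nearly minimal L^2 energy among the convex combinations of tails form a Cauchy
  sequence by the parallelogram law. This replaces weak compactness in L^p.\<close>

locale unit_seq = finite_measure M for M :: "'a measure" +
  fixes a :: "nat \<Rightarrow> 'a \<Rightarrow> real"
  assumes a_meas [measurable]: "\<And>k. a k \<in> borel_measurable M" and a_bound: "\<And>k x. \<bar>a k x\<bar> \<le> 1"
begin

text \<open>A pair records weights together with a bound N for their support, so that all sums are
  finite. Vanishing below m makes them convex combinations of a tail, which have the same limit
  under every linear functional that converges along the sequence.\<close>

definition weights :: "nat \<Rightarrow> (nat \<times> (nat \<Rightarrow> real)) set" where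
  "weights m = {(N, w). (\<forall>k. 0 \<le> w k) \<and> (\<forall>k. k < m \<or> N < k \<longrightarrow> w k = 0) \<and> (\<Sum>k\<le>N. w k) = 1}"

definition cmb :: "nat \<times> (nat \<Rightarrow> real) \<Rightarrow> 'a \<Rightarrow> real" where
  "cmb c x = (\<Sum>k\<le>fst c. snd c k * a k x)"

definition energy :: "nat \<times> (nat \<Rightarrow> real) \<Rightarrow> real" where
  "energy c = (\<integral>x. (cmb c x)\<^sup>2 \<partial>M)"

lemma cmb_meas [measurable]: "cmb c \<in> borel_measurable M"
  unfolding cmb_def by measurable

lemma cmb_bound:
  assumes "c \<in> weights m" shows "\<bar>cmb c x\<bar> \<le> 1"
proof -
  have "\<bar>cmb c x\<bar> \<le> (\<Sum>k\<le>fst c. \<bar>snd c k * a k x\<bar>)" unfolding cmb_def by (rule sum_abs)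
  also have "\<dots> \<le> (\<Sum>k\<le>fst c. snd c k * 1)"
  proof (rule sum_mono)
    fix k
    have "0 \<le> snd c k" using assms by (auto simp: weights_def)
    then show "\<bar>snd c k * a k x\<bar> \<le> snd c k * 1"
      using a_bound[of k x] by (simp add: abs_mult mult_left_le)
  qed
  also have "\<dots> = 1" using assms by (auto simp: weights_def)
  finally show ?thesis .
qed

lemma integrable_bounded_square:
  assumes [measurable]: "u \<in> borel_measurable M" and "\<And>x. \<bar>u x\<bar> \<le> C" shows "integrable M (\<lambda>x. (u x)\<^sup>2 :: real)"
proof (rule integrable_const_bound[where B="C\<^sup>2"])
  show "AE x in M. norm ((u x)\<^sup>2) \<le> C\<^sup>2"
    using assms(2) by (intro AE_I2) (metis abs_ge_zero norm_power power_mono real_norm_def)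
qed measurable

lemma weights_mono: "m \<le> m' \<Longrightarrow> weights m' \<subseteq> weights m"
  by (auto simp: weights_def)

lemma weights_nonempty: "weights m \<noteq> {}"
proof -
  have "(m, \<lambda>k. if k = m then 1 else 0) \<in> weights m" by (auto simp: weights_def)
  then show ?thesis by blast
qed

definition mid :: "nat \<times> (nat \<Rightarrow> real) \<Rightarrow> nat \<times> (nat \<Rightarrow> real) \<Rightarrow> nat \<times> (nat \<Rightarrow> real)" where
  "mid c d = (max (fst c) (fst d), \<lambda>k. (snd c k + snd d k) / 2)"

lemma sum_extend:
  fixes w :: "nat \<Rightarrow> real"
  assumes "N \<le> N'" "\<And>k. N < k \<Longrightarrow> w k = 0"
  shows "(\<Sum>k\<le>N'. w k * v k) = (\<Sum>k\<le>N. w k * v k)"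
  using assms by (intro sum.mono_neutral_right) auto

lemma mid_weights:
  assumes "c \<in> weights m" "d \<in> weights m"
  shows "mid c d \<in> weights m" "cmb (mid c d) x = (cmb c x + cmb d x) / 2"
proof -
  let ?N = "max (fst c) (fst d)"
  have c: "(\<Sum>k\<le>?N. snd c k * v k) = (\<Sum>k\<le>fst c. snd c k * v k)" for v
    using assms(1) by (intro sum_extend) (auto simp: weights_def)
  have d: "(\<Sum>k\<le>?N. snd d k * v k) = (\<Sum>k\<le>fst d. snd d k * v k)" for v
    using assms(2) by (intro sum_extend) (auto simp: weights_def)
  have cd: "(\<Sum>k\<le>?N. (snd c k + snd d k) / 2 * v k) = ((\<Sum>k\<le>fst c. snd c k * v k) + (\<Sum>k\<le>fst d. snd d k * v k)) / 2" for v
    unfolding c[symmetric] d[symmetric] by (simp add: sum.distrib[symmetric] sum_divide_distrib field_simps)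
  show "cmb (mid c d) x = (cmb c x + cmb d x) / 2"
    using cd[of "\<lambda>k. a k x"] by (simp add: cmb_def mid_def)
  have "(\<Sum>k\<le>?N. (snd c k + snd d k) / 2) = 1"
    using cd[of "\<lambda>_. 1"] assms by (auto simp: weights_def)
  then show "mid c d \<in> weights m" using assms by (auto simp: weights_def mid_def)
qed

lemma parallelogram:
  assumes "c \<in> weights m" "d \<in> weights m"
  shows "(\<integral>x. (cmb c x - cmb d x)\<^sup>2 \<partial>M) = 2 * energy c + 2 * energy d - 4 * energy (mid c d)"
proof -
  have ic: "integrable M (\<lambda>x. (cmb c x)\<^sup>2)" "integrable M (\<lambda>x. (cmb d x)\<^sup>2)" "integrable M (\<lambda>x. (cmb (mid c d) x)\<^sup>2)"
    using cmb_bound[OF assms(1)] cmb_bound[OF assms(2)] cmb_bound[OF mid_weights(1)[OF assms]]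
    by (auto intro!: integrable_bounded_square)
  have "(\<integral>x. (cmb c x - cmb d x)\<^sup>2 \<partial>M) = (\<integral>x. 2 * (cmb c x)\<^sup>2 + 2 * (cmb d x)\<^sup>2 - 4 * (cmb (mid c d) x)\<^sup>2 \<partial>M)"
    unfolding mid_weights(2)[OF assms] by (intro Bochner_Integration.integral_cong refl) (simp add: power2_eq_square field_simps)
  also have "\<dots> = 2 * energy c + 2 * energy d - 4 * energy (mid c d)"
    unfolding energy_def using ic by simp
  finally show ?thesis .
qed

text \<open>Infimum of the energy over combinations of the tail starting at m. It increases with m
  and is bounded by the total mass, hence converges.\<close>

definition low :: "nat \<Rightarrow> real" where
  "low m = Inf (energy ` weights m)"

lemma energy_nonneg: "0 \<le> energy c"
  unfolding energy_def by simp

lemma energy_bdd: "bdd_below (energy ` A)"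
  using energy_nonneg by (intro bdd_belowI2)

lemma low_le: "c \<in> weights m \<Longrightarrow> low m \<le> energy c"
  unfolding low_def using energy_bdd by (intro cInf_lower) auto

lemma low_mono: "m \<le> m' \<Longrightarrow> low m \<le> low m'"
  unfolding low_def by (rule cInf_superset_mono[OF _ energy_bdd image_mono[OF weights_mono]]) (use weights_nonempty in auto)

lemma low_bounded: "low m \<le> measure M (space M)"
proof -
  obtain c where c: "c \<in> weights m" using weights_nonempty by blast
  have "energy c \<le> (\<integral>x. 1 \<partial>M)"
    unfolding energy_def
  proof (rule integral_mono)
    show "integrable M (\<lambda>x. (cmb c x)\<^sup>2)" using cmb_bound[OF c] by (auto intro!: integrable_bounded_square)
    show "(cmb c x)\<^sup>2 \<le> 1" for x using cmb_bound[OF c, of x] by (simp add: abs_square_le_1)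
  qed simp
  then show ?thesis using low_le[OF c] by simp
qed

text \<open>Let L be the limit of \<open>low\<close>. Nearly minimal combinations from far tails
  have energy close to L, and so does their midpoint from below, so the parallelogram law makes
  successive choices close in L^2. The rate is fast enough for convergence almost everywhere of the
  whole sequence.\<close>

lemma convex_combinations_converge:
  obtains c where "\<And>j. c j \<in> weights j" "AE x in M. convergent (\<lambda>j. cmb (c j) x)"
proof -
  have "incseq low" using low_mono by (auto simp: incseq_def)
  then obtain L where L: "low \<longlonglongrightarrow> L" "\<And>m. low m \<le> L"
    using incseq_convergent low_bounded by metis
  \<comment> \<open>The factor 1/8 cancels the total error coefficient 2 + 2 + 4 in the
    parallelogram law. The rate 16^-j stays summable after weighting by 4^j, and the weights 4^j
    give the pointwise rate 2^-j.\<close>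
  define \<epsilon> where "\<epsilon> = (\<lambda>j::nat. (1/16)^j / 8 :: real)"
  have \<epsilon>: "0 < \<epsilon> j" for j by (simp add: \<epsilon>_def)
  have \<epsilon>m: "\<epsilon> (Suc j) \<le> \<epsilon> j" for j by (simp add: \<epsilon>_def)
  have "\<exists>m c. m \<ge> j \<and> L - \<epsilon> j < low m \<and> c \<in> weights m \<and> energy c < low m + \<epsilon> j" for j
  proof -
    have "\<forall>\<^sub>F m in sequentially. L - \<epsilon> j < low m" using L(1) \<epsilon>[of j] by (intro order_tendstoD) auto
    then obtain m0 where m0: "\<And>m. m \<ge> m0 \<Longrightarrow> L - \<epsilon> j < low m" by (auto simp: eventually_sequentially)
    define m where "m = max m0 j"
    have "Inf (energy ` weights m) < low m + \<epsilon> j" using \<epsilon>[of j] by (simp add: low_def)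
    then obtain c where "c \<in> weights m" "energy c < low m + \<epsilon> j"
      using cInf_lessD[of "energy ` weights m"] weights_nonempty by blast
    then show ?thesis using m0[of m] by (intro exI[of _ m] exI[of _ c]) (auto simp: m_def)
  qed
  then obtain m c where mc: "\<And>j. m j \<ge> j" "\<And>j. L - \<epsilon> j < low (m j)" "\<And>j. c j \<in> weights (m j)" "\<And>j. energy (c j) < low (m j) + \<epsilon> j"
    by metis
  have cj: "c j \<in> weights j" for j using mc(1,3) weights_mono by blast
  have diff: "(\<integral>x. (cmb (c j) x - cmb (c (Suc j)) x)\<^sup>2 \<partial>M) \<le> (1/16)^j" for j
  proof -
    \<comment> \<open>The smaller index gives a tail to which both combinations belong, as the
      midpoint requires.\<close>
    define k where "k = min (m j) (m (Suc j))"
    have k: "c j \<in> weights k" "c (Suc j) \<in> weights k"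
      using mc(3) weights_mono[of k "m j"] weights_mono[of k "m (Suc j)"] by (auto simp: k_def)
    have "L - \<epsilon> j < low k" using mc(2)[of j] mc(2)[of "Suc j"] \<epsilon>m[of j] by (auto simp: k_def min_def)
    also have "low k \<le> energy (mid (c j) (c (Suc j)))" by (rule low_le[OF mid_weights(1)[OF k]])
    finally have "L - \<epsilon> j < energy (mid (c j) (c (Suc j)))" .
    moreover have "energy (c j) < L + \<epsilon> j" "energy (c (Suc j)) < L + \<epsilon> j"
      using mc(4)[of j] mc(4)[of "Suc j"] L(2)[of "m j"] L(2)[of "m (Suc j)"] \<epsilon>m[of j] by linarith+
    ultimately have "(\<integral>x. (cmb (c j) x - cmb (c (Suc j)) x)\<^sup>2 \<partial>M) \<le> 8 * \<epsilon> j"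
      unfolding parallelogram[OF k] by linarith
    then show ?thesis by (simp add: \<epsilon>_def)
  qed
  let ?\<Delta> = "\<lambda>j x. cmb (c (Suc j)) x - cmb (c j) x"
  have "(\<integral>\<^sup>+x. (\<Sum>j. ennreal (4^j * (?\<Delta> j x)\<^sup>2)) \<partial>M) = (\<Sum>j. \<integral>\<^sup>+x. ennreal (4^j * (?\<Delta> j x)\<^sup>2) \<partial>M)"
    by (rule nn_integral_suminf) measurable
  also have "\<dots> \<le> (\<Sum>j. ennreal ((1/4)^j))"
  proof (intro suminf_le)
    fix j
    have b: "\<bar>?\<Delta> j x\<bar> \<le> 2" for x using cmb_bound[OF cj, of j x] cmb_bound[OF cj, of "Suc j" x] by linarith
    have i: "integrable M (\<lambda>x. (?\<Delta> j x)\<^sup>2)" by (rule integrable_bounded_square[OF _ b]) measurable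
    have "(\<integral>\<^sup>+x. ennreal (4^j * (?\<Delta> j x)\<^sup>2) \<partial>M) = ennreal (\<integral>x. 4^j * (?\<Delta> j x)\<^sup>2 \<partial>M)"
      using i by (intro nn_integral_eq_integral) auto
    also have "\<dots> \<le> ennreal (4^j * (1/16)^j)"
      using diff[of j] by (intro ennreal_leI) (simp add: power2_commute[of "cmb (c (Suc j)) _"])
    also have "4^j * (1/16)^j = (1/4 :: real)^j" by (simp add: power_mult_distrib[symmetric])
    finally show "(\<integral>\<^sup>+x. ennreal (4^j * (?\<Delta> j x)\<^sup>2) \<partial>M) \<le> ennreal ((1/4)^j)" .
  qed auto
  also have "\<dots> = ennreal (\<Sum>j. (1/4)^j)" by (intro suminf_ennreal2) (auto simp: summable_geometric)
  finally have fin: "(\<integral>\<^sup>+x. (\<Sum>j. ennreal (4^j * (?\<Delta> j x)\<^sup>2)) \<partial>M) < \<infinity>" by (auto intro: le_less_trans)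
  have "AE x in M. (\<Sum>j. ennreal (4^j * (?\<Delta> j x)\<^sup>2)) \<noteq> \<infinity>"
    using fin by (intro nn_integral_noteq_infinite) auto
  then have "AE x in M. convergent (\<lambda>j. cmb (c j) x)"
  proof eventually_elim
    case (elim x)
    define K where "K = enn2real (\<Sum>j. ennreal (4^j * (?\<Delta> j x)\<^sup>2))"
    have K: "(\<Sum>j. ennreal (4^j * (?\<Delta> j x)\<^sup>2)) = ennreal K" "0 \<le> K"
      unfolding K_def using elim by (simp_all only: ennreal_enn2real_if enn2real_nonneg infinity_ennreal_def if_False)
    have b: "\<bar>?\<Delta> j x\<bar> \<le> sqrt K * (1/2)^j" for j
    proof -
      have "ennreal (4^j * (?\<Delta> j x)\<^sup>2) \<le> ennreal K"
        using sum_le_suminf[of "\<lambda>j. ennreal (4^j * (?\<Delta> j x)\<^sup>2)" "{j}"] K by auto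
      then have "4^j * (?\<Delta> j x)\<^sup>2 \<le> K" using K(2) by (simp add: ennreal_le_iff)
      moreover have "(4::real)^j = (2^j)\<^sup>2" by (simp add: power_mult[symmetric] mult.commute[of j] power_mult)
      ultimately have "(2^j * \<bar>?\<Delta> j x\<bar>)\<^sup>2 \<le> K" by (simp add: power_mult_distrib)
      then have "2^j * \<bar>?\<Delta> j x\<bar> \<le> sqrt K" by (rule real_le_rsqrt)
      then show ?thesis by (simp add: field_simps power_divide)
    qed
    have "summable (\<lambda>j. sqrt K * (1/2)^j)" by (intro summable_mult summable_geometric) simp
    then have "summable (\<lambda>j. ?\<Delta> j x)" by (rule summable_comparison_test'[of _ 0]) (use b in auto)
    then have "convergent (\<lambda>n. \<Sum>j<n. ?\<Delta> j x)" by (simp add: summable_iff_convergent)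
    then have "convergent (\<lambda>n. cmb (c n) x - cmb (c 0) x)" by (simp only: sum_lessThan_telescope[of "\<lambda>j. cmb (c j) x"])
    then obtain z where "(\<lambda>n. cmb (c n) x - cmb (c 0) x) \<longlonglongrightarrow> z" by (auto simp: convergent_def)
    then have "(\<lambda>n. (cmb (c n) x - cmb (c 0) x) + cmb (c 0) x) \<longlonglongrightarrow> z + cmb (c 0) x" by (intro tendsto_intros)
    then show ?case by (auto simp: convergent_def)
  qed
  then show ?thesis using that cj by blast
qed

end

section \<open>Difference quotients and weak partial derivatives\<close>

lemma test_fun_facts:
  fixes \<phi> :: "'a::euclidean_space \<Rightarrow> real"
  assumes "test_fun G \<phi>" "i \<in> Basis"
  obtains R L where "0 < R" "0 < L" "\<And>x. R < norm x \<Longrightarrow> \<phi> x = 0" "continuous_on UNIV \<phi>" "\<And>x. \<bar>\<phi> x\<bar> \<le> L"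
    "continuous_on UNIV (\<lambda>x. frechet_derivative \<phi> (at x) i)"
    "\<And>x t. ((\<lambda>t. \<phi> (x + t *\<^sub>R i)) has_real_derivative frechet_derivative \<phi> (at (x + t *\<^sub>R i)) i) (at t)"
    "\<And>x \<delta>. 0 < \<delta> \<Longrightarrow> \<delta> \<le> 1 \<Longrightarrow> \<bar>\<phi> (x - \<delta> *\<^sub>R i) - \<phi> x\<bar> \<le> L * \<delta>"
    "\<And>x \<delta>. 0 < \<delta> \<Longrightarrow> \<delta> \<le> 1 \<Longrightarrow> R + 1 < norm x \<Longrightarrow> \<phi> (x - \<delta> *\<^sub>R i) = 0"
proof -
  let ?d = "\<lambda>x. frechet_derivative \<phi> (at x) i"
  have sm: "smooth_fun \<phi>" and cpt: "compact (closure {x. \<phi> x \<noteq> 0})" using assms(1) by (auto simp: test_fun_def)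
  have ni: "norm i = 1" using assms(2) by simp
  have df: "\<phi> differentiable at x" for x using sm[unfolded smooth_fun_def, rule_format, of "[]"] by simp
  have dd: "?d differentiable at x" for x using sm[unfolded smooth_fun_def, rule_format, of "[i]"] assms(2) by simp
  have c\<phi>: "continuous_on UNIV \<phi>"
    using df by (intro continuous_at_imp_continuous_on ballI differentiable_imp_continuous_within) auto
  have cd: "continuous_on UNIV ?d"
    using dd by (intro continuous_at_imp_continuous_on ballI differentiable_imp_continuous_within) auto
  obtain R where R: "0 < R" "\<And>x. x \<in> closure {x. \<phi> x \<noteq> 0} \<Longrightarrow> norm x \<le> R"
    using compact_imp_bounded[OF cpt] unfolding bounded_pos by blast
  have z: "\<phi> x = 0" if "R < norm x" for x
    using R(2)[of x] that closure_subset[of "{x. \<phi> x \<noteq> 0}"] by fastforce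
  \<comment> \<open>Radius R + 2 leaves room for shifts of length at most 1 from points of the ball
    of radius R + 1.\<close>
  have "compact (?d ` cball 0 (R + 2))" "compact (\<phi> ` cball 0 (R + 2))"
    by (intro compact_continuous_image continuous_on_subset[OF cd] continuous_on_subset[OF c\<phi>] compact_cball subset_UNIV)+
  then have "bounded (?d ` cball 0 (R + 2) \<union> \<phi> ` cball 0 (R + 2))" by (simp add: compact_imp_bounded)
  then obtain L where L: "0 < L" "\<And>y. y \<in> ?d ` cball 0 (R + 2) \<union> \<phi> ` cball 0 (R + 2) \<Longrightarrow> norm y \<le> L"
    unfolding bounded_pos by blast
  have Ld: "\<bar>?d x\<bar> \<le> L" "\<bar>\<phi> x\<bar> \<le> L" if "norm x \<le> R + 2" for x using L(2)[of "?d x"] L(2)[of "\<phi> x"] that by auto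
  have der: "((\<lambda>t. \<phi> (x + t *\<^sub>R i)) has_real_derivative ?d (x + t *\<^sub>R i)) (at t)" for x t
  proof -
    have 1: "((\<lambda>t. x + t *\<^sub>R i) has_derivative (\<lambda>h. h *\<^sub>R i)) (at t)" by (auto intro!: derivative_eq_intros)
    have 2: "(\<phi> has_derivative frechet_derivative \<phi> (at (x + t *\<^sub>R i))) (at (x + t *\<^sub>R i))"
      using df frechet_derivative_works by blast
    have "((\<lambda>t. \<phi> (x + t *\<^sub>R i)) has_derivative (\<lambda>h. frechet_derivative \<phi> (at (x + t *\<^sub>R i)) (h *\<^sub>R i))) (at t)"
      by (rule has_derivative_compose[OF 1 2])
    moreover have "(\<lambda>h. frechet_derivative \<phi> (at (x + t *\<^sub>R i)) (h *\<^sub>R i)) = (*) (?d (x + t *\<^sub>R i))"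
      using linear_frechet_derivative[OF df] by (auto simp: fun_eq_iff linear_cmul)
    ultimately show ?thesis by (simp add: has_field_derivative_def)
  qed
  have zero2: "\<phi> (x - \<delta> *\<^sub>R i) = 0" if "0 < \<delta>" "\<delta> \<le> 1" "R + 1 < norm x" for x \<delta>
  proof (rule z)
    have "norm x \<le> norm (x - \<delta> *\<^sub>R i) + norm (\<delta> *\<^sub>R i)" using norm_triangle_ineq[of "x - \<delta> *\<^sub>R i" "\<delta> *\<^sub>R i"] by simp
    then show "R < norm (x - \<delta> *\<^sub>R i)" using that ni by simp
  qed
  have lip: "\<bar>\<phi> (x - \<delta> *\<^sub>R i) - \<phi> x\<bar> \<le> L * \<delta>" if \<delta>: "0 < \<delta>" "\<delta> \<le> 1" for x \<delta>
  proof (cases "norm x \<le> R + 1")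
    case True
    let ?y = "x - \<delta> *\<^sub>R i"
    have "\<exists>s>0. s < \<delta> \<and> \<phi> (?y + \<delta> *\<^sub>R i) - \<phi> (?y + 0 *\<^sub>R i) = (\<delta> - 0) * ?d (?y + s *\<^sub>R i)"
      using \<delta> by (intro MVT2 der) auto
    then obtain s where s: "0 < s" "s < \<delta>" "\<phi> x - \<phi> ?y = \<delta> * ?d (?y + s *\<^sub>R i)" by auto
    have "?y + s *\<^sub>R i = x - (\<delta> - s) *\<^sub>R i" by (simp add: algebra_simps)
    then have "norm (?y + s *\<^sub>R i) \<le> norm x + norm ((\<delta> - s) *\<^sub>R i)" by (metis norm_triangle_ineq4)
    also have "\<dots> \<le> R + 2" using True ni s \<delta> by simp
    finally have "\<bar>?d (?y + s *\<^sub>R i)\<bar> \<le> L" by (rule Ld)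
    then have "\<delta> * \<bar>?d (?y + s *\<^sub>R i)\<bar> \<le> \<delta> * L" using \<delta> by (intro mult_left_mono) auto
    then have "\<bar>\<phi> x - \<phi> ?y\<bar> \<le> \<delta> * L" using s(3) \<delta> by (simp add: abs_mult)
    then show ?thesis by (simp add: abs_minus_commute mult.commute)
  next
    case False
    then show ?thesis using zero2[OF \<delta>, of x] z[of x] L(1) \<delta> by simp
  qed
  have bd: "\<bar>\<phi> x\<bar> \<le> L" for x using Ld(2)[of x] z[of x] L(1) by (cases "norm x \<le> R + 2") auto
  show ?thesis by (rule that[OF R(1) L(1) z c\<phi> bd cd der lip zero2])
qed

lemma Lp_test_integrable:
  fixes h :: "'a::euclidean_space \<Rightarrow> real"
  assumes "1 \<le> p" "Lp p h" "k \<in> borel_measurable borel" "\<And>z. \<bar>k z\<bar> \<le> C" "\<And>z. R < norm z \<Longrightarrow> k z = 0"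
  shows "integrable lborel (\<lambda>z. h z * k z)"
proof -
  have "integrable lborel (\<lambda>z. k z *\<^sub>R h z)"
    by (rule Lp_integrable_kernel[OF assms(1,2,3,4), of 0 R]) (use assms(5) in auto)
  then show ?thesis by (simp add: mult.commute)
qed

text \<open>Translation invariance moves the difference quotient from f to the test function, where
  it tends to minus the derivative and is bounded by L, with support in one fixed ball.\<close>

lemma diff_quotient_limit:
  fixes f :: "'a::euclidean_space \<Rightarrow> real"
  assumes p: "1 \<le> p" and f: "Lp p f" and i: "i \<in> Basis" and \<phi>: "test_fun G \<phi>"
    and \<delta>: "\<And>k. 0 < \<delta> k" "\<And>k. \<delta> k \<le> 1 / real (Suc k)"
  shows "(\<lambda>k. \<integral>x. (f (x + \<delta> k *\<^sub>R i) - f x) / \<delta> k * \<phi> x \<partial>lborel) \<longlonglongrightarrow> - (\<integral>x. f x * frechet_derivative \<phi> (at x) i \<partial>lborel)"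
proof -
  let ?d = "\<lambda>x. frechet_derivative \<phi> (at x) i"
  obtain R L where T: "0 < R" "0 < L" "\<And>x. R < norm x \<Longrightarrow> \<phi> x = 0" "continuous_on UNIV \<phi>" "\<And>x. \<bar>\<phi> x\<bar> \<le> L"
    "continuous_on UNIV ?d"
    "\<And>x t. ((\<lambda>t. \<phi> (x + t *\<^sub>R i)) has_real_derivative ?d (x + t *\<^sub>R i)) (at t)"
    "\<And>x \<delta>. 0 < \<delta> \<Longrightarrow> \<delta> \<le> 1 \<Longrightarrow> \<bar>\<phi> (x - \<delta> *\<^sub>R i) - \<phi> x\<bar> \<le> L * \<delta>"
    "\<And>x \<delta>. 0 < \<delta> \<Longrightarrow> \<delta> \<le> 1 \<Longrightarrow> R + 1 < norm x \<Longrightarrow> \<phi> (x - \<delta> *\<^sub>R i) = 0"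
    using test_fun_facts[OF \<phi> i] by metis
  have [measurable]: "\<phi> \<in> borel_measurable borel" "?d \<in> borel_measurable borel" "f \<in> borel_measurable borel"
    using T(4,6) f by (auto simp: Lp_def intro: borel_measurable_continuous_onI)
  have \<delta>1: "\<delta> k \<le> 1" for k using \<delta>(2)[of k] by (rule order_trans) simp
  have \<delta>0: "\<delta> \<longlonglongrightarrow> 0"
  proof (rule tendsto_sandwich[of "\<lambda>_. 0" _ _ "\<lambda>k. 1 / real (Suc k)"])
    show "(\<lambda>k. 1 / real (Suc k)) \<longlonglongrightarrow> 0" by real_asymp
    show "\<forall>\<^sub>F k in sequentially. 0 \<le> \<delta> k" using less_imp_le[OF \<delta>(1)] by (intro always_eventually allI)
    show "\<forall>\<^sub>F k in sequentially. \<delta> k \<le> 1 / real (Suc k)" using \<delta>(2) by (intro always_eventually allI)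
  qed simp
  have i1: "integrable lborel (\<lambda>x. f x * \<phi> x)"
    by (rule Lp_test_integrable[OF p f _ T(5,3)]) measurable
  have i2: "integrable lborel (\<lambda>x. f x * \<phi> (x - \<delta> k *\<^sub>R i))" for k
    by (rule Lp_test_integrable[OF p f _ T(5), of "\<lambda>x. x - \<delta> k *\<^sub>R i" "R + 1"]) (use T(9)[OF \<delta>(1) \<delta>1] in auto)
  have eq: "(\<integral>x. (f (x + \<delta> k *\<^sub>R i) - f x) / \<delta> k * \<phi> x \<partial>lborel) = (\<integral>x. f x * ((\<phi> (x - \<delta> k *\<^sub>R i) - \<phi> x) / \<delta> k) \<partial>lborel)" for k
  proof -
    have i3: "integrable lborel (\<lambda>x. f (x + \<delta> k *\<^sub>R i) * \<phi> x)"
    proof -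
      have "integrable (distr lborel borel ((+) (\<delta> k *\<^sub>R i))) (\<lambda>x. f x * \<phi> (x - \<delta> k *\<^sub>R i))"
        unfolding lborel_distr_plus by (rule i2)
      then have "integrable lborel (\<lambda>x. f (\<delta> k *\<^sub>R i + x) * \<phi> (\<delta> k *\<^sub>R i + x - \<delta> k *\<^sub>R i))"
        by (subst (asm) integrable_distr_eq) auto
      then show ?thesis by (simp add: add.commute)
    qed
    have "(\<integral>x. f (x + \<delta> k *\<^sub>R i) * \<phi> x \<partial>lborel) = (\<integral>x. (\<lambda>x. f x * \<phi> (x - \<delta> k *\<^sub>R i)) (x + \<delta> k *\<^sub>R i) \<partial>lborel)" by simp
    also have "\<dots> = (\<integral>x. f x * \<phi> (x - \<delta> k *\<^sub>R i) \<partial>lborel)" by (rule integral_translate) measurable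
    finally have tr: "(\<integral>x. f (x + \<delta> k *\<^sub>R i) * \<phi> x \<partial>lborel) = (\<integral>x. f x * \<phi> (x - \<delta> k *\<^sub>R i) \<partial>lborel)" .
    have "(\<integral>x. (f (x + \<delta> k *\<^sub>R i) - f x) / \<delta> k * \<phi> x \<partial>lborel) = (\<integral>x. (f (x + \<delta> k *\<^sub>R i) * \<phi> x - f x * \<phi> x) / \<delta> k \<partial>lborel)"
      by (intro Bochner_Integration.integral_cong refl) (simp add: field_simps)
    also have "\<dots> = ((\<integral>x. f (x + \<delta> k *\<^sub>R i) * \<phi> x \<partial>lborel) - (\<integral>x. f x * \<phi> x \<partial>lborel)) / \<delta> k"
      using i1 i3 by simp
    also have "\<dots> = (\<integral>x. (f x * \<phi> (x - \<delta> k *\<^sub>R i) - f x * \<phi> x) / \<delta> k \<partial>lborel)"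
      unfolding tr using i1 i2 by simp
    also have "\<dots> = (\<integral>x. f x * ((\<phi> (x - \<delta> k *\<^sub>R i) - \<phi> x) / \<delta> k) \<partial>lborel)"
      by (intro Bochner_Integration.integral_cong refl) (simp add: field_simps)
    finally show ?thesis .
  qed
  have "(\<lambda>k. \<integral>x. f x * ((\<phi> (x - \<delta> k *\<^sub>R i) - \<phi> x) / \<delta> k) \<partial>lborel) \<longlonglongrightarrow> (\<integral>x. f x * (- ?d x) \<partial>lborel)"
  proof (rule integral_dominated_convergence[where w="\<lambda>x. norm (L *\<^sub>R (indicator (cball 0 (R + 1)) x *\<^sub>R f x))"])
    show "integrable lborel (\<lambda>x. norm (L *\<^sub>R (indicator (cball 0 (R + 1)) x *\<^sub>R f x)))"
      by (intro integrable_norm integrable_scaleR_right Lp_integrable_cball[OF p f])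
    show "AE x in lborel. (\<lambda>k. f x * ((\<phi> (x - \<delta> k *\<^sub>R i) - \<phi> x) / \<delta> k)) \<longlonglongrightarrow> f x * (- ?d x)"
    proof (intro AE_I2 tendsto_mult tendsto_const)
      fix x
      have "((\<lambda>h. (\<phi> (x + (0 + h) *\<^sub>R i) - \<phi> (x + 0 *\<^sub>R i)) / h) \<longlongrightarrow> ?d (x + 0 *\<^sub>R i)) (at 0)"
        using T(7)[of x 0] unfolding DERIV_def .
      then have d0: "((\<lambda>h. (\<phi> (x + h *\<^sub>R i) - \<phi> x) / h) \<longlongrightarrow> ?d x) (at 0)" by simp
      have "filterlim (\<lambda>k. - \<delta> k) (at 0) sequentially"
        unfolding filterlim_at using \<delta>0 tendsto_minus[OF \<delta>0] \<delta>(1) by (auto intro!: always_eventually simp: less_imp_neq[symmetric])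
      from filterlim_compose[OF d0 this]
      have "(\<lambda>k. (\<phi> (x + (- \<delta> k) *\<^sub>R i) - \<phi> x) / (- \<delta> k)) \<longlonglongrightarrow> ?d x" .
      from tendsto_minus[OF this] show "(\<lambda>k. (\<phi> (x - \<delta> k *\<^sub>R i) - \<phi> x) / \<delta> k) \<longlonglongrightarrow> - ?d x" by simp
    qed
    show "AE x in lborel. norm (f x * ((\<phi> (x - \<delta> k *\<^sub>R i) - \<phi> x) / \<delta> k)) \<le> norm (L *\<^sub>R (indicator (cball 0 (R + 1)) x *\<^sub>R f x))" for k
    proof (rule AE_I2)
      fix x
      show "norm (f x * ((\<phi> (x - \<delta> k *\<^sub>R i) - \<phi> x) / \<delta> k)) \<le> norm (L *\<^sub>R (indicator (cball 0 (R + 1)) x *\<^sub>R f x))"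
      proof (cases "norm x \<le> R + 1")
        case True
        have "\<bar>\<phi> (x - \<delta> k *\<^sub>R i) - \<phi> x\<bar> / \<delta> k \<le> L" using T(8)[OF \<delta>(1) \<delta>1, of x k] \<delta>(1)[of k] by (simp add: divide_le_eq)
        then have "\<bar>f x\<bar> * (\<bar>\<phi> (x - \<delta> k *\<^sub>R i) - \<phi> x\<bar> / \<delta> k) \<le> \<bar>f x\<bar> * L" by (intro mult_left_mono) auto
        then show ?thesis using True \<delta>(1)[of k] T(2) by (simp add: abs_mult mult.commute)
      next
        case False
        then show ?thesis using T(9)[OF \<delta>(1) \<delta>1, of x k] T(3)[of x] T(1) by simp
      qed
    qed
  qed measurable
  then show ?thesis unfolding eq by simp
qed

text \<open>The difference quotients are dominated by a single H in L^p along a suitable sequence of steps;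
  after division by H they are bounded, so the L^2 argument applies for every p.\<close>

lemma weak_partial_exists:
  fixes f :: "'a::euclidean_space \<Rightarrow> real"
  assumes p: "1 \<le> p" and f: "Lp p f" and b: "Lpb p b" and i: "i \<in> Basis"
    and ug: "\<And>\<delta>. 0 < \<delta> \<Longrightarrow> \<delta> \<le> 1 \<Longrightarrow> AE x in lborel. ennreal \<bar>f (x + \<delta> *\<^sub>R i) - f x\<bar> \<le> cint b (\<lambda>t. x + t *\<^sub>R i) 0 \<delta>"
  obtains D where "Lp p D"
    "\<And>\<phi>. test_fun UNIV \<phi> \<Longrightarrow> (\<integral>x. f x * frechet_derivative \<phi> (at x) i \<partial>lborel) = - (\<integral>x. D x * \<phi> x \<partial>lborel)"
proof -
  have p0: "0 < p" using p by simp
  have ni: "norm i = 1" using i by simp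
  let ?b = "\<lambda>x. enn2real (b x)"
  have Lb: "Lp p ?b" by (rule Lp_enn2real[OF p0 b])
  have [measurable]: "f \<in> borel_measurable borel" "b \<in> borel_measurable borel" using f b by (auto simp: Lp_def Lpb_def)
  obtain \<delta> where \<delta>: "\<And>k. 0 < \<delta> k" "\<And>k. \<delta> k \<le> 1 / real (Suc k)"
    "\<And>k. pint p (\<lambda>x. lineavg (\<delta> k) i ?b x - ?b x) \<le> ennreal (small_cap p k)"
    using fast_lineavg[OF p Lb ni] by blast
  have \<delta>1: "\<delta> k \<le> 1" for k using \<delta>(2)[of k] by (rule order_trans) simp
  have [measurable]: "lineavg (\<delta> k) i ?b \<in> borel_measurable borel" for k
    by (rule lineavg_measurable[OF _ \<delta>(1) ni]) measurable
  define q where "q = (\<lambda>k x. (f (x + \<delta> k *\<^sub>R i) - f x) / \<delta> k)"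
  have [measurable]: "q k \<in> borel_measurable borel" for k unfolding q_def by measurable
  have qM: "AE x in lborel. \<bar>q k x\<bar> \<le> lineavg (\<delta> k) i ?b x" for k
  proof -
    have "pae p UNIV (\<lambda>\<gamma> l. cint b \<gamma> 0 l < \<infinity> \<and> (AE t in lborel. t \<in> {0..l} \<longrightarrow> b (\<gamma> t) = ennreal (?b (\<gamma> t))))"
      by (intro pae_conj p0 pae_finite b pae_AE Lpb_AE_enn2real[OF p0 b])
    from pae_line[OF p this ni] ug[OF \<delta>(1) \<delta>1, of k] show ?thesis
    proof eventually_elim
      case (elim x)
      let ?\<gamma> = "\<lambda>t. x + t *\<^sub>R i"
      have cb: "cint b ?\<gamma> 0 (\<delta> k) < \<infinity>" using elim(1) cint_mono_interval[of 0 0 "\<delta> k" 1 b ?\<gamma>] \<delta>1[of k] by (auto intro: le_less_trans)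
      have "AE t in lborel. t \<in> {0..\<delta> k} \<longrightarrow> b (?\<gamma> t) = ennreal (?b (?\<gamma> t))"
        using elim(1) \<delta>1[of k] by (auto elim!: eventually_mono)
      note B = line_LINT_enn2real[OF _ cb this]
      have "0 \<le> (LINT s:{0..\<delta> k}|lborel. ?b (x + s *\<^sub>R i))"
        unfolding set_lebesgue_integral_def by (intro integral_nonneg_AE) (auto simp: indicator_def)
      then have "\<bar>f (x + \<delta> k *\<^sub>R i) - f x\<bar> \<le> (LINT s:{0..\<delta> k}|lborel. ?b (x + s *\<^sub>R i))"
        using elim(2) B(2) by (simp add: ennreal_le_iff)
      then have "\<bar>f (x + \<delta> k *\<^sub>R i) - f x\<bar> / \<delta> k \<le> (LINT s:{0..\<delta> k}|lborel. ?b (x + s *\<^sub>R i)) / \<delta> k"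
        using \<delta>(1)[of k] by (intro divide_right_mono) auto
      then show ?case using \<delta>(1)[of k] by (simp add: q_def lineavg_def)
    qed
  qed
  \<comment> \<open>One function that dominates the deviation of every average from
    \<open>?b\<close>, so that \<open>H\<close> below dominates all difference quotients at
    once.\<close>
  define E where "E = (\<lambda>x. SUP k. ennreal (2^k) * ennreal (norm (lineavg (\<delta> k) i ?b x - ?b x)))"
  have LE: "Lpb p E"
    unfolding E_def by (rule Lpb_fast[where K=1]) (use p0 \<delta>(3) in \<open>auto simp: pint_def\<close>)
  define H where "H = (\<lambda>x. ?b x + enn2real (E x))"
  have LH: "Lp p H" unfolding H_def using p0 by (intro Lp_add Lb Lp_enn2real LE) auto
  then have [measurable]: "H \<in> borel_measurable borel" by (simp add: Lp_def)
  have H0: "0 \<le> H x" for x by (simp add: H_def)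
  have "AE x in lborel. \<forall>k. \<bar>q k x\<bar> \<le> lineavg (\<delta> k) i ?b x" using qM by (simp add: AE_all_countable)
  with Lpb_AE_finite[OF p0 LE] have qH: "AE x in lborel. \<forall>k. \<bar>q k x\<bar> \<le> H x"
  proof eventually_elim
    case (elim x)
    show ?case
    proof
      fix k
      have "ennreal 1 * ennreal (norm (lineavg (\<delta> k) i ?b x - ?b x)) \<le> ennreal (2^k) * ennreal (norm (lineavg (\<delta> k) i ?b x - ?b x))"
        by (intro mult_right_mono ennreal_leI) auto
      also have "\<dots> \<le> E x" unfolding E_def by (rule SUP_upper) simp
      also have "E x = ennreal (enn2real (E x))" using elim(1) by simp
      finally have "norm (lineavg (\<delta> k) i ?b x - ?b x) \<le> enn2real (E x)" by (simp add: ennreal_le_iff)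
      then have "lineavg (\<delta> k) i ?b x \<le> H x" by (simp add: H_def)
      then show "\<bar>q k x\<bar> \<le> H x" using elim(2) order_trans by blast
    qed
  qed
  \<comment> \<open>The truncation makes the bound 1 hold at every point, as \<open>unit_seq\<close>
    requires, and changes nothing where |q k| \<le> H. Where H vanishes, division gives 0, and
    almost everywhere there q k is 0 too.\<close>
  define a where "a = (\<lambda>k x. max (- 1) (min 1 (q k x / H x)))"
  have qa: "AE x in lborel. \<forall>k. q k x = H x * a k x"
    using qH
  proof eventually_elim
    case (elim x)
    show ?case
    proof
      fix k
      have "\<bar>q k x\<bar> \<le> H x" using elim by blast
      then show "q k x = H x * a k x"
        using H0[of x] by (cases "H x = 0") (auto simp: a_def min_def max_def field_simps abs_le_iff)
    qed
  qed
  \<comment> \<open>A positive integrable weight makes the measure finite without changing the null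
    sets, so the L^2 argument applies and its conclusion holds almost everywhere for Lebesgue
    measure.\<close>
  obtain w :: "'a \<Rightarrow> ennreal" where w: "w \<in> borel_measurable lborel" "integral\<^sup>N lborel w \<noteq> \<infinity>" "\<forall>x\<in>space lborel. 0 < w x \<and> w x < \<infinity>"
    using sigma_finite_measure.Ex_finite_integrable_function[OF lborel.sigma_finite_measure_axioms] by blast
  define M where "M = density lborel w"
  have "finite_measure M"
  proof (rule finite_measureI)
    have "emeasure M (space M) = integral\<^sup>N lborel w"
      unfolding M_def using w(1) by (subst emeasure_density) auto
    then show "emeasure M (space M) \<noteq> \<infinity>" using w(2) by simp
  qed
  moreover have "a k \<in> borel_measurable M" for k
  proof -
    have "a k \<in> borel_measurable borel" unfolding a_def by measurable
    then show ?thesis by (simp add: M_def)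
  qed
  moreover have "\<bar>a k x\<bar> \<le> 1" for k x by (auto simp: a_def)
  ultimately interpret U: unit_seq M a by (intro unit_seq.intro unit_seq_axioms.intro)
  obtain c where c: "\<And>j. c j \<in> U.weights j" "AE x in M. convergent (\<lambda>j. U.cmb (c j) x)"
    using U.convex_combinations_converge by blast
  have ae: "AE x in lborel. convergent (\<lambda>j. U.cmb (c j) x)"
    using c(2) w(3) unfolding M_def by (subst (asm) AE_density) (use w(1) in auto)
  have [measurable]: "U.cmb (c j) \<in> borel_measurable borel" for j
    using U.cmb_meas[of "c j"] by (simp add: M_def)
  define D where "D = (\<lambda>x. H x * lim (\<lambda>j. U.cmb (c j) x))"
  have [measurable]: "D \<in> borel_measurable borel" unfolding D_def by measurable
  define Q where "Q = (\<lambda>j x. H x * U.cmb (c j) x)"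
  have Qlim: "AE x in lborel. (\<lambda>j. Q j x) \<longlonglongrightarrow> D x"
    using ae by eventually_elim (auto simp: Q_def D_def convergent_LIMSEQ_iff intro!: tendsto_mult)
  have Qb: "\<bar>Q j x\<bar> \<le> H x" for j x
  proof -
    have "H x * \<bar>U.cmb (c j) x\<bar> \<le> H x * 1" using U.cmb_bound[OF c(1), of j x] H0[of x] by (intro mult_left_mono) auto
    then show ?thesis using H0[of x] by (simp add: Q_def abs_mult)
  qed
  have "AE x in lborel. norm (D x) \<le> norm (H x)"
    using Qlim
  proof eventually_elim
    case (elim x)
    have "(\<lambda>j. \<bar>Q j x\<bar>) \<longlonglongrightarrow> \<bar>D x\<bar>" using elim by (intro tendsto_intros)
    then have "\<bar>D x\<bar> \<le> H x" using Qb by (intro LIMSEQ_le_const2[of _ "\<bar>D x\<bar>"]) auto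
    then show ?case using H0[of x] by simp
  qed
  then have LD: "Lp p D" using p0 LH by (intro Lp_mono[of p H D]) auto
  have "(\<integral>x. f x * frechet_derivative \<phi> (at x) i \<partial>lborel) = - (\<integral>x. D x * \<phi> x \<partial>lborel)" if \<phi>: "test_fun UNIV \<phi>" for \<phi>
  proof -
    obtain R L where T: "\<And>x. R < norm x \<Longrightarrow> \<phi> x = 0" "continuous_on UNIV \<phi>" "\<And>x. \<bar>\<phi> x\<bar> \<le> L"
      using test_fun_facts[OF \<phi> i] by metis
    have [measurable]: "\<phi> \<in> borel_measurable borel" using T(2) by (rule borel_measurable_continuous_onI)
    let ?I = "- (\<integral>x. f x * frechet_derivative \<phi> (at x) i \<partial>lborel)"
    define y where "y = (\<lambda>k. \<integral>x. q k x * \<phi> x \<partial>lborel)"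
    have ylim: "y \<longlonglongrightarrow> ?I" unfolding y_def q_def by (rule diff_quotient_limit[OF p f i \<phi> \<delta>(1,2)])
    have iH: "integrable lborel (\<lambda>x. H x * \<phi> x)" by (rule Lp_test_integrable[OF p LH _ T(3,1)]) measurable
    have iq: "integrable lborel (\<lambda>x. q k x * \<phi> x)" for k
      using qH by (intro Bochner_Integration.integrable_bound[OF iH]) (auto simp: abs_mult intro!: mult_right_mono elim!: eventually_mono intro: order_trans)
    have Qy: "(\<integral>x. Q j x * \<phi> x \<partial>lborel) = (\<Sum>k\<le>fst (c j). snd (c j) k * y k)" for j
    proof -
      have "(\<integral>x. Q j x * \<phi> x \<partial>lborel) = (\<integral>x. (\<Sum>k\<le>fst (c j). snd (c j) k * (q k x * \<phi> x)) \<partial>lborel)"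
      proof (rule integral_cong_AE)
        show "AE x in lborel. Q j x * \<phi> x = (\<Sum>k\<le>fst (c j). snd (c j) k * (q k x * \<phi> x))"
          using qa by eventually_elim (simp add: Q_def U.cmb_def sum_distrib_left sum_distrib_right mult_ac)
      qed (auto simp: Q_def)
      also have "\<dots> = (\<Sum>k\<le>fst (c j). snd (c j) k * y k)"
        unfolding y_def using iq by (subst Bochner_Integration.integral_sum) auto
      finally show ?thesis .
    qed
    have lim1: "(\<lambda>j. \<integral>x. Q j x * \<phi> x \<partial>lborel) \<longlonglongrightarrow> ?I"
    proof (rule LIMSEQ_I)
      fix e :: real assume "0 < e"
      obtain N where N: "\<And>k. k \<ge> N \<Longrightarrow> norm (y k - ?I) < e/2" using LIMSEQ_D[OF ylim, of "e/2"] \<open>0 < e\<close> by auto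
      have "norm ((\<integral>x. Q j x * \<phi> x \<partial>lborel) - ?I) < e" if "j \<ge> N" for j
      proof -
        \<comment> \<open>The weights vanish below j and sum to 1, so the combination averages only
          values \<open>y k\<close> with k \<ge> j, all of them close to the limit.\<close>
        have W: "\<And>k. 0 \<le> snd (c j) k" "\<And>k. k < j \<Longrightarrow> snd (c j) k = 0" "(\<Sum>k\<le>fst (c j). snd (c j) k) = 1"
          using c(1)[of j] by (auto simp: U.weights_def)
        have "(\<integral>x. Q j x * \<phi> x \<partial>lborel) - ?I = (\<Sum>k\<le>fst (c j). snd (c j) k * y k) - (\<Sum>k\<le>fst (c j). snd (c j) k) * ?I"
          unfolding Qy W(3) by simp
        also have "\<dots> = (\<Sum>k\<le>fst (c j). snd (c j) k * (y k - ?I))"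
          unfolding sum_distrib_right by (simp add: sum_subtractf[symmetric] algebra_simps)
        finally have "norm ((\<integral>x. Q j x * \<phi> x \<partial>lborel) - ?I) \<le> (\<Sum>k\<le>fst (c j). norm (snd (c j) k * (y k - ?I)))"
          by (simp only: norm_sum)
        also have "\<dots> \<le> (\<Sum>k\<le>fst (c j). snd (c j) k * (e/2))"
        proof (rule sum_mono)
          fix k
          show "norm (snd (c j) k * (y k - ?I)) \<le> snd (c j) k * (e/2)"
          proof (cases "k < j")
            case False
            then have "norm (y k - ?I) \<le> e/2" using N[of k] that by simp
            then have "snd (c j) k * norm (y k - ?I) \<le> snd (c j) k * (e/2)" using W(1) by (rule mult_left_mono)
            then show ?thesis unfolding norm_mult using W(1)[of k] by simp
          qed (simp add: W(2))
        qed
        also have "\<dots> = e/2" unfolding sum_distrib_right[symmetric] W(3) by simp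
        also have "\<dots> < e" using \<open>0 < e\<close> by simp
        finally show ?thesis .
      qed
      then show "\<exists>no. \<forall>n\<ge>no. norm ((\<integral>x. Q n x * \<phi> x \<partial>lborel) - ?I) < e" by blast
    qed
    have lim2: "(\<lambda>j. \<integral>x. Q j x * \<phi> x \<partial>lborel) \<longlonglongrightarrow> (\<integral>x. D x * \<phi> x \<partial>lborel)"
    proof (rule integral_dominated_convergence[where w="\<lambda>x. norm (H x * \<phi> x)"])
      show "integrable lborel (\<lambda>x. norm (H x * \<phi> x))" using iH by (rule integrable_norm)
      show "AE x in lborel. (\<lambda>j. Q j x * \<phi> x) \<longlonglongrightarrow> D x * \<phi> x"
        using Qlim by eventually_elim (intro tendsto_intros)
      show "AE x in lborel. norm (Q j x * \<phi> x) \<le> norm (H x * \<phi> x)" for j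
        using Qb[of j] H0 by (intro AE_I2) (auto simp: abs_mult intro!: mult_right_mono)
    qed (auto simp: Q_def)
    have "?I = (\<integral>x. D x * \<phi> x \<partial>lborel)" using LIMSEQ_unique[OF lim1 lim2] .
    then show ?thesis by simp
  qed
  then show ?thesis using that LD by blast
qed

lemma Lp_sum:
  assumes "0 < p" "finite I" "\<And>i. i \<in> I \<Longrightarrow> Lp p (f i)" shows "Lp p (\<lambda>x. \<Sum>i\<in>I. f i x)"
  using assms(2,3)
proof (induction rule: finite_induct)
  case empty
  then show ?case by (simp add: Lp_def pint_def)
next
  case (insert j I)
  then show ?case using assms(1) by (auto intro!: Lp_add)
qed

lemma weak_grad_exists:
  fixes f :: "'a::euclidean_space \<Rightarrow> real"
  assumes p: "1 \<le> p" and f: "Lp p f" and b: "Lpb p b"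
    and ug: "\<And>e \<delta>. norm e = 1 \<Longrightarrow> 0 < \<delta> \<Longrightarrow> \<delta> \<le> 1 \<Longrightarrow> AE x in lborel. ennreal \<bar>f (x + \<delta> *\<^sub>R e) - f x\<bar> \<le> cint b (\<lambda>t. x + t *\<^sub>R e) 0 \<delta>"
  obtains Df where "Lp p Df" "weak_grad UNIV f Df"
proof -
  have p0: "0 < p" using p by simp
  have "\<exists>D. Lp p D \<and> (\<forall>\<phi>. test_fun UNIV \<phi> \<longrightarrow> (\<integral>x. f x * frechet_derivative \<phi> (at x) i \<partial>lborel) = - (\<integral>x. D x * \<phi> x \<partial>lborel))"
    if "i \<in> Basis" for i :: 'a
    using weak_partial_exists[OF p f b that ug[OF norm_Basis[OF that]]] by blast
  then obtain D where D: "\<And>i. i \<in> Basis \<Longrightarrow> Lp p (D i)"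
    "\<And>i \<phi>. i \<in> Basis \<Longrightarrow> test_fun UNIV \<phi> \<Longrightarrow> (\<integral>x. f x * frechet_derivative \<phi> (at x) i \<partial>lborel) = - (\<integral>x. D i x * \<phi> x \<partial>lborel)"
    by metis
  define Df where "Df = (\<lambda>x. \<Sum>i\<in>Basis. D i x *\<^sub>R i)"
  have comp: "Df x \<bullet> i = D i x" if "i \<in> Basis" for x i using that by (simp add: Df_def)
  have "Lp p Df" unfolding Df_def
  proof (rule Lp_sum[OF p0 finite_Basis])
    fix i :: 'a assume i: "i \<in> Basis"
    have "D i \<in> borel_measurable borel" using D(1)[OF i] by (simp add: Lp_def)
    then show "Lp p (\<lambda>x. D i x *\<^sub>R i)" using p0 i by (intro Lp_mono[OF _ D(1)[OF i]]) auto
  qed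
  moreover have "weak_grad UNIV f Df" unfolding weak_grad_def using D(2) comp by simp
  ultimately show ?thesis by (rule that)
qed

section \<open>Gluing along quasiopen pieces\<close>

lemma borel_version:
  fixes h :: "'a::euclidean_space \<Rightarrow> 'b::euclidean_space"
  assumes "h \<in> borel_measurable lebesgue"
  obtains h' where "h' \<in> borel_measurable borel" "AE x in lborel. h x = h' x"
proof -
  have "\<exists>g. g \<in> borel_measurable lborel \<and> (AE x in lborel. h x \<bullet> i = g x)" for i
  proof -
    have "(\<lambda>x. h x \<bullet> i) \<in> borel_measurable lebesgue" using assms by (intro borel_measurable_inner) auto
    from completion_ex_borel_measurable_real[OF this] show ?thesis by auto
  qed
  then obtain g where g: "\<And>i. g i \<in> borel_measurable lborel" "\<And>i. AE x in lborel. h x \<bullet> i = g i x" by metis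
  have gm: "g i \<in> borel_measurable borel" for i using g(1)[of i] by simp
  have "AE x in lborel. \<forall>i\<in>Basis. h x \<bullet> i = g i x"
    using g(2) by (intro AE_ball_countable[THEN iffD2]) (auto intro: countable_finite)
  then have "AE x in lborel. h x = (\<Sum>i\<in>Basis. g i x *\<^sub>R i)"
  proof eventually_elim
    case (elim x)
    have "h x = (\<Sum>i\<in>Basis. (h x \<bullet> i) *\<^sub>R i)" by (rule euclidean_representation[symmetric])
    also have "\<dots> = (\<Sum>i\<in>Basis. g i x *\<^sub>R i)" using elim by (intro sum.cong) auto
    finally show ?case .
  qed
  moreover have "(\<lambda>x. \<Sum>i\<in>Basis. g i x *\<^sub>R i) \<in> borel_measurable borel" using gm by measurable
  ultimately show ?thesis using that by blast
qed

lemma measurable_AE_eq_lebesgue: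
  assumes "g \<in> borel_measurable lebesgue" "AE x in lborel. f x = g x"
  shows "f \<in> borel_measurable lebesgue"
proof (rule measurableI)
  fix A assume A: "A \<in> sets (borel :: 'b measure)"
  let ?N = "{x. f x \<noteq> g x}"
  have N: "?N \<inter> S \<in> sets lebesgue" for S
    using assms(2) by (intro sets_lebesgue_AE) (auto elim!: eventually_mono)
  have eq: "f -` A \<inter> space lebesgue = (g -` A \<inter> space lebesgue - ?N \<inter> UNIV) \<union> ?N \<inter> f -` A" by auto
  have "g -` A \<inter> space lebesgue \<in> sets lebesgue" using assms(1) A by (rule measurable_sets)
  then show "f -` A \<inter> space lebesgue \<in> sets lebesgue" unfolding eq by (intro sets.Diff sets.Un N)
qed simp

lemma Lp_on_borel:
  fixes w :: "'a::euclidean_space \<Rightarrow> 'b::euclidean_space"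
  assumes "Lp_on p G w"
  obtains f where "Lp p f" "AE x in lborel. indicator G x *\<^sub>R w x = f x"
proof -
  have "(\<lambda>x. indicator G x *\<^sub>R w x) \<in> borel_measurable lebesgue"
    using assms by (simp add: Lp_on_def set_borel_measurable_def)
  from borel_version[OF this] obtain f where f: "f \<in> borel_measurable borel" "AE x in lborel. indicator G x *\<^sub>R w x = f x" by blast
  have "pint p f = (\<integral>\<^sup>+ x\<in>G. ennreal (norm (w x) powr p) \<partial>lborel)"
    unfolding pint_def using f(2) by (intro nn_integral_cong_AE, eventually_elim) (auto simp: indicator_def)
  then have "Lp p f" using assms f(1) by (simp add: Lp_def Lp_on_def nn_integral_lebesgue)
  then show ?thesis using that f(2) by blast
qed

lemma test_fun_measurable:
  fixes \<phi> :: "'a::euclidean_space \<Rightarrow> real"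
  assumes "test_fun G \<phi>" "i \<in> Basis"
  shows "\<phi> \<in> borel_measurable borel" "(\<lambda>x. frechet_derivative \<phi> (at x) i) \<in> borel_measurable borel"
  using test_fun_facts[OF assms] borel_measurable_continuous_onI by metis+

lemma set_LINT_lebesgue:
  fixes u f :: "'a::euclidean_space \<Rightarrow> real"
  assumes "AE x in lborel. indicator G x * u x = f x" "f \<in> borel_measurable borel"
  shows "(LINT x:G|lebesgue. u x) = (\<integral>x. f x \<partial>lborel)"
proof -
  have fl: "f \<in> borel_measurable lebesgue" using assms(2) by (intro measurable_completion) simp
  have ul: "(\<lambda>x. indicator G x * u x) \<in> borel_measurable lebesgue" by (rule measurable_AE_eq_lebesgue[OF fl assms(1)])
  have "(LINT x:G|lebesgue. u x) = (\<integral>x. f x \<partial>lebesgue)"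
    unfolding set_lebesgue_integral_def using assms(1) ul fl
    by (intro integral_cong_AE) (auto simp: AE_lebesgue_iff)
  also have "\<dots> = (\<integral>x. f x \<partial>lborel)" using assms(2) by (intro integral_completion) simp
  finally show ?thesis .
qed

text \<open>The Borel functions represent w and Dw extended by 0 off G, so they belong to L^p of the
  whole space and can be mollified.\<close>

lemma classical_W1p_borel:
  assumes "classical_W1p p G w Dw"
  obtains f Df where "Lp p f" "Lp p Df" "weak_grad G f Df"
    "AE x in lborel. x \<in> G \<longrightarrow> w x = f x" "AE x in lborel. x \<in> G \<longrightarrow> Dw x = Df x"
proof -
  obtain f where f: "Lp p f" "AE x in lborel. indicator G x *\<^sub>R w x = f x"
    using Lp_on_borel assms by (metis classical_W1p_def)
  obtain Df where Df: "Lp p Df" "AE x in lborel. indicator G x *\<^sub>R Dw x = Df x"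
    using Lp_on_borel assms by (metis classical_W1p_def)
  have m: "f \<in> borel_measurable borel" "Df \<in> borel_measurable borel" using f Df by (auto simp: Lp_def)
  have "weak_grad G f Df"
    unfolding weak_grad_def
  proof (intro allI impI ballI)
    fix \<phi> i assume \<phi>: "test_fun G \<phi>" and i: "i \<in> (Basis :: 'a set)"
    note [measurable] = m test_fun_measurable[OF \<phi> i]
    have "(LINT x:G|lebesgue. w x * frechet_derivative \<phi> (at x) i) = (\<integral>x. f x * frechet_derivative \<phi> (at x) i \<partial>lborel)"
      by (rule set_LINT_lebesgue) (use f(2) in \<open>auto elim!: eventually_mono\<close>)
    moreover have "(LINT x:G|lebesgue. (Dw x \<bullet> i) * \<phi> x) = (\<integral>x. (Df x \<bullet> i) * \<phi> x \<partial>lborel)"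
    proof (rule set_LINT_lebesgue)
      show "AE x in lborel. indicator G x * ((Dw x \<bullet> i) * \<phi> x) = (Df x \<bullet> i) * \<phi> x"
        using Df(2) by eventually_elim (auto simp: indicator_def split: if_splits)
    qed measurable
    moreover have "(LINT x:G|lebesgue. w x * frechet_derivative \<phi> (at x) i) = - (LINT x:G|lebesgue. (Dw x \<bullet> i) * \<phi> x)"
      using assms \<phi> i unfolding classical_W1p_def by blast
    ultimately show "(\<integral>x. f x * frechet_derivative \<phi> (at x) i \<partial>lborel) = - (\<integral>x. (Df x \<bullet> i) * \<phi> x \<partial>lborel)" by simp
  qed
  moreover have "AE x in lborel. x \<in> G \<longrightarrow> w x = f x" using f(2) by eventually_elim auto
  moreover have "AE x in lborel. x \<in> G \<longrightarrow> Dw x = Df x" using Df(2) by eventually_elim auto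
  ultimately show ?thesis using that f(1) Df(1) by blast
qed

lemma Lp_Lp_on:
  assumes "Lp p f" shows "Lp_on p UNIV f"
  using assms by (auto simp: Lp_def Lp_on_def pint_def set_borel_measurable_def nn_integral_lebesgue intro: measurable_completion)

lemma classical_W1p_UNIV:
  fixes f :: "'a::euclidean_space \<Rightarrow> real"
  assumes "Lp p f" "Lp p Df" "weak_grad UNIV f Df"
  shows "classical_W1p p UNIV f Df"
  unfolding classical_W1p_def
proof (intro conjI allI impI ballI Lp_Lp_on assms(1,2) open_UNIV)
  fix \<phi> :: "'a \<Rightarrow> real" and i :: 'a assume \<phi>: "test_fun UNIV \<phi>" and i: "i \<in> Basis"
  note [measurable] = Lp_measurable[OF assms(1)] Lp_measurable[OF assms(2)] test_fun_measurable[OF \<phi> i]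
  have "(LINT x:UNIV|lebesgue. f x * frechet_derivative \<phi> (at x) i) = (\<integral>x. f x * frechet_derivative \<phi> (at x) i \<partial>lborel)"
    by (rule set_LINT_lebesgue) auto
  moreover have "(LINT x:UNIV|lebesgue. (Df x \<bullet> i) * \<phi> x) = (\<integral>x. (Df x \<bullet> i) * \<phi> x \<partial>lborel)"
    by (rule set_LINT_lebesgue) auto
  ultimately show "(LINT x:UNIV|lebesgue. f x * frechet_derivative \<phi> (at x) i) = - (LINT x:UNIV|lebesgue. (Df x \<bullet> i) * \<phi> x)"
    using assms(3) \<phi> i unfolding weak_grad_def by simp
qed

section \<open>Newtonian functions along almost every curve\<close>

text \<open>The endpoint inequality for almost every curve holds on all subcurves at once. Every
  point of the curve is an endpoint of a nondegenerate subcurve, and an infinite value there would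
  contradict the finite line integral.\<close>

lemma pae_ereal_ugc:
  assumes "0 < p" "Lpb p g" "pae p U (\<lambda>\<gamma> l. ediff (v (\<gamma> 0)) (v (\<gamma> l)) \<le> line_int g \<gamma> l)"
  shows "pae p U (\<lambda>\<gamma> l. (\<forall>t\<in>{0..l}. \<bar>v (\<gamma> t)\<bar> \<noteq> \<infinity>) \<and> ugc (\<lambda>x. real_of_ereal (v x)) g \<gamma> l)"
proof -
  have gm: "g \<in> borel_measurable borel" using assms(2) by (simp add: Lpb_def)
  have "pae p U (\<lambda>\<gamma> l. cint g \<gamma> 0 l < \<infinity> \<and> (\<forall>s t. 0 \<le> s \<and> s < t \<and> t \<le> l \<and> \<gamma> ` {s..t} \<subseteq> U \<longrightarrow>
     ediff (v (subcurve \<gamma> s 0)) (v (subcurve \<gamma> s (t - s))) \<le> line_int g (subcurve \<gamma> s) (t - s)))"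
    by (intro pae_conj assms(1) pae_finite assms(2) pae_subcurves[OF assms(3)])
  then show ?thesis
  proof (rule pae_mono)
    fix \<gamma> l assume c: "curve_in \<gamma> l U" and P: "cint g \<gamma> 0 l < \<infinity> \<and> (\<forall>s t. 0 \<le> s \<and> s < t \<and> t \<le> l \<and> \<gamma> ` {s..t} \<subseteq> U \<longrightarrow>
     ediff (v (subcurve \<gamma> s 0)) (v (subcurve \<gamma> s (t - s))) \<le> line_int g (subcurve \<gamma> s) (t - s))"
    have ac: "arc_curve \<gamma> l" and l: "0 < l" using c arc_curve_pos by (auto simp: curve_in_def image_subset_iff)
    have e: "ediff (v (\<gamma> s)) (v (\<gamma> t)) \<le> cint g \<gamma> s t" if "0 \<le> s" "s < t" "t \<le> l" for s t
    proof -
      have "\<gamma> ` {s..t} \<subseteq> U" using c that by (force simp: curve_in_def)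
      then have "ediff (v (subcurve \<gamma> s 0)) (v (subcurve \<gamma> s (t - s))) \<le> line_int g (subcurve \<gamma> s) (t - s)" using P that by blast
      also have "\<dots> = cint g \<gamma> s t" using that by (intro line_int_subcurve[OF ac gm])
      finally show ?thesis by (simp add: subcurve_def)
    qed
    have fin: "cint g \<gamma> s t < \<infinity>" if "0 \<le> s" "t \<le> l" for s t
      using cint_mono_interval[of 0 s t l g \<gamma>] that P by (auto intro: le_less_trans)
    have ef: "ediff (v (\<gamma> s)) (v (\<gamma> t)) < \<infinity>" if "0 \<le> s" "s < t" "t \<le> l" for s t
      using e[OF that] fin[of s t] that by (auto intro: le_less_trans)
    have vf: "\<bar>v (\<gamma> t)\<bar> \<noteq> \<infinity>" if "t \<in> {0..l}" for t
    proof (cases "t = 0")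
      case True
      then show ?thesis using ediff_finite(1)[OF ef[of 0 l]] l by simp
    next
      case False
      then show ?thesis using ediff_finite(2)[OF ef[of 0 t]] that by simp
    qed
    have "ugc (\<lambda>x. real_of_ereal (v x)) g \<gamma> l"
      unfolding ugc_def
    proof (intro allI impI)
      fix s t assume st: "0 \<le> s \<and> s \<le> t \<and> t \<le> l"
      show "ennreal \<bar>real_of_ereal (v (\<gamma> s)) - real_of_ereal (v (\<gamma> t))\<bar> \<le> cint g \<gamma> s t"
      proof (cases "s = t")
        case False
        then show ?thesis using e[of s t] ediff_ereal_of[OF ef[of s t]] st by simp
      qed simp
    qed
    with vf show "(\<forall>t\<in>{0..l}. \<bar>v (\<gamma> t)\<bar> \<noteq> \<infinity>) \<and> ugc (\<lambda>x. real_of_ereal (v x)) g \<gamma> l" by (intro conjI ballI)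
  qed
qed

text \<open>The p-integral of g is finite over U only. Its envelope is p-integrable on the whole
  space, so it serves at once as upper gradient and as exceptional density.\<close>

lemma N1p_real_ugc:
  assumes "0 < p" "U \<in> sets lebesgue" "upper_gradient U v g" "(\<integral>\<^sup>+ x\<in>U. epow (g x) p \<partial>lebesgue) < \<infinity>"
  obtains g' where "Lpb p g'" "AE x in lborel. x \<in> U \<longrightarrow> g' x = g x" "\<And>x. x \<in> U \<Longrightarrow> g x \<le> g' x"
    "pae p U (\<lambda>\<gamma> l. (\<forall>t\<in>{0..l}. \<bar>v (\<gamma> t)\<bar> \<noteq> \<infinity>) \<and> ugc (\<lambda>x. real_of_ereal (v x)) g' \<gamma> l)"
proof -
  have gm: "g \<in> borel_measurable borel" using assms(3) by (simp add: upper_gradient_def)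
  obtain g' where g': "g' \<in> borel_measurable borel" "\<And>x. x \<in> U \<Longrightarrow> g x \<le> g' x"
    "AE x in lborel. g' x = g x * indicator U x"
    "(\<integral>\<^sup>+x. epow (g' x) p \<partial>lborel) = (\<integral>\<^sup>+x\<in>U. epow (g x) p \<partial>lebesgue)"
    using Lpb_envelope[OF assms(2) measurable_restrict_borel[OF gm]] by blast
  have L: "Lpb p g'" using g' assms(4) by (simp add: Lpb_def)
  have "pae p U (\<lambda>\<gamma> l. ediff (v (\<gamma> 0)) (v (\<gamma> l)) \<le> line_int g' \<gamma> l)"
    unfolding pae_def
  proof (intro exI[of _ g'] conjI allI impI L)
    fix \<gamma> l assume c: "curve_in \<gamma> l U \<and> line_int g' \<gamma> l < \<infinity>"
    then have "ediff (v (\<gamma> 0)) (v (\<gamma> l)) \<le> line_int g \<gamma> l" using assms(3) by (auto simp: upper_gradient_def)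
    also have "\<dots> \<le> line_int g' \<gamma> l"
      unfolding line_int_cint using c by (intro cint_mono g'(2)) (auto simp: curve_in_def image_subset_iff)
    finally show "ediff (v (\<gamma> 0)) (v (\<gamma> l)) \<le> line_int g' \<gamma> l" .
  qed
  from pae_ereal_ugc[OF assms(1) L this] show ?thesis
    using g' by (intro that[OF L]) (auto elim!: eventually_mono)
qed

section \<open>Representatives given on path-open pieces\<close>

text \<open>What is kept of a quasicovering is path-openness of the pieces and a cover of U up to a
  set that neither measure nor almost every curve sees, together with one good representative on
  each piece. The index type is countable so that exceptional families can be combined.\<close>

locale gradient_system =
  fixes p :: real and U :: "'a::euclidean_space set" and V :: "'i::countable \<Rightarrow> 'a set"
    and F :: "'i \<Rightarrow> 'a \<Rightarrow> real" and DF :: "'i \<Rightarrow> 'a \<Rightarrow> 'a" and u :: "'a \<Rightarrow> real" and Du :: "'a \<Rightarrow> 'a"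
  assumes p1: "1 < p" and U: "U \<in> sets lebesgue" and VU: "\<And>i. V i \<subseteq> U"
    and path_open: "\<And>i. path_open p UNIV (V i)"
    and cover_pae: "pae p UNIV (\<lambda>\<gamma> l. \<gamma> ` {0..l} \<inter> (U - (\<Union>i. V i)) = {})"
    and cover_AE: "AE x in lborel. x \<notin> U - (\<Union>i. V i)"
    and F_ugc: "\<And>i. pae p (V i) (ugc (F i) (\<lambda>x. ennreal (norm (DF i x))))"
    and F_ftc: "\<And>i. pae p (V i) (line_ftc (F i) (DF i))"
    and LpDF: "\<And>i. Lp p (DF i)"
    and uF: "\<And>i. AE x in lborel. x \<in> V i \<longrightarrow> u x = F i x"
    and DuF: "\<And>i. AE x in lborel. x \<in> V i \<longrightarrow> Du x = DF i x"
    and Lpu: "Lp_on p U u" and LpDu: "Lp_on p U Du"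
begin

lemma p0: "0 < p" using p1 by simp

lemma Du_measurable: "(\<lambda>x. ennreal (norm (Du x))) \<in> borel_measurable (restrict_space lebesgue U)"
proof -
  have "(\<lambda>x. indicator U x *\<^sub>R Du x) \<in> borel_measurable lebesgue"
    using LpDu by (simp add: Lp_on_def set_borel_measurable_def)
  then have "(\<lambda>x. ennreal (norm (indicator U x *\<^sub>R Du x))) \<in> borel_measurable lebesgue" by measurable
  also have "(\<lambda>x. ennreal (norm (indicator U x *\<^sub>R Du x))) = (\<lambda>x. ennreal (norm (Du x)) * indicator U x)"
    by (auto simp: indicator_def fun_eq_iff)
  finally show ?thesis using U by (subst borel_measurable_restrict_space_iff_ennreal) auto
qed

lemma u_measurable: "(\<lambda>x. indicator U x * u x) \<in> borel_measurable lebesgue"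
  using Lpu by (simp add: Lp_on_def set_borel_measurable_def)

lemma envelope:
  obtains h where "Lpb p h" "\<And>x. x \<in> U \<Longrightarrow> ennreal (norm (Du x)) \<le> h x"
    "AE x in lborel. h x = ennreal (norm (Du x)) * indicator U x"
    "(\<integral>\<^sup>+x. epow (h x) p \<partial>lborel) = (\<integral>\<^sup>+x\<in>U. ennreal (norm (Du x) powr p) \<partial>lebesgue)"
proof -
  obtain h where h: "h \<in> borel_measurable borel" "\<And>x. x \<in> U \<Longrightarrow> ennreal (norm (Du x)) \<le> h x"
    "AE x in lborel. h x = ennreal (norm (Du x)) * indicator U x"
    "(\<integral>\<^sup>+x. epow (h x) p \<partial>lborel) = (\<integral>\<^sup>+x\<in>U. epow (ennreal (norm (Du x))) p \<partial>lebesgue)"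
    using Lpb_envelope[OF U Du_measurable] by blast
  then have "Lpb p h" using LpDu by (simp add: Lpb_def Lp_on_def)
  then show ?thesis using that h by simp
qed

lemma AE_pieces:
  assumes "\<And>i. AE x in lborel. x \<in> V i \<longrightarrow> P x" shows "AE x in lborel. x \<in> U \<longrightarrow> P x"
proof -
  have "AE x in lborel. \<forall>i. x \<in> V i \<longrightarrow> P x" unfolding AE_all_countable using assms by blast
  with cover_AE show ?thesis by eventually_elim blast
qed

lemma openin_interval:
  fixes r l :: real
  assumes "openin (top_of_set {0..l}) {t \<in> {0..l}. \<gamma> t \<in> S}" "r \<in> {0..l}" "\<gamma> r \<in> S"
  obtains d where "0 < d" "\<And>t. t \<in> {0..l} \<Longrightarrow> \<bar>t - r\<bar> < d \<Longrightarrow> \<gamma> t \<in> S"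
proof -
  obtain d where d: "0 < d" "ball r d \<inter> {0..l} \<subseteq> {t \<in> {0..l}. \<gamma> t \<in> S}"
    using assms unfolding openin_contains_ball by blast
  show ?thesis
  proof (rule that[OF d(1)])
    fix t assume "t \<in> {0..l}" "\<bar>t - r\<bar> < d"
    then have "t \<in> ball r d \<inter> {0..l}" by (simp add: dist_real_def abs_minus_commute)
    then show "\<gamma> t \<in> S" using d(2) by blast
  qed
qed

text \<open>Along almost every curve the pieces are relatively open and cover all parameters. Near
  each parameter g coincides with one \<open>F i\<close>, whose gradient norm equals h at almost
  every parameter, so the inequality holds locally and then globally.\<close>

lemma glue_ugc:
  assumes h: "Lpb p h" "AE x in lborel. x \<in> U \<longrightarrow> h x = ennreal (norm (Du x))"
    and eq: "\<And>i. pae p (V i) (\<lambda>\<gamma> l. \<forall>t\<in>{0..l}. g (\<gamma> t) = F i (\<gamma> t))"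
  shows "pae p U (ugc g h)"
proof -
  have flat_exp: "h \<in> borel_measurable borel" using h by (simp add: Lpb_def)
  have AE: "AE x in lborel. x \<in> V i \<longrightarrow> h x = ennreal (norm (DF i x))" for i
    using h(2) DuF[of i] by eventually_elim (use VU in auto)
  have "pae p U (\<lambda>\<gamma> l. \<forall>i. openin (top_of_set {0..l}) {t \<in> {0..l}. \<gamma> t \<in> V i} \<and>
      (\<forall>s t. 0 \<le> s \<and> s < t \<and> t \<le> l \<and> \<gamma> ` {s..t} \<subseteq> V i \<longrightarrow> (\<forall>\<tau>\<in>{0..t - s}. g (subcurve \<gamma> s \<tau>) = F i (subcurve \<gamma> s \<tau>))) \<and>
      (\<forall>s t. 0 \<le> s \<and> s < t \<and> t \<le> l \<and> \<gamma> ` {s..t} \<subseteq> V i \<longrightarrow> ugc (F i) (\<lambda>x. ennreal (norm (DF i x))) (subcurve \<gamma> s) (t - s)) \<and>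
      (AE t in lborel. t \<in> {0..l} \<longrightarrow> (\<gamma> t \<in> V i \<longrightarrow> h (\<gamma> t) = ennreal (norm (DF i (\<gamma> t))))))"
    by (intro pae_all pae_conj p0 pae_subset[OF path_open] pae_subcurves[OF eq] pae_subcurves[OF F_ugc] pae_AE[OF AE]) auto
  moreover have "pae p U (\<lambda>\<gamma> l. \<gamma> ` {0..l} \<inter> (U - (\<Union>i. V i)) = {})" by (rule pae_subset[OF cover_pae]) simp
  ultimately have "pae p U (\<lambda>\<gamma> l. (\<forall>i. openin (top_of_set {0..l}) {t \<in> {0..l}. \<gamma> t \<in> V i} \<and>
      (\<forall>s t. 0 \<le> s \<and> s < t \<and> t \<le> l \<and> \<gamma> ` {s..t} \<subseteq> V i \<longrightarrow> (\<forall>\<tau>\<in>{0..t - s}. g (subcurve \<gamma> s \<tau>) = F i (subcurve \<gamma> s \<tau>))) \<and>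
      (\<forall>s t. 0 \<le> s \<and> s < t \<and> t \<le> l \<and> \<gamma> ` {s..t} \<subseteq> V i \<longrightarrow> ugc (F i) (\<lambda>x. ennreal (norm (DF i x))) (subcurve \<gamma> s) (t - s)) \<and>
      (AE t in lborel. t \<in> {0..l} \<longrightarrow> (\<gamma> t \<in> V i \<longrightarrow> h (\<gamma> t) = ennreal (norm (DF i (\<gamma> t)))))) \<and>
      \<gamma> ` {0..l} \<inter> (U - (\<Union>i. V i)) = {})" (is "pae p U (\<lambda>\<gamma> l. (\<forall>i. ?P \<gamma> l i) \<and> _)") by (intro pae_conj p0)
  then show ?thesis
  proof (rule pae_mono)
    fix \<gamma> l assume c: "curve_in \<gamma> l U" and P: "(\<forall>i. ?P \<gamma> l i) \<and> \<gamma> ` {0..l} \<inter> (U - (\<Union>i. V i)) = {}"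
    have ac: "arc_curve \<gamma> l" using c by (simp add: curve_in_def)
    show "ugc g h \<gamma> l"
    proof (rule ugc_localI[OF ac flat_exp])
      fix r assume r: "0 \<le> r" "r \<le> l"
      have "\<gamma> r \<in> U" using c r by (auto simp: curve_in_def image_subset_iff)
      moreover have "\<gamma> r \<in> \<gamma> ` {0..l}" using r by simp
      ultimately obtain i where i: "\<gamma> r \<in> V i" using P by blast
      have Pi: "?P \<gamma> l i" using P by blast
      obtain d where d: "0 < d" "\<And>t. t \<in> {0..l} \<Longrightarrow> \<bar>t - r\<bar> < d \<Longrightarrow> \<gamma> t \<in> V i"
        using openin_interval[of l \<gamma> "V i" r] Pi i r by auto
      have "ennreal \<bar>g (\<gamma> s) - g (\<gamma> t)\<bar> \<le> cint h \<gamma> s t"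
        if st: "0 \<le> s \<and> s \<le> r \<and> r \<le> t \<and> t \<le> l \<and> t - s < d" for s t
      proof (cases "s < t")
        case True
        have sub: "\<gamma> ` {s..t} \<subseteq> V i" using d(2) st by auto
        then have g1: "\<forall>\<tau>\<in>{0..t - s}. g (subcurve \<gamma> s \<tau>) = F i (subcurve \<gamma> s \<tau>)"
          and g2: "ugc (F i) (\<lambda>x. ennreal (norm (DF i x))) (subcurve \<gamma> s) (t - s)" using Pi st True by blast+
        have "g (\<gamma> s) = F i (\<gamma> s)" "g (\<gamma> t) = F i (\<gamma> t)"
          using g1[rule_format, of 0] g1[rule_format, of "t - s"] True by (auto simp: subcurve_def)
        moreover have "ennreal \<bar>F i (\<gamma> s) - F i (\<gamma> t)\<bar> \<le> cint (\<lambda>x. ennreal (norm (DF i x))) (subcurve \<gamma> s) 0 (t - s)"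
          using ugcD[OF g2, of 0 "t - s"] True by (simp add: subcurve_def)
        moreover have "cint (\<lambda>x. ennreal (norm (DF i x))) (subcurve \<gamma> s) 0 (t - s) = cint (\<lambda>x. ennreal (norm (DF i x))) \<gamma> s t"
          using Lp_Lpb[OF LpDF] st True unfolding line_int_cint[symmetric]
          by (intro line_int_subcurve[OF ac]) (auto simp: Lpb_def)
        moreover have "cint (\<lambda>x. ennreal (norm (DF i x))) \<gamma> s t \<le> cint h \<gamma> s t"
        proof (rule cint_mono_AE)
          have "AE \<tau> in lborel. \<tau> \<in> {0..l} \<longrightarrow> (\<gamma> \<tau> \<in> V i \<longrightarrow> h (\<gamma> \<tau>) = ennreal (norm (DF i (\<gamma> \<tau>))))" using Pi by blast
          then show "AE \<tau> in lborel. \<tau> \<in> {s..t} \<longrightarrow> ennreal (norm (DF i (\<gamma> \<tau>))) \<le> h (\<gamma> \<tau>)"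
            by eventually_elim (use sub st in \<open>auto simp: image_subset_iff\<close>)
        qed
        ultimately show ?thesis by simp
      next
        case False
        then have "t = s" using st by simp
        then show ?thesis by simp
      qed
      then show "\<exists>d>0. \<forall>s t. 0 \<le> s \<and> s \<le> r \<and> r \<le> t \<and> t \<le> l \<and> t - s < d \<longrightarrow> ennreal \<bar>g (\<gamma> s) - g (\<gamma> t)\<bar> \<le> cint h \<gamma> s t"
        using d(1) by blast
    qed
  qed
qed

lemma pieces_eq:
  assumes "Lpb p b" "pae p U (ugc g b)" "AE x in lborel. x \<in> U \<longrightarrow> g x = u x"
  shows "pae p (V i) (\<lambda>\<gamma> l. \<forall>t\<in>{0..l}. g (\<gamma> t) = F i (\<gamma> t))"
proof (rule pae_eq[OF p0 assms(1) Lp_Lpb[OF LpDF] pae_subset[OF assms(2) VU] F_ugc])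
  show "AE x in lborel. x \<in> V i \<longrightarrow> g x = F i x"
    using assms(3) uF[of i] by eventually_elim (use VU in auto)
qed

text \<open>On each piece g agrees with \<open>F i\<close> along almost every curve. Hence b bounds
  the increments of \<open>F i\<close> there, and \<open>local_grad_bound\<close> applies piece by
  piece.\<close>

lemma minimal:
  assumes "Lpb p b" "pae p U (ugc g b)" "AE x in lborel. x \<in> U \<longrightarrow> g x = u x"
  shows "AE x in lborel. x \<in> U \<longrightarrow> ennreal (norm (Du x)) \<le> b x"
proof (rule AE_pieces)
  fix i
  have "pae p (V i) (\<lambda>\<gamma> l. (\<forall>t\<in>{0..l}. g (\<gamma> t) = F i (\<gamma> t)) \<and> ugc g b \<gamma> l)"
    by (intro pae_conj p0 pieces_eq[OF assms] pae_subset[OF assms(2) VU])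
  then have "pae p (V i) (ugc (F i) b)" by (rule pae_mono) (auto simp: ugc_def)
  then have "AE x in lborel. x \<in> V i \<longrightarrow> ennreal (norm (DF i x)) \<le> b x"
    using p1 by (intro local_grad_bound[OF _ path_open LpDF F_ftc assms(1)]) auto
  with DuF[of i] show "AE x in lborel. x \<in> V i \<longrightarrow> ennreal (norm (Du x)) \<le> b x"
    by eventually_elim auto
qed

text \<open>The chosen piece may vary wildly from point to point; \<open>patch_eq\<close> shows that
  curves do not notice. Outside all pieces the value is arbitrary.\<close>

definition patch :: "'a \<Rightarrow> real" where
  "patch x = F (SOME i. x \<in> V i) x"

text \<open>The piece chosen at a point of the curve is relatively open along the curve, so the
  point lies on a nondegenerate subcurve in the overlap, where the two representatives agree.
  Countability lets one density serve all possible choices.\<close>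

lemma patch_eq: "pae p (V i) (\<lambda>\<gamma> l. \<forall>t\<in>{0..l}. patch (\<gamma> t) = F i (\<gamma> t))"
proof -
  have e: "pae p (V i \<inter> V j) (\<lambda>\<gamma> l. \<forall>t\<in>{0..l}. F i (\<gamma> t) = F j (\<gamma> t))" for j
  proof (rule pae_eq[OF p0 Lp_Lpb[OF LpDF] Lp_Lpb[OF LpDF] pae_subset[OF F_ugc] pae_subset[OF F_ugc]])
    show "AE x in lborel. x \<in> V i \<inter> V j \<longrightarrow> F i x = F j x" using uF[of i] uF[of j] by eventually_elim auto
  qed auto
  have "pae p (V i) (\<lambda>\<gamma> l. \<forall>j. openin (top_of_set {0..l}) {t \<in> {0..l}. \<gamma> t \<in> V j} \<and>
     (\<forall>s t. 0 \<le> s \<and> s < t \<and> t \<le> l \<and> \<gamma> ` {s..t} \<subseteq> V i \<inter> V j \<longrightarrow> (\<forall>\<tau>\<in>{0..t - s}. F i (subcurve \<gamma> s \<tau>) = F j (subcurve \<gamma> s \<tau>))))"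
    (is "pae p _ (\<lambda>\<gamma> l. \<forall>j. ?P \<gamma> l j)")
    by (intro pae_all pae_conj p0 pae_subset[OF path_open] pae_subcurves[OF e]) auto
  then show ?thesis
  proof (rule pae_mono, intro ballI)
    fix \<gamma> l r assume c: "curve_in \<gamma> l (V i)" and P: "\<forall>j. ?P \<gamma> l j" and r: "r \<in> {0..l}"
    define j where "j = (SOME j. \<gamma> r \<in> V j)"
    have "\<gamma> r \<in> V i" using c r by (auto simp: curve_in_def image_subset_iff)
    then have j: "\<gamma> r \<in> V j" unfolding j_def by (rule someI)
    have l: "0 < l" using c arc_curve_pos by (auto simp: curve_in_def image_subset_iff)
    have Pj: "?P \<gamma> l j" using P by blast
    obtain d where d: "0 < d" "\<And>t. t \<in> {0..l} \<Longrightarrow> \<bar>t - r\<bar> < d \<Longrightarrow> \<gamma> t \<in> V j"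
      using openin_interval[of l \<gamma> "V j" r] Pj j r by auto
    \<comment> \<open>Half of d keeps the closed interval within distance d of r. Clamping to
      \<open>{0..l}\<close> still leaves s < t, also when r is an endpoint.\<close>
    define s where "s = max 0 (r - d/2)"
    define t where "t = min l (r + d/2)"
    have st: "0 \<le> s" "s \<le> r" "r \<le> t" "t \<le> l" "s < t" using d(1) r l by (auto simp: s_def t_def min_def max_def)
    have "\<gamma> ` {s..t} \<subseteq> V i \<inter> V j"
    proof (rule image_subsetI)
      fix \<tau> assume \<tau>: "\<tau> \<in> {s..t}"
      then have "\<tau> \<in> {0..l}" "\<bar>\<tau> - r\<bar> < d" using st d(1) by (auto simp: s_def t_def)
      then show "\<gamma> \<tau> \<in> V i \<inter> V j" using d(2) c by (auto simp: curve_in_def image_subset_iff)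
    qed
    then have "\<forall>\<tau>\<in>{0..t - s}. F i (subcurve \<gamma> s \<tau>) = F j (subcurve \<gamma> s \<tau>)" using Pj st by blast
    from this[rule_format, of "r - s"] have "F i (\<gamma> r) = F j (\<gamma> r)" using st by (simp add: subcurve_def)
    then show "patch (\<gamma> r) = F i (\<gamma> r)" by (simp add: patch_def j_def)
  qed
qed

lemma patch_AE: "AE x in lborel. x \<in> U \<longrightarrow> patch x = u x"
proof (rule AE_pieces)
  fix i
  have "AE x in lborel. \<forall>i. x \<in> V i \<longrightarrow> u x = F i x" using uF by (simp add: AE_all_countable)
  then show "AE x in lborel. x \<in> V i \<longrightarrow> patch x = u x"
  proof eventually_elim
    case (elim x)
    show ?case
    proof
      assume "x \<in> V i"
      then have "x \<in> V (SOME i. x \<in> V i)" by (rule someI)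
      then show "patch x = u x" using elim by (simp add: patch_def)
    qed
  qed
qed

lemma eabs_pow_norm:
  assumes "AE x in lborel. x \<in> U \<longrightarrow> v x = ereal (u x)"
  shows "(\<integral>\<^sup>+ x\<in>U. eabs_pow (v x) p \<partial>lebesgue) = (\<integral>\<^sup>+ x\<in>U. ennreal (\<bar>u x\<bar> powr p) \<partial>lebesgue)"
  unfolding nn_integral_lebesgue using assms
  by (intro nn_integral_cong_AE, eventually_elim) (auto simp: indicator_def eabs_pow_def)

text \<open>Both densities are finite almost everywhere, so the perturbations tend to h pointwise,
  and the perturbation with factor 1 dominates all of them.\<close>

lemma ug_norm_limit:
  assumes h: "Lpb p h" and \<rho>: "Lpb p \<rho>"
  shows "(\<lambda>n. \<integral>\<^sup>+x. epow (h x + ennreal (1 / real (Suc n)) * \<rho> x) p \<partial>lborel) \<longlonglongrightarrow> (\<integral>\<^sup>+x. epow (h x) p \<partial>lborel)"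
proof (rule nn_integral_dominated_convergence[where w="\<lambda>x. epow (h x + \<rho> x) p"])
  have [measurable]: "h \<in> borel_measurable borel" "\<rho> \<in> borel_measurable borel" using h \<rho> by (auto simp: Lpb_def)
  show "(\<lambda>x. epow (h x + ennreal (1 / real (Suc n)) * \<rho> x) p) \<in> borel_measurable lborel" for n by measurable
  show "(\<lambda>x. epow (h x) p) \<in> borel_measurable lborel" "(\<lambda>x. epow (h x + \<rho> x) p) \<in> borel_measurable lborel" by measurable
  show "(\<integral>\<^sup>+x. epow (h x + \<rho> x) p \<partial>lborel) < \<infinity>" using Lpb_add[OF h \<rho>] p0 by (simp add: Lpb_def)
  show "AE x in lborel. epow (h x + ennreal (1 / real (Suc n)) * \<rho> x) p \<le> epow (h x + \<rho> x) p" for n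
  proof (intro AE_I2 epow_mono add_left_mono)
    fix x
    have "ennreal (1 / real (Suc n)) * \<rho> x \<le> ennreal 1 * \<rho> x" by (intro mult_right_mono ennreal_leI) auto
    then show "ennreal (1 / real (Suc n)) * \<rho> x \<le> \<rho> x" by simp
  qed (use p0 in auto)
  show "AE x in lborel. (\<lambda>n. epow (h x + ennreal (1 / real (Suc n)) * \<rho> x) p) \<longlonglongrightarrow> epow (h x) p"
    using Lpb_AE_finite[OF p0 h] Lpb_AE_finite[OF p0 \<rho>]
  proof eventually_elim
    case (elim x)
    obtain a where a: "h x = ennreal a" "0 \<le> a" using elim(1) by (cases "h x") auto
    obtain b where b: "\<rho> x = ennreal b" "0 \<le> b" using elim(2) by (cases "\<rho> x") auto
    have "epow (h x + ennreal (1 / real (Suc n)) * \<rho> x) p = ennreal ((a + 1 / real (Suc n) * b) powr p)" for n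
    proof -
      have "h x + ennreal (1 / real (Suc n)) * \<rho> x = ennreal (a + 1 / real (Suc n) * b)"
        unfolding a(1) b(1) using a(2) b(2) by (subst ennreal_plus) (simp_all add: ennreal_mult'[symmetric])
      moreover have "0 \<le> a + 1 / real (Suc n) * b" using a(2) b(2) by simp
      ultimately show ?thesis by (simp only: epow_ennreal)
    qed
    moreover have "(\<lambda>n. (a + 1 / real (Suc n) * b) powr p) \<longlonglongrightarrow> a powr p"
    proof (rule tendsto_powr2[OF _ tendsto_const])
      have "(\<lambda>n. 1 / real (Suc n)) \<longlonglongrightarrow> 0" by real_asymp
      then have "(\<lambda>n. a + 1 / real (Suc n) * b) \<longlonglongrightarrow> a + 0 * b" by (intro tendsto_intros)
      then show "(\<lambda>n. a + 1 / real (Suc n) * b) \<longlonglongrightarrow> a" by simp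
    qed (use a(2) b(2) p0 in auto)
    ultimately show ?case using a by (simp add: tendsto_ennrealI)
  qed
qed

text \<open>Every positive multiple of the density has infinite integral on the exceptional curves,
  so adding it turns an inequality on almost every curve into one on every curve.\<close>

lemma upper_gradient_perturb:
  assumes h: "Lpb p h" and pae: "pae p U (\<lambda>\<gamma> l. ediff (v (\<gamma> 0)) (v (\<gamma> l)) \<le> line_int h \<gamma> l)"
  obtains \<rho> where "Lpb p \<rho>" "\<And>\<epsilon>. 0 < \<epsilon> \<Longrightarrow> upper_gradient U v (\<lambda>x. h x + ennreal \<epsilon> * \<rho> x)"
proof -
  obtain \<rho> where \<rho>: "Lpb p \<rho>" "\<And>\<gamma> l. curve_in \<gamma> l U \<Longrightarrow> line_int \<rho> \<gamma> l < \<infinity> \<Longrightarrow> ediff (v (\<gamma> 0)) (v (\<gamma> l)) \<le> line_int h \<gamma> l"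
    using pae by (auto simp: pae_def)
  have m: "h \<in> borel_measurable borel" "\<rho> \<in> borel_measurable borel" using h \<rho>(1) by (auto simp: Lpb_def)
  have "upper_gradient U v (\<lambda>x. h x + ennreal \<epsilon> * \<rho> x)" if "0 < \<epsilon>" for \<epsilon>
    unfolding upper_gradient_def
  proof (intro conjI allI impI)
    show "(\<lambda>x. h x + ennreal \<epsilon> * \<rho> x) \<in> borel_measurable borel" using m by measurable
    fix \<gamma> l assume c: "curve_in \<gamma> l U"
    then have ac: "arc_curve \<gamma> l" by (simp add: curve_in_def)
    have eq: "line_int (\<lambda>x. h x + ennreal \<epsilon> * \<rho> x) \<gamma> l = line_int h \<gamma> l + ennreal \<epsilon> * line_int \<rho> \<gamma> l"
      unfolding line_int_cint using m by (simp add: cint_add[OF ac] cint_cmult[OF ac])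
    show "ediff (v (\<gamma> 0)) (v (\<gamma> l)) \<le> line_int (\<lambda>x. h x + ennreal \<epsilon> * \<rho> x) \<gamma> l"
    proof (cases "line_int \<rho> \<gamma> l < \<infinity>")
      case True
      then show ?thesis unfolding eq using \<rho>(2)[OF c] by (simp add: add_increasing2)
    next
      case False
      then have "line_int \<rho> \<gamma> l = \<infinity>" by (simp add: not_less top_unique)
      then show ?thesis unfolding eq using that by (simp add: ennreal_mult_top)
    qed
  qed
  then show ?thesis using that \<rho>(1) by blast
qed

text \<open>The upper bound comes from the genuine upper gradients h + \<rho>/(n+1), the lower bound
  from \<open>minimal\<close> applied to an arbitrary upper gradient of finite p-integral.\<close>

lemma inf_upper_gradients:
  assumes v: "AE x in lborel. x \<in> U \<longrightarrow> v x = ereal (u x)"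
    and h: "Lpb p h" "(\<integral>\<^sup>+x. epow (h x) p \<partial>lborel) = (\<integral>\<^sup>+x\<in>U. ennreal (norm (Du x) powr p) \<partial>lebesgue)"
    and pae: "pae p U (\<lambda>\<gamma> l. ediff (v (\<gamma> 0)) (v (\<gamma> l)) \<le> line_int h \<gamma> l)"
  shows "(INF g \<in> {g. upper_gradient U v g}. (\<integral>\<^sup>+ x\<in>U. epow (g x) p \<partial>lebesgue)) = (\<integral>\<^sup>+x\<in>U. ennreal (norm (Du x) powr p) \<partial>lebesgue)"
proof (rule antisym)
  obtain \<rho> where \<rho>: "Lpb p \<rho>" "\<And>\<epsilon>. 0 < \<epsilon> \<Longrightarrow> upper_gradient U v (\<lambda>x. h x + ennreal \<epsilon> * \<rho> x)"
    using upper_gradient_perturb[OF h(1) pae] by blast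
  have "(INF g \<in> {g. upper_gradient U v g}. (\<integral>\<^sup>+ x\<in>U. epow (g x) p \<partial>lebesgue)) \<le> (\<integral>\<^sup>+x. epow (h x + ennreal (1 / real (Suc n)) * \<rho> x) p \<partial>lborel)" for n
  proof -
    have "(INF g \<in> {g. upper_gradient U v g}. (\<integral>\<^sup>+ x\<in>U. epow (g x) p \<partial>lebesgue)) \<le> (\<integral>\<^sup>+ x\<in>U. epow (h x + ennreal (1 / real (Suc n)) * \<rho> x) p \<partial>lebesgue)"
      by (rule INF_lower) (use \<rho>(2)[of "1 / real (Suc n)"] in simp)
    also have "\<dots> \<le> (\<integral>\<^sup>+x. epow (h x + ennreal (1 / real (Suc n)) * \<rho> x) p \<partial>lborel)"
      unfolding nn_integral_lebesgue by (intro nn_integral_mono) (auto simp: indicator_def)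
    finally show ?thesis .
  qed
  then have "(INF g \<in> {g. upper_gradient U v g}. (\<integral>\<^sup>+ x\<in>U. epow (g x) p \<partial>lebesgue)) \<le> (\<integral>\<^sup>+x. epow (h x) p \<partial>lborel)"
    by (intro LIMSEQ_le_const[OF ug_norm_limit[OF h(1) \<rho>(1)]]) auto
  then show "(INF g \<in> {g. upper_gradient U v g}. (\<integral>\<^sup>+ x\<in>U. epow (g x) p \<partial>lebesgue)) \<le> (\<integral>\<^sup>+x\<in>U. ennreal (norm (Du x) powr p) \<partial>lebesgue)"
    unfolding h(2) .
  show "(\<integral>\<^sup>+x\<in>U. ennreal (norm (Du x) powr p) \<partial>lebesgue) \<le> (INF g \<in> {g. upper_gradient U v g}. (\<integral>\<^sup>+ x\<in>U. epow (g x) p \<partial>lebesgue))"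
  proof (rule INF_greatest)
    fix g assume "g \<in> {g. upper_gradient U v g}"
    then have g: "upper_gradient U v g" by simp
    show "(\<integral>\<^sup>+x\<in>U. ennreal (norm (Du x) powr p) \<partial>lebesgue) \<le> (\<integral>\<^sup>+ x\<in>U. epow (g x) p \<partial>lebesgue)"
    proof (cases "(\<integral>\<^sup>+ x\<in>U. epow (g x) p \<partial>lebesgue) < \<infinity>")
      case True
      obtain g' where g': "Lpb p g'" "AE x in lborel. x \<in> U \<longrightarrow> g' x = g x" "\<And>x. x \<in> U \<Longrightarrow> g x \<le> g' x"
        "pae p U (\<lambda>\<gamma> l. (\<forall>t\<in>{0..l}. \<bar>v (\<gamma> t)\<bar> \<noteq> \<infinity>) \<and> ugc (\<lambda>x. real_of_ereal (v x)) g' \<gamma> l)"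
        using N1p_real_ugc[OF p0 U g True] by blast
      have "AE x in lborel. x \<in> U \<longrightarrow> ennreal (norm (Du x)) \<le> g' x"
        by (rule minimal[OF g'(1) pae_mono[OF g'(4)]]) (use v in \<open>auto elim!: eventually_mono\<close>)
      with g'(2) have "AE x in lborel. x \<in> U \<longrightarrow> ennreal (norm (Du x)) \<le> g x" by eventually_elim auto
      then show ?thesis unfolding nn_integral_lebesgue
      proof (intro nn_integral_mono_AE, eventually_elim)
        case (elim x)
        show ?case
        proof (cases "x \<in> U")
          case True
          then have "epow (ennreal (norm (Du x))) p \<le> epow (g x) p" using elim p0 by (intro epow_mono) auto
          then show ?thesis using True by simp
        qed simp
      qed
    qed (auto simp: not_less top_unique)
  qed
qed

text \<open>Membership supplies some p-integrable upper gradient, through which v is identified with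
  the representatives along almost every curve. \<open>glue_ugc\<close> then puts the envelope h of
  |Du| in its place, and \<open>minimal\<close> compares it with every competitor.\<close>

lemma N1p_properties:
  assumes v: "v \<in> N1p p U" "AE x in lborel. x \<in> U \<longrightarrow> v x = ereal (u x)"
  shows "minimal_pwug p U v (\<lambda>x. ennreal (norm (Du x)))"
    "N1p_normp p U v = (\<integral>\<^sup>+ x\<in>U. ennreal (\<bar>u x\<bar> powr p + norm (Du x) powr p) \<partial>lebesgue)"
proof -
  let ?v = "\<lambda>x. real_of_ereal (v x)"
  have vu: "AE x in lborel. x \<in> U \<longrightarrow> ?v x = u x" using v(2) by eventually_elim auto
  obtain g0 where "upper_gradient U v g0" "(\<integral>\<^sup>+ x\<in>U. eabs_pow (v x) p \<partial>lebesgue) + (\<integral>\<^sup>+ x\<in>U. epow (g0 x) p \<partial>lebesgue) < \<infinity>"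
    using N1p_normp_less[of p U v \<infinity>] v(1) by (auto simp: N1p_def)
  then obtain g where g: "Lpb p g"
    "pae p U (\<lambda>\<gamma> l. (\<forall>t\<in>{0..l}. \<bar>v (\<gamma> t)\<bar> \<noteq> \<infinity>) \<and> ugc ?v g \<gamma> l)"
    using N1p_real_ugc[OF p0 U, of v g0] by auto
  obtain h where h: "Lpb p h" "\<And>x. x \<in> U \<Longrightarrow> ennreal (norm (Du x)) \<le> h x"
    "AE x in lborel. h x = ennreal (norm (Du x)) * indicator U x"
    "(\<integral>\<^sup>+x. epow (h x) p \<partial>lborel) = (\<integral>\<^sup>+x\<in>U. ennreal (norm (Du x) powr p) \<partial>lebesgue)"
    using envelope by blast
  have hU: "AE x in lborel. x \<in> U \<longrightarrow> h x = ennreal (norm (Du x))" using h(3) by eventually_elim auto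
  have gu: "pae p U (ugc ?v g)" by (rule pae_mono[OF g(2)]) simp
  have uh: "pae p U (ugc ?v h)" by (rule glue_ugc[OF h(1) hU pieces_eq[OF g(1) gu vu]])
  have eh: "pae p U (\<lambda>\<gamma> l. ediff (v (\<gamma> 0)) (v (\<gamma> l)) \<le> line_int h \<gamma> l)"
  proof (rule pae_mono[OF pae_conj[OF p0 g(2) uh]])
    fix \<gamma> l assume c: "curve_in \<gamma> l U" and P: "((\<forall>t\<in>{0..l}. \<bar>v (\<gamma> t)\<bar> \<noteq> \<infinity>) \<and> ugc ?v g \<gamma> l) \<and> ugc ?v h \<gamma> l"
    have l: "0 < l" using c arc_curve_pos by (auto simp: curve_in_def image_subset_iff)
    have f: "v (\<gamma> 0) = ereal (?v (\<gamma> 0))" "v (\<gamma> l) = ereal (?v (\<gamma> l))" using P l by (auto simp: ereal_real')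
    have "ediff (v (\<gamma> 0)) (v (\<gamma> l)) = ennreal \<bar>?v (\<gamma> 0) - ?v (\<gamma> l)\<bar>" by (subst f(1), subst f(2)) simp
    also have "\<dots> \<le> cint h \<gamma> 0 l" using P l by (intro ugcD[of ?v h]) auto
    finally show "ediff (v (\<gamma> 0)) (v (\<gamma> l)) \<le> line_int h \<gamma> l" by (simp add: line_int_cint)
  qed
  have "p_weak_upper_gradient p U v (\<lambda>x. ennreal (norm (Du x)))"
  proof (rule p_weak_upper_gradientI[OF p0 Du_measurable], rule pae_mono[OF pae_conj[OF p0 eh pae_AE[OF hU]]])
    fix \<gamma> l assume c: "curve_in \<gamma> l U" and P: "ediff (v (\<gamma> 0)) (v (\<gamma> l)) \<le> line_int h \<gamma> l \<and>
      (AE t in lborel. t \<in> {0..l} \<longrightarrow> (\<gamma> t \<in> U \<longrightarrow> h (\<gamma> t) = ennreal (norm (Du (\<gamma> t)))))"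
    have "line_int h \<gamma> l \<le> line_int (\<lambda>x. ennreal (norm (Du x))) \<gamma> l"
      unfolding line_int_cint
    proof (rule cint_mono_AE)
      have "AE t in lborel. t \<in> {0..l} \<longrightarrow> (\<gamma> t \<in> U \<longrightarrow> h (\<gamma> t) = ennreal (norm (Du (\<gamma> t))))" using P by blast
      then show "AE t in lborel. t \<in> {0..l} \<longrightarrow> h (\<gamma> t) \<le> ennreal (norm (Du (\<gamma> t)))"
        by eventually_elim (use c in \<open>auto simp: curve_in_def image_subset_iff\<close>)
    qed
    then show "ediff (v (\<gamma> 0)) (v (\<gamma> l)) \<le> line_int (\<lambda>x. ennreal (norm (Du x))) \<gamma> l" using P order_trans by blast
  qed
  moreover have "(\<integral>\<^sup>+ x\<in>U. epow (ennreal (norm (Du x))) p \<partial>lebesgue) < \<infinity>" using LpDu by (simp add: Lp_on_def)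
  moreover have "AE x in lebesgue. x \<in> U \<longrightarrow> ennreal (norm (Du x)) \<le> g' x"
    if g': "p_weak_upper_gradient p U v g'" "(\<integral>\<^sup>+ x\<in>U. epow (g' x) p \<partial>lebesgue) < \<infinity>" for g'
  proof -
    have "g' \<in> borel_measurable (restrict_space lebesgue U)" using g' by (simp add: p_weak_upper_gradient_def)
    from Lpb_envelope[OF U this, of p] obtain b where b: "b \<in> borel_measurable borel" "\<And>x. x \<in> U \<Longrightarrow> g' x \<le> b x"
      "AE x in lborel. b x = g' x * indicator U x" "(\<integral>\<^sup>+x. epow (b x) p \<partial>lborel) = (\<integral>\<^sup>+x\<in>U. epow (g' x) p \<partial>lebesgue)" by blast
    have Lb: "Lpb p b" using b g'(2) by (simp add: Lpb_def)
    have "pae p U (\<lambda>\<gamma> l. ediff (v (\<gamma> 0)) (v (\<gamma> l)) \<le> line_int b \<gamma> l)"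
    proof (rule pae_mono[OF p_weak_upper_gradientD[OF p0 U g'(1)]])
      fix \<gamma> l assume c: "curve_in \<gamma> l U" and e: "ediff (v (\<gamma> 0)) (v (\<gamma> l)) \<le> line_int g' \<gamma> l"
      have "line_int g' \<gamma> l \<le> line_int b \<gamma> l"
        unfolding line_int_cint using c by (intro cint_mono b(2)) (auto simp: curve_in_def image_subset_iff)
      then show "ediff (v (\<gamma> 0)) (v (\<gamma> l)) \<le> line_int b \<gamma> l" using e by (rule order_trans[rotated])
    qed
    from pae_ereal_ugc[OF p0 Lb this] have "pae p U (ugc ?v b)" by (rule pae_mono) simp
    from minimal[OF Lb this vu] b(3) show ?thesis
      unfolding AE_lebesgue_iff by eventually_elim auto
  qed
  ultimately show "minimal_pwug p U v (\<lambda>x. ennreal (norm (Du x)))" unfolding minimal_pwug_def by blast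
  have um: "(\<lambda>x. ennreal (\<bar>u x\<bar> powr p) * indicator U x) \<in> borel_measurable lebesgue"
  proof -
    have "(\<lambda>x. ennreal (\<bar>indicator U x * u x\<bar> powr p)) \<in> borel_measurable lebesgue" using u_measurable by measurable
    also have "(\<lambda>x. ennreal (\<bar>indicator U x * u x\<bar> powr p)) = (\<lambda>x. ennreal (\<bar>u x\<bar> powr p) * indicator U x)"
      by (auto simp: indicator_def fun_eq_iff)
    finally show ?thesis .
  qed
  have Dm: "(\<lambda>x. ennreal (norm (Du x) powr p) * indicator U x) \<in> borel_measurable lebesgue"
  proof -
    have "(\<lambda>x. indicator U x *\<^sub>R Du x) \<in> borel_measurable lebesgue"
      using LpDu by (simp add: Lp_on_def set_borel_measurable_def)
    then have "(\<lambda>x. ennreal (norm (indicator U x *\<^sub>R Du x) powr p)) \<in> borel_measurable lebesgue" by measurable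
    also have "(\<lambda>x. ennreal (norm (indicator U x *\<^sub>R Du x) powr p)) = (\<lambda>x. ennreal (norm (Du x) powr p) * indicator U x)"
      by (auto simp: indicator_def fun_eq_iff)
    finally show ?thesis .
  qed
  have "N1p_normp p U v = (\<integral>\<^sup>+ x\<in>U. ennreal (\<bar>u x\<bar> powr p) \<partial>lebesgue) + (\<integral>\<^sup>+x\<in>U. ennreal (norm (Du x) powr p) \<partial>lebesgue)"
    unfolding N1p_normp_def eabs_pow_norm[OF v(2)] inf_upper_gradients[OF v(2) h(1,4) eh] ..
  also have "\<dots> = (\<integral>\<^sup>+ x. ennreal (\<bar>u x\<bar> powr p) * indicator U x + ennreal (norm (Du x) powr p) * indicator U x \<partial>lebesgue)"
    using um Dm by (rule nn_integral_add[symmetric])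
  also have "\<dots> = (\<integral>\<^sup>+ x\<in>U. ennreal (\<bar>u x\<bar> powr p + norm (Du x) powr p) \<partial>lebesgue)"
    by (intro nn_integral_cong) (auto simp: indicator_def)
  finally show "N1p_normp p U v = (\<integral>\<^sup>+ x\<in>U. ennreal (\<bar>u x\<bar> powr p + norm (Du x) powr p) \<partial>lebesgue)" .
qed

lemma patch_N1p: "(\<lambda>x. ereal (patch x)) \<in> N1p p U"
proof -
  obtain h where h: "Lpb p h" "\<And>x. x \<in> U \<Longrightarrow> ennreal (norm (Du x)) \<le> h x"
    "AE x in lborel. h x = ennreal (norm (Du x)) * indicator U x"
    using envelope by blast
  have hU: "AE x in lborel. x \<in> U \<longrightarrow> h x = ennreal (norm (Du x))" using h(3) by eventually_elim auto
  have "pae p U (ugc patch h)" by (rule glue_ugc[OF h(1) hU patch_eq])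
  then have "pae p U (\<lambda>\<gamma> l. ediff (ereal (patch (\<gamma> 0))) (ereal (patch (\<gamma> l))) \<le> line_int h \<gamma> l)"
  proof (rule pae_mono)
    fix \<gamma> l assume c: "curve_in \<gamma> l U" and P: "ugc patch h \<gamma> l"
    have "0 < l" using c arc_curve_pos by (auto simp: curve_in_def image_subset_iff)
    then show "ediff (ereal (patch (\<gamma> 0))) (ereal (patch (\<gamma> l))) \<le> line_int h \<gamma> l"
      using ugcD[OF P, of 0 l] by (simp add: line_int_cint)
  qed
  from upper_gradient_perturb[OF h(1) this] obtain \<rho> where \<rho>: "Lpb p \<rho>"
    "\<And>\<epsilon>. 0 < \<epsilon> \<Longrightarrow> upper_gradient U (\<lambda>x. ereal (patch x)) (\<lambda>x. h x + ennreal \<epsilon> * \<rho> x)" by blast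
  have "(INF g \<in> {g. upper_gradient U (\<lambda>x. ereal (patch x)) g}. (\<integral>\<^sup>+ x\<in>U. epow (g x) p \<partial>lebesgue)) \<le> (\<integral>\<^sup>+ x\<in>U. epow (h x + ennreal 1 * \<rho> x) p \<partial>lebesgue)"
    by (rule INF_lower) (use \<rho>(2)[of 1] in simp)
  also have "\<dots> \<le> (\<integral>\<^sup>+x. epow (h x + \<rho> x) p \<partial>lborel)"
    unfolding nn_integral_lebesgue by (intro nn_integral_mono) (auto simp: indicator_def)
  also have "\<dots> < \<infinity>" using Lpb_add[OF h(1) \<rho>(1)] p0 by (simp add: Lpb_def)
  finally have 1: "(INF g \<in> {g. upper_gradient U (\<lambda>x. ereal (patch x)) g}. (\<integral>\<^sup>+ x\<in>U. epow (g x) p \<partial>lebesgue)) < \<infinity>" .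
  have 2: "(\<integral>\<^sup>+ x\<in>U. eabs_pow (ereal (patch x)) p \<partial>lebesgue) < \<infinity>"
    using eabs_pow_norm[of "\<lambda>x. ereal (patch x)"] patch_AE Lpu by (simp add: Lp_on_def)
  have "(\<lambda>x. indicator U x * patch x) \<in> borel_measurable lebesgue"
    by (rule measurable_AE_eq_lebesgue[OF u_measurable]) (use patch_AE in \<open>auto simp: indicator_def elim!: eventually_mono\<close>)
  then have "patch \<in> borel_measurable (restrict_space lebesgue U)"
    using U by (subst borel_measurable_restrict_space_iff) (auto simp: mult.commute)
  then show ?thesis using 1 2 by (auto simp: N1p_def N1p_normp_def)
qed

end

section \<open>From the Kilpelainen-Maly space to Newtonian functions\<close>

text \<open>Mollification with radius at most r at points of the ball stays within the ball of twice
  the radius, hence in G.\<close>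

lemma classical_ball_representative:
  assumes p: "1 \<le> p" and f: "Lp p f" "Lp p Df" "weak_grad G f Df" and r: "0 < r" "ball q (2 * r) \<subseteq> G"
  obtains F where "AE x in lborel. F x = f x" "pae p (ball q r) (\<lambda>\<gamma> l. ugc F (\<lambda>x. ennreal (norm (Df x))) \<gamma> l \<and> line_ftc F Df \<gamma> l)"
proof -
  have "cball x r \<subseteq> G" if "x \<in> ball q r" for x
  proof -
    have "cball x r \<subseteq> ball q (2 * r)"
    proof
      fix y assume "y \<in> cball x r"
      then show "y \<in> ball q (2 * r)" using that dist_triangle[of q y x] by (auto simp: dist_commute)
    qed
    then show ?thesis using r by blast
  qed
  then obtain fk Fk where "fast_seq p (ball q r) f Df fk Fk"
    using fast_seq_exists[OF p f r(1), of "ball q r"] by blast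
  then interpret fast_seq p "ball q r" f Df fk Fk .
  show ?thesis by (rule that[OF flim_AE flim_pae])
qed

definition dense_seq :: "nat \<Rightarrow> 'a::euclidean_space" where
  "dense_seq = from_nat_into (SOME D. countable D \<and> closure D = UNIV)"

lemma dense_seq:
  fixes x :: "'a::euclidean_space"
  assumes "0 < e" obtains n where "dist (dense_seq n) x < e"
proof -
  obtain D0 :: "'a set" where "countable D0" "closure D0 = UNIV" by (rule countable_closure_UNIV)
  then have ex: "countable D0 \<and> closure D0 = UNIV" by blast
  define D :: "'a set" where "D = (SOME D. countable D \<and> closure D = UNIV)"
  have D: "countable D" "closure D = UNIV" unfolding D_def using someI[of "\<lambda>D. countable D \<and> closure D = UNIV", OF ex] by auto
  then have ne: "D \<noteq> {}" by auto
  obtain y where y: "y \<in> D" "dist y x < e" using D(2) assms by (metis UNIV_I closure_approachable)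
  then obtain n where "from_nat_into D n = y" using from_nat_into_surj[OF D(1)] by blast
  then show ?thesis using that[of n] y by (simp add: dense_seq_def D_def)
qed

lemma dense_balls:
  fixes x :: "'a::euclidean_space"
  assumes "open G" "x \<in> G"
  obtains m n where "x \<in> ball (dense_seq m) (1 / real (Suc n))" "ball (dense_seq m) (2 * (1 / real (Suc n))) \<subseteq> G"
proof -
  obtain e where e: "0 < e" "ball x e \<subseteq> G" using assms open_contains_ball by blast
  \<comment> \<open>If x lies within r of the centre, the doubled ball is contained in the ball of
    radius 3r about x, hence the third.\<close>
  obtain n where n: "1 / real (Suc n) < e / 3" using e(1) nat_approx_posE[of "e/3"] by auto
  let ?r = "1 / real (Suc n)"
  have r: "0 < ?r" by simp
  obtain m where m: "dist (dense_seq m) x < ?r" using dense_seq[OF r] by blast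
  have "ball (dense_seq m) (2 * ?r) \<subseteq> ball x e"
  proof
    fix y :: 'a assume "y \<in> ball (dense_seq m) (2 * ?r)"
    then have "dist (dense_seq m) y < 2 * ?r" by simp
    moreover have "dist x y \<le> dist x (dense_seq m) + dist (dense_seq m) y" by (rule dist_triangle)
    moreover have "dist x (dense_seq m) < ?r" using m by (simp add: dist_commute)
    ultimately have "dist x y < e" using n by linarith
    then show "y \<in> ball x e" by simp
  qed
  then show ?thesis using that[of m n] m e(2) by auto
qed

lemma path_open_Int_open:
  assumes "path_open p UNIV V" "open B"
  shows "path_open p UNIV (V \<inter> B)"
proof (rule pae_mono[OF assms(1)])
  fix \<gamma> l assume c: "curve_in \<gamma> l (UNIV::'a set)" and o: "openin (top_of_set {0..l}) {t \<in> {0..l}. \<gamma> t \<in> V}"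
  have "openin (top_of_set {0..l}) ({0..l} \<inter> \<gamma> -` B)"
    using c assms(2) arc_curve_continuous by (intro continuous_openin_preimage_gen) (auto simp: curve_in_def image_subset_iff)
  from openin_Int[OF o this] show "openin (top_of_set {0..l}) {t \<in> {0..l}. \<gamma> t \<in> V \<inter> B}"
    by (rule back_subst[of "openin (top_of_set {0..l})"]) auto
qed

lemma path_open_empty: "path_open p UNIV {}"
  by (auto simp: pae_def Lpb_def intro!: exI[of _ "\<lambda>_. 0"])

lemma pae_empty: "pae p {} P"
proof -
  have "\<not> curve_in \<gamma> l {}" for \<gamma> :: "real \<Rightarrow> 'a" and l
    using arc_curve_pos[of \<gamma> l] by (auto simp: curve_in_def image_subset_iff)
  then show ?thesis unfolding pae_def by (intro exI[of _ "\<lambda>_. 0"]) (auto simp: Lpb_def)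
qed

text \<open>A good representative is available on balls whose doubles lie in the open set of a
  piece, so each member of the quasicovering is cut up by countably many small balls. Triples that
  do not qualify receive the empty piece, which keeps the full product as index type.\<close>

lemma KM_gradient_system:
  fixes U :: "'a::euclidean_space set"
  assumes p: "1 < p" and U: "U \<in> sets lebesgue" and KM: "KM_W1p p U u Du"
  obtains V :: "nat \<times> nat \<times> nat \<Rightarrow> 'a set" and F DF where "gradient_system p U V F DF u Du"
proof -
  have p0: "0 < p" and p1: "1 \<le> p" using p by auto
  have Lp_on: "Lp_on p U u" "Lp_on p U Du" using KM by (auto simp: KM_W1p_def)
  obtain \<B> where \<B>: "quasicovering p U \<B>"
    "\<And>V. V \<in> \<B> \<Longrightarrow> \<exists>G w Dw. open G \<and> V \<subseteq> G \<and> classical_W1p p G w Dw \<and>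
       (AE x in lebesgue. x \<in> V \<longrightarrow> u x = w x) \<and> (AE x in lebesgue. x \<in> V \<longrightarrow> Du x = Dw x)"
    using KM unfolding KM_W1p_def by blast
  have qc: "countable \<B>" "\<And>V. V \<in> \<B> \<Longrightarrow> quasiopen p V" "\<Union>\<B> \<subseteq> U" "Cp p (U - \<Union>\<B>) = 0"
    using \<B>(1) by (auto simp: quasicovering_def)
  define R where "R V T \<longleftrightarrow> open (fst T) \<and> V \<subseteq> fst T \<and> Lp p (fst (snd T)) \<and> Lp p (snd (snd T)) \<and>
      weak_grad (fst T) (fst (snd T)) (snd (snd T)) \<and>
      (AE x in lborel. x \<in> V \<longrightarrow> u x = fst (snd T) x) \<and> (AE x in lborel. x \<in> V \<longrightarrow> Du x = snd (snd T) x)" for V T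
  have "\<forall>V\<in>\<B>. \<exists>T. R V T"
  proof
    fix V assume V: "V \<in> \<B>"
    obtain G w Dw where G: "open G" "V \<subseteq> G" "classical_W1p p G w Dw"
      "AE x in lborel. x \<in> V \<longrightarrow> u x = w x" "AE x in lborel. x \<in> V \<longrightarrow> Du x = Dw x"
      using \<B>(2)[OF V] unfolding AE_lebesgue_iff by blast
    obtain f Df where f: "Lp p f" "Lp p Df" "weak_grad G f Df"
      "AE x in lborel. x \<in> G \<longrightarrow> w x = f x" "AE x in lborel. x \<in> G \<longrightarrow> Dw x = Df x"
      using classical_W1p_borel[OF G(3)] by blast
    have "AE x in lborel. x \<in> V \<longrightarrow> u x = f x" using G(4) f(4) by eventually_elim (use G(2) in auto)
    moreover have "AE x in lborel. x \<in> V \<longrightarrow> Du x = Df x" using G(5) f(5) by eventually_elim (use G(2) in auto)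
    ultimately have "R V (G, f, Df)" unfolding R_def fst_conv snd_conv using G(1,2) f(1,2,3) by (intro conjI)
    then show "\<exists>T. R V T" by blast
  qed
  from bchoice[OF this] obtain T where T: "\<And>V. V \<in> \<B> \<Longrightarrow> R V (T V)" by blast
  define G f Df where "G = (\<lambda>V. fst (T V))" and "f = (\<lambda>V. fst (snd (T V)))" and "Df = (\<lambda>V. snd (snd (T V)))"
  have G: "\<And>V. V \<in> \<B> \<Longrightarrow> open (G V)" "\<And>V. V \<in> \<B> \<Longrightarrow> V \<subseteq> G V" "\<And>V. V \<in> \<B> \<Longrightarrow> Lp p (f V)"
    "\<And>V. V \<in> \<B> \<Longrightarrow> Lp p (Df V)" "\<And>V. V \<in> \<B> \<Longrightarrow> weak_grad (G V) (f V) (Df V)"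
    "\<And>V. V \<in> \<B> \<Longrightarrow> AE x in lborel. x \<in> V \<longrightarrow> u x = f V x" "\<And>V. V \<in> \<B> \<Longrightarrow> AE x in lborel. x \<in> V \<longrightarrow> Du x = Df V x"
    using T[unfolded R_def] unfolding G_def f_def Df_def by simp_all
  define W where "W = (\<lambda>n::nat. from_nat_into \<B> n)"
  \<comment> \<open>The first conjunct guards \<open>from_nat_into\<close>, whose values are members
    of \<B> only if \<B> is nonempty.\<close>
  define ok where "ok = (\<lambda>(i, m, n). \<B> \<noteq> {} \<and> ball (dense_seq m) (2 * (1 / real (Suc n))) \<subseteq> G (W i))"
  have W: "W i \<in> \<B>" if "ok (i, m, n)" for i m n using that by (auto simp: ok_def W_def from_nat_into)
  define B where "B = (\<lambda>(i::nat, m, n). ball (dense_seq m :: 'a) (1 / real (Suc n)))"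
  define S where "S z F \<longleftrightarrow> (AE x in lborel. F x = f (W (fst z)) x) \<and>
     pae p (B z) (\<lambda>\<gamma> l. ugc F (\<lambda>x. ennreal (norm (Df (W (fst z)) x))) \<gamma> l \<and> line_ftc F (Df (W (fst z))) \<gamma> l)" for z F
  have "\<forall>z\<in>Collect ok. \<exists>F. S z F"
  proof
    fix z assume z: "z \<in> Collect ok"
    obtain i m n where fields: "z = (i, m, n)" by (cases z)
    then have Wi: "W i \<in> \<B>" "ball (dense_seq m) (2 * (1 / real (Suc n))) \<subseteq> G (W i)" using W z by (auto simp: ok_def)
    have "0 < 1 / real (Suc n)" by simp
    from classical_ball_representative[OF p1 G(3)[OF Wi(1)] G(4)[OF Wi(1)] G(5)[OF Wi(1)] this Wi(2)]
    obtain F where "AE x in lborel. F x = f (W i) x"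
      "pae p (ball (dense_seq m) (1 / real (Suc n))) (\<lambda>\<gamma> l. ugc F (\<lambda>x. ennreal (norm (Df (W i) x))) \<gamma> l \<and> line_ftc F (Df (W i)) \<gamma> l)" .
    then have "S z F" unfolding S_def fields B_def prod.case fst_conv by (rule conjI)
    then show "\<exists>F. S z F" by blast
  qed
  from bchoice[OF this] obtain F where S: "\<And>z. ok z \<Longrightarrow> S z (F z)" by blast
  have F: "\<And>z. ok z \<Longrightarrow> AE x in lborel. F z x = f (W (fst z)) x"
    "\<And>z. ok z \<Longrightarrow> pae p (B z) (\<lambda>\<gamma> l. ugc (F z) (\<lambda>x. ennreal (norm (Df (W (fst z)) x))) \<gamma> l \<and> line_ftc (F z) (Df (W (fst z))) \<gamma> l)"
    using S[unfolded S_def] by simp_all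
  define V where "V = (\<lambda>z. if ok z then W (fst z) \<inter> B z else {})"
  define DF where "DF = (\<lambda>z. if ok z then Df (W (fst z)) else (\<lambda>_. 0))"
  have okW: "W (fst z) \<in> \<B>" if "ok z" for z using W that by (cases z) auto
  have UV: "(\<Union>z. V z) = \<Union>\<B>"
  proof
    show "(\<Union>z. V z) \<subseteq> \<Union>\<B>" using okW by (auto simp: V_def split: if_splits)
    show "\<Union>\<B> \<subseteq> (\<Union>z. V z)"
    proof
      fix x assume "x \<in> \<Union>\<B>"
      then obtain A where A: "A \<in> \<B>" "x \<in> A" by blast
      then obtain i where i: "W i = A" using from_nat_into_surj[OF qc(1)] by (auto simp: W_def)
      have "x \<in> G A" using G(2) A by blast
      then obtain m n where mn: "x \<in> ball (dense_seq m) (1 / real (Suc n))" "ball (dense_seq m) (2 * (1 / real (Suc n))) \<subseteq> G A"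
        using dense_balls[OF G(1)[OF A(1)]] by blast
      then have "ok (i, m, n)" using A i by (auto simp: ok_def)
      then have "x \<in> V (i, m, n)" using A i mn by (auto simp: V_def B_def)
      then show "x \<in> (\<Union>z. V z)" by blast
    qed
  qed
  have openB: "open (B z)" for z by (cases z) (simp add: B_def)
  have "gradient_system p U V F DF u Du"
  proof
    show "1 < p" "U \<in> sets lebesgue" "Lp_on p U u" "Lp_on p U Du" by fact+
    fix z
    show "V z \<subseteq> U" using UV qc(3) by blast
    show "path_open p UNIV (V z)"
    proof (cases "ok z")
      case True
      then show ?thesis using path_open_Int_open[OF quasiopen_path_open[OF p0 qc(2)[OF okW[OF True]]] openB[of z]] by (simp add: V_def)
    qed (use path_open_empty in \<open>simp add: V_def\<close>)
    show "pae p (V z) (ugc (F z) (\<lambda>x. ennreal (norm (DF z x))))"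
    proof (cases "ok z")
      case True
      have "pae p (B z) (ugc (F z) (\<lambda>x. ennreal (norm (DF z x))))"
        by (rule pae_mono[OF F(2)[OF True]]) (use True in \<open>auto simp: DF_def\<close>)
      then show ?thesis by (rule pae_subset) (use True in \<open>auto simp: V_def\<close>)
    qed (simp add: V_def pae_empty)
    show "pae p (V z) (line_ftc (F z) (DF z))"
    proof (cases "ok z")
      case True
      have "pae p (B z) (line_ftc (F z) (DF z))"
        by (rule pae_mono[OF F(2)[OF True]]) (use True in \<open>auto simp: DF_def\<close>)
      then show ?thesis by (rule pae_subset) (use True in \<open>auto simp: V_def\<close>)
    qed (simp add: V_def pae_empty)
    show "Lp p (DF z)" using G(4)[OF okW[of z]] by (cases "ok z") (auto simp: DF_def Lp_def pint_def)
    show "AE x in lborel. x \<in> V z \<longrightarrow> u x = F z x"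
    proof (cases "ok z")
      case True
      from G(6)[OF okW[OF True]] F(1)[OF True] show ?thesis by eventually_elim (auto simp: V_def)
    qed (simp add: V_def)
    show "AE x in lborel. x \<in> V z \<longrightarrow> Du x = DF z x"
    proof (cases "ok z")
      case True
      from G(7)[OF okW[OF True]] show ?thesis by eventually_elim (auto simp: V_def DF_def True)
    qed (simp add: V_def)
  next
    show "pae p UNIV (\<lambda>\<gamma> l. \<gamma> ` {0..l} \<inter> (U - (\<Union>i. V i)) = {})" unfolding UV by (rule pae_Cp_zero[OF p0 qc(4)])
    show "AE x in lborel. x \<notin> U - (\<Union>i. V i)" unfolding UV by (rule Cp_zero_AE[OF p0 qc(4)])
  qed
  then show ?thesis by (rule that)
qed

section \<open>From Newtonian functions to the Kilpelainen-Maly space\<close>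

definition quasicont :: "real \<Rightarrow> ('a::euclidean_space \<Rightarrow> real) \<Rightarrow> bool" where
  "quasicont p F \<longleftrightarrow> (\<forall>e>0. \<exists>A. open A \<and> Cp p A < ennreal e \<and> continuous_on (- A) F)"

text \<open>The inequality along segments bounds difference quotients and so yields a weak gradient;
  mollification then yields F. Both f and F satisfy upper gradient inequalities and agree almost
  everywhere, so almost every curve misses the set where they differ, and this null set has capacity
  zero.\<close>

lemma quasicontinuous_representative:
  fixes f :: "'a::euclidean_space \<Rightarrow> real"
  assumes p: "1 < p" and f: "f \<in> borel_measurable lebesgue" "(\<integral>\<^sup>+x. ennreal (\<bar>f x\<bar> powr p) \<partial>lborel) < \<infinity>"
    and b: "Lpb p b" and ug: "\<And>\<gamma> l. curve_in \<gamma> l UNIV \<Longrightarrow> ugc f b \<gamma> l"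
  obtains f' Df F where "classical_W1p p UNIV f' Df" "Lp p Df" "AE x in lborel. f x = f' x" "AE x in lborel. f x = F x"
    "quasicont p F" "pae p UNIV (ugc F (\<lambda>x. ennreal (norm (Df x))))" "pae p UNIV (line_ftc F Df)" "Cp p {x. f x \<noteq> F x} = 0"
proof -
  have p0: "0 < p" and p1: "1 \<le> p" using p by auto
  obtain f' where f': "f' \<in> borel_measurable borel" "AE x in lborel. f x = f' x" using borel_version[OF f(1)] by blast
  have "pint p f' = (\<integral>\<^sup>+x. ennreal (\<bar>f x\<bar> powr p) \<partial>lborel)"
    unfolding pint_def using f'(2) by (intro nn_integral_cong_AE, eventually_elim) simp
  then have Lf: "Lp p f'" using f'(1) f(2) by (simp add: Lp_def)
  have "AE x in lborel. ennreal \<bar>f' (x + \<delta> *\<^sub>R e) - f' x\<bar> \<le> cint b (\<lambda>t. x + t *\<^sub>R e) 0 \<delta>" if "norm e = 1" "0 < \<delta>" "\<delta> \<le> 1" for e \<delta>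
    using f'(2) AE_translate[OF f'(2), of "\<delta> *\<^sub>R e"]
  proof eventually_elim
    case (elim x)
    have "curve_in (\<lambda>t. x + t *\<^sub>R e) \<delta> UNIV" using arc_curve_segment[OF that(1,2)] by (simp add: curve_in_def)
    from ugcD[OF ug[OF this], of 0 \<delta>] show ?case using elim that by (simp add: abs_minus_commute)
  qed
  from weak_grad_exists[OF p1 Lf b this] obtain Df where Df: "Lp p Df" "weak_grad UNIV f' Df" by blast
  obtain fk Fk where "fast_seq p UNIV f' Df fk Fk"
    using fast_seq_exists[OF p1 Lf Df, of 1 UNIV] by auto
  then interpret fast_seq p UNIV f' Df fk Fk .
  have qc: "quasicont p flim" unfolding quasicont_def using flim_quasicontinuous by metis
  have fF: "AE x in lborel. f x = flim x" using f'(2) flim_AE by eventually_elim simp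
  have u1: "pae p UNIV (ugc flim (\<lambda>x. ennreal (norm (Df x))))" by (rule pae_mono[OF flim_pae]) simp
  have u2: "pae p UNIV (line_ftc flim Df)" by (rule pae_mono[OF flim_pae]) simp
  have u3: "pae p UNIV (ugc f b)" by (rule pae_mono[OF pae_finite[OF b]]) (rule ug)
  have "Cp p {x. f x \<noteq> flim x} = 0"
  proof (rule Cp_zeroI[OF p0])
    show "AE x in lborel. x \<notin> {x. f x \<noteq> flim x}" using fF by simp
    have "pae p UNIV (\<lambda>\<gamma> l. \<forall>t\<in>{0..l}. f (\<gamma> t) = flim (\<gamma> t))"
      by (rule pae_eq[OF p0 b Lp_Lpb[OF Df(1)] u3 u1]) (use fF in simp)
    then show "pae p UNIV (\<lambda>\<gamma> l. \<gamma> ` {0..l} \<inter> {x. f x \<noteq> flim x} = {})" by (rule pae_mono) auto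
  qed
  then show ?thesis using that[OF classical_W1p_UNIV[OF Lf Df] Df(1) f'(2) fF qc u1 u2] by blast
qed

text \<open>Outside a small open set A both functions are continuous, so the strict inequality
  defines a relatively open set there, and adding A makes it open. The set U contributes its own
  exceptional set G.\<close>

lemma quasiopen_Int_less:
  assumes p: "0 < p" and U: "quasiopen p U" and F: "quasicont p F" and \<psi>: "quasicont p \<psi>"
  shows "quasiopen p (U \<inter> {x. \<bar>F x\<bar> < c * \<psi> x})"
  unfolding quasiopen_def
proof (intro allI impI)
  fix e :: real assume e: "0 < e"
  obtain G where G: "open G" "Cp p G < ennreal (e/4)" "open (U \<union> G)" using U e unfolding quasiopen_def by (meson divide_pos_pos zero_less_numeral)
  \<comment> \<open>Two nested unions follow, and each use of \<open>Cp_Un_less\<close> costs a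
    factor 4.\<close>
  obtain A1 where A1: "open A1" "Cp p A1 < ennreal (e/4/4)" "continuous_on (- A1) F" using F e unfolding quasicont_def by (meson divide_pos_pos zero_less_numeral)
  obtain A2 where A2: "open A2" "Cp p A2 < ennreal (e/4/4)" "continuous_on (- A2) \<psi>" using \<psi> e unfolding quasicont_def by (meson divide_pos_pos zero_less_numeral)
  define A where "A = A1 \<union> A2"
  let ?W = "{x. \<bar>F x\<bar> < c * \<psi> x}"
  have "continuous_on (- A) (\<lambda>x. c * \<psi> x - \<bar>F x\<bar>)"
    by (intro continuous_intros continuous_on_subset[OF A1(3)] continuous_on_subset[OF A2(3)]) (auto simp: A_def)
  then have "openin (top_of_set (- A)) (- A \<inter> (\<lambda>x. c * \<psi> x - \<bar>F x\<bar>) -` {0<..})"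
    by (intro continuous_openin_preimage_gen) auto
  then obtain T where T: "open T" "- A \<inter> (\<lambda>x. c * \<psi> x - \<bar>F x\<bar>) -` {0<..} = - A \<inter> T" unfolding openin_open by blast
  have "?W \<union> A = T \<union> A" using T(2) by (auto simp: set_eq_iff)
  then have oW: "open (?W \<union> A)" using T(1) A1(1) A2(1) by (auto simp: A_def)
  have "(U \<inter> ?W) \<union> (G \<union> A) = ((U \<union> G) \<inter> (?W \<union> A)) \<union> (G \<union> A)" by auto
  then have "open ((U \<inter> ?W) \<union> (G \<union> A))" using oW G A1(1) A2(1) by (auto simp: A_def intro!: open_Un open_Int)
  moreover have "Cp p A < ennreal (e/4)" unfolding A_def by (rule Cp_Un_less[OF p A1(2) A2(2)]) (use e in simp)
  then have "Cp p (G \<union> A) < ennreal e" by (rule Cp_Un_less[OF p G(2) _ e])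
  moreover have "open (G \<union> A)" using G A1 A2 by (auto simp: A_def)
  ultimately show "\<exists>G. open G \<and> Cp p G < ennreal e \<and> open (U \<inter> ?W \<union> G)" by blast
qed

lemma Cp_zero_UN:
  fixes Z :: "'i::countable \<Rightarrow> 'a::euclidean_space set"
  assumes "0 < p" "\<And>i. Cp p (Z i) = 0" shows "Cp p (\<Union>i. Z i) = 0"
proof (rule Cp_zeroI[OF assms(1)])
  have "AE x in lborel. \<forall>i. x \<notin> Z i" using Cp_zero_AE[OF assms(1) assms(2)] by (simp add: AE_all_countable)
  then show "AE x in lborel. x \<notin> (\<Union>i. Z i)" by simp
  have "pae p UNIV (\<lambda>\<gamma> l. \<forall>i. \<gamma> ` {0..l} \<inter> Z i = {})" by (intro pae_all assms(1) pae_Cp_zero[OF assms(1) assms(2)])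
  then show "pae p UNIV (\<lambda>\<gamma> l. \<gamma> ` {0..l} \<inter> (\<Union>i. Z i) = {})" by (rule pae_mono) blast
qed

definition clamp01 :: "ereal \<Rightarrow> real" where
  "clamp01 a = real_of_ereal (min 1 (max 0 a))"

lemma clamp01: "0 \<le> clamp01 a" "clamp01 a \<le> 1" "1 \<le> clamp01 a \<longleftrightarrow> 1 \<le> a"
  by (cases a; auto simp: clamp01_def min_def max_def one_ereal_def zero_ereal_def)+

lemma clamp01_diff: "ennreal \<bar>clamp01 a - clamp01 b\<bar> \<le> ediff a b"
proof (cases "ediff a b < \<infinity>")
  case True
  then obtain x y where "a = ereal x" "b = ereal y" using ediff_finite[OF True] by (cases a; cases b) auto
  moreover have "clamp01 (ereal z) = min 1 (max 0 z)" for z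
    by (auto simp: clamp01_def min_def max_def one_ereal_def zero_ereal_def)
  ultimately show ?thesis by (auto simp: min_def max_def intro!: ennreal_leI)
qed (auto simp: not_less top_unique)

section \<open>Truncations of a Newtonian function, extended to the whole space\<close>

text \<open>The genuine upper gradient g is kept beside its p-integrable envelope g' because the
  truncations need an inequality along every curve, with a density on the whole space. The capacity
  bound is placed on the superlevel sets of \<open>w j\<close>, which contain \<open>G j\<close> and
  on which the cutoff vanishes.\<close>

locale newton_function =
  fixes p :: real and U :: "'a::euclidean_space set" and v :: "'a \<Rightarrow> ereal" and g g' :: "'a \<Rightarrow> ennreal"
    and G :: "nat \<Rightarrow> 'a set" and w :: "nat \<Rightarrow> 'a \<Rightarrow> ereal" and gw :: "nat \<Rightarrow> 'a \<Rightarrow> ennreal"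
  assumes p: "1 < p" and qo: "quasiopen p U" and v_meas: "v \<in> borel_measurable (restrict_space lebesgue U)"
    and v_int: "(\<integral>\<^sup>+ x\<in>U. eabs_pow (v x) p \<partial>lebesgue) < \<infinity>"
    and ug: "upper_gradient U v g" and Lg': "Lpb p g'" and gg': "\<And>x. x \<in> U \<Longrightarrow> g x \<le> g' x"
    and pae_v: "pae p U (ugc (\<lambda>x. real_of_ereal (v x)) g')"
    and G: "\<And>j. open (U \<union> G j)"
    and w_meas: "\<And>j. w j \<in> borel_measurable lebesgue" and w1: "\<And>j x. x \<in> G j \<Longrightarrow> 1 \<le> w j x"
    and w_ug: "\<And>j. upper_gradient UNIV (w j) (gw j)" and Lgw: "\<And>j. Lpb p (gw j)"
    and w_cap: "\<And>j. Cp p {x. 1 \<le> w j x} < ennreal (small_cap p j)"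
begin

lemma p0: "0 < p" and p1: "1 \<le> p" using p by auto

lemma U: "U \<in> sets lebesgue" by (rule quasiopen_sets_lebesgue[OF p0 qo])

text \<open>An index (j, m, n, k) stands for the exceptional set \<open>G j\<close>, the ball about
  \<open>dense_seq m\<close> of radius 1/(n+1), and the truncation height k + 1.\<close>

definition ok :: "nat \<times> nat \<times> nat \<times> nat \<Rightarrow> bool" where
  "ok = (\<lambda>(j, m, n, k). ball (dense_seq m) (1 / real (Suc n)) \<subseteq> U \<union> G j)"

definition \<theta> :: "nat \<times> nat \<times> nat \<times> nat \<Rightarrow> 'a \<Rightarrow> real" where
  "\<theta> = (\<lambda>(j, m, n, k). bump (1 / real (Suc n)) (dense_seq m))"

definition \<psi> :: "nat \<times> nat \<times> nat \<times> nat \<Rightarrow> 'a \<Rightarrow> real" where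
  "\<psi> z x = max 0 (min (\<theta> z x) (1 - clamp01 (w (fst z) x)))"

definition K :: "nat \<times> nat \<times> nat \<times> nat \<Rightarrow> real" where
  "K = (\<lambda>(j, m, n, k). real (Suc k))"

text \<open>Infinite values of v become 0. This is harmless, since the upper gradient has infinite
  integral over every curve through such a point.\<close>

definition vr :: "'a \<Rightarrow> real" where
  "vr x = real_of_ereal (v x)"

definition ftr :: "nat \<times> nat \<times> nat \<times> nat \<Rightarrow> 'a \<Rightarrow> real" where
  "ftr z x = max (- (K z * \<psi> z x)) (min (K z * \<psi> z x) (vr x))"

definition g\<psi> :: "nat \<times> nat \<times> nat \<times> nat \<Rightarrow> 'a \<Rightarrow> ennreal" where
  "g\<psi> = (\<lambda>(j, m, n, k) x. ennreal (norm (grad_bump (1 / real (Suc n)) (dense_seq m) x)) + gw j x)"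

definition gf :: "nat \<times> nat \<times> nat \<times> nat \<Rightarrow> 'a \<Rightarrow> ennreal" where
  "gf z x = g' x + ennreal (K z) * g\<psi> z x"

lemma K_pos: "0 < K z" by (cases z) (simp add: K_def)

lemma \<psi>_nonneg: "0 \<le> \<psi> z x" by (simp add: \<psi>_def)

lemma \<theta>_nonneg: "0 \<le> \<theta> z x" by (cases z) (simp add: \<theta>_def bump_bounds)

lemma \<psi>_le_\<theta>: "\<psi> z x \<le> \<theta> z x" using \<theta>_nonneg[of z x] by (simp add: \<psi>_def)

text \<open>A point with positive \<psi> lies in the ball, hence in U \<union> \<open>G j\<close>,
  and it is not in \<open>G j\<close> because \<open>w j\<close> is at least 1 there.\<close>

lemma \<psi>_pos_U:
  assumes "ok z" "0 < \<psi> z x" shows "x \<in> U"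
proof (cases z)
  case (fields j m n k)
  have "0 < \<theta> z x" using assms(2) \<psi>_le_\<theta>[of z x] by linarith
  then have "norm (x - dense_seq m) < 1 / real (Suc n)"
    using bump_zero[of "1 / real (Suc n)" x "dense_seq m"] unfolding fields \<theta>_def by (cases "1 / real (Suc n) \<le> norm (x - dense_seq m)") auto
  then have "x \<in> U \<union> G j" using assms(1) unfolding fields ok_def by (auto simp: dist_norm norm_minus_commute)
  moreover have "x \<notin> G j"
  proof
    assume "x \<in> G j"
    then have "1 \<le> clamp01 (w j x)" using w1 clamp01(3) by blast
    then show False using assms(2) unfolding fields \<psi>_def by simp
  qed
  ultimately show ?thesis by blast
qed

lemma Lpb_grad_bump: "0 < r \<Longrightarrow> Lpb p (\<lambda>x. ennreal (norm (grad_bump r (a::'a) x)))"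
proof -
  assume r: "0 < r"
  have "(\<integral>\<^sup>+x. epow (ennreal (norm (grad_bump r a x))) p \<partial>lborel) \<le> (\<integral>\<^sup>+x. ennreal ((4 * r) powr p) * indicator (cball a r) x \<partial>lborel)"
  proof (intro nn_integral_mono)
    fix x
    show "epow (ennreal (norm (grad_bump r a x))) p \<le> ennreal ((4 * r) powr p) * indicator (cball a r) x"
    proof (cases "x \<in> cball a r")
      case True
      then show ?thesis using grad_bump_bound[OF r, of a x] p0 by (auto intro!: ennreal_leI powr_mono2)
    next
      case False
      then have "r \<le> norm (x - a)" by (simp add: dist_norm norm_minus_commute)
      from grad_bump_zero[OF r this] show ?thesis using p0 by simp
    qed
  qed
  also have "\<dots> < \<infinity>" using emeasure_lborel_cball_finite[of a r]
    by (subst nn_integral_cmult_indicator) (auto simp: ennreal_mult_less_top)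
  finally show ?thesis by (simp add: Lpb_def)
qed

lemma Lpb_g\<psi>: "Lpb p (g\<psi> z)"
proof (cases z)
  case (fields j m n k)
  show ?thesis unfolding fields g\<psi>_def using p0 by (auto intro!: Lpb_add Lpb_grad_bump Lgw)
qed

lemma Lpb_gf: "Lpb p (gf z)"
  unfolding gf_def using p0 K_pos[of z] by (intro Lpb_add Lg' Lpb_cmult Lpb_g\<psi>) auto

lemma \<psi>_ugc:
  assumes c: "curve_in \<gamma> l UNIV" shows "ugc (\<psi> z) (g\<psi> z) \<gamma> l"
  unfolding ugc_def
proof (intro allI impI)
  fix s t assume st: "0 \<le> s \<and> s \<le> t \<and> t \<le> l"
  obtain j m n k where z: "z = (j, m, n, k)" by (cases z)
  have ac: "arc_curve \<gamma> l" using c by (simp add: curve_in_def)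
  let ?gb = "\<lambda>x. ennreal (norm (grad_bump (1 / real (Suc n)) (dense_seq m) x))"
  show "ennreal \<bar>\<psi> z (\<gamma> s) - \<psi> z (\<gamma> t)\<bar> \<le> cint (g\<psi> z) \<gamma> s t"
  proof (cases "s < t")
    case True
    have 1: "ennreal \<bar>\<theta> z (\<gamma> s) - \<theta> z (\<gamma> t)\<bar> \<le> cint ?gb \<gamma> s t"
      unfolding z \<theta>_def prod.case using c1grad_ugc[OF c1grad_bump open_UNIV c] st by (intro ugcD) auto
    have "ennreal \<bar>clamp01 (w j (\<gamma> s)) - clamp01 (w j (\<gamma> t))\<bar> \<le> ediff (w j (\<gamma> s)) (w j (\<gamma> t))" by (rule clamp01_diff)
    also have "\<dots> \<le> cint (gw j) \<gamma> s t" using st True by (intro upper_gradient_cint[OF w_ug ac]) auto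
    finally have 2: "ennreal \<bar>clamp01 (w j (\<gamma> s)) - clamp01 (w j (\<gamma> t))\<bar> \<le> cint (gw j) \<gamma> s t" .
    have "\<bar>\<psi> z (\<gamma> s) - \<psi> z (\<gamma> t)\<bar> \<le> \<bar>\<theta> z (\<gamma> s) - \<theta> z (\<gamma> t)\<bar> + \<bar>clamp01 (w j (\<gamma> s)) - clamp01 (w j (\<gamma> t))\<bar>"
      unfolding \<psi>_def z fst_conv by (auto simp: max_def min_def)
    then have "ennreal \<bar>\<psi> z (\<gamma> s) - \<psi> z (\<gamma> t)\<bar> \<le> ennreal \<bar>\<theta> z (\<gamma> s) - \<theta> z (\<gamma> t)\<bar> + ennreal \<bar>clamp01 (w j (\<gamma> s)) - clamp01 (w j (\<gamma> t))\<bar>"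
      by (simp add: ennreal_plus[symmetric] ennreal_leI del: ennreal_plus)
    also have "\<dots> \<le> cint ?gb \<gamma> s t + cint (gw j) \<gamma> s t" by (rule add_mono[OF 1 2])
    also have "\<dots> = cint (\<lambda>x. ?gb x + gw j x) \<gamma> s t" using st w_ug[of j] by (intro cint_add[OF ac, symmetric]) (auto simp: upper_gradient_def)
    finally show ?thesis unfolding z g\<psi>_def by simp
  qed (use st in simp)
qed

lemma ftr_bounds: "\<bar>ftr z x\<bar> \<le> K z * \<psi> z x" "\<bar>ftr z x\<bar> \<le> \<bar>vr x\<bar>"
proof -
  have "0 \<le> K z * \<psi> z x" using K_pos[of z] \<psi>_nonneg[of z x] by simp
  then show "\<bar>ftr z x\<bar> \<le> K z * \<psi> z x" "\<bar>ftr z x\<bar> \<le> \<bar>vr x\<bar>" by (auto simp: ftr_def max_def min_def)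
qed

text \<open>If \<psi> vanishes somewhere on the arc, then |\<open>ftr z\<close>| \<le>
  \<open>K z\<close> \<psi> at both ends, and the inequality for \<psi> on either side of the zero
  suffices. Otherwise the whole arc stays in U, where the upper gradient of v is available. Together
  the two cases cover every curve, although v is controlled in U only.\<close>

lemma ftr_ugc:
  assumes ok: "ok z" and c: "curve_in \<gamma> l UNIV" shows "ugc (ftr z) (gf z) \<gamma> l"
  unfolding ugc_def
proof (intro allI impI)
  fix s t assume st: "0 \<le> s \<and> s \<le> t \<and> t \<le> l"
  have ac: "arc_curve \<gamma> l" using c by (simp add: curve_in_def)
  have m: "g' \<in> borel_measurable borel" "g\<psi> z \<in> borel_measurable borel" using Lg' Lpb_g\<psi> by (auto simp: Lpb_def)
  have eq: "cint (gf z) \<gamma> s t = cint g' \<gamma> s t + ennreal (K z) * cint (g\<psi> z) \<gamma> s t"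
    unfolding gf_def using m st by (subst cint_add[OF ac]) (auto simp: cint_cmult[OF ac])
  have \<psi>d: "ennreal \<bar>\<psi> z (\<gamma> a) - \<psi> z (\<gamma> b)\<bar> \<le> cint (g\<psi> z) \<gamma> a b" if "0 \<le> a" "a \<le> b" "b \<le> l" for a b
    using ugcD[OF \<psi>_ugc[OF c]] that by blast
  have Kmul: "ennreal (K z * a) = ennreal (K z) * ennreal a" if "0 \<le> a" for a using K_pos[of z] that by (simp add: ennreal_mult)
  consider "s = t" | "s < t" "\<exists>\<tau>\<in>{s..t}. \<psi> z (\<gamma> \<tau>) = 0" | "s < t" "\<forall>\<tau>\<in>{s..t}. \<psi> z (\<gamma> \<tau>) \<noteq> 0" using st by force
  then show "ennreal \<bar>ftr z (\<gamma> s) - ftr z (\<gamma> t)\<bar> \<le> cint (gf z) \<gamma> s t"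
  proof cases
    case 1
    then show ?thesis by simp
  next
    case 2
    then obtain \<tau> where \<tau>: "s \<le> \<tau>" "\<tau> \<le> t" "\<psi> z (\<gamma> \<tau>) = 0" by auto
    have "\<bar>ftr z (\<gamma> s) - ftr z (\<gamma> t)\<bar> \<le> K z * \<bar>\<psi> z (\<gamma> s) - \<psi> z (\<gamma> \<tau>)\<bar> + K z * \<bar>\<psi> z (\<gamma> \<tau>) - \<psi> z (\<gamma> t)\<bar>"
      using ftr_bounds(1)[of z "\<gamma> s"] ftr_bounds(1)[of z "\<gamma> t"] \<psi>_nonneg[of z "\<gamma> s"] \<psi>_nonneg[of z "\<gamma> t"] \<tau>(3) by simp
    then have "ennreal \<bar>ftr z (\<gamma> s) - ftr z (\<gamma> t)\<bar> \<le> ennreal (K z * \<bar>\<psi> z (\<gamma> s) - \<psi> z (\<gamma> \<tau>)\<bar> + K z * \<bar>\<psi> z (\<gamma> \<tau>) - \<psi> z (\<gamma> t)\<bar>)" by (rule ennreal_leI)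
    also have "\<dots> = ennreal (K z) * (ennreal \<bar>\<psi> z (\<gamma> s) - \<psi> z (\<gamma> \<tau>)\<bar> + ennreal \<bar>\<psi> z (\<gamma> \<tau>) - \<psi> z (\<gamma> t)\<bar>)"
      using K_pos[of z] by (simp add: Kmul distrib_left)
    also have "\<dots> \<le> ennreal (K z) * (cint (g\<psi> z) \<gamma> s \<tau> + cint (g\<psi> z) \<gamma> \<tau> t)"
      using \<tau> st by (intro mult_left_mono add_mono \<psi>d) auto
    also have "\<dots> = ennreal (K z) * cint (g\<psi> z) \<gamma> s t" using cint_split[OF ac m(2), of s \<tau> t] \<tau> st by simp
    also have "\<dots> \<le> cint (gf z) \<gamma> s t" unfolding eq by simp
    finally show ?thesis .
  next
    case 3
    have inU: "\<gamma> ` {s..t} \<subseteq> U" using 3(2) \<psi>_pos_U[OF ok] \<psi>_nonneg[of z] by (force simp: less_le)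
    have "ediff (v (\<gamma> s)) (v (\<gamma> t)) \<le> cint g \<gamma> s t" using st 3 inU by (intro upper_gradient_cint[OF ug ac]) auto
    also have "\<dots> \<le> cint g' \<gamma> s t" using inU by (intro cint_mono gg') auto
    finally have e: "ediff (v (\<gamma> s)) (v (\<gamma> t)) \<le> cint g' \<gamma> s t" .
    have e': "ennreal \<bar>vr (\<gamma> s) - vr (\<gamma> t)\<bar> \<le> cint g' \<gamma> s t"
    proof (cases "ediff (v (\<gamma> s)) (v (\<gamma> t)) < \<infinity>")
      case True
      then show ?thesis using e ediff_ereal_of[OF True] by (simp add: vr_def)
    next
      case False
      then have "cint g' \<gamma> s t = \<infinity>" using e by (simp add: not_less top_unique)
      then show ?thesis by simp
    qed
    have "\<bar>ftr z (\<gamma> s) - ftr z (\<gamma> t)\<bar> \<le> \<bar>vr (\<gamma> s) - vr (\<gamma> t)\<bar> + \<bar>K z * \<psi> z (\<gamma> s) - K z * \<psi> z (\<gamma> t)\<bar>"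
      unfolding ftr_def by (auto simp: max_def min_def)
    also have "\<bar>K z * \<psi> z (\<gamma> s) - K z * \<psi> z (\<gamma> t)\<bar> = K z * \<bar>\<psi> z (\<gamma> s) - \<psi> z (\<gamma> t)\<bar>"
      using K_pos[of z] by (simp add: right_diff_distrib[symmetric] abs_mult)
    finally have "ennreal \<bar>ftr z (\<gamma> s) - ftr z (\<gamma> t)\<bar> \<le> ennreal \<bar>vr (\<gamma> s) - vr (\<gamma> t)\<bar> + ennreal (K z) * ennreal \<bar>\<psi> z (\<gamma> s) - \<psi> z (\<gamma> t)\<bar>"
      using K_pos[of z] by (simp add: Kmul[symmetric] ennreal_plus[symmetric] ennreal_leI del: ennreal_plus)
    also have "\<dots> \<le> cint (gf z) \<gamma> s t" unfolding eq using e' \<psi>d[of s t] st by (intro add_mono mult_left_mono) auto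
    finally show ?thesis .
  qed
qed

lemma vr_measurable: "(\<lambda>x. vr x * indicator U x) \<in> borel_measurable lebesgue"
proof -
  have "vr \<in> borel_measurable (restrict_space lebesgue U)" unfolding vr_def using v_meas by measurable
  then show ?thesis using U by (subst (asm) borel_measurable_restrict_space_iff) (auto simp: mult.commute)
qed

lemma \<psi>_measurable: "\<psi> z \<in> borel_measurable lebesgue"
proof (cases z)
  case (fields j m n k)
  have [measurable]: "bump r a \<in> borel_measurable lebesgue" for r and a :: 'a
    using bump_measurable by (intro measurable_completion) simp
  note [measurable] = w_meas
  show ?thesis unfolding fields \<psi>_def \<theta>_def clamp01_def prod.case fst_conv by measurable
qed

text \<open>v is measurable on U only; replacing it by 0 elsewhere does not change the truncation,
  because \<psi> vanishes off U.\<close>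

lemma ftr_measurable: "ok z \<Longrightarrow> ftr z \<in> borel_measurable lebesgue"
proof -
  assume ok: "ok z"
  have "ftr z x = max (- (K z * \<psi> z x)) (min (K z * \<psi> z x) (vr x * indicator U x))" for x
    using \<psi>_pos_U[OF ok, of x] \<psi>_nonneg[of z x] by (cases "\<psi> z x = 0") (auto simp: ftr_def)
  moreover note [measurable] = \<psi>_measurable vr_measurable
  have "(\<lambda>x. max (- (K z * \<psi> z x)) (min (K z * \<psi> z x) (vr x * indicator U x))) \<in> borel_measurable lebesgue" by measurable
  ultimately show ?thesis by presburger
qed

lemma \<psi>_int: "(\<integral>\<^sup>+x. ennreal (\<bar>\<psi> z x\<bar> powr p) \<partial>lborel) < \<infinity>"
proof (cases z)
  case (fields j m n k)
  let ?r = "1 / real (Suc n)"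
  have "(\<integral>\<^sup>+x. ennreal (\<bar>\<psi> z x\<bar> powr p) \<partial>lborel) \<le> (\<integral>\<^sup>+x. indicator (cball (dense_seq m :: 'a) ?r) x \<partial>lborel)"
  proof (intro nn_integral_mono)
    fix x
    have b: "\<bar>\<psi> z x\<bar> \<le> bump ?r (dense_seq m) x" using \<psi>_nonneg[of z x] \<psi>_le_\<theta>[of z x] unfolding fields \<theta>_def by simp
    show "ennreal (\<bar>\<psi> z x\<bar> powr p) \<le> indicator (cball (dense_seq m) ?r) x"
    proof (cases "x \<in> cball (dense_seq m) ?r")
      case True
      have "\<bar>\<psi> z x\<bar> powr p \<le> 1 powr p" using b bump_bounds(2)[of ?r "dense_seq m" x] p0 by (intro powr_mono2) auto
      then show ?thesis using True by simp
    next
      case False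
      then have "?r \<le> norm (x - dense_seq m)" by (simp add: dist_norm norm_minus_commute)
      then have "\<psi> z x = 0" using b bump_zero[of ?r x "dense_seq m"] by simp
      then show ?thesis using p0 by simp
    qed
  qed
  also have "\<dots> < \<infinity>" using emeasure_lborel_cball_finite[of "dense_seq m :: 'a" ?r] by simp
  finally show ?thesis .
qed

lemma ftr_int: "ok z \<Longrightarrow> (\<integral>\<^sup>+x. ennreal (\<bar>ftr z x\<bar> powr p) \<partial>lborel) < \<infinity>"
proof -
  assume ok: "ok z"
  have "(\<integral>\<^sup>+x. ennreal (\<bar>ftr z x\<bar> powr p) \<partial>lborel) \<le> (\<integral>\<^sup>+ x\<in>U. eabs_pow (v x) p \<partial>lborel)"
  proof (intro nn_integral_mono)
    fix x
    show "ennreal (\<bar>ftr z x\<bar> powr p) \<le> eabs_pow (v x) p * indicator U x"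
    proof (cases "0 < \<psi> z x")
      case True
      then have "x \<in> U" by (rule \<psi>_pos_U[OF ok])
      moreover have "ennreal (\<bar>ftr z x\<bar> powr p) \<le> eabs_pow (v x) p"
        using ftr_bounds(2)[of z x] p0 by (cases "v x") (auto simp: eabs_pow_def vr_def intro!: ennreal_leI powr_mono2)
      ultimately show ?thesis by simp
    next
      case False
      then have "\<psi> z x = 0" using \<psi>_nonneg[of z x] by simp
      then have "ftr z x = 0" using ftr_bounds(1)[of z x] by simp
      then show ?thesis using p0 by simp
    qed
  qed
  also have "\<dots> < \<infinity>" using v_int by (simp add: nn_integral_lebesgue)
  finally show ?thesis .
qed

text \<open>With quasicontinuous representatives F and P of the truncation and of \<psi>, the set
  \<open>V z\<close>, the part of U where |F| < K P, is quasiopen. Up to sets of capacity zero it is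
  the part where truncation is inactive. A point of U in no \<open>V z\<close> either has
  \<open>w j\<close> at least 1 for every j or lies where a representative differs from its
  function, and both sets have capacity zero.\<close>

lemma pieces:
  obtains V f' Df F where
    "\<And>z. ok z \<Longrightarrow> quasiopen p (V z)" "\<And>z. ok z \<Longrightarrow> V z \<subseteq> U" "Cp p (U - (\<Union>z\<in>{z. ok z}. V z)) = 0"
    "\<And>z. ok z \<Longrightarrow> classical_W1p p UNIV (f' z) (Df z)" "\<And>z. ok z \<Longrightarrow> Lp p (Df z)"
    "\<And>z. ok z \<Longrightarrow> AE x in lborel. x \<in> V z \<longrightarrow> vr x = f' z x" "\<And>z. ok z \<Longrightarrow> AE x in lborel. x \<in> V z \<longrightarrow> vr x = F z x"
    "\<And>z. ok z \<Longrightarrow> pae p UNIV (ugc (F z) (\<lambda>x. ennreal (norm (Df z x))))" "\<And>z. ok z \<Longrightarrow> pae p UNIV (line_ftc (F z) (Df z))"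
proof -
  define R where "R z T \<longleftrightarrow> classical_W1p p UNIV (fst T) (fst (snd T)) \<and> Lp p (fst (snd T)) \<and>
    (AE x in lborel. ftr z x = fst T x) \<and> (AE x in lborel. ftr z x = snd (snd T) x) \<and> quasicont p (snd (snd T)) \<and>
    pae p UNIV (ugc (snd (snd T)) (\<lambda>x. ennreal (norm (fst (snd T) x)))) \<and> pae p UNIV (line_ftc (snd (snd T)) (fst (snd T))) \<and>
    Cp p {x. ftr z x \<noteq> snd (snd T) x} = 0" for z T
  have "\<forall>z\<in>Collect ok. \<exists>T. R z T"
  proof
    fix z assume "z \<in> Collect ok"
    then have z: "ok z" by simp
    show "\<exists>T. R z T"
    proof (rule quasicontinuous_representative[OF p ftr_measurable[OF z] ftr_int[OF z] Lpb_gf ftr_ugc[OF z]])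
      fix f' Df F assume "classical_W1p p UNIV f' Df" "Lp p Df" "AE x in lborel. ftr z x = f' x" "AE x in lborel. ftr z x = F x"
        "quasicont p F" "pae p UNIV (ugc F (\<lambda>x. ennreal (norm (Df x))))" "pae p UNIV (line_ftc F Df)" "Cp p {x. ftr z x \<noteq> F x} = 0"
      then have "R z (f', Df, F)" unfolding R_def fst_conv snd_conv by (intro conjI)
      then show ?thesis by blast
    qed
  qed
  from bchoice[OF this] obtain T where T: "\<And>z. ok z \<Longrightarrow> R z (T z)" by blast
  define f' Df F where "f' = (\<lambda>z. fst (T z))" and "Df = (\<lambda>z. fst (snd (T z)))" and "F = (\<lambda>z. snd (snd (T z)))"
  have f: "\<And>z. ok z \<Longrightarrow> classical_W1p p UNIV (f' z) (Df z)" "\<And>z. ok z \<Longrightarrow> Lp p (Df z)"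
    "\<And>z. ok z \<Longrightarrow> AE x in lborel. ftr z x = f' z x" "\<And>z. ok z \<Longrightarrow> AE x in lborel. ftr z x = F z x"
    "\<And>z. ok z \<Longrightarrow> quasicont p (F z)" "\<And>z. ok z \<Longrightarrow> pae p UNIV (ugc (F z) (\<lambda>x. ennreal (norm (Df z x))))"
    "\<And>z. ok z \<Longrightarrow> pae p UNIV (line_ftc (F z) (Df z))" "\<And>z. ok z \<Longrightarrow> Cp p {x. ftr z x \<noteq> F z x} = 0"
    using T[unfolded R_def] unfolding f'_def Df_def F_def by simp_all
  have "\<exists>P. (AE x in lborel. \<psi> z x = P x) \<and> quasicont p P \<and> Cp p {x. \<psi> z x \<noteq> P x} = 0" for z
  proof (rule quasicontinuous_representative[OF p \<psi>_measurable[of z] \<psi>_int Lpb_g\<psi> \<psi>_ugc])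
    fix P assume "AE x in lborel. \<psi> z x = P x" "quasicont p P" "Cp p {x. \<psi> z x \<noteq> P x} = 0"
    then show ?thesis by (intro exI conjI)
  qed
  then obtain P where P: "\<And>z. AE x in lborel. \<psi> z x = P z x" "\<And>z. quasicont p (P z)" "\<And>z. Cp p {x. \<psi> z x \<noteq> P z x} = 0" by metis
  define V where "V = (\<lambda>z. U \<inter> {x. \<bar>F z x\<bar> < K z * P z x})"
  have eq: "vr x = ftr z x" if "x \<in> V z" "ftr z x = F z x" "\<psi> z x = P z x" for x z
  proof -
    have "\<bar>ftr z x\<bar> < K z * \<psi> z x" using that by (simp add: V_def)
    then show ?thesis by (auto simp: ftr_def max_def min_def split: if_splits)
  qed
  define Z1 where "Z1 = {x. \<forall>j. 1 \<le> w j x}"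
  define Z where "Z = (\<lambda>z. (if ok z then {x. ftr z x \<noteq> F z x} else {}))"
  have cap1: "Cp p Z1 = 0"
  proof (rule Cp_zeroI[OF p0])
    have lt: "Cp p Z1 < ennreal (small_cap p j)" for j
      using Cp_mono[of Z1 "{x. 1 \<le> w j x}" p] w_cap[of j] by (force simp: Z1_def)
    show "AE x in lborel. x \<notin> Z1" using small_cap_Inter_null[OF p0 lt] by simp
    show "pae p UNIV (\<lambda>\<gamma> l. \<gamma> ` {0..l} \<inter> Z1 = {})"
      by (rule pae_mono[OF pae_small_cap[OF p0 lt]]) blast
  qed
  have "Cp p (\<Union>z. Z z) = 0" by (rule Cp_zero_UN[OF p0]) (auto simp: Z_def f(8) Cp_empty p0)
  moreover have "Cp p (\<Union>z. {x. \<psi> z x \<noteq> P z x}) = 0" by (rule Cp_zero_UN[OF p0 P(3)])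
  \<comment> \<open>Three sets of capacity zero, padded to a sequence so that the countable union
    lemma applies.\<close>
  ultimately have "Cp p (\<Union>i::nat. if i = 0 then Z1 else if i = 1 then (\<Union>z. Z z) else (\<Union>z. {x. \<psi> z x \<noteq> P z x})) = 0" (is "Cp p (\<Union>i. ?Z i) = 0")
    using cap1 by (intro Cp_zero_UN[OF p0]) auto
  then have c0: "Cp p (\<Union>i. ?Z i) = 0" .
  have "U - (\<Union>z\<in>{z. ok z}. V z) \<subseteq> (\<Union>i. ?Z i)"
  proof
    fix x assume x: "x \<in> U - (\<Union>z\<in>{z. ok z}. V z)"
    show "x \<in> (\<Union>i. ?Z i)"
    proof (rule ccontr)
      assume "x \<notin> (\<Union>i. ?Z i)"
      then have n: "x \<notin> ?Z 0" "x \<notin> ?Z 1" "x \<notin> ?Z 2" by blast+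
      then have "x \<notin> Z1" and nf: "\<And>z. ok z \<Longrightarrow> ftr z x = F z x" and np: "\<And>z. \<psi> z x = P z x"
        by (auto simp: Z_def)
      then obtain j where j: "\<not> 1 \<le> w j x" by (auto simp: Z1_def)
      then have cl: "clamp01 (w j x) < 1" using clamp01(3)[of "w j x"] by linarith
      have "x \<in> U \<union> G j" using x by simp
      then obtain m n where mn: "x \<in> ball (dense_seq m) (1 / real (Suc n))" "ball (dense_seq m) (2 * (1 / real (Suc n))) \<subseteq> U \<union> G j"
        using dense_balls[OF G] by blast
      have "ball (dense_seq m) (1 / real (Suc n)) \<subseteq> ball (dense_seq m :: 'a) (2 * (1 / real (Suc n)))" by (rule subset_ball) (simp add: divide_right_mono)
      then have ok: "ok (j, m, n, k)" for k unfolding ok_def using mn(2) by auto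
      \<comment> \<open>\<psi> does not depend on the height index, so q is a fixed positive number
        and the height can be chosen afterwards.\<close>
      define q where "q = \<psi> (j, m, n, 0) x"
      have qk: "\<psi> (j, m, n, k) x = q" for k by (simp add: q_def \<psi>_def \<theta>_def)
      have "0 < bump (1 / real (Suc n)) (dense_seq m) x" using mn(1) by (intro bump_pos) (auto simp: dist_norm norm_minus_commute)
      then have q: "0 < q" using cl by (simp add: q_def \<psi>_def \<theta>_def)
      obtain k :: nat where k: "\<bar>vr x\<bar> / q < real k" using reals_Archimedean2 by blast
      let ?z = "(j, m, n, k)"
      have "\<bar>vr x\<bar> < K ?z * \<psi> ?z x"
      proof -
        have "\<bar>vr x\<bar> < real k * q" using k q by (simp add: pos_divide_less_eq)
        also have "\<dots> \<le> real (Suc k) * q" using q by (intro mult_right_mono) auto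
        finally show ?thesis by (simp add: K_def qk)
      qed
      then have "\<bar>F ?z x\<bar> < K ?z * P ?z x" using ftr_bounds(2)[of ?z x] nf[OF ok] np[of ?z] by simp
      then have "x \<in> V ?z" using x by (simp add: V_def)
      then show False using x ok[of k] by blast
    qed
  qed
  from Cp_mono[OF this, of p] have c: "Cp p (U - (\<Union>z\<in>{z. ok z}. V z)) = 0" unfolding c0 by (simp only: le_zero_eq)
  show ?thesis
  proof (rule that[of V f' Df F])
    show "quasiopen p (V z)" if "ok z" for z unfolding V_def by (rule quasiopen_Int_less[OF p0 qo f(5)[OF that] P(2)])
    show "V z \<subseteq> U" for z by (simp add: V_def)
    show "AE x in lborel. x \<in> V z \<longrightarrow> vr x = f' z x" if "ok z" for z
      using f(3)[OF that] f(4)[OF that] P(1)[of z] by eventually_elim (metis eq)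
    show "AE x in lborel. x \<in> V z \<longrightarrow> vr x = F z x" if "ok z" for z
      using f(4)[OF that] P(1)[of z] by eventually_elim (metis eq)
  qed (use c f in auto)
qed

lemma path_open_Int:
  assumes "path_open p UNIV A"
    "path_open p UNIV ((B::'a set))"
  shows "path_open p UNIV (A \<inter> B)"
proof (rule pae_mono[OF pae_conj[OF p0 assms]])
  fix \<gamma> l assume "openin (top_of_set {0..l}) {t \<in> {0..l}. \<gamma> t \<in> A} \<and> openin (top_of_set {0..l}) {t \<in> {0..l}. \<gamma> t \<in> B}"
  then have "openin (top_of_set {0..l}) ({t \<in> {0..l}. \<gamma> t \<in> A} \<inter> {t \<in> {0..l}. \<gamma> t \<in> B})" by (intro openin_Int) auto
  then show "openin (top_of_set {0..l}) {t \<in> {0..l}. \<gamma> t \<in> A \<inter> B}"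
    by (rule back_subst[of "openin (top_of_set {0..l})"]) auto
qed

text \<open>The gradients of two pieces agree almost everywhere on the overlap: the difference of
  the representatives vanishes along almost every curve there, so 0 is an upper gradient of it and
  \<open>local_grad_bound\<close> applies. The combined gradient is dominated by g', which puts it
  in L^p.\<close>

lemma KM:
  assumes u: "AE x in lborel. x \<in> U \<longrightarrow> v x = ereal (u x)"
  shows "\<exists>Du. KM_W1p p U u Du"
proof -
  obtain V f' Df F where P:
    "\<And>z. ok z \<Longrightarrow> quasiopen p (V z)" "\<And>z. ok z \<Longrightarrow> V z \<subseteq> U" "Cp p (U - (\<Union>z\<in>{z. ok z}. V z)) = 0"
    "\<And>z. ok z \<Longrightarrow> classical_W1p p UNIV (f' z) (Df z)" "\<And>z. ok z \<Longrightarrow> Lp p (Df z)"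
    "\<And>z. ok z \<Longrightarrow> AE x in lborel. x \<in> V z \<longrightarrow> vr x = f' z x" "\<And>z. ok z \<Longrightarrow> AE x in lborel. x \<in> V z \<longrightarrow> vr x = F z x"
    "\<And>z. ok z \<Longrightarrow> pae p UNIV (ugc (F z) (\<lambda>x. ennreal (norm (Df z x))))" "\<And>z. ok z \<Longrightarrow> pae p UNIV (line_ftc (F z) (Df z))"
    using pieces by blast
  have uvr: "AE x in lborel. x \<in> U \<longrightarrow> u x = vr x" using u by eventually_elim (auto simp: vr_def)
  have po: "path_open p UNIV (V z)" if "ok z" for z
    by (rule quasiopen_path_open[OF p0 P(1)[OF that]])
  have pv: "pae p U (ugc vr g')" using pae_v unfolding vr_def .
  have Dg: "AE x in lborel. x \<in> V z \<longrightarrow> ennreal (norm (Df z x)) \<le> g' x" if z: "ok z" for z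
  proof (rule local_grad_bound[OF p1 po[OF z] P(5)[OF z] pae_subset[OF P(9)[OF z]] Lg'])
    have "pae p (V z) (\<lambda>\<gamma> l. \<forall>t\<in>{0..l}. vr (\<gamma> t) = F z (\<gamma> t))"
      by (rule pae_eq[OF p0 Lg' Lp_Lpb[OF P(5)[OF z]] pae_subset[OF pv P(2)[OF z]] pae_subset[OF P(8)[OF z]]]) (use P(7)[OF z] in auto)
    from pae_conj[OF p0 this pae_subset[OF pv P(2)[OF z]]] show "pae p (V z) (ugc (F z) g')"
      by (rule pae_mono) (auto simp: ugc_def)
  qed simp
  have cons: "AE x in lborel. x \<in> V z \<inter> V z' \<longrightarrow> Df z x = Df z' x" if z: "ok z" "ok z'" for z z'
  proof -
    have L0: "Lpb p (\<lambda>_. 0 :: ennreal)" by (simp add: Lpb_def)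
    have ftc: "pae p (V z \<inter> V z') (line_ftc (\<lambda>x. F z x - F z' x) (\<lambda>x. Df z x - Df z' x))"
    proof (rule pae_mono[OF pae_conj[OF p0 pae_subset[OF P(9)[OF z(1)]] pae_subset[OF P(9)[OF z(2)]]]])
      fix \<gamma> l assume a: "line_ftc (F z) (Df z) \<gamma> l \<and> line_ftc (F z') (Df z') \<gamma> l"
      show "line_ftc (\<lambda>x. F z x - F z' x) (\<lambda>x. Df z x - Df z' x) \<gamma> l"
        unfolding line_ftc_def
      proof (intro allI impI)
        fix x e assume xe: "norm e = 1 \<and> (\<forall>\<tau>\<in>{0..l}. \<gamma> \<tau> = x + \<tau> *\<^sub>R e)"
        have i: "set_integrable lborel {0..l} (\<lambda>\<tau>. Df z (x + \<tau> *\<^sub>R e) \<bullet> e)" "set_integrable lborel {0..l} (\<lambda>\<tau>. Df z' (x + \<tau> *\<^sub>R e) \<bullet> e)"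
          and e: "F z (x + l *\<^sub>R e) - F z x = (LINT \<tau>:{0..l}|lborel. Df z (x + \<tau> *\<^sub>R e) \<bullet> e)"
          "F z' (x + l *\<^sub>R e) - F z' x = (LINT \<tau>:{0..l}|lborel. Df z' (x + \<tau> *\<^sub>R e) \<bullet> e)"
          using a xe unfolding line_ftc_def by blast+
        show "set_integrable lborel {0..l} (\<lambda>\<tau>. (Df z (x + \<tau> *\<^sub>R e) - Df z' (x + \<tau> *\<^sub>R e)) \<bullet> e) \<and>
          F z (x + l *\<^sub>R e) - F z' (x + l *\<^sub>R e) - (F z x - F z' x) = (LINT \<tau>:{0..l}|lborel. (Df z (x + \<tau> *\<^sub>R e) - Df z' (x + \<tau> *\<^sub>R e)) \<bullet> e)"
          unfolding inner_diff_left set_integral_diff(2)[OF i] using set_integral_diff(1)[OF i] e by auto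
      qed
    qed auto
    have eq: "pae p (V z \<inter> V z') (\<lambda>\<gamma> l. \<forall>t\<in>{0..l}. F z (\<gamma> t) = F z' (\<gamma> t))"
    proof (rule pae_eq[OF p0 Lp_Lpb[OF P(5)[OF z(1)]] Lp_Lpb[OF P(5)[OF z(2)]] pae_subset[OF P(8)[OF z(1)]] pae_subset[OF P(8)[OF z(2)]]])
      show "AE x in lborel. x \<in> V z \<inter> V z' \<longrightarrow> F z x = F z' x" using P(7)[OF z(1)] P(7)[OF z(2)] by eventually_elim auto
    qed auto
    have "AE x in lborel. x \<in> V z \<inter> V z' \<longrightarrow> ennreal (norm (Df z x - Df z' x)) \<le> 0"
    proof (rule local_grad_bound[OF p1 path_open_Int[OF po[OF z(1)] po[OF z(2)]] _ ftc L0])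
      show "Lp p (\<lambda>x. Df z x - Df z' x)" using p0 P(5) z by (intro Lp_diff) auto
      show "pae p (V z \<inter> V z') (ugc (\<lambda>x. F z x - F z' x) (\<lambda>_. 0))"
        by (rule pae_mono[OF eq]) (auto simp: ugc_def)
    qed
    then show ?thesis by eventually_elim auto
  qed
  define zz :: "nat \<Rightarrow> nat \<times> nat \<times> nat \<times> nat" where "zz = from_nat"
  define A where "A = (\<lambda>n. if ok (zz n) then V (zz n) else {})"
  define D where "D = (\<lambda>n. if ok (zz n) then Df (zz n) else (\<lambda>_. 0))"
  have surj: "\<exists>n. zz n = z" for z unfolding zz_def by (metis from_nat_to_nat)
  have UA: "(\<Union>n. A n) = (\<Union>z\<in>{z. ok z}. V z)"
  proof (intro subset_antisym subsetI)
    fix x assume "x \<in> (\<Union>z\<in>{z. ok z}. V z)"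
    then obtain z where z: "ok z" "x \<in> V z" by blast
    obtain n where "zz n = z" using surj by blast
    then have "x \<in> A n" using z by (simp add: A_def)
    then show "x \<in> (\<Union>n. A n)" by blast
  next
    fix x assume "x \<in> (\<Union>n. A n)"
    then obtain n where "ok (zz n)" "x \<in> V (zz n)" by (auto simp: A_def simp del: split_paired_Ex split: if_splits)
    then show "x \<in> (\<Union>z\<in>{z. ok z}. V z)" by blast
  qed
  have Am[measurable]: "A n \<in> sets lebesgue" for n
    using quasiopen_sets_lebesgue[OF p0 P(1)] by (auto simp: A_def)
  have Dm[measurable]: "D n \<in> borel_measurable lebesgue" for n
    using P(5)[of "zz n"] by (auto simp: D_def Lp_def intro!: measurable_completion)
  \<comment> \<open>Taking the first piece that contains x makes the choice measurable. The default
    0 concerns only a null part of U and points outside U.\<close>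
  define Du where "Du = (\<lambda>x. if \<exists>n. x \<in> A n then D (LEAST n. x \<in> A n) x else 0)"
  have cons_all: "AE x in lborel. \<forall>n m. x \<in> A n \<and> x \<in> A m \<longrightarrow> D n x = D m x"
    unfolding AE_all_countable
  proof (intro allI)
    fix n m
    show "AE x in lborel. x \<in> A n \<and> x \<in> A m \<longrightarrow> D n x = D m x"
    proof (cases "ok (zz n) \<and> ok (zz m)")
      case True
      from cons[of "zz n" "zz m"] True show ?thesis by (auto simp: A_def D_def)
    qed (auto simp: A_def)
  qed
  have DuD: "AE x in lborel. \<forall>n. x \<in> A n \<longrightarrow> Du x = D n x"
    using cons_all
  proof eventually_elim
    case (elim x)
    show ?case
    proof (intro allI impI)
      fix n assume n: "x \<in> A n"
      then have "x \<in> A (LEAST n. x \<in> A n)" by (rule LeastI)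
      then have "D (LEAST n. x \<in> A n) x = D n x" using elim n by blast
      moreover have "\<exists>n. x \<in> A n" using n by blast
      ultimately show "Du x = D n x" by (simp only: Du_def if_True)
    qed
  qed
  have Du_meas: "Du \<in> borel_measurable lebesgue"
  proof -
    \<comment> \<open>Restrictions to the first N pieces: measurable by induction on N, and
      eventually equal to \<open>Du\<close> at each point.\<close>
    define S where "S = (\<lambda>N x. if \<exists>n<N. x \<in> A n then Du x else 0)"
    have "S N \<in> borel_measurable lebesgue" for N
    proof (induction N)
      case 0
      then show ?case by (simp add: S_def)
    next
      case (Suc N)
      note [measurable] = Suc
      have "S (Suc N) x = (if x \<in> (\<Union>n<N. A n) then S N x else if x \<in> A N then D N x else 0)" for x
      proof (cases "\<exists>n<N. x \<in> A n")
        case True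
        then show ?thesis by (auto simp: S_def less_Suc_eq)
      next
        case False
        have "(LEAST n. x \<in> A n) = N" if "x \<in> A N"
          using that False by (intro Least_equality) (auto simp: not_less[symmetric])
        then show ?thesis using False by (auto simp: S_def Du_def less_Suc_eq)
      qed
      then have "S (Suc N) = (\<lambda>x. if x \<in> (\<Union>n<N. A n) then S N x else if x \<in> A N then D N x else 0)" by (rule ext)
      moreover have "(\<Union>n<N. A n) \<in> sets lebesgue" by (intro sets.finite_UN) auto
      ultimately show ?case by (auto intro!: measurable_If_set)
    qed
    moreover have "(\<lambda>N. S N x) \<longlonglongrightarrow> Du x" for x
    proof (rule tendsto_eventually)
      show "\<forall>\<^sub>F N in sequentially. S N x = Du x"
      proof (cases "\<exists>n. x \<in> A n")
        case True
        then obtain n where "x \<in> A n" by blast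
        then have "S N x = Du x" if "N > n" for N using that by (auto simp: S_def)
        then show ?thesis unfolding eventually_sequentially by (intro exI[of _ "Suc n"]) auto
      next
        case False
        then show ?thesis by (simp add: S_def Du_def)
      qed
    qed
    ultimately show ?thesis by (rule borel_measurable_LIMSEQ_metric)
  qed
  have Dug: "AE x in lborel. x \<in> U \<longrightarrow> ennreal (norm (Du x)) \<le> g' x"
  proof -
    have "AE x in lborel. \<forall>n. x \<in> A n \<longrightarrow> ennreal (norm (D n x)) \<le> g' x"
      unfolding AE_all_countable using Dg by (auto simp: A_def D_def)
    moreover have "AE x in lborel. x \<notin> U - (\<Union>n. A n)" unfolding UA by (rule Cp_zero_AE[OF p0 P(3)])
    ultimately show ?thesis using DuD by eventually_elim force
  qed
  have "Lp_on p U Du"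
  proof -
    have "(\<integral>\<^sup>+ x\<in>U. ennreal (norm (Du x) powr p) \<partial>lebesgue) \<le> (\<integral>\<^sup>+x. epow (g' x) p \<partial>lborel)"
      unfolding nn_integral_lebesgue using Dug
    proof (intro nn_integral_mono_AE, eventually_elim)
      case (elim x)
      show ?case
      proof (cases "x \<in> U")
        case True
        then have "epow (ennreal (norm (Du x))) p \<le> epow (g' x) p" using elim p0 by (intro epow_mono) auto
        then show ?thesis using True by simp
      qed simp
    qed
    also have "\<dots> < \<infinity>" using Lg' by (simp add: Lpb_def)
    finally show ?thesis unfolding Lp_on_def set_borel_measurable_def
      using U Du_meas by (auto intro!: borel_measurable_scaleR)
  qed
  moreover have "Lp_on p U u"
  proof -
    have "(\<lambda>x. indicator U x *\<^sub>R u x) \<in> borel_measurable lebesgue"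
      by (rule measurable_AE_eq_lebesgue[OF vr_measurable]) (use uvr in \<open>auto simp: indicator_def elim!: eventually_mono\<close>)
    moreover have "(\<integral>\<^sup>+ x\<in>U. ennreal (norm (u x) powr p) \<partial>lebesgue) = (\<integral>\<^sup>+ x\<in>U. eabs_pow (v x) p \<partial>lebesgue)"
      unfolding nn_integral_lebesgue using u
      by (intro nn_integral_cong_AE, eventually_elim) (auto simp: indicator_def eabs_pow_def)
    ultimately show ?thesis using v_int by (simp add: Lp_on_def set_borel_measurable_def)
  qed
  moreover have "quasicovering p U (V ` {z. ok z})"
    unfolding quasicovering_def
  proof (intro conjI ballI)
    show "\<Union> (V ` {z. ok z}) \<subseteq> U" using P(2) by blast
  qed (use P(1,3) in auto)
  moreover have "\<exists>G w Dw. open G \<and> V z \<subseteq> G \<and> classical_W1p p G w Dw \<and>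
           (AE x in lebesgue. x \<in> V z \<longrightarrow> u x = w x) \<and> (AE x in lebesgue. x \<in> V z \<longrightarrow> Du x = Dw x)" if z: "ok z" for z
  proof -
    obtain n where n: "zz n = z" using surj by blast
    have 1: "AE x in lborel. x \<in> V z \<longrightarrow> u x = f' z x"
      using uvr P(6)[OF z] by eventually_elim (use P(2)[OF z] in auto)
    have 2: "AE x in lborel. x \<in> V z \<longrightarrow> Du x = Df z x"
      using DuD
    proof eventually_elim
      case (elim x)
      from elim[rule_format, of n] show ?case using n z by (simp add: A_def D_def)
    qed
    show ?thesis using P(4)[OF z] 1 2 unfolding AE_lebesgue_iff by blast
  qed
  ultimately show ?thesis unfolding KM_W1p_def by (intro exI[of _ Du] conjI exI[of _ "V ` {z. ok z}"]) auto
qed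

end

lemma Nhat_imp_KM:
  fixes U :: "'a::euclidean_space set"
  assumes p: "1 < p" and U: "quasiopen p U" and v: "v \<in> N1p p U" and vu: "AE x in lborel. x \<in> U \<longrightarrow> v x = ereal (u x)"
  shows "\<exists>Du. KM_W1p p U u Du"
proof -
  have p0: "0 < p" using p by simp
  have Um: "U \<in> sets lebesgue" by (rule quasiopen_sets_lebesgue[OF p0 U])
  obtain g where g: "upper_gradient U v g" "(\<integral>\<^sup>+ x\<in>U. eabs_pow (v x) p \<partial>lebesgue) + (\<integral>\<^sup>+ x\<in>U. epow (g x) p \<partial>lebesgue) < \<infinity>"
    using N1p_normp_less[of p U v \<infinity>] v by (auto simp: N1p_def)
  then have fin: "(\<integral>\<^sup>+ x\<in>U. eabs_pow (v x) p \<partial>lebesgue) < \<infinity>" "(\<integral>\<^sup>+ x\<in>U. epow (g x) p \<partial>lebesgue) < \<infinity>" by auto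
  obtain g' where g': "Lpb p g'" "\<And>x. x \<in> U \<Longrightarrow> g x \<le> g' x"
    "pae p U (\<lambda>\<gamma> l. (\<forall>t\<in>{0..l}. \<bar>v (\<gamma> t)\<bar> \<noteq> \<infinity>) \<and> ugc (\<lambda>x. real_of_ereal (v x)) g' \<gamma> l)"
    using N1p_real_ugc[OF p0 Um g(1) fin(2)] by blast
  obtain G where G: "\<And>j. open (G j)" "\<And>j. Cp p (G j) < ennreal (small_cap p j)" "\<And>j. open (U \<union> G j)"
    using quasiopenE[OF U] by blast
  have "\<exists>w h. w \<in> borel_measurable lebesgue \<and> (\<forall>x\<in>G j. 1 \<le> w x) \<and> upper_gradient UNIV w h \<and> Lpb p h \<and> Cp p {x. 1 \<le> w x} < ennreal (small_cap p j)" for j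
  proof -
    obtain w h where w: "w \<in> N1p p UNIV" "\<And>x. x \<in> G j \<Longrightarrow> 1 \<le> w x" "upper_gradient UNIV w h"
      "(\<integral>\<^sup>+ x. eabs_pow (w x) p \<partial>lborel) + (\<integral>\<^sup>+ x. epow (h x) p \<partial>lborel) < ennreal (small_cap p j)"
      using Cp_less[OF G(2)] by blast
    have wm: "w \<in> borel_measurable lebesgue" using w(1) by (simp add: N1p_def lebesgue_on_UNIV_eq)
    \<comment> \<open>The function w is admissible also for its own superlevel set, which may be
      larger than \<open>G j\<close>.\<close>
    have "Cp p {x. 1 \<le> w x} \<le> (\<integral>\<^sup>+ x. eabs_pow (w x) p \<partial>lborel) + (\<integral>\<^sup>+ x. epow (h x) p \<partial>lborel)"
      by (rule Cp_le[OF wm _ w(3)]) simp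
    then have c: "Cp p {x. 1 \<le> w x} < ennreal (small_cap p j)" using w(4) by (rule le_less_trans)
    have "(\<integral>\<^sup>+ x. epow (h x) p \<partial>lborel) \<le> (\<integral>\<^sup>+ x. eabs_pow (w x) p \<partial>lborel) + (\<integral>\<^sup>+ x. epow (h x) p \<partial>lborel)" by simp
    also have "\<dots> < \<infinity>" using w(4) by (rule less_trans) simp
    finally have "Lpb p h" using w(3) by (simp add: Lpb_def upper_gradient_def)
    then show ?thesis using w wm c by blast
  qed
  then obtain w h where w: "\<And>j. w j \<in> borel_measurable lebesgue" "\<And>j x. x \<in> G j \<Longrightarrow> 1 \<le> w j x"
    "\<And>j. upper_gradient UNIV (w j) (h j)" "\<And>j. Lpb p (h j)" "\<And>j. Cp p {x. 1 \<le> w j x} < ennreal (small_cap p j)" by metis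
  interpret newton_function p U v g g' G w h
  proof
    show "v \<in> borel_measurable (restrict_space lebesgue U)" using v by (simp add: N1p_def)
    show "pae p U (ugc (\<lambda>x. real_of_ereal (v x)) g')" by (rule pae_mono[OF g'(3)]) simp
  qed (use p U fin g g' G w in auto)
  show ?thesis by (rule KM[OF vu])
qed

theorem theorem7p8:
  fixes U :: "'a::euclidean_space set" and p :: real
  assumes "1 < p" and "quasiopen p U"
  shows "(\<forall>u. u \<in> Nhat p U \<longleftrightarrow> (\<exists>Du. KM_W1p p U u Du)) \<and>
    (\<forall>u Du. u \<in> Nhat p U \<longrightarrow> KM_W1p p U u Du \<longrightarrow>
       Nhat_norm p U u = KM_norm p U u Du \<and>
       (\<forall>v. v \<in> N1p p U \<and> (AE x in lebesgue. x \<in> U \<longrightarrow> v x = ereal (u x)) \<longrightarrow>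
          minimal_pwug p U v (\<lambda>x. ennreal (norm (Du x)))))"
proof -
  have Um: "U \<in> sets lebesgue" using assms by (intro quasiopen_sets_lebesgue[of p]) auto
  have 1: "\<exists>Du. KM_W1p p U u Du" if u: "u \<in> Nhat p U" for u
  proof -
    obtain v where "v \<in> N1p p U" "AE x in lborel. x \<in> U \<longrightarrow> v x = ereal (u x)"
      using u by (auto simp: Nhat_def AE_lebesgue_iff)
    then show ?thesis by (rule Nhat_imp_KM[OF assms])
  qed
  have 2: "u \<in> Nhat p U" if KM: "KM_W1p p U u Du" for u Du
  proof -
    obtain V :: "nat \<times> nat \<times> nat \<Rightarrow> 'a set" and F DF where "gradient_system p U V F DF u Du"
      using KM_gradient_system[OF assms(1) Um KM] by blast
    then interpret gradient_system p U V F DF u Du .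
    have "AE x in lborel. x \<in> U \<longrightarrow> ereal (patch x) = ereal (u x)" using patch_AE by eventually_elim simp
    then have "AE x in lebesgue. x \<in> U \<longrightarrow> ereal (patch x) = ereal (u x)" unfolding AE_lebesgue_iff .
    then show ?thesis unfolding Nhat_def by (intro CollectI bexI[OF _ patch_N1p])
  qed
  have 3: "N1p_normp p U v = (\<integral>\<^sup>+ x\<in>U. ennreal (\<bar>u x\<bar> powr p + norm (Du x) powr p) \<partial>lebesgue) \<and>
      minimal_pwug p U v (\<lambda>x. ennreal (norm (Du x)))"
    if KM: "KM_W1p p U u Du" and v: "v \<in> N1p p U" "AE x in lebesgue. x \<in> U \<longrightarrow> v x = ereal (u x)" for u Du v
  proof -
    obtain V :: "nat \<times> nat \<times> nat \<Rightarrow> 'a set" and F DF where "gradient_system p U V F DF u Du"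
      using KM_gradient_system[OF assms(1) Um KM] by blast
    then interpret gradient_system p U V F DF u Du .
    show ?thesis using N1p_properties[OF v(1) v(2)[unfolded AE_lebesgue_iff]] by blast
  qed
  have 4: "Nhat_norm p U u = KM_norm p U u Du" if u: "u \<in> Nhat p U" and KM: "KM_W1p p U u Du" for u Du
  proof -
    let ?P = "\<lambda>v. v \<in> N1p p U \<and> (AE x in lebesgue. x \<in> U \<longrightarrow> v x = ereal (u x))"
    \<comment> \<open>The formula for the norm gives the same value for every representative v, so
      the choice made in \<open>Nhat_norm\<close> is immaterial.\<close>
    have "\<exists>v. ?P v" using u by (auto simp: Nhat_def)
    then have "?P (SOME v. ?P v)" by (rule someI_ex)
    then have "N1p_normp p U (SOME v. ?P v) = (\<integral>\<^sup>+ x\<in>U. ennreal (\<bar>u x\<bar> powr p + norm (Du x) powr p) \<partial>lebesgue)" using 3[OF KM] by blast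
    then show ?thesis by (simp add: Nhat_norm_def KM_norm_def N1p_norm_def)
  qed
  show ?thesis using 1 2 3 4 by blast
qed

end
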